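(* Let $q$ be a real analytic function on a neighborhood of the origin in $\mathbb{R}^n$ with $q(0)=0$, and let $r_0>0$, $h>0$, $l$ be as in the context. Write $h=\frac{1}{m+\gamma}$ with $m$ a nonnegative integer and $0<\gamma\le1$. Let $s_1,\dots,s_m$ be linearly independent real analytic functions on a neighborhood of the origin with $s_i(0)=0$ for all $i$. Then there are constants $C>0$, $\delta>0$ and $0<r_1<r_0$, depending on $q$ and the $s_i$, such that for every $s=\sum_{i=1}^m\eta_is_i$ with all $|\eta_i|<\delta$ and every $\epsilon\in(0,\tfrac12)$, $$m(\{x:|x|<r_1,\ |q(x)+s(x)|<\epsilon\})\le C\epsilon^{h}|\ln\epsilon|^{l}.$$ Consequently, if $t>0$ satisfies $\int_{\{|x|<r_0\}}|q(x)|^{-t}\,dx<\infty$, then there is a constant $D_t$ such that $\int_{\{|x|<r_1\}}|q(x)+s(x)|^{-t}\,dx<D_t$ for every such $s$.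
   Context: For a real analytic $q$ near $0\in\mathbb{R}^n$ with $q(0)=0$, there exist $r_0>0$, a real $h>0$ and an integer $0\le l\le n-1$ such that for every $0<r\le r_0$, $m(\{x:|x|<r,\ |q(x)|<\epsilon\})=c_r\epsilon^h|\ln\epsilon|^l+o(\epsilon^h|\ln\epsilon|^l)$ as $\epsilon\to0^+$ with $c_r>0$; here $m$ denotes Lebesgue measure. *)

theory Defs
  imports "HOL-Analysis.Analysis" "HOL-Library.Landau_Symbols"
begin

definition monom_at :: "('n::finite \<Rightarrow> nat) \<Rightarrow> real^'n \<Rightarrow> real^'n \<Rightarrow> real" where
  "monom_at \<alpha> y x = (\<Prod>i\<in>UNIV. (x$i - y$i) ^ (\<alpha> i))"

definition real_analytic_on :: "(real^'n::finite \<Rightarrow> real) \<Rightarrow> (real^'n) set \<Rightarrow> bool" where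
  "real_analytic_on f U \<longleftrightarrow>
     (\<forall>y\<in>U. \<exists>e>0. \<exists>c::('n \<Rightarrow> nat) \<Rightarrow> real.
        \<forall>x\<in>ball y e. ((\<lambda>\<alpha>. c \<alpha> * monom_at \<alpha> y x) has_sum f x) UNIV)"

end

(* Finitely many compositions of blow-ups, shears and power maps cover a neighbourhood of the
   origin. In each of these charts q, s_1, ..., s_m are combinations with constant coefficients of
   at most m + 1 functions g_i = x^(b_i) * unit whose exponents b_i increase strictly, and the
   Jacobian is a monomial times a unit. Along the flow t -> exp(t) x the g_i behave like
   exponentials with the distinct rates |b_i|, so by a Vandermonde argument some derivative of
   order at most m of q + s along the flow is comparable to the largest of its terms. If |q| is
   of size sigma and s is small, this largest term is at least of size sigma. The one-dimensional
   sublevel estimate, averaged over the flow, then gives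
     m {sigma <= |q| < 2 sigma, |q + s| < eps} <= C (eps / sigma)^(1/m) m {|q| < 8 sigma}.
   Since h < 1/m, summation over sigma = 2^k eps against the known asymptotics of m {|q| < sigma}
   yields the first bound, with the same exponents. Integrability of |q|^(-t) forces t < h, and the
   second bound follows from the first by summing over dyadic level sets. *)

theory Submission
  imports Defs "HOL-Complex_Analysis.Complex_Analysis" "HOL-Real_Asymp.Real_Asymp"
begin

text \<open>Uniformity in \<eta> dictates the form of the resolution. Resolving \<open>q\<close>
  alone says nothing about q + s, and resolving every q + s by itself gives constants that depend on
  \<eta>. Hence the whole linear span of q, s_1, ..., s_m is resolved once: \<eta> then enters only
  through a vector of constant coefficients, and a small \<eta> moves the leading coefficient of
  \<open>q\<close> by at most half. The flow is a dilation because a monomial is merely multiplied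
  by exp(|b| t), so |q| and the Jacobian stay comparable along short orbits. The right-hand side of
  the sublevel estimate is the measure of a sublevel set of \<open>q\<close>, not a power of
  \<sigma>; no exponent is ever computed in a chart, and h and l come only from the assumed
  asymptotics. Blow-ups collapse and power maps fold, so two inequalities take the place of the
  change of variables formula. Making a germ monomial is an induction on the number of variables: a
  Tschirnhaus shift confines the coefficients to fewer variables, power maps clear the fractional
  slopes of the Newton polygon, and blow-ups lower the order in the last variable.\<close>

no_notation fps_nth (infixl "$" 75)

section \<open>Functions on polydiscs that are holomorphic in each variable\<close>

definition upd :: "'a^'n \<Rightarrow> 'n \<Rightarrow> 'a \<Rightarrow> 'a^'n" where
  "upd z k w = (\<chi> i. if i = k then w else z$i)"

lemma upd_nth [simp]: "upd z k w $ i = (if i = k then w else z$i)"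
  by (simp add: upd_def)

lemma upd_upd [simp]: "upd (upd z k v) k w = upd z k w"
  by (simp add: vec_eq_iff)

lemma upd_commute: "k \<noteq> l \<Longrightarrow> upd (upd z k v) l w = upd (upd z l w) k v"
  by (simp add: vec_eq_iff)

lemma upd_same [simp]: "upd z k (z$k) = z"
  by (simp add: vec_eq_iff)

lemma continuous_on_upd [continuous_intros]:
  fixes f :: "'b::topological_space \<Rightarrow> ('a::topological_space)^'n::finite"
  assumes "continuous_on S f" "continuous_on S g"
  shows "continuous_on S (\<lambda>x. upd (f x) k (g x))"
  unfolding upd_def
proof (rule continuous_on_vec_lambda)
  show "continuous_on S (\<lambda>x. if i = k then g x else f x $ i)" for i
    by (cases "i = k") (auto intro!: continuous_intros assms)
qed

definition PD :: "real \<Rightarrow> (complex^'n::finite) set" where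
  "PD r = {z. \<forall>i. norm (z$i) < r}"

lemma PD_iff: "z \<in> PD r \<longleftrightarrow> (\<forall>i. norm (z$i) < r)"
  by (simp add: PD_def)

lemma upd_in_PD: "z \<in> PD r \<Longrightarrow> norm w < r \<Longrightarrow> upd z k w \<in> PD r"
  by (simp add: PD_iff)

lemma PD_nth: "z \<in> PD r \<Longrightarrow> norm (z$k) < r"
  by (simp add: PD_iff)

lemma PD_mono: "r \<le> s \<Longrightarrow> z \<in> PD r \<Longrightarrow> z \<in> PD s"
  by (meson PD_iff order_less_le_trans)

lemma zero_in_PD [simp]: "r > 0 \<Longrightarrow> 0 \<in> PD r"
  by (simp add: PD_iff)

lemma open_PD: "open (PD r :: (complex^'n::finite) set)"
proof -
  have "PD r = (\<Inter>i\<in>UNIV. {z::complex^'n. norm (z$i) < r})"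
    by (auto simp: PD_iff)
  moreover have "open {z::complex^'n. norm (z$i) < r}" for i
    by (intro open_Collect_less continuous_intros)
  ultimately show ?thesis by auto
qed

text \<open>By Osgood's lemma, continuity together with holomorphy in each variable separately is
  holomorphy in several variables. In this form the one-variable theory applies to one coordinate at
  a time, and parameter integrals and uniform limits are easily covered.\<close>

definition hol :: "(complex^'n::finite \<Rightarrow> complex) \<Rightarrow> real \<Rightarrow> bool" where
  "hol F r \<longleftrightarrow> continuous_on (PD r) F \<and>
     (\<forall>z\<in>PD r. \<forall>k. (\<lambda>w. F (upd z k w)) holomorphic_on ball 0 r)"

definition pd :: "'n \<Rightarrow> (complex^'n::finite \<Rightarrow> complex) \<Rightarrow> complex^'n \<Rightarrow> complex" where
  "pd k F z = deriv (\<lambda>w. F (upd z k w)) (z$k)"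

lemma holI:
  assumes "continuous_on (PD r) F"
    and "\<And>z k. z \<in> PD r \<Longrightarrow> (\<lambda>w. F (upd z k w)) holomorphic_on ball 0 r"
  shows "hol F r"
  using assms by (auto simp: hol_def)

lemma hol_cont: "hol F r \<Longrightarrow> continuous_on (PD r) F"
  and hol_sep: "hol F r \<Longrightarrow> z \<in> PD r \<Longrightarrow> (\<lambda>w. F (upd z k w)) holomorphic_on ball 0 r"
  by (auto simp: hol_def)

lemma hol_mono: "hol F r \<Longrightarrow> s \<le> r \<Longrightarrow> hol F s"
  unfolding hol_def
  by (meson PD_mono continuous_on_subset holomorphic_on_subset subsetI subset_ball)

lemma hol_const: "hol (\<lambda>z. c) r"
  by (rule holI) auto

lemma hol_coord:
  fixes i :: "'n::finite"
  shows "hol (\<lambda>z. z$i :: complex) r"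
proof (rule holI)
  show "(\<lambda>w. upd z k w $ i) holomorphic_on ball 0 r" for z :: "complex^'n" and k
    by (cases "i = k") (auto intro!: holomorphic_intros)
qed (auto intro!: continuous_intros)

lemma hol_add: "hol F r \<Longrightarrow> hol G r \<Longrightarrow> hol (\<lambda>z. F z + G z) r"
  and hol_diff: "hol F r \<Longrightarrow> hol G r \<Longrightarrow> hol (\<lambda>z. F z - G z) r"
  and hol_mult: "hol F r \<Longrightarrow> hol G r \<Longrightarrow> hol (\<lambda>z. F z * G z) r"
  by (auto simp: hol_def intro!: continuous_intros holomorphic_intros)

lemma hol_divide: "hol F r \<Longrightarrow> hol G r \<Longrightarrow> (\<And>z. z \<in> PD r \<Longrightarrow> G z \<noteq> 0) \<Longrightarrow> hol (\<lambda>z. F z / G z) r"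
  by (auto simp: hol_def upd_in_PD intro!: continuous_intros holomorphic_intros)

lemma hol_cong: "hol F r \<Longrightarrow> (\<And>z. z \<in> PD r \<Longrightarrow> F z = G z) \<Longrightarrow> hol G r"
  by (rule holI)
    (auto simp: upd_in_PD hol_cont dest: hol_sep
      intro: continuous_on_eq[OF hol_cont] holomorphic_transform[OF hol_sep])

text \<open>Cauchy's formula writes the derivative as an integral over the circle of radius
  \<open>s\<close>, whose integrand is jointly continuous in the parameter, the point and the
  angle.\<close>

lemma continuous_on_deriv_param:
  fixes F :: "'a::topological_space \<Rightarrow> complex \<Rightarrow> complex"
  assumes cont: "continuous_on (X \<times> cball 0 s) (\<lambda>(x, w). F x w)"
    and hol: "\<And>x. x \<in> X \<Longrightarrow> F x holomorphic_on ball 0 s"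
  shows "continuous_on (X \<times> ball 0 s) (\<lambda>(x, w). deriv (F x) w)"
proof -
  define c where "c = circlepath 0 s"
  define J where "J p = integral (cbox 0 1) (\<lambda>t. F (fst p) (c t) / (c t - snd p)^2 *
      vector_derivative c (at t))" for p
  have c_in: "c t \<in> sphere 0 \<bar>s\<bar>" if "t \<in> {0..1}" for t
    using that unfolding c_def path_image_circlepath[symmetric] path_image_def by blast
  have eq: "deriv (F x) w = 1 / (2 * of_real pi * \<i>) * J (x, w)" if "x \<in> X" "w \<in> ball 0 s" for x w
  proof -
    have "continuous_on (cball 0 s) (\<lambda>w. (\<lambda>(x, w). F x w) (x, w))"
      by (rule continuous_on_compose2[OF cont]) (use that in \<open>auto intro!: continuous_intros\<close>)
    then have "continuous_on (cball 0 s) (F x)" by simp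
    from Cauchy_derivative_integral_circlepath(2)[OF this hol[OF that(1)] that(2)]
    show ?thesis
      by (simp add: DERIV_imp_deriv contour_integral_integral J_def c_def)
  qed
  have "continuous_on (X \<times> ball (0::complex) s) J"
    unfolding J_def
  proof (rule integral_continuous_on_param)
    have cc: "continuous_on ((X \<times> ball (0::complex) s) \<times> cbox 0 1) (\<lambda>y. c (snd y))"
      unfolding c_def circlepath by (intro continuous_intros)
    have cv: "continuous_on ((X \<times> ball (0::complex) s) \<times> cbox 0 1) (\<lambda>y. vector_derivative c (at (snd y)))"
      unfolding c_def vector_derivative_circlepath by (intro continuous_intros)
    have "continuous_on ((X \<times> ball (0::complex) s) \<times> cbox 0 1) (\<lambda>y. (\<lambda>(x, w). F x w) (fst (fst y), c (snd y)))"
    proof (rule continuous_on_compose2[OF cont])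
      show "continuous_on ((X \<times> ball (0::complex) s) \<times> cbox 0 1) (\<lambda>y. (fst (fst y), c (snd y)))"
        by (intro continuous_intros cc)
      show "(\<lambda>y. (fst (fst y), c (snd y))) ` ((X \<times> ball (0::complex) s) \<times> cbox 0 1) \<subseteq> X \<times> cball 0 s"
      proof -
        have "(fst (fst y), c (snd y)) \<in> X \<times> cball 0 s" if "y \<in> (X \<times> ball (0::complex) s) \<times> cbox 0 1" for y
        proof -
          have "norm (snd (fst y)) < s" using that by auto
          then have "\<bar>s\<bar> = s" using norm_ge_zero[of "snd (fst y)"] by linarith
          then show ?thesis using c_in[of "snd y"] that by auto
        qed
        then show ?thesis by blast
      qed
    qed
    moreover have "c (snd y) - snd (fst y) \<noteq> 0" if "y \<in> (X \<times> ball (0::complex) s) \<times> cbox 0 1" for y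
      using that c_in[of "snd y"] by auto
    ultimately show "continuous_on ((X \<times> ball (0::complex) s) \<times> cbox 0 1)
       (\<lambda>(p, t). F (fst p) (c t) / (c t - snd p)\<^sup>2 * vector_derivative c (at t))"
      by (auto simp: split_beta intro!: continuous_intros cc[unfolded cbox_interval] cv[unfolded cbox_interval])
  qed
  then have "continuous_on (X \<times> ball (0::complex) s) (\<lambda>p. 1 / (2 * of_real pi * \<i>) * J p)"
    by (intro continuous_intros)
  then show ?thesis
    by (rule continuous_on_eq) (auto simp: eq)
qed


lemma PD_shrink:
  assumes "z \<in> PD r"
  obtains s where "s < r" "z \<in> PD s"
proof -
  define m where "m = Max (range (\<lambda>i. norm (z$i)))"
  have m: "norm (z$i) \<le> m" for i
    unfolding m_def by (rule Max_ge) auto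
  have "m < r"
    unfolding m_def using assms by (subst Max_less_iff) (auto simp: PD_iff)
  show ?thesis
  proof
    show "(m + r) / 2 < r" using \<open>m < r\<close> by simp
    have "m < (m + r) / 2" using \<open>m < r\<close> by simp
    then show "z \<in> PD ((m + r) / 2)"
      unfolding PD_iff using m le_less_trans by blast
  qed
qed

lemma holomorphic_on_ball_shrink:
  assumes "\<And>s. s < r \<Longrightarrow> f holomorphic_on ball 0 s"
  shows "f holomorphic_on ball 0 r"
proof -
  have "ball 0 r = (\<Union>s\<in>{..<r}. ball (0::complex) s)"
    by (auto simp: dense) (use dense in blast)
  moreover have "f holomorphic_on (\<Union>s\<in>{..<r}. ball 0 s)"
    by (rule holomorphic_on_UN_open) (use assms in auto)
  ultimately show ?thesis by (rule ssubst)
qed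

text \<open>Gives Cauchy's formula its room: on a polydisc of radius s < r the function is
  continuous up to the boundary, which may fail on \<open>PD r\<close> itself.\<close>

lemma hol_shrink:
  fixes F :: "complex^'n::finite \<Rightarrow> complex"
  assumes "\<And>s. s < r \<Longrightarrow> hol F s"
  shows "hol F r"
proof (rule holI)
  have "PD r = (\<Union>s\<in>{..<r}. PD s :: (complex^'n) set)"
    by (auto elim: PD_shrink dest: PD_mono[OF less_imp_le])
  then show "continuous_on (PD r) F"
    using assms by (auto intro!: continuous_on_open_UN open_PD simp: hol_cont)
next
  fix z :: "complex^'n" and k assume z: "z \<in> PD r"
  from PD_shrink[OF z] obtain s0 where s0: "s0 < r" "z \<in> PD s0" .
  show "(\<lambda>w. F (upd z k w)) holomorphic_on ball 0 r"
  proof (rule holomorphic_on_ball_shrink)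
    fix s assume "s < r"
    \<comment> \<open>The other coordinates of \<open>z\<close> have to lie in the smaller polydisc
      as well, hence the maximum with \<open>s0\<close>.\<close>
    then have "(\<lambda>w. F (upd z k w)) holomorphic_on ball 0 (max s s0)"
      using s0 by (intro hol_sep assms) (auto intro: PD_mono[of s0])
    then show "(\<lambda>w. F (upd z k w)) holomorphic_on ball 0 s"
      by (rule holomorphic_on_subset) auto
  qed
qed

lemma hol_has_pd:
  assumes "hol F r" "z \<in> PD r" "norm w < r"
  shows "((\<lambda>w. F (upd z k w)) has_field_derivative pd k F (upd z k w)) (at w)"
  using holomorphic_derivI[OF hol_sep[OF assms(1,2), of k] open_ball, of w] assms(3)
  by (simp add: pd_def)

text \<open>Differentiation under the integral sign in one coordinate. The joint continuity of the
  derivative comes from \<open>continuous_on_deriv_param\<close>, whose closed disc forces the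
  passage to s < r.\<close>

lemma hol_integral:
  fixes G :: "real \<Rightarrow> complex^'n::finite \<Rightarrow> complex"
  assumes cont: "continuous_on (PD r \<times> {0..1}) (\<lambda>(z, t). G t z)"
    and hol: "\<And>t. t \<in> {0..1} \<Longrightarrow> hol (G t) r"
  shows "hol (\<lambda>z. integral {0..1} (\<lambda>t. G t z)) r"
proof (rule holI)
  show "continuous_on (PD r) (\<lambda>z. integral {0..1} (\<lambda>t. G t z))"
    using integral_continuous_on_param[of "PD r" 0 1 "\<lambda>z t. G t z"] cont by simp
  fix z :: "complex^'n" and k assume z: "z \<in> PD r"
  show "(\<lambda>w. integral {0..1} (\<lambda>t. G t (upd z k w))) holomorphic_on ball 0 r"
  proof (rule holomorphic_on_ball_shrink)
    fix s assume s: "s < r"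
    have cG: "continuous_on ({0..1} \<times> cball 0 s) (\<lambda>(t, w). G t (upd z k w))"
      unfolding split_beta
      by (rule continuous_on_compose2[OF cont[unfolded split_beta], of _ "\<lambda>p. (upd z k (snd p), fst p)", simplified])
        (use s z in \<open>auto intro!: continuous_intros upd_in_PD\<close>)
    have hG: "(\<lambda>w. G t (upd z k w)) holomorphic_on ball 0 s" if "t \<in> {0..1}" for t
      using hol_sep[OF hol[OF that] z, of k] by (rule holomorphic_on_subset) (use s in auto)
    have "(\<lambda>w. integral (cbox 0 1) (\<lambda>t. G t (upd z k w))) holomorphic_on ball 0 s"
    proof (rule leibniz_rule_holomorphic[where fx = "\<lambda>w t. deriv (\<lambda>w. G t (upd z k w)) w"])
      show "((\<lambda>w. G t (upd z k w)) has_field_derivative deriv (\<lambda>w. G t (upd z k w)) w) (at w within ball 0 s)"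
        if "w \<in> ball 0 s" "t \<in> cbox 0 1" for w t
        using holomorphic_derivI[OF hG open_ball that(1)] that by auto
      show "(\<lambda>t. G t (upd z k w)) integrable_on cbox 0 1" if "w \<in> ball 0 s" for w
        by (rule integrable_continuous, simp,
            rule continuous_on_compose2[OF cG[unfolded split_beta], of _ "\<lambda>t. (t, w)", simplified])
          (use that in \<open>auto intro!: continuous_intros\<close>)
      show "continuous_on (ball 0 s \<times> cbox 0 1) (\<lambda>(w, t). deriv (\<lambda>w. G t (upd z k w)) w)"
        unfolding split_beta
        by (rule continuous_on_compose2[OF continuous_on_deriv_param[OF cG hG, unfolded split_beta],
              of _ "\<lambda>p. (snd p, fst p)", simplified])
          (auto intro!: continuous_intros)
    qed auto
    then show "(\<lambda>w. integral {0..1} (\<lambda>t. G t (upd z k w))) holomorphic_on ball 0 s" by simp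
  qed
qed

lemma hol_upd_const:
  assumes F: "hol F r" and w: "norm w < r"
  shows "hol (\<lambda>z. F (upd z k w)) r"
proof (rule holI)
  show "continuous_on (PD r) (\<lambda>z. F (upd z k w))"
    by (rule continuous_on_compose2[OF hol_cont[OF F]])
      (use w in \<open>auto intro!: continuous_intros upd_in_PD\<close>)
  show "(\<lambda>v. F (upd (upd z l v) k w)) holomorphic_on ball 0 r" if "z \<in> PD r" for z l
    using hol_sep[OF F upd_in_PD[OF that w, of k], of l]
    by (cases "k = l") (auto simp: upd_commute)
qed

lemma hol_upd_scale:
  assumes F: "hol F r" and c: "norm c \<le> 1"
  shows "hol (\<lambda>z. F (upd z k (c * z$k))) r"
proof (rule holI)
  have *: "norm (c * w) < r" if "norm w < r" for w
    using c that mult_left_le_one_le[of "norm w" "norm c"] by (simp add: norm_mult mult.commute)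
  show "continuous_on (PD r) (\<lambda>z. F (upd z k (c * z$k)))"
    by (rule continuous_on_compose2[OF hol_cont[OF F]])
      (auto intro!: continuous_intros upd_in_PD * PD_nth)
  show "(\<lambda>v. F (upd (upd z l v) k (c * upd z l v $ k))) holomorphic_on ball 0 r" if z: "z \<in> PD r" for z l
  proof (cases "k = l")
    case True
    have "(\<lambda>w. F (upd z k w)) \<circ> (\<lambda>w. c * w) holomorphic_on ball 0 r"
      by (rule holomorphic_on_compose_gen[OF _ hol_sep[OF F z]])
        (use * in \<open>auto intro!: holomorphic_intros\<close>)
    with True show ?thesis by (simp add: o_def)
  next
    case False
    with hol_sep[OF F upd_in_PD[OF z *[OF PD_nth[OF z]]], of k k l] show ?thesis
      by (simp add: upd_commute)
  qed
qed

text \<open>Cauchy's formula on the circle of radius \<open>s\<close> with s' < s < r makes the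
  partial derivative a parameter integral with holomorphic integrand; the gap between s' and
  \<open>s\<close> keeps the denominator away from zero.\<close>

lemma hol_pd:
  fixes F :: "complex^'n::finite \<Rightarrow> complex"
  assumes F: "hol F r"
  shows "hol (pd k F) r"
proof (rule hol_shrink)
  fix s' assume "s' < r"
  then obtain s where s: "s' < s" "s < r" using dense by blast
  show "hol (pd k F) s'"
  proof (cases "s > 0")
    case False
    then have "z \<notin> PD s'" for z :: "complex^'n"
      using s PD_nth[of z s' undefined] norm_ge_zero[of "z $ undefined"] by linarith
    then have "PD s' = ({} :: (complex^'n) set)" by blast
    then show ?thesis by (simp add: hol_def)
  next
    case True
    define c where "c = circlepath 0 s"
    have c_norm: "norm (c t) = s" if "t \<in> {0..1}" for t
    proof -
      have "c t \<in> sphere 0 \<bar>s\<bar>"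
        using that unfolding c_def path_image_circlepath[symmetric] path_image_def by blast
      then show ?thesis using True by simp
    qed
    define G where "G t z = F (upd z k (c t)) / (c t - z$k)^2 * vector_derivative c (at t)" for t z
    have nz: "c t - z$k \<noteq> 0" if "t \<in> {0..1}" "z \<in> PD s'" for t z
      using c_norm[OF that(1)] PD_nth[OF that(2), of k] s by auto
    have F': "hol F s'" by (rule hol_mono[OF F]) (use s in auto)
    have "hol (\<lambda>z. integral {0..1} (\<lambda>t. G t z)) s'"
    proof (rule hol_integral)
      have "hol (\<lambda>z. F (upd z k (c t))) s'" if "t \<in> {0..1}" for t
        by (rule hol_mono[OF hol_upd_const[OF F]]) (use c_norm[OF that] s in auto)
      then show "hol (G t) s'" if "t \<in> {0..1}" for t
        unfolding G_def power2_eq_square using that nz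
        by (intro hol_mult hol_divide hol_diff hol_const hol_coord) auto
      have cc: "continuous_on (PD s' \<times> {0..1}) (\<lambda>y. c (snd y))"
        unfolding c_def circlepath by (intro continuous_intros)
      have cv: "continuous_on (PD s' \<times> {0..1}) (\<lambda>y. vector_derivative c (at (snd y)))"
        unfolding c_def vector_derivative_circlepath by (intro continuous_intros)
      have cF: "continuous_on (PD s' \<times> {0..1}) (\<lambda>y. F (upd (fst y) k (c (snd y))))"
        by (rule continuous_on_compose2[OF hol_cont[OF F]])
          (use c_norm s in \<open>auto intro!: continuous_intros cc upd_in_PD intro: PD_mono[of s' r]\<close>)
      show "continuous_on (PD s' \<times> {0..1}) (\<lambda>(z, t). G t z)"
        unfolding split_beta G_def
        by (intro continuous_intros cc cv cF) (use nz in \<open>auto simp: power2_eq_square\<close>)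
    qed
    then have "hol (\<lambda>z. 1 / (2 * of_real pi * \<i>) * integral {0..1} (\<lambda>t. G t z)) s'"
      by (intro hol_mult hol_const)
    then show ?thesis
    proof (rule hol_cong)
      fix z :: "complex^'n" assume z: "z \<in> PD s'"
      have zr: "z \<in> PD r" using z s by (auto intro: PD_mono[of s' r])
      have "(\<lambda>w. F (upd z k w)) holomorphic_on ball 0 r" by (rule hol_sep[OF F zr])
      then have h: "continuous_on (cball 0 s) (\<lambda>w. F (upd z k w))" "(\<lambda>w. F (upd z k w)) holomorphic_on ball 0 s"
        using s by (auto intro: holomorphic_on_subset intro!: holomorphic_on_imp_continuous_on)
      have "z $ k \<in> ball 0 s" using PD_nth[OF z, of k] s by auto
      from Cauchy_derivative_integral_circlepath(2)[OF h this]
      show "1 / (2 * of_real pi * \<i>) * integral {0..1} (\<lambda>t. G t z) = pd k F z"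
        by (simp add: pd_def DERIV_imp_deriv contour_integral_integral G_def c_def)
    qed
  qed
qed

text \<open>Hadamard's lemma: \<open>G\<close> is the mean of the partial derivative over the
  segment from the hyperplane z_k = 0 to the point. Division by a coordinate rests on this instead
  of a rearrangement of power series.\<close>

lemma hol_hadamard:
  fixes F :: "complex^'n::finite \<Rightarrow> complex"
  assumes F: "hol F r"
  obtains G where "hol G r" "\<And>z. z \<in> PD r \<Longrightarrow> F z = F (upd z k 0) + z$k * G z"
proof
  define G where "G z = integral {0..1} (\<lambda>t. pd k F (upd z k (of_real t * z$k)))" for z
  have le: "norm (of_real t * z$k) < r" if "z \<in> PD r" "t \<in> {0..1}" for z and t :: real
    using mult_left_le_one_le[of "norm (z$k)" t] that PD_nth[OF that(1), of k] by (simp add: norm_mult)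
  have pc: "continuous_on (PD r \<times> {0..1}) (\<lambda>p. pd k F (upd (fst p) k (of_real (snd p) * fst p $ k)))"
    by (rule continuous_on_compose2[OF hol_cont[OF hol_pd[OF F]]])
      (auto intro!: continuous_intros upd_in_PD le)
  show "hol G r" unfolding G_def
  proof (rule hol_integral)
    show "hol (\<lambda>z. pd k F (upd z k (of_real t * z $ k))) r" if "t \<in> {0..1}" for t
      by (rule hol_upd_scale[OF hol_pd[OF F]]) (use that in auto)
    show "continuous_on (PD r \<times> {0..1}) (\<lambda>(z, t). pd k F (upd z k (complex_of_real t * z $ k)))"
      using pc by (simp add: split_beta)
  qed
  fix z :: "complex^'n" assume z: "z \<in> PD r"
  have "((\<lambda>t. z$k * pd k F (upd z k (of_real t * z$k))) has_integral
      F (upd z k (of_real 1 * z$k)) - F (upd z k (of_real 0 * z$k))) {0..1}"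
  proof (rule fundamental_theorem_of_calculus)
    fix t :: real assume t: "t \<in> {0..1}"
    have "((\<lambda>w. F (upd z k w)) has_field_derivative pd k F (upd z k (of_real t * z$k))) (at (of_real t * z$k))"
      by (rule hol_has_pd[OF F z le[OF z t]])
    moreover have "((\<lambda>t. of_real t * z$k) has_vector_derivative z$k) (at t within {0..1})"
      by (auto intro!: derivative_eq_intros)
    ultimately show "((\<lambda>t. F (upd z k (of_real t * z$k))) has_vector_derivative
       z$k * pd k F (upd z k (of_real t * z$k))) (at t within {0..1})"
      using field_vector_diff_chain_within[of "\<lambda>t. of_real t * z$k" "z$k" t "{0..1}" "\<lambda>w. F (upd z k w)"]
      by (simp add: o_def has_field_derivative_at_within)
  qed simp
  from integral_unique[OF this] have "z$k * G z = F z - F (upd z k 0)"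
    unfolding G_def by simp
  then show "F z = F (upd z k 0) + z$k * G z" by simp
qed

text \<open>Continuous partial derivatives give total differentiability: the coordinates in
  \<open>T\<close> are moved one after the other, and each move costs at most e * norm v by the mean
  value inequality.\<close>

lemma hol_has_derivative:
  fixes F :: "complex^'n::finite \<Rightarrow> complex"
  assumes F: "hol F r" and z: "z \<in> PD r"
  shows "(F has_derivative (\<lambda>v. \<Sum>i\<in>UNIV. v$i * pd i F z)) (at z)"
proof -
  define P where "P T v = (\<chi> i. if i \<in> T then v$i else 0)" for T and v :: "complex^'n"
  have P_nth: "P T v $ i = (if i \<in> T then v$i else 0)" for T v i by (simp add: P_def)
  have claim: "\<exists>d>0. \<forall>v. norm v < d \<longrightarrow>
      norm (F (z + P T v) - F z - (\<Sum>i\<in>T. v$i * pd i F z)) \<le> e * card T * norm v"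
    if "finite T" "e > 0" for T and e :: real
    using that(1)
  proof (induction T rule: finite_induct)
    case empty
    have "P {} v = 0" for v by (simp add: P_def vec_eq_iff)
    then show ?case by (auto intro: exI[of _ 1])
  next
    case (insert k T)
    then obtain d1 where d1: "d1 > 0" "\<And>v. norm v < d1 \<Longrightarrow>
       norm (F (z + P T v) - F z - (\<Sum>i\<in>T. v$i * pd i F z)) \<le> e * card T * norm v" by blast
    have "isCont (pd k F) z"
      using hol_cont[OF hol_pd[OF F]] z open_PD continuous_on_eq_continuous_at by blast
    then have "\<exists>d>0. \<forall>y. norm (y - z) < d \<longrightarrow> norm (pd k F y - pd k F z) < e"
      using \<open>e > 0\<close> unfolding continuous_at_eps_delta dist_norm by blast
    then obtain d2 where d2: "d2 > 0" "\<And>y. norm (y - z) < d2 \<Longrightarrow> norm (pd k F y - pd k F z) < e"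
      by (elim exE conjE) (rule that, auto)
    obtain d3 where d3: "d3 > 0" "ball z d3 \<subseteq> PD r"
      using open_PD z open_contains_ball by blast
    define d where "d = min d1 (min d2 d3)"
    show ?case
    proof (intro exI conjI allI impI)
      show "d > 0" using d1 d2 d3 by (simp add: d_def)
      fix v :: "complex^'n" assume v: "norm v < d"
      define y where "y = z + P T v"
      have near: "norm (upd y k w - z) < d" if "norm (w - z$k) \<le> norm (v$k)" for w
      proof -
        have "norm (upd y k w - z) \<le> norm v"
          by (rule norm_le_componentwise_cart) (use that in \<open>auto simp: y_def P_nth\<close>)
        with v show ?thesis by simp
      qed
      have yk: "y$k = z$k" using insert by (simp add: y_def P_nth)
      have inPD: "upd y k w \<in> PD r" if "norm (w - z$k) \<le> norm (v$k)" for w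
        using near[OF that] d3 by (auto simp: d_def dist_norm norm_minus_commute)
      \<comment> \<open>The linear term is subtracted first, so that the derivative to be bounded is
        the difference between \<open>pd k F\<close> at a nearby point and at
        \<open>z\<close>.\<close>
      have "norm ((F (upd y k (z$k + v$k)) - (z$k + v$k) * pd k F z) - (F (upd y k (z$k)) - z$k * pd k F z))
          \<le> e * norm ((z$k + v$k) - z$k)"
      proof (rule field_differentiable_bound)
        show "convex (cball (z$k) (norm (v$k)))" by simp
        fix w assume "w \<in> cball (z$k) (norm (v$k))"
        then have w: "norm (w - z$k) \<le> norm (v$k)" by (simp add: dist_norm norm_minus_commute)
        have "norm w < r" using PD_nth[OF inPD[OF w], of k] by simp
        from hol_has_pd[OF F inPD[OF w] this, of k]
        have "((\<lambda>w. F (upd y k w)) has_field_derivative pd k F (upd y k w)) (at w)" by simp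
        from has_field_derivative_at_within[OF DERIV_diff[OF this DERIV_cmult_right[OF DERIV_ident]]]
        show "((\<lambda>w. F (upd y k w) - w * pd k F z) has_field_derivative pd k F (upd y k w) - pd k F z)
            (at w within cball (z$k) (norm (v$k)))"
          by simp
        show "norm (pd k F (upd y k w) - pd k F z) \<le> e"
          using d2(2)[of "upd y k w"] near[OF w] by (simp add: d_def less_imp_le)
      qed (auto simp: dist_norm)
      moreover have "upd y k (z$k) = y" using yk by (simp add: vec_eq_iff)
      moreover have "upd y k (z$k + v$k) = z + P (insert k T) v"
        using insert by (auto simp: vec_eq_iff y_def P_nth)
      ultimately have "norm (F (z + P (insert k T) v) - F y - v$k * pd k F z) \<le> e * norm (v$k)"
        by (simp add: algebra_simps)
      moreover have "norm (v$k) \<le> norm v" by (simp add: Finite_Cartesian_Product.norm_nth_le)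
      ultimately have 1: "norm (F (z + P (insert k T) v) - F y - v$k * pd k F z) \<le> e * norm v"
        using \<open>e > 0\<close> by (meson mult_left_mono less_imp_le order_trans)
      have 2: "norm (F y - F z - (\<Sum>i\<in>T. v$i * pd i F z)) \<le> e * card T * norm v"
        using d1(2)[of v] v by (simp add: d_def y_def)
      have "F (z + P (insert k T) v) - F z - (\<Sum>i\<in>insert k T. v$i * pd i F z) =
        (F (z + P (insert k T) v) - F y - v$k * pd k F z) + (F y - F z - (\<Sum>i\<in>T. v$i * pd i F z))"
        using insert by simp
      then show "norm (F (z + P (insert k T) v) - F z - (\<Sum>i\<in>insert k T. v$i * pd i F z))
          \<le> e * card (insert k T) * norm v"
        using norm_triangle_mono[OF 1 2] insert by (simp add: algebra_simps)
    qed
  qed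
  show ?thesis
    unfolding has_derivative_at_alt
  proof (intro conjI allI impI)
    have "linear (\<lambda>v. \<Sum>i\<in>UNIV. v$i * pd i F z)"
      by (intro linear_compose_sum linearI ballI) (auto simp: algebra_simps)
    then show "bounded_linear (\<lambda>v. \<Sum>i\<in>UNIV. v$i * pd i F z)"
      by (rule linear_conv_bounded_linear[THEN iffD1])
    fix e :: real assume "e > 0"
    then obtain d where d: "d > 0" "\<And>v. norm v < d \<Longrightarrow>
      norm (F (z + P UNIV v) - F z - (\<Sum>i\<in>UNIV. v$i * pd i F z)) \<le> e / CARD('n) * CARD('n) * norm v"
      using claim[of UNIV "e / CARD('n)"] by auto
    have P_UNIV: "P UNIV v = v" for v by (simp add: P_def vec_eq_iff)
    show "\<exists>d>0. \<forall>y. norm (y - z) < d \<longrightarrow>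
        norm (F y - F z - (\<Sum>i\<in>UNIV. (y - z)$i * pd i F z)) \<le> e * norm (y - z)"
    proof (intro exI[of _ d] conjI allI impI)
      fix y assume "norm (y - z) < d"
      from d(2)[OF this] show "norm (F y - F z - (\<Sum>i\<in>UNIV. (y - z)$i * pd i F z)) \<le> e * norm (y - z)"
        by (simp add: P_UNIV)
    qed (rule d)
  qed
qed

text \<open>Holomorphy in each variable alone does not compose; the total derivative does.\<close>

lemma hol_chain:
  fixes F :: "complex^'n::finite \<Rightarrow> complex"
  assumes F: "hol F r" and "open S"
    and \<Phi>: "\<And>i. (\<lambda>w. \<Phi> w $ i) holomorphic_on S" and im: "\<And>w. w \<in> S \<Longrightarrow> \<Phi> w \<in> PD r"
  shows "(\<lambda>w. F (\<Phi> w)) holomorphic_on S"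
proof (rule holomorphic_onI)
  fix w assume w: "w \<in> S"
  define D where "D = (\<chi> i. deriv (\<lambda>w. \<Phi> w $ i) w)"
  have "(\<Phi> has_derivative (\<lambda>h. \<chi> i. h * D $ i)) (at w)"
  proof (rule has_derivative_componentwise_within[THEN iffD2], intro ballI)
    fix b :: "complex^'n" assume "b \<in> Basis"
    then obtain i c where b: "b = axis i c" "c \<in> Basis" by (auto simp: Basis_vec_def)
    have "((\<lambda>w. \<Phi> w $ i) has_derivative (\<lambda>h. h * D$i)) (at w)"
      using holomorphic_derivI[OF \<Phi>[of i] \<open>open S\<close> w]
      by (simp add: has_field_derivative_def D_def mult.commute[of _ "deriv _ _"])
    then have "((\<lambda>w. \<Phi> w $ i \<bullet> c) has_derivative (\<lambda>h. (h * D$i) \<bullet> c)) (at w)"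
      by (rule has_derivative_inner_left)
    then show "((\<lambda>x. \<Phi> x \<bullet> b) has_derivative (\<lambda>x. (\<chi> i. x * D $ i) \<bullet> b)) (at w)"
      by (simp add: b inner_axis)
  qed
  from has_derivative_compose[OF this hol_has_derivative[OF F im[OF w]]]
  have "((\<lambda>w. F (\<Phi> w)) has_derivative (\<lambda>h. \<Sum>i\<in>UNIV. h * D $ i * pd i F (\<Phi> w))) (at w)" by simp
  moreover have "(\<lambda>h. \<Sum>i\<in>UNIV. h * D $ i * pd i F (\<Phi> w)) = (*) (\<Sum>i\<in>UNIV. D $ i * pd i F (\<Phi> w))"
    by (auto simp: sum_distrib_left sum_distrib_right mult_ac)
  ultimately show "(\<lambda>w. F (\<Phi> w)) field_differentiable at w within S"
    unfolding field_differentiable_def has_field_derivative_def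
    by (metis has_derivative_at_withinI)
qed

lemma hol_compose:
  fixes F :: "complex^'n::finite \<Rightarrow> complex" and \<Phi> :: "complex^'m::finite \<Rightarrow> complex^'n"
  assumes F: "hol F r" and \<Phi>: "\<And>i. hol (\<lambda>z. \<Phi> z $ i) s" and im: "\<And>z. z \<in> PD s \<Longrightarrow> \<Phi> z \<in> PD r"
  shows "hol (\<lambda>z. F (\<Phi> z)) s"
proof (rule holI)
  have "continuous_on (PD s) (\<lambda>z. \<chi> i. \<Phi> z $ i)"
    by (intro continuous_on_vec_lambda hol_cont \<Phi>)
  then have "continuous_on (PD s) \<Phi>" by (simp add: vec_lambda_eta)
  then show "continuous_on (PD s) (\<lambda>z. F (\<Phi> z))"
    by (rule continuous_on_compose2[OF hol_cont[OF F]]) (use im in auto)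
  show "(\<lambda>w. F (\<Phi> (upd z k w))) holomorphic_on ball 0 s" if "z \<in> PD s" for z k
    by (rule hol_chain[OF F open_ball hol_sep[OF \<Phi> that]]) (use im that in \<open>auto simp: upd_in_PD\<close>)
qed

lemma norm_vec_less:
  fixes z :: "('a::real_normed_vector)^'n::finite"
  assumes "\<And>i. norm (z$i) < d / CARD('n)"
  shows "norm z < d"
proof -
  have "norm z \<le> (\<Sum>i\<in>UNIV. norm (z$i))"
    unfolding norm_vec_def by (rule L2_set_le_sum) simp
  also have "\<dots> < (\<Sum>i\<in>(UNIV::'n set). d / CARD('n))"
    by (rule sum_strict_mono) (use assms in auto)
  finally show ?thesis by simp
qed

lemma PD_subset_open:
  assumes "open T" "0 \<in> T"
  obtains s where "s > 0" "PD s \<subseteq> (T :: (complex^'n::finite) set)"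
proof -
  obtain d where d: "d > 0" "ball 0 d \<subseteq> T"
    using assms open_contains_ball by blast
  show ?thesis
  proof
    show "d / CARD('n) > 0" using d by simp
    show "PD (d / CARD('n)) \<subseteq> T"
    proof
      fix z :: "complex^'n" assume "z \<in> PD (d / CARD('n))"
      then have "norm z < d" by (intro norm_vec_less) (auto simp: PD_iff)
      then show "z \<in> T" using d(2) by auto
    qed
  qed
qed

section \<open>Boxes in real space and germs of real analytic functions at the origin\<close>

definition RB :: "real \<Rightarrow> (real^'n::finite) set" where
  "RB r = {x. \<forall>i. \<bar>x$i\<bar> < r}"

lemma RB_iff: "x \<in> RB r \<longleftrightarrow> (\<forall>i. \<bar>x$i\<bar> < r)"
  by (simp add: RB_def)

lemma RB_nth: "x \<in> RB r \<Longrightarrow> \<bar>x$i\<bar> < r"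
  by (simp add: RB_iff)

lemma RB_mono: "r \<le> s \<Longrightarrow> x \<in> RB r \<Longrightarrow> x \<in> RB s"
  by (meson RB_iff order_less_le_trans)

lemma zero_in_RB [simp]: "r > 0 \<Longrightarrow> 0 \<in> RB r"
  by (simp add: RB_iff)

lemma upd_in_RB: "x \<in> RB r \<Longrightarrow> \<bar>t\<bar> < r \<Longrightarrow> upd x k t \<in> RB r"
  by (simp add: RB_iff)

lemma open_RB: "open (RB r :: (real^'n::finite) set)"
proof -
  have "RB r = (\<Inter>i\<in>UNIV. {x::real^'n. \<bar>x$i\<bar> < r})"
    by (auto simp: RB_iff)
  moreover have "open {x::real^'n. \<bar>x$i\<bar> < r}" for i
    by (intro open_Collect_less continuous_intros)
  ultimately show ?thesis by auto
qed

lemma ball_subset_RB: "ball 0 r \<subseteq> (RB r :: (real^'n::finite) set)"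
  using component_le_norm_cart le_less_trans by (fastforce simp: RB_iff)

lemma RB_subset_ball: "RB (d / CARD('n)) \<subseteq> (ball 0 d :: (real^'n::finite) set)"
  by (auto simp: RB_iff intro!: norm_vec_less)

lemma eventually_RB:
  "eventually P (nhds (0::real^'n::finite)) \<longleftrightarrow> (\<exists>r>0. \<forall>x\<in>RB r. P x)"
proof
  assume "eventually P (nhds (0::real^'n))"
  then obtain d where d: "d > 0" "\<And>x. x \<in> ball 0 d \<Longrightarrow> P x"
    unfolding eventually_nhds_metric by auto
  show "\<exists>r>0. \<forall>x\<in>RB r. P x"
    using d RB_subset_ball[of d, where 'n='n] by (intro exI[of _ "d / CARD('n)"]) auto
next
  assume "\<exists>r>0. \<forall>x\<in>RB r. P x"
  then show "eventually P (nhds (0::real^'n))"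
    unfolding eventually_nhds using open_RB by (metis zero_in_RB)
qed

lemma eventually_RBI: "r > 0 \<Longrightarrow> (\<And>x. x \<in> RB r \<Longrightarrow> P x) \<Longrightarrow> eventually P (nhds (0::real^'n::finite))"
  unfolding eventually_RB by blast

lemma uniform_radius:
  fixes P :: "'i::finite \<Rightarrow> real \<Rightarrow> bool"
  assumes "\<And>i. \<exists>r>0. P i r" and mono: "\<And>i r s. P i r \<Longrightarrow> 0 < s \<Longrightarrow> s \<le> r \<Longrightarrow> P i s"
  shows "\<exists>r>0. \<forall>i. P i r"
proof -
  obtain r where r: "\<And>i. r i > 0" "\<And>i. P i (r i)" using assms(1) by metis
  have "Min (range r) > 0" using r by (subst Min_gr_iff) auto
  moreover have "P i (Min (range r))" for i
    by (rule mono[OF r(2)]) (use calculation in auto)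
  ultimately show ?thesis by blast
qed

definition cvec :: "real^'n \<Rightarrow> complex^'n::finite" where
  "cvec x = (\<chi> i. complex_of_real (x$i))"

lemma cvec_nth [simp]: "cvec x $ i = of_real (x$i)"
  by (simp add: cvec_def)

lemma cvec_in_PD [simp]: "cvec x \<in> PD r \<longleftrightarrow> x \<in> RB r"
  by (simp add: PD_iff RB_iff)

lemma cvec_0 [simp]: "cvec 0 = 0"
  by (simp add: vec_eq_iff)

lemma cvec_upd: "cvec (upd x k t) = upd (cvec x) k (of_real t)"
  by (simp add: vec_eq_iff)

lemma continuous_on_cvec [continuous_intros]:
  "continuous_on S f \<Longrightarrow> continuous_on S (\<lambda>x. cvec (f x))"
  unfolding cvec_def by (intro continuous_on_vec_lambda continuous_intros)

lemma bounded_linear_cvec: "bounded_linear cvec"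
proof -
  have "linear (cvec :: real^'n \<Rightarrow> complex^'n)"
    by (rule linearI) (auto simp: vec_eq_iff complex_eq_iff)
  then show ?thesis by (simp add: linear_conv_bounded_linear)
qed

text \<open>Real analyticity of the germ at 0, encoded by a holomorphic extension to some polydisc.
  Away from the origin \<open>f\<close> is arbitrary, which is why identities between such functions
  are stated eventually at \<open>nhds 0\<close>.\<close>

definition an :: "(real^'n::finite \<Rightarrow> real) \<Rightarrow> bool" where
  "an f \<longleftrightarrow> (\<exists>r>0. \<exists>F. hol F r \<and> (\<forall>x\<in>RB r. F (cvec x) = of_real (f x)))"

lemma anI: "r > 0 \<Longrightarrow> hol F r \<Longrightarrow> (\<And>x. x \<in> RB r \<Longrightarrow> F (cvec x) = of_real (f x)) \<Longrightarrow> an f"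
  unfolding an_def by blast

lemma anE:
  assumes "an f"
  obtains r F where "r > 0" "hol F r" "\<And>x. x \<in> RB r \<Longrightarrow> F (cvec x) = of_real (f x)"
  using assms unfolding an_def by blast

lemma an_cong: "an f \<Longrightarrow> \<forall>\<^sub>F x in nhds 0. f x = g x \<Longrightarrow> an g"
proof -
  assume "an f" "\<forall>\<^sub>F x in nhds 0. f x = g x"
  then obtain r F s where "r > 0" "hol F r" "\<And>x. x \<in> RB r \<Longrightarrow> F (cvec x) = of_real (f x)"
     and s: "s > 0" "\<And>x. x \<in> RB s \<Longrightarrow> f x = g x"
    unfolding eventually_RB by (elim anE) blast
  moreover have "x \<in> RB r" "x \<in> RB s" if "x \<in> RB (min r s)" for x :: "real^'a"
    using that by (auto intro: RB_mono[of "min r s"])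
  ultimately show "an g"
    by (intro anI[of "min r s" F]) (auto intro: hol_mono)
qed

text \<open>\<open>H\<close> is the operation on the complex extensions and \<open>h\<close> its
  real counterpart; both extensions are cut down to a common radius.\<close>

lemma an2:
  fixes f g :: "real^'n::finite \<Rightarrow> real"
  assumes f: "an f" and g: "an g"
    and H: "\<And>(F::complex^'n \<Rightarrow> complex) G r. hol F r \<Longrightarrow> hol G r \<Longrightarrow> hol (\<lambda>z. H (F z) (G z)) r"
    and h: "\<And>a b. H (of_real a) (of_real b) = of_real (h a b)"
  shows "an (\<lambda>x. h (f x) (g x))"
proof -
  obtain r F where F: "r > 0" "hol F r" "\<And>x. x \<in> RB r \<Longrightarrow> F (cvec x) = of_real (f x)"
    using f by (elim anE) blast
  obtain s G where G: "s > 0" "hol G s" "\<And>x. x \<in> RB s \<Longrightarrow> G (cvec x) = of_real (g x)"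
    using g by (elim anE) blast
  show ?thesis
  proof (rule anI)
    show "hol (\<lambda>z. H (F z) (G z)) (min r s)"
      by (rule H) (auto intro: hol_mono F G)
    fix x :: "real^'n" assume "x \<in> RB (min r s)"
    then have "x \<in> RB r" "x \<in> RB s" by (auto intro: RB_mono[of "min r s"])
    then show "H (F (cvec x)) (G (cvec x)) = of_real (h (f x) (g x))"
      by (simp add: F G h)
  qed (use F G in auto)
qed

lemma an_const [simp]: "an (\<lambda>x. c)"
  by (rule anI[of 1 "\<lambda>z. of_real c"]) (auto simp: hol_const)

lemma an_coord [simp]: "an (\<lambda>x. x$i)"
  by (rule anI[of 1 "\<lambda>z. z$i"]) (auto simp: hol_coord)

lemma an_add: "an f \<Longrightarrow> an g \<Longrightarrow> an (\<lambda>x. f x + g x)"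
  by (rule an2[where H = "(+)"]) (auto intro: hol_add)

lemma an_diff: "an f \<Longrightarrow> an g \<Longrightarrow> an (\<lambda>x. f x - g x)"
  by (rule an2[where H = "(-)"]) (auto intro: hol_diff)

lemma an_mult: "an f \<Longrightarrow> an g \<Longrightarrow> an (\<lambda>x. f x * g x)"
  by (rule an2[where H = "(*)"]) (auto intro: hol_mult)

lemma an_minus: "an f \<Longrightarrow> an (\<lambda>x. - f x)"
  using an_diff[of "\<lambda>x. 0" f] by simp

lemma an_power: "an f \<Longrightarrow> an (\<lambda>x. f x ^ n)"
  by (induction n) (auto intro: an_mult)

lemma an_sum: "(\<And>i. i \<in> I \<Longrightarrow> an (f i)) \<Longrightarrow> an (\<lambda>x. \<Sum>i\<in>I. f i x)"
  by (induction I rule: infinite_finite_induct) (auto intro: an_add)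

lemma an_prod: "(\<And>i. i \<in> I \<Longrightarrow> an (f i)) \<Longrightarrow> an (\<lambda>x. \<Prod>i\<in>I. f i x)"
  by (induction I rule: infinite_finite_induct) (auto intro: an_mult)

lemmas an_intros = an_const an_coord an_add an_diff an_mult an_minus an_power an_sum an_prod

lemma an_inverse:
  fixes f :: "real^'n::finite \<Rightarrow> real"
  assumes "an f" "f 0 \<noteq> 0"
  shows "an (\<lambda>x. inverse (f x))"
proof -
  obtain r F where F: "r > 0" "hol F r" "\<And>x. x \<in> RB r \<Longrightarrow> F (cvec x) = of_real (f x)"
    using assms by (elim anE) blast
  have "open (PD r \<inter> F -` (-{0}))"
    by (rule continuous_open_preimage[OF hol_cont[OF F(2)] open_PD]) auto
  moreover have "F 0 \<noteq> 0"
    using F(3)[of 0] F(1) assms(2) by simp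
  ultimately obtain s where s: "s > 0" "PD s \<subseteq> PD r \<inter> F -` (-{0})"
    using F(1) by (elim PD_subset_open) auto
  show ?thesis
  proof (rule anI)
    show "0 < min r s" using s F by simp
    show "hol (\<lambda>z. 1 / F z) (min r s)"
      using s by (intro hol_divide hol_const hol_mono[OF F(2)]) (auto dest: PD_mono[of "min r s" s, rotated])
    show "1 / F (cvec x) = of_real (inverse (f x))" if "x \<in> RB (min r s)" for x
      using F(3)[of x] RB_mono[OF _ that, of r] by (simp add: inverse_eq_divide)
  qed
qed

lemma hol_cnj:
  fixes G :: "complex^'n::finite \<Rightarrow> complex"
  assumes "hol G r"
  shows "hol (\<lambda>z. cnj (G (\<chi> i. cnj (z$i)))) r"
proof (rule holI)
  show "continuous_on (PD r) (\<lambda>z. cnj (G (\<chi> i. cnj (z$i))))"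
    by (intro continuous_on_cnj continuous_on_compose2[OF hol_cont[OF assms]] continuous_on_vec_lambda continuous_intros)
      (auto simp: PD_iff)
  fix z :: "complex^'n" and k assume "z \<in> PD r"
  then have "(\<chi> i. cnj (z$i)) \<in> PD r" by (simp add: PD_iff)
  from hol_sep[OF assms this, of k]
  have "cnj \<circ> (\<lambda>w. G (upd (\<chi> i. cnj (z$i)) k w)) \<circ> cnj holomorphic_on ball 0 r"
    by (intro holomorphic_on_compose_cnj_cnj) (auto simp: image_iff elim!: holomorphic_on_subset)
  moreover have "upd (\<chi> i. cnj (z$i)) k (cnj w) = (\<chi> i. cnj (upd z k w $ i))" for w
    by (auto simp: vec_eq_iff)
  ultimately show "(\<lambda>w. cnj (G (\<chi> i. cnj (upd z k w $ i)))) holomorphic_on ball 0 r"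
    by (simp add: o_def)
qed

text \<open>The real part is not holomorphic, but the mean of \<open>G\<close> and its Schwarz
  reflection is, and it equals the real part at real points. Derivatives and quotients formed on the
  complex side thus come back as real germs, without a check that they are real on real
  points.\<close>

lemma an_Re:
  fixes G :: "complex^'n::finite \<Rightarrow> complex"
  assumes "hol G r" "r > 0"
  shows "an (\<lambda>x. Re (G (cvec x)))"
proof (rule anI[OF assms(2)])
  show "hol (\<lambda>z. 1/2 * (G z + cnj (G (\<chi> i. cnj (z$i))))) r"
    by (intro hol_mult hol_const hol_add assms hol_cnj)
  show "1/2 * (G (cvec x) + cnj (G (\<chi> i. cnj (cvec x $ i)))) = complex_of_real (Re (G (cvec x)))" for x
    by (simp add: cvec_def[symmetric] complex_add_cnj)
qed

lemma an_compose:
  fixes f :: "real^'n::finite \<Rightarrow> real" and \<Phi> :: "real^'m::finite \<Rightarrow> real^'n"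
  assumes f: "an f" and \<Phi>: "\<And>i. an (\<lambda>x. \<Phi> x $ i)" and 0: "\<Phi> 0 = 0"
  shows "an (\<lambda>x. f (\<Phi> x))"
proof -
  obtain r F where F: "r > 0" "hol F r" "\<And>x. x \<in> RB r \<Longrightarrow> F (cvec x) = of_real (f x)"
    using f by (elim anE) blast
  have "\<exists>G s. s > 0 \<and> hol G s \<and> (\<forall>x\<in>RB s. G (cvec x) = of_real (\<Phi> x $ i))" for i
    using \<Phi>[of i] unfolding an_def by blast
  then obtain G where "\<And>i. \<exists>s>0. hol (G i) s \<and> (\<forall>x\<in>RB s. G i (cvec x) = of_real (\<Phi> x $ i))"
    by metis
  then have "\<exists>s>0. \<forall>i. hol (G i) s \<and> (\<forall>x\<in>RB s. G i (cvec x) = of_real (\<Phi> x $ i))"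
    by (rule uniform_radius) (auto intro: hol_mono RB_mono)
  then obtain s where s: "s > 0" "\<And>i. hol (G i) s" "\<And>i x. x \<in> RB s \<Longrightarrow> G i (cvec x) = of_real (\<Phi> x $ i)"
    by blast
  have "continuous_on (PD s) (\<lambda>z. \<chi> i. G i z)"
    by (intro continuous_on_vec_lambda hol_cont s)
  then have "open (PD s \<inter> (\<lambda>z. \<chi> i. G i z) -` PD r)"
    by (intro continuous_open_preimage open_PD)
  moreover have "G i 0 = 0" for i using s(3)[of 0 i] s(1) 0 by simp
  ultimately obtain t where t: "t > 0" "PD t \<subseteq> PD s \<inter> (\<lambda>z. \<chi> i. G i z) -` PD r"
    using s(1) F(1) by (elim PD_subset_open) (auto simp: PD_iff)
  show ?thesis
  proof (rule anI)
    show "0 < min s t" using s t by simp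
    show "hol (\<lambda>z. F (\<chi> i. G i z)) (min s t)"
      by (rule hol_compose[OF F(2)]) (use t in \<open>auto intro: hol_mono[OF s(2)] dest: PD_mono[of "min s t" t, rotated]\<close>)
    fix x :: "real^'m" assume x: "x \<in> RB (min s t)"
    have "x \<in> RB s" "cvec x \<in> PD t" using x by (auto intro: RB_mono[of "min s t"])
    then have *: "(\<chi> i. G i (cvec x)) = cvec (\<Phi> x)" "(\<chi> i. G i (cvec x)) \<in> PD r"
      using s(3) t(2) by (auto simp: vec_eq_iff simp del: cvec_in_PD)
    then show "F (\<chi> i. G i (cvec x)) = of_real (f (\<Phi> x))"
      using F(3)[of "\<Phi> x"] by simp
  qed
qed

lemma an_continuous:
  assumes "an f"
  obtains r where "r > 0" "continuous_on (RB r) f"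
proof -
  obtain r F where F: "r > 0" "hol F r" "\<And>x. x \<in> RB r \<Longrightarrow> F (cvec x) = of_real (f x)"
    using assms by (elim anE) blast
  have "continuous_on (RB r) (\<lambda>x. Re (F (cvec x)))"
    by (intro continuous_intros continuous_on_compose2[OF hol_cont[OF F(2)]]) auto
  then have "continuous_on (RB r) f"
    by (rule continuous_on_eq) (simp add: F)
  with F(1) show ?thesis by (rule that)
qed

lemma an_tendsto: "an f \<Longrightarrow> (f \<longlongrightarrow> f 0) (nhds 0)"
proof -
  assume "an f"
  then obtain r where "r > 0" "continuous_on (RB r) f" by (rule an_continuous)
  then have "isCont f 0" using open_RB continuous_on_eq_continuous_at zero_in_RB by blast
  then show ?thesis
    by (simp add: tendsto_at_iff_tendsto_nhds isCont_def)
qed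

lemma an_map_tendsto:
  assumes "\<And>i. an (\<lambda>x. \<Phi> x $ i)" "\<Phi> 0 = 0"
  shows "filterlim \<Phi> (nhds 0) (nhds 0)"
  using vec_tendstoI[of \<Phi> 0 "nhds 0"] an_tendsto[OF assms(1)] assms(2) by simp

lemma an_eventually_compose:
  assumes "\<And>i. an (\<lambda>x. \<Phi> x $ i)" "\<Phi> 0 = 0" "\<forall>\<^sub>F x in nhds 0. P x"
  shows "\<forall>\<^sub>F x in nhds 0. P (\<Phi> x)"
  by (rule eventually_compose_filterlim[OF assms(3) an_map_tendsto]) (use assms in auto)

lemma an_eventually_nz:
  assumes "an f" "f 0 \<noteq> 0"
  shows "\<forall>\<^sub>F x in nhds 0. f x \<noteq> 0"
  using an_tendsto[OF assms(1)] assms(2) by (rule tendsto_imp_eventually_ne)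

lemma an_upd: "an f \<Longrightarrow> an \<phi> \<Longrightarrow> \<phi> 0 = 0 \<Longrightarrow> an (\<lambda>x. f (upd x k (\<phi> x)))"
proof (rule an_compose[where \<Phi> = "\<lambda>x. upd x k (\<phi> x)"])
  assume "an \<phi>"
  then show "an (\<lambda>x. upd x k (\<phi> x) $ i)" for i by (cases "i = k") auto
qed (auto simp: vec_eq_iff)

lemma an_hadamard:
  fixes f :: "real^'n::finite \<Rightarrow> real"
  assumes "an f"
  obtains g where "an g" "\<forall>\<^sub>F x in nhds 0. f x = f (upd x k 0) + x$k * g x"
proof -
  obtain r F where F: "r > 0" "hol F r" "\<And>x. x \<in> RB r \<Longrightarrow> F (cvec x) = of_real (f x)"
    using assms by (elim anE) blast
  obtain G where G: "hol G r" "\<And>z. z \<in> PD r \<Longrightarrow> F z = F (upd z k 0) + z$k * G z"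
    using hol_hadamard[OF F(2), of k] by blast
  have "f x = f (upd x k 0) + x$k * Re (G (cvec x))" if "x \<in> RB r" for x
  proof -
    have "upd (cvec x) k 0 = cvec (upd x k 0)" by (simp add: cvec_upd)
    moreover have "upd x k 0 \<in> RB r" using that F(1) by (intro upd_in_RB) auto
    ultimately have "complex_of_real (f x) = of_real (f (upd x k 0)) + of_real (x$k) * G (cvec x)"
      using G(2)[of "cvec x"] F(3) that by simp
    then show ?thesis by (simp add: complex_eq_iff)
  qed
  then show ?thesis
    by (intro that[of "\<lambda>x. Re (G (cvec x))"] an_Re[OF G(1) F(1)] eventually_RBI[OF F(1)])
qed

text \<open>The hypothesis kills the constant term of Hadamard's lemma, the restriction to x_k =
  0.\<close>

lemma an_divide_coord:
  assumes "an f" "\<forall>\<^sub>F x in nhds 0. x$k = 0 \<longrightarrow> f x = 0"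
  obtains g where "an g" "\<forall>\<^sub>F x in nhds 0. f x = x$k * g x"
proof -
  obtain g where g: "an g" "\<forall>\<^sub>F x in nhds 0. f x = f (upd x k 0) + x$k * g x"
    using an_hadamard[OF assms(1), of k] by blast
  have "\<forall>\<^sub>F x in nhds 0. upd x k 0 $ k = 0 \<longrightarrow> f (upd x k 0) = 0"
  proof (rule an_eventually_compose[OF _ _ assms(2)])
    show "an (\<lambda>x. upd x k 0 $ i)" for i by (cases "i = k") auto
  qed (simp add: vec_eq_iff)
  with g(2) have "\<forall>\<^sub>F x in nhds 0. f x = x$k * g x"
    by eventually_elim simp
  with g(1) show ?thesis by (rule that)
qed

lemma an_deriv:
  fixes f :: "real^'n::finite \<Rightarrow> real"
  assumes "an f"
  shows "\<exists>D. (\<forall>i. an (D i)) \<and>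
    (\<forall>\<^sub>F x in nhds 0. (f has_derivative (\<lambda>v. \<Sum>i\<in>UNIV. v$i * D i x)) (at x))"
proof -
  obtain r F where F: "r > 0" "hol F r" "\<And>x. x \<in> RB r \<Longrightarrow> F (cvec x) = of_real (f x)"
    using assms by (elim anE) blast
  define D where "D i x = Re (pd i F (cvec x))" for i x
  have "(f has_derivative (\<lambda>v. \<Sum>i\<in>UNIV. v$i * D i x)) (at x)" if "x \<in> RB r" for x
  proof -
    have "(cvec has_derivative cvec) (at x)"
      by (rule bounded_linear_imp_has_derivative[OF bounded_linear_cvec])
    moreover have "(F has_derivative (\<lambda>v. \<Sum>i\<in>UNIV. v$i * pd i F (cvec x))) (at (cvec x))"
      by (rule hol_has_derivative[OF F(2)]) (use that in simp)
    ultimately have "((\<lambda>x. F (cvec x)) has_derivative (\<lambda>v. \<Sum>i\<in>UNIV. cvec v$i * pd i F (cvec x))) (at x)"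
      by (rule has_derivative_compose)
    then have "((\<lambda>x. Re (F (cvec x))) has_derivative (\<lambda>v. Re (\<Sum>i\<in>UNIV. cvec v$i * pd i F (cvec x)))) (at x)"
      by (rule bounded_linear.has_derivative[OF bounded_linear_Re])
    moreover have "(\<lambda>v. Re (\<Sum>i\<in>UNIV. cvec v$i * pd i F (cvec x))) = (\<lambda>v. \<Sum>i\<in>UNIV. v$i * D i x)"
      by (simp add: D_def)
    ultimately have "((\<lambda>x. Re (F (cvec x))) has_derivative (\<lambda>v. \<Sum>i\<in>UNIV. v$i * D i x)) (at x)"
      by simp
    then show ?thesis
      by (rule has_derivative_transform_within_open[OF _ open_RB that]) (simp add: F)
  qed
  moreover have "an (D i)" for i
    unfolding D_def by (rule an_Re[OF hol_pd[OF F(2)] F(1)])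
  ultimately show ?thesis
    by (intro exI[of _ D] conjI allI eventually_RBI[OF F(1)])
qed

text \<open>The identity theorem along the line through \<open>w\<close> and \<open>p\<close>: the
  complex parameters whose point lies in the polydisc form a convex open set containing 0 and 1, and
  the real zeros accumulate at 0. One radius serves all pairs of points.\<close>

lemma an_line:
  fixes f :: "real^'n::finite \<Rightarrow> real"
  assumes "an f"
  obtains r where "r > 0"
    "\<And>p w. p \<in> RB r \<Longrightarrow> w \<in> RB r \<Longrightarrow> \<forall>\<^sub>F t in nhds 0. f (w + t *\<^sub>R (p - w)) = 0 \<Longrightarrow> f p = 0"
proof -
  obtain r F where F: "r > 0" "hol F r" "\<And>x. x \<in> RB r \<Longrightarrow> F (cvec x) = of_real (f x)"
    using assms by (elim anE) blast
  have "f p = 0" if p: "p \<in> RB r" and w: "w \<in> RB r" and ev: "\<forall>\<^sub>F t in nhds 0. f (w + t *\<^sub>R (p - w)) = 0" for p w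
  proof -
    define \<Phi> where "\<Phi> t = (\<chi> i. of_real (w$i) + t * of_real (p$i - w$i))" for t :: complex
    have \<Phi>_real: "\<Phi> (of_real t) = cvec (w + t *\<^sub>R (p - w))" for t
      by (simp add: \<Phi>_def vec_eq_iff)
    define S where "S = {t. \<Phi> t \<in> PD r}"
    have S_eq: "S = (\<Inter>i. (\<lambda>t. of_real (w$i) + t * of_real (p$i - w$i)) -` ball 0 r)"
      by (auto simp: S_def PD_iff \<Phi>_def)
    have "open S"
      unfolding S_eq by (intro open_INT finite ballI open_vimage continuous_intros) auto
    have "convex S"
    proof (rule convexI)
      fix a b :: complex and u v :: real assume ab: "a \<in> S" "b \<in> S" "0 \<le> u" "0 \<le> v" "u + v = 1"
      have "\<Phi> (u *\<^sub>R a + v *\<^sub>R b) $ i = u *\<^sub>R (\<Phi> a $ i) + v *\<^sub>R (\<Phi> b $ i)" for i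
      proof -
        have "complex_of_real (w$i) = (of_real u + of_real v) * of_real (w$i)"
          using ab by (simp flip: of_real_add)
        then show ?thesis
          by (simp add: \<Phi>_def scaleR_conv_of_real algebra_simps)
      qed
      moreover have "u *\<^sub>R (\<Phi> a $ i) + v *\<^sub>R (\<Phi> b $ i) \<in> ball 0 r" for i
        by (rule convexD[OF convex_ball]) (use ab in \<open>auto simp: S_def PD_iff\<close>)
      ultimately show "u *\<^sub>R a + v *\<^sub>R b \<in> S" by (simp add: S_def PD_iff)
    qed
    have "(\<lambda>t. F (\<Phi> t)) holomorphic_on S"
      by (rule hol_chain[OF F(2) \<open>open S\<close>]) (auto simp: \<Phi>_def S_def intro!: holomorphic_intros)
    have in01: "0 \<in> S" "1 \<in> S"
      using \<Phi>_real[of 0] \<Phi>_real[of 1] p w by (simp_all add: S_def)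
    obtain d where d: "d > 0" "\<And>t. \<bar>t\<bar> < d \<Longrightarrow> f (w + t *\<^sub>R (p - w)) = 0"
      using ev unfolding eventually_nhds_metric by auto
    have "F (\<Phi> 1) = 0"
    proof (rule analytic_continuation[where f = "\<lambda>t. F (\<Phi> t)" and S = S and U = "S \<inter> of_real ` {-d<..<d}" and \<xi> = 0])
      show "connected S" using \<open>convex S\<close> by (rule convex_connected)
      show "(\<lambda>t. F (\<Phi> t)) holomorphic_on S" by fact
      show "0 islimpt S \<inter> complex_of_real ` {- d<..<d}"
        unfolding islimpt_approachable
      proof (intro allI impI)
        fix e :: real assume "e > 0"
        obtain e' where e': "e' > 0" "ball 0 e' \<subseteq> S" using \<open>open S\<close> in01 open_contains_ball by blast
        define t where "t = min (e/2) (min (e'/2) (d/2))"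
        have "t > 0" "t < e" "t < e'" "t < d" using \<open>e > 0\<close> e' d by (auto simp: t_def)
        then show "\<exists>x'\<in>S \<inter> complex_of_real ` {- d<..<d}. x' \<noteq> 0 \<and> dist x' 0 < e"
          using e' by (intro bexI[of _ "of_real t"]) auto
      qed
      show "F (\<Phi> z) = 0" if z: "z \<in> S \<inter> of_real ` {-d<..<d}" for z
      proof -
        obtain t where t: "z = of_real t" "\<bar>t\<bar> < d" using z by auto
        have "cvec (w + t *\<^sub>R (p - w)) \<in> PD r" using z t by (simp add: S_def \<Phi>_real del: cvec_in_PD)
        then show ?thesis using d(2)[OF t(2)] F(3) t by (simp add: \<Phi>_real)
      qed
    qed (use \<open>open S\<close> in01 in auto)
    then show "f p = 0" using \<Phi>_real[of 1] F(3)[OF p] by simp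
  qed
  then show ?thesis by (rule that[OF F(1)])
qed

text \<open>The germs form an integral domain. Near a point \<open>w\<close> with g(w) \<noteq> 0
  the factor \<open>f\<close> vanishes, and \<open>an_line\<close> carries this zero from
  \<open>w\<close> to every point of the box.\<close>

lemma an_mult_eq_0:
  fixes f g :: "real^'n::finite \<Rightarrow> real"
  assumes f: "an f" and g: "an g" and fg: "\<forall>\<^sub>F x in nhds 0. f x * g x = 0"
  shows "(\<forall>\<^sub>F x in nhds 0. f x = 0) \<or> (\<forall>\<^sub>F x in nhds 0. g x = 0)"
proof (rule disjCI)
  assume nz: "\<not> (\<forall>\<^sub>F x in nhds 0. g x = 0)"
  obtain r1 where r1: "r1 > 0" "\<And>p w. p \<in> RB r1 \<Longrightarrow> w \<in> RB r1 \<Longrightarrow> \<forall>\<^sub>F t in nhds 0. f (w + t *\<^sub>R (p - w)) = 0 \<Longrightarrow> f p = 0"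
    using an_line[OF f] by metis
  obtain r2 where r2: "r2 > 0" "continuous_on (RB r2) g" using an_continuous[OF g] by blast
  obtain r3 where r3: "r3 > 0" "\<And>x. x \<in> RB r3 \<Longrightarrow> f x * g x = 0"
    using fg unfolding eventually_RB by blast
  define r where "r = min r1 (min r2 r3)"
  have "r > 0" using r1 r2 r3 by (simp add: r_def)
  obtain w where w: "w \<in> RB r" "g w \<noteq> 0"
    using nz \<open>r > 0\<close> unfolding eventually_RB by blast
  have "continuous_on (RB r) g"
    by (rule continuous_on_subset[OF r2(2)]) (auto simp: r_def intro: RB_mono[of r])
  then have "isCont g w" using w open_RB continuous_on_eq_continuous_at by blast
  have "f p = 0" if p: "p \<in> RB r1" for p
  proof (rule r1(2)[OF p, of w])
    show "w \<in> RB r1" using w by (auto simp: r_def intro: RB_mono[of r])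
    have "((\<lambda>t. w + t *\<^sub>R (p - w)) \<longlongrightarrow> w + 0 *\<^sub>R (p - w)) (nhds 0)"
      by (intro tendsto_intros filterlim_ident)
    then have lim: "((\<lambda>t. w + t *\<^sub>R (p - w)) \<longlongrightarrow> w) (nhds 0)" by simp
    from isCont_tendsto_compose[OF \<open>isCont g w\<close> this]
    have "\<forall>\<^sub>F t in nhds 0. g (w + t *\<^sub>R (p - w)) \<noteq> 0"
      using w by (intro tendsto_imp_eventually_ne)
    moreover have "\<forall>\<^sub>F t in nhds 0. w + t *\<^sub>R (p - w) \<in> RB r"
      using topological_tendstoD[OF lim open_RB w(1)] .
    ultimately show "\<forall>\<^sub>F t in nhds 0. f (w + t *\<^sub>R (p - w)) = 0"
    proof eventually_elim
      case (elim t)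
      then have "w + t *\<^sub>R (p - w) \<in> RB r3" by (auto simp: r_def intro: RB_mono[of r])
      with r3(2) elim show ?case by fastforce
    qed
  qed
  then show "\<forall>\<^sub>F x in nhds 0. f x = 0" using r1(1) by (intro eventually_RBI)
qed

section \<open>Uniform limits and power series\<close>

text \<open>Weierstrass' theorem in each coordinate. It serves both power series and the Newton
  iterates of the implicit function.\<close>

lemma hol_uniform_limit:
  fixes \<phi> :: "complex^'n::finite \<Rightarrow> complex"
  assumes W: "\<And>n. hol (W n) s" and lim: "uniform_limit (PD s) W \<phi> F" and F: "F \<noteq> bot"
  shows "hol \<phi> s"
proof (rule holI)
  show "continuous_on (PD s) \<phi>"
    by (rule uniform_limit_theorem[OF _ lim F]) (use W in \<open>auto simp: hol_cont\<close>)
  fix z :: "complex^'n" and k assume z: "z \<in> PD s"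
  show "(\<lambda>w. \<phi> (upd z k w)) holomorphic_on ball 0 s"
  proof (rule holomorphic_on_ball_shrink)
    fix s' assume s': "s' < s"
    have h: "(\<lambda>w. W n (upd z k w)) holomorphic_on ball 0 s" for n
      by (rule hol_sep[OF W z])
    have "continuous_on (cball 0 s') (\<lambda>w. W n (upd z k w)) \<and> (\<lambda>w. W n (upd z k w)) holomorphic_on ball 0 s'" for n
      using s' by (auto intro!: holomorphic_on_imp_continuous_on intro: holomorphic_on_subset[OF h])
    then have ev: "\<forall>\<^sub>F n in F. continuous_on (cball 0 s') (\<lambda>w. W n (upd z k w)) \<and>
        (\<lambda>w. W n (upd z k w)) holomorphic_on ball 0 s'"
      by (intro always_eventually allI)
    have ul: "uniform_limit (cball 0 s') (\<lambda>n w. W n (upd z k w)) (\<lambda>w. \<phi> (upd z k w)) F"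
      by (rule uniform_limit_compose'[OF lim]) (use s' z in \<open>auto intro!: upd_in_PD\<close>)
    show "(\<lambda>w. \<phi> (upd z k w)) holomorphic_on ball 0 s'"
      by (rule holomorphic_uniform_limit[OF ev ul F])
  qed
qed

lemma hol_prod: "(\<And>i. i \<in> I \<Longrightarrow> hol (f i) r) \<Longrightarrow> hol (\<lambda>x. \<Prod>i\<in>I. f i x) r"
  by (induction I rule: infinite_finite_induct) (auto intro: hol_mult hol_const)

lemma hol_sum: "(\<And>i. i \<in> I \<Longrightarrow> hol (f i) r) \<Longrightarrow> hol (\<lambda>x. \<Sum>i\<in>I. f i x) r"
  by (induction I rule: infinite_finite_induct) (auto intro: hol_add hol_const)

lemma hol_power: "hol f r \<Longrightarrow> hol (\<lambda>x. f x ^ n) r"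
  by (induction n) (auto intro: hol_mult hol_const)

text \<open>Summability of the series at the corner with all coordinates \<open>r\<close> bounds its
  terms on the complex polydisc of radius \<open>r\<close>, where the Weierstrass test then
  applies.\<close>

lemma an_of_real_analytic:
  fixes f :: "real^'n::finite \<Rightarrow> real"
  assumes "R > 0" "real_analytic_on f (ball 0 R)"
  shows "an f"
proof -
  obtain e c where e: "e > 0" and c: "\<And>x. x \<in> ball 0 e \<Longrightarrow> ((\<lambda>\<alpha>. c \<alpha> * monom_at \<alpha> 0 x) has_sum f x) UNIV"
    using assms unfolding real_analytic_on_def by (meson centre_in_ball)
  \<comment> \<open>With n coordinates, half of e / n in each of them keeps that corner inside the
    ball of radius \<open>e\<close>.\<close>
  define r where "r = e / (2 * CARD('n))"
  have r: "r > 0" using e by (simp add: r_def)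
  have RB: "x \<in> ball 0 e" if "\<And>i. \<bar>x$i\<bar> \<le> r" for x :: "real^'n"
  proof -
    have "\<bar>x$i\<bar> < e / CARD('n)" for i
      using that[of i] e by (simp add: r_def field_simps)
    then have "norm x < e" by (intro norm_vec_less) simp
    then show ?thesis by simp
  qed
  define T where "T \<alpha> z = complex_of_real (c \<alpha>) * (\<Prod>i\<in>UNIV. (z$i) ^ \<alpha> i)" for \<alpha> and z :: "complex^'n"
  define M where "M \<alpha> = norm (c \<alpha> * monom_at \<alpha> 0 ((\<chi> i. r) :: real^'n))" for \<alpha>
  have "(\<lambda>\<alpha>. c \<alpha> * monom_at \<alpha> 0 ((\<chi> i. r) :: real^'n)) summable_on UNIV"
    using c[OF RB, of "\<chi> i. r"] r by (auto simp: summable_on_def)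
  then have M: "M summable_on UNIV"
    unfolding M_def by (subst (asm) summable_on_iff_abs_summable_on_real) simp
  have le: "norm (T \<alpha> z) \<le> M \<alpha>" if "z \<in> PD r" for \<alpha> z
  proof -
    have "(\<Prod>i\<in>UNIV. norm (z$i) ^ \<alpha> i) \<le> (\<Prod>i\<in>UNIV. r ^ \<alpha> i)"
      using PD_nth[OF that] by (intro prod_mono conjI power_mono zero_le_power norm_ge_zero) (auto intro: less_imp_le)
    then show ?thesis
      using r by (simp add: T_def M_def monom_at_def norm_mult prod_norm[symmetric] norm_power abs_mult abs_prod
          power_abs mult_left_mono)
  qed
  have "hol (\<lambda>z. \<Sum>\<^sub>\<infinity>\<alpha>. T \<alpha> z) r"
  proof (rule hol_uniform_limit)
    show "uniform_limit (PD r) (\<lambda>X z. \<Sum>\<alpha>\<in>X. T \<alpha> z) (\<lambda>z. \<Sum>\<^sub>\<infinity>\<alpha>. T \<alpha> z) (finite_subsets_at_top UNIV)"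
      by (rule Weierstrass_m_test_general[OF le M])
    show "hol (\<lambda>z. \<Sum>\<alpha>\<in>X. T \<alpha> z) r" for X
      unfolding T_def by (intro hol_sum hol_mult hol_const hol_prod hol_power hol_coord)
  qed simp
  then show ?thesis
  proof (rule anI[OF r])
    fix x :: "real^'n" assume "x \<in> RB r"
    then have "x \<in> ball 0 e" by (intro RB) (auto simp: RB_iff less_imp_le)
    from has_sum_of_real[OF c[OF this], where 'a = complex]
    have "((\<lambda>\<alpha>. T \<alpha> (cvec x)) has_sum of_real (f x)) UNIV"
      by (simp add: T_def monom_at_def)
    then show "(\<Sum>\<^sub>\<infinity>\<alpha>. T \<alpha> (cvec x)) = of_real (f x)" by (rule infsumI)
  qed
qed

section \<open>Order along an axis and the implicit function theorem\<close>

text \<open>Regularity of order \<open>d\<close> in x_k, as in Weierstrass preparation: on the k-th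
  axis \<open>f\<close> has a zero of exact order \<open>d\<close>. The unit is a germ in all
  variables so that the calculus of \<open>an\<close> applies to it.\<close>

definition reg :: "'n::finite \<Rightarrow> nat \<Rightarrow> (real^'n \<Rightarrow> real) \<Rightarrow> bool" where
  "reg k d f \<longleftrightarrow> (\<exists>u. an u \<and> u 0 \<noteq> 0 \<and> (\<forall>\<^sub>F x in nhds 0. f (axis k (x$k)) = (x$k)^d * u x))"

lemma axis_eq_upd: "axis k t = upd 0 k t"
  by (simp add: vec_eq_iff axis_def)

text \<open>The holomorphic extension restricted to the axis factors as w^n g(w) with g(0) \<noteq>
  0; its real part supplies the unit.\<close>

lemma reg_exists:
  fixes f :: "real^'n::finite \<Rightarrow> real"
  assumes "an f" "\<not> (\<forall>\<^sub>F t in nhds 0. f (axis k t) = 0)"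
  shows "\<exists>d. reg k d f"
proof -
  obtain r F where F: "r > 0" "hol F r" "\<And>x. x \<in> RB r \<Longrightarrow> F (cvec x) = of_real (f x)"
    using assms by (elim anE) blast
  define h where "h w = F (upd 0 k w)" for w
  have h: "h holomorphic_on ball 0 r"
    unfolding h_def by (rule hol_sep[OF F(2)]) (use F in auto)
  have h_real: "h (of_real t) = of_real (f (axis k t))" if "\<bar>t\<bar> < r" for t
  proof -
    have "upd 0 k t \<in> RB r" using that F(1) by (intro upd_in_RB) auto
    from F(3)[OF this] show ?thesis by (simp add: h_def axis_eq_upd cvec_upd)
  qed
  show ?thesis
  proof (cases "f 0 = 0")
    case False
    have "an (\<lambda>x. f (axis k (x$k)))"
    proof (rule an_compose[OF assms(1)])
      show "an (\<lambda>x. axis k (x$k) $ i)" for i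
        by (cases "i = k") (auto simp: axis_def)
    qed (simp add: iffD2[OF axis_eq_0_iff])
    then have "reg k 0 f" unfolding reg_def using False
      by (intro exI[of _ "\<lambda>x. f (axis k (x$k))"]) (simp add: iffD2[OF axis_eq_0_iff])
    then show ?thesis ..
  next
    case True
    have ax0: "axis k (0::real) = 0" by (simp add: iffD2[OF axis_eq_0_iff])
    have h0: "h 0 = 0" using h_real[of 0] F(1) True ax0 by simp
    have "\<not> h constant_on ball 0 r"
    proof
      assume "h constant_on ball 0 r"
      then have "h w = 0" if "w \<in> ball 0 r" for w
        using h0 that F(1) unfolding constant_on_def by (metis centre_in_ball)
      then have "f (axis k t) = 0" if "\<bar>t\<bar> < r" for t
        using h_real[OF that] that by simp
      then have "\<forall>\<^sub>F t in nhds 0. f (axis k t) = 0"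
        unfolding eventually_nhds_metric using F(1) by (intro exI[of _ r]) auto
      with assms(2) show False by simp
    qed
    have "(0::complex) \<in> ball 0 r" using F(1) by simp
    obtain g s n where g: "0 < n" "0 < s" "ball (0::complex) s \<subseteq> ball 0 r" "g holomorphic_on ball 0 s"
        "\<And>w. w \<in> ball 0 s \<Longrightarrow> h w = (w - 0)^n * g w" "\<And>w. w \<in> ball 0 s \<Longrightarrow> g w \<noteq> 0"
      by (rule holomorphic_factor_zero_nonconstant[OF h open_ball connected_ball
            \<open>0 \<in> ball 0 r\<close> h0 \<open>\<not> h constant_on ball 0 r\<close>]) (rule that; (assumption | simp))
    have sr: "\<bar>t\<bar> < r" if "\<bar>t\<bar> < s" for t
    proof -
      have "complex_of_real t \<in> ball 0 s" using that by simp
      from subsetD[OF g(3) this] show ?thesis by simp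
    qed
    have hg: "hol (\<lambda>z::complex^'n. g (z$k)) s"
    proof (rule holI)
      show "continuous_on (PD s) (\<lambda>z. g (z $ k))"
        by (rule continuous_on_compose2[OF holomorphic_on_imp_continuous_on[OF g(4)]])
          (auto simp: PD_nth intro!: continuous_intros)
      show "(\<lambda>w. g (upd z i w $ k)) holomorphic_on ball 0 s" for z :: "complex^'n" and i
        using g(4) by (cases "i = k") auto
    qed
    define u where "u x = Re (g (cvec x $ k))" for x
    have "an u" unfolding u_def using an_Re[OF hg g(2)] .
    have eq: "of_real (f (axis k t)) = of_real (t ^ n) * g (of_real t)" if "\<bar>t\<bar> < s" for t
      using h_real[OF sr[OF that]] g(5)[of "of_real t"] that by simp
    \<comment> \<open>\<open>g\<close> comes from the complex side. At real points off 0 it is a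
      quotient of reals, hence real; by continuity so is g(0), and its real part cannot
      vanish.\<close>
    have "Im (g 0) = 0"
    proof (rule tendsto_unique[of "at (0::real)"])
      have "isCont g 0"
        using holomorphic_on_imp_continuous_on[OF g(4)] g(2) continuous_on_eq_continuous_at[OF open_ball]
        by (metis centre_in_ball)
      then have "isCont g (complex_of_real 0)" by simp
      with isCont_o2[of "0::real" complex_of_real g]
      have "isCont (\<lambda>t. g (complex_of_real t)) 0" by simp
      then have "((\<lambda>t. g (complex_of_real t)) \<longlongrightarrow> g 0) (at 0)" by (simp add: isCont_def)
      then show "((\<lambda>t. Im (g (complex_of_real t))) \<longlongrightarrow> Im (g 0)) (at 0)"
        by (rule tendsto_Im)
      have "Im (g (of_real t)) = 0" if "\<bar>t\<bar> < s" "t \<noteq> 0" for t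
        using arg_cong[OF eq[OF that(1)], of Im] that(2) by simp
      then have "\<forall>\<^sub>F t in at 0. Im (g (of_real t)) = 0"
        unfolding eventually_at using g(2) by (intro exI[of _ s]) auto
      then show "((\<lambda>t. Im (g (complex_of_real t))) \<longlongrightarrow> 0) (at 0)"
        by (rule tendsto_eventually)
    qed simp
    moreover have "g 0 \<noteq> 0" using g(2,6) by simp
    ultimately have "u 0 \<noteq> 0" by (simp add: u_def complex_eq_iff)
    moreover have "\<forall>x\<in>RB s. f (axis k (x$k)) = (x$k)^n * u x"
    proof
      fix x :: "real^'n" assume "x \<in> RB s"
      from arg_cong[OF eq[OF RB_nth[OF this, of k]], of Re]
      show "f (axis k (x$k)) = (x$k)^n * u x" by (simp add: u_def)
    qed
    ultimately have "reg k n f"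
      unfolding reg_def eventually_RB using \<open>an u\<close> g(2) by blast
    then show ?thesis ..
  qed
qed

lemma hol_implicit:
  fixes F :: "complex^'n::finite \<Rightarrow> complex"
  assumes F: "hol F r" and r: "r > 0" and F0: "F 0 = 0" and a0: "pd k F 0 \<noteq> 0"
  defines "W \<equiv> rec_nat (\<lambda>z. 0) (\<lambda>n w z. w z - F (upd z k (w z)) / pd k F 0)"
  obtains s \<phi> where "s > 0" "s \<le> r" "hol \<phi> s" "\<phi> 0 = 0" "\<And>z. z \<in> PD s \<Longrightarrow> F (upd z k (\<phi> z)) = 0"
    "\<And>z. z \<in> PD s \<Longrightarrow> norm (\<phi> z) < r"
    "\<And>z. z \<in> PD s \<Longrightarrow> (\<lambda>n. W n z) \<longlonglongrightarrow> \<phi> z" "\<And>n z. z \<in> PD s \<Longrightarrow> norm (W n z) < r"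
proof -
  define a where "a = pd k F 0"
  have W0: "W 0 z = 0" and WS: "W (Suc n) z = W n z - F (upd z k (W n z)) / a" for n z
    by (simp_all add: W_def a_def)
  \<comment> \<open>A slope within half of \<open>norm a\<close> from \<open>a\<close> is what makes
    the contraction factor 1/2.\<close>
  have "open (PD r \<inter> (\<lambda>z. pd k F z) -` ball a (norm a / 2))"
    by (intro continuous_open_preimage open_PD hol_cont hol_pd F open_ball)
  then obtain \<rho>0 where \<rho>0: "\<rho>0 > 0" "PD \<rho>0 \<subseteq> PD r \<inter> (\<lambda>z. pd k F z) -` ball a (norm a / 2)"
    using r a0 by (elim PD_subset_open) (auto simp: a_def)
  define \<rho> where "\<rho> = min \<rho>0 r / 2"
  have \<rho>: "\<rho> > 0" "\<rho> < \<rho>0" "\<rho> < r" using \<rho>0 r by (auto simp: \<rho>_def)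
  have "hol (\<lambda>z. F (upd z k 0)) r" by (rule hol_upd_const[OF F]) (use r in simp)
  \<comment> \<open>With this bound the first iterate has size at most \<rho>/2, so the contraction
    maps the closed disc of radius \<rho> into itself.\<close>
  then have "open (PD r \<inter> (\<lambda>z. F (upd z k 0)) -` ball 0 (norm a * \<rho> / 2))"
    by (intro continuous_open_preimage open_PD hol_cont open_ball)
  moreover have "upd 0 k 0 = (0::complex^'n)" by (simp add: vec_eq_iff)
  ultimately obtain s0 where s0: "s0 > 0" "PD s0 \<subseteq> PD r \<inter> (\<lambda>z. F (upd z k 0)) -` ball 0 (norm a * \<rho> / 2)"
    using r a0 \<rho> F0 by (elim PD_subset_open) (auto simp: a_def)
  define s where "s = min s0 \<rho>"
  have s: "s > 0" "s \<le> \<rho>" "s \<le> s0" using s0 \<rho> by (auto simp: s_def)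
  define T where "T z w = w - F (upd z k w) / a" for z w
  have inP: "upd z k w \<in> PD \<rho>0" if "z \<in> PD s" "w \<in> cball 0 \<rho>" for z w
    using that s \<rho> by (intro upd_in_PD) (auto intro: PD_mono[of s])
  have inr: "z \<in> PD r" if "z \<in> PD s" for z :: "complex^'n"
    using that s \<rho> by (auto intro: PD_mono[of s])
  have contr: "norm (T z w1 - T z w2) \<le> 1/2 * norm (w1 - w2)"
    if z: "z \<in> PD s" and w: "w1 \<in> cball 0 \<rho>" "w2 \<in> cball 0 \<rho>" for z w1 w2
  proof (rule field_differentiable_bound[where S = "cball 0 \<rho>" and f' = "\<lambda>w. 1 - pd k F (upd z k w) / a"])
    fix w :: complex assume w: "w \<in> cball 0 \<rho>"
    then have "((\<lambda>w. F (upd z k w)) has_field_derivative pd k F (upd z k w)) (at w)"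
      using \<rho> by (intro hol_has_pd[OF F inr[OF z]]) auto
    from has_field_derivative_at_within[OF DERIV_diff[OF DERIV_ident DERIV_cdivide[OF this]]]
    show "(T z has_field_derivative 1 - pd k F (upd z k w) / a) (at w within cball 0 \<rho>)"
      unfolding T_def by simp
    have "norm (a - pd k F (upd z k w)) < norm a / 2"
      using inP[OF z w] \<rho>0 by (auto simp: dist_norm)
    moreover have "1 - pd k F (upd z k w) / a = (a - pd k F (upd z k w)) / a"
      using a0 by (simp add: a_def field_simps)
    ultimately show "norm (1 - pd k F (upd z k w) / a) \<le> 1/2"
      using a0 by (simp add: norm_divide a_def field_simps)
  qed (use w in auto)
  have T0: "norm (T z 0) \<le> \<rho> / 2" if z: "z \<in> PD s" for z
  proof -
    have "norm (F (upd z k 0)) < norm a * \<rho> / 2"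
      using s0(2) PD_mono[OF s(3) z] by auto
    then show ?thesis using a0 by (simp add: T_def norm_divide a_def field_simps)
  qed
  have maps: "T z w \<in> cball 0 \<rho>" if z: "z \<in> PD s" and w: "w \<in> cball 0 \<rho>" for z w
  proof -
    have "norm (T z w) \<le> norm (T z w - T z 0) + norm (T z 0)" by norm
    also have "\<dots> \<le> 1/2 * norm (w - 0) + \<rho> / 2"
      using contr[OF z w, of 0] T0[OF z] \<rho> by (intro add_mono) auto
    finally show ?thesis using w by simp
  qed
  have fixp: "\<exists>!w. w \<in> cball 0 \<rho> \<and> T z w = w" if z: "z \<in> PD s" for z
  proof -
    have "\<exists>!w\<in>cball 0 \<rho>. T z w = w"
    proof (rule Banach_fix)
      show "T z ` cball 0 \<rho> \<subseteq> cball 0 \<rho>" using maps[OF z] by blast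
      show "dist (T z x) (T z y) \<le> 1/2 * dist x y" if "x \<in> cball 0 \<rho>" "y \<in> cball 0 \<rho>" for x y
        using contr[OF z that] by (simp add: dist_norm)
    qed (use \<rho> in \<open>auto simp: complete_eq_closed\<close>)
    then show ?thesis .
  qed
  define \<phi> where "\<phi> z = (THE w. w \<in> cball 0 \<rho> \<and> T z w = w)" for z
  have \<phi>: "\<phi> z \<in> cball 0 \<rho>" "T z (\<phi> z) = \<phi> z" if "z \<in> PD s" for z
    using theI'[OF fixp[OF that]] by (auto simp: \<phi>_def)
  have W_in: "W n z \<in> cball 0 \<rho>" if "z \<in> PD s" for n z
    by (induction n) (use maps[OF that] \<rho> in \<open>auto simp: W0 WS T_def[symmetric]\<close>)
  have W_hol: "hol (W n) s" for n
  proof (induction n)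
    case 0
    then show ?case by (simp add: W_def hol_const)
  next
    case (Suc n)
    have "hol (\<lambda>z. F (upd z k (W n z))) s"
    proof (rule hol_compose[OF F])
      show "hol (\<lambda>z. upd z k (W n z) $ i) s" for i
        using Suc by (cases "i = k") (auto simp: hol_coord)
      show "upd z k (W n z) \<in> PD r" if "z \<in> PD s" for z
        using inP[OF that W_in[OF that]] \<rho>0 by blast
    qed
    then have "hol (\<lambda>z. W n z - F (upd z k (W n z)) / a) s"
      using Suc a0 by (intro hol_diff hol_divide hol_const) (auto simp: a_def)
    then show ?case by (rule hol_cong) (simp add: WS)
  qed
  have rate: "norm (W n z - \<phi> z) \<le> (1/2)^n * \<rho>" if z: "z \<in> PD s" for n z
  proof (induction n)
    case 0
    then show ?case using \<phi>(1)[OF z] by (simp add: W0)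
  next
    case (Suc n)
    have "W (Suc n) z = T z (W n z)" by (simp add: WS T_def)
    then have "norm (W (Suc n) z - \<phi> z) = norm (T z (W n z) - T z (\<phi> z))"
      by (simp only: \<phi>(2)[OF z])
    also have "\<dots> \<le> 1/2 * norm (W n z - \<phi> z)" by (rule contr[OF z W_in[OF z] \<phi>(1)[OF z]])
    finally show ?case using Suc by simp
  qed
  have "(\<lambda>n. (1/2)^n * \<rho>) \<longlonglongrightarrow> 0 * \<rho>"
    by (intro tendsto_intros LIMSEQ_power_zero) simp
  then have half: "(\<lambda>n. (1/2)^n * \<rho>) \<longlonglongrightarrow> 0" by simp
  have ul: "uniform_limit (PD s) W \<phi> sequentially"
  proof (rule uniform_limitI)
    fix e :: real assume "e > 0"
    from order_tendstoD(2)[OF half this]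
    show "\<forall>\<^sub>F n in sequentially. \<forall>z\<in>PD s. dist (W n z) (\<phi> z) < e"
      by eventually_elim (auto simp: dist_norm intro: le_less_trans[OF rate])
  qed
  show ?thesis
  proof (rule that)
    show "s > 0" "s \<le> r" using s \<rho> by auto
    show "hol \<phi> s" by (rule hol_uniform_limit[OF W_hol ul]) simp
    have 0: "0 \<in> PD s" using s by simp
    have "0 \<in> cball 0 \<rho> \<and> T 0 0 = 0" using \<rho> \<open>upd 0 k 0 = (0::complex^'n)\<close> F0 by (simp add: T_def)
    then show "\<phi> 0 = 0" using fixp[OF 0] \<phi>[OF 0] by blast
    show "F (upd z k (\<phi> z)) = 0" if "z \<in> PD s" for z
      using \<phi>(2)[OF that] a0 by (simp add: T_def a_def)
    show "norm (\<phi> z) < r" if "z \<in> PD s" for z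
      using \<phi>(1)[OF that] \<rho> by simp
    show "(\<lambda>n. W n z) \<longlonglongrightarrow> \<phi> z" if "z \<in> PD s" for z
      by (rule tendsto_uniform_limitI[OF ul that])
    show "norm (W n z) < r" if "z \<in> PD s" for n z
      using W_in[OF that, of n] \<rho> by simp
  qed
qed

lemma an_implicit:
  fixes f :: "real^'n::finite \<Rightarrow> real"
  assumes f: "an f" "f 0 = 0" and D: "((\<lambda>t. f (upd 0 k t)) has_real_derivative D) (at 0)" "D \<noteq> 0"
  obtains \<phi> where "an \<phi>" "\<phi> 0 = 0" "\<And>x t. \<phi> (upd x k t) = \<phi> x" "\<forall>\<^sub>F x in nhds 0. f (upd x k (\<phi> x)) = 0"
proof -
  obtain r F where F: "r > 0" "hol F r" "\<And>x. x \<in> RB r \<Longrightarrow> F (cvec x) = of_real (f x)"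
    using f by (elim anE) blast
  have upd0: "upd 0 k 0 = (0::real^'n)" "upd 0 k 0 = (0::complex^'n)" by (simp_all add: vec_eq_iff)
  have a: "pd k F 0 = of_real D"
  proof -
    have "((\<lambda>w. F (upd 0 k w)) has_field_derivative pd k F (upd 0 k 0)) (at 0)"
      by (rule hol_has_pd[OF F(2)]) (use F(1) in auto)
    then have "((\<lambda>w. F (upd 0 k w)) has_field_derivative pd k F 0) (at (complex_of_real 0))"
      using upd0 by simp
    from has_vector_derivative_real_field[OF this]
    have "((\<lambda>t. F (upd 0 k (of_real t))) has_vector_derivative pd k F 0) (at 0)" by simp
    then have 1: "((\<lambda>t. complex_of_real (f (upd 0 k t))) has_vector_derivative pd k F 0) (at 0)"
    proof (rule has_vector_derivative_transform_within_open[where S = "{-r<..<r}"])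
      fix t assume "t \<in> {-r<..<r}"
      then have "upd 0 k t \<in> RB r" using F(1) by (intro upd_in_RB) auto
      from F(3)[OF this] show "F (upd 0 k (of_real t)) = of_real (f (upd 0 k t))" by (simp add: cvec_upd)
    qed (use F(1) in auto)
    have "((\<lambda>t. complex_of_real (f (upd 0 k t))) has_vector_derivative of_real D) (at 0)"
      using D(1) has_vector_derivative_of_real by blast
    with 1 show ?thesis by (rule vector_derivative_unique_at)
  qed
  have F0: "F 0 = 0" using F(3)[of 0] F(1) f(2) by simp
  have a0: "pd k F 0 \<noteq> 0" using a D(2) by simp
  define W where "W = rec_nat (\<lambda>z. 0) (\<lambda>n w z. w z - F (upd z k (w z)) / pd k F 0)"
  obtain s \<phi> where \<phi>: "s > 0" "s \<le> r" "hol \<phi> s" "\<phi> 0 = 0" "\<And>z. z \<in> PD s \<Longrightarrow> F (upd z k (\<phi> z)) = 0"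
    "\<And>z. z \<in> PD s \<Longrightarrow> norm (\<phi> z) < r"
    "\<And>z. z \<in> PD s \<Longrightarrow> (\<lambda>n. W n z) \<longlonglongrightarrow> \<phi> z" "\<And>n z. z \<in> PD s \<Longrightarrow> norm (W n z) < r"
    using hol_implicit[OF F(2,1) F0 a0] unfolding W_def by blast
  have F_upd: "F (upd (cvec x) k (of_real t)) = of_real (f (upd x k t))" if "x \<in> RB s" "\<bar>t\<bar> < r" for x t
  proof -
    have "upd x k t \<in> RB r" using that \<phi>(2) by (intro upd_in_RB) (auto intro: RB_mono)
    from F(3)[OF this] show ?thesis by (simp add: cvec_upd)
  qed
  \<comment> \<open>With real slope and at a real point each Newton step stays real, and the reals
    are closed.\<close>
  have W_real: "W n (cvec x) \<in> \<real>" if "x \<in> RB s" for n x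
  proof (induction n)
    case (Suc n)
    then obtain t where t: "W n (cvec x) = of_real t" by (auto elim: Reals_cases)
    then have "\<bar>t\<bar> < r" using \<phi>(8)[of "cvec x" n] that by simp
    with t show ?case using F_upd[OF that] a by (simp add: W_def)
  qed (simp add: W_def)
  have \<phi>_real: "\<phi> (cvec x) \<in> \<real>" if "x \<in> RB s" for x
    by (rule closed_sequentially[OF closed_complex_Reals W_real[OF that] \<phi>(7)]) (use that in simp)
  define \<psi> where "\<psi> x = Re (\<phi> (cvec x))" for x
  have "an \<psi>" unfolding \<psi>_def by (rule an_Re[OF \<phi>(3,1)])
  have zero: "f (upd x k (\<psi> x)) = 0" if "x \<in> RB s" for x
  proof -
    have *: "\<phi> (cvec x) = of_real (\<psi> x)" using \<phi>_real[OF that] by (simp add: \<psi>_def)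
    moreover from this have "\<bar>\<psi> x\<bar> < r" using \<phi>(6)[of "cvec x"] that by simp
    ultimately show ?thesis using F_upd[OF that] \<phi>(5)[of "cvec x"] that by simp
  qed
  show ?thesis
  \<comment> \<open>Evaluating at x_k = 0 makes the solution independent of x_k; the equation solved
    does not involve x_k either.\<close>
  proof (rule that[of "\<lambda>x. \<psi> (upd x k 0)"])
    show "an (\<lambda>x. \<psi> (upd x k 0))" by (rule an_upd[OF \<open>an \<psi>\<close>]) auto
    show "\<psi> (upd 0 k 0) = 0" using \<phi>(4) upd0 by (simp add: \<psi>_def)
    have "f (upd x k (\<psi> (upd x k 0))) = 0" if "x \<in> RB s" for x
      using zero[OF upd_in_RB[OF that], of 0 k] \<phi>(1) by simp
    then show "\<forall>\<^sub>F x in nhds 0. f (upd x k (\<psi> (upd x k 0))) = 0"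
      by (rule eventually_RBI[OF \<phi>(1)])
  qed simp
qed

section \<open>Taylor expansion in one variable, dependence on coordinates, and the Tschirnhaus
  shift\<close>

text \<open>A relation rather than an operator, since only the germ of the derivative is
  determined.\<close>

definition ddk :: "'n::finite \<Rightarrow> (real^'n \<Rightarrow> real) \<Rightarrow> (real^'n \<Rightarrow> real) \<Rightarrow> bool" where
  "ddk k f g \<longleftrightarrow> (\<forall>\<^sub>F x in nhds 0. ((\<lambda>t. f (upd x k t)) has_real_derivative g x) (at (x$k)))"

lemma an_ddk:
  fixes f :: "real^'n::finite \<Rightarrow> real"
  assumes "an f"
  shows "\<exists>g. an g \<and> ddk k f g"
proof -
  obtain D where D: "\<forall>i. an (D i)"
    "\<forall>\<^sub>F x in nhds 0. (f has_derivative (\<lambda>v. \<Sum>i\<in>UNIV. v$i * D i x)) (at x)"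
    using an_deriv[OF assms] by (elim exE conjE) (rule that)
  have "ddk k f (D k)" unfolding ddk_def using D(2)
  proof eventually_elim
    case (elim x)
    have "((\<lambda>t. x + (t - x$k) *\<^sub>R axis k 1) has_derivative (\<lambda>h. h *\<^sub>R axis k 1)) (at (x$k))"
    proof -
      have "((\<lambda>t. (t - x$k) *\<^sub>R (axis k 1 :: real^'n)) has_derivative (\<lambda>h. h *\<^sub>R axis k 1)) (at (x$k))"
        by (intro bounded_linear.has_derivative[OF bounded_linear_scaleR_left]
            has_derivative_diff[OF has_derivative_ident has_derivative_const, simplified])
      from has_derivative_add[OF has_derivative_const[of x] this] show ?thesis by simp
    qed
    moreover have eq: "x + (t - x$k) *\<^sub>R axis k 1 = upd x k t" for t
      by (simp add: vec_eq_iff axis_def)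
    ultimately have "((\<lambda>t. upd x k t) has_derivative (\<lambda>h. h *\<^sub>R axis k 1)) (at (x$k))" by simp
    moreover have "(f has_derivative (\<lambda>v. \<Sum>i\<in>UNIV. v$i * D i x)) (at (upd x k (x$k)))"
      using elim by simp
    ultimately have "((\<lambda>t. f (upd x k t)) has_derivative (\<lambda>h. \<Sum>i\<in>UNIV. (h *\<^sub>R axis k 1)$i * D i x)) (at (x$k))"
      by (rule has_derivative_compose)
    moreover have "(\<lambda>h. \<Sum>i\<in>UNIV. (h *\<^sub>R axis k 1)$i * D i x) = (*) (D k x)"
    proof
      fix h
      have "(\<Sum>i\<in>UNIV. (h *\<^sub>R axis k 1)$i * D i x) = (\<Sum>i\<in>UNIV. if i = k then h * D k x else 0)"
        by (intro sum.cong) (auto simp: axis_def)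
      then show "(\<Sum>i\<in>UNIV. (h *\<^sub>R axis k 1)$i * D i x) = D k x * h" by simp
    qed
    ultimately show ?case by (simp add: has_field_derivative_def)
  qed
  with D(1)[rule_format, of k] show ?thesis by (intro exI conjI)
qed

text \<open>Hadamard's lemma applied \<open>d\<close> times to the remainder. Each coefficient is a
  restriction to x_k = 0 and therefore does not change with x_k.\<close>

lemma an_taylor:
  fixes f :: "real^'n::finite \<Rightarrow> real"
  assumes "an f"
  shows "\<exists>c u. (\<forall>j. an (c j) \<and> (\<forall>x t. c j (upd x k t) = c j x)) \<and> an u \<and>
    (\<forall>\<^sub>F x in nhds 0. f x = (\<Sum>j<d. c j x * (x$k)^j) + (x$k)^d * u x)"
proof (induction d)
  case 0
  show ?case by (intro exI[of _ "\<lambda>_ _. 0"] exI[of _ f]) (use assms in simp)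
next
  case (Suc d)
  then obtain c u where c: "\<And>j. an (c j)" "\<And>j x t. c j (upd x k t) = c j x" and u: "an u"
    and ev: "\<forall>\<^sub>F x in nhds 0. f x = (\<Sum>j<d. c j x * (x$k)^j) + (x$k)^d * u x"
    by (elim exE conjE) (rule that, auto)
  obtain g where g: "an g" "\<forall>\<^sub>F x in nhds 0. u x = u (upd x k 0) + x$k * g x"
    using an_hadamard[OF u, of k] by blast
  define c' where "c' = c(d := \<lambda>x. u (upd x k 0))"
  have "an (\<lambda>x. u (upd x k 0))" by (rule an_upd[OF u]) auto
  then have "\<forall>j. an (c' j) \<and> (\<forall>x t. c' j (upd x k t) = c' j x)"
    using c by (auto simp: c'_def)
  moreover have "\<forall>\<^sub>F x in nhds 0. f x = (\<Sum>j<Suc d. c' j x * (x$k)^j) + (x$k)^Suc d * g x"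
    using ev g(2)
  proof eventually_elim
    case (elim x)
    have "(\<Sum>j<d. c' j x * (x$k)^j) = (\<Sum>j<d. c j x * (x$k)^j)"
      by (intro sum.cong) (auto simp: c'_def)
    with elim(1) show ?case
      by (subst (asm) elim(2)) (simp add: c'_def algebra_simps)
  qed
  ultimately show ?case using g(1) by blast
qed

text \<open>Differentiating the expansion once gives an expansion of the same kind with one term
  less for the shifted sequence of derivatives. This identifies the coefficients with derivatives on
  x_k = 0; at order \<open>d\<close> the value at the origin is enough.\<close>

lemma taylor_coeff:
  assumes "\<And>i. ddk k (fs i) (fs (Suc i))" "an u" "\<And>j x t. j < d \<Longrightarrow> c j (upd x k t) = c j x"
    and "\<forall>\<^sub>F x in nhds 0. fs 0 x = (\<Sum>j<d. c j x * (x$k)^j) + (x$k)^d * u x"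
  shows "(\<forall>i<d. \<forall>\<^sub>F x in nhds 0. x$k = 0 \<longrightarrow> fs i x = fact i * c i x) \<and> fs d 0 = fact d * u 0"
  using assms
proof (induction d arbitrary: fs c u)
  case 0
  then show ?case using eventually_nhds_x_imp_x by fastforce
next
  case (Suc d)
  obtain v where v: "an v" "ddk k u v" using an_ddk[OF Suc.prems(2)] by blast
  define c' where "c' j x = (1 + real j) * c (Suc j) x" for j x
  \<comment> \<open>By the product rule the derivative of the remainder x_k^(d+1) u is x_k^d times
    this germ.\<close>
  define u' where "u' x = real (Suc d) * u x + x$k * v x" for x
  obtain r where r: "r > 0" "\<And>x. x \<in> RB r \<Longrightarrow> fs 0 x = (\<Sum>j<Suc d. c j x * (x$k)^j) + (x$k)^Suc d * u x"
    using Suc.prems(4) unfolding eventually_RB by blast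
  have "\<forall>\<^sub>F x in nhds 0. x \<in> RB r" by (rule eventually_RBI[OF r(1)])
  then have "\<forall>\<^sub>F x in nhds 0. fs (Suc 0) x = (\<Sum>j<d. c' j x * (x$k)^j) + (x$k)^d * u' x"
    using v(2)[unfolded ddk_def] Suc.prems(1)[of 0, unfolded ddk_def]
  proof eventually_elim
    case (elim x)
    have "((\<lambda>t. (\<Sum>j<Suc d. c j x * t^j) + t^Suc d * u (upd x k t)) has_real_derivative
        (\<Sum>j<Suc d. c j x * (real j * (x$k)^(j - 1))) + (real (Suc d) * (x$k)^d * u x + v x * (x$k)^Suc d))
        (at (x$k))"
    proof (rule DERIV_add[OF DERIV_sum])
      show "((\<lambda>t. c j x * t^j) has_real_derivative c j x * (real j * (x$k)^(j - 1))) (at (x$k))" for j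
        using DERIV_cmult[OF DERIV_pow[of j "x$k"], of "c j x"] by simp
      show "((\<lambda>t. t^Suc d * u (upd x k t)) has_real_derivative
          real (Suc d) * (x$k)^d * u x + v x * (x$k)^Suc d) (at (x$k))"
        using DERIV_mult[OF DERIV_pow[of "Suc d" "x$k"] elim(2)] by simp
    qed
    then have "((\<lambda>t. fs 0 (upd x k t)) has_real_derivative
        (\<Sum>j<Suc d. c j x * (real j * (x$k)^(j - 1))) + (real (Suc d) * (x$k)^d * u x + v x * (x$k)^Suc d))
        (at (x$k))"
    proof (rule has_field_derivative_transform_within_open[where S = "{-r<..<r}"])
      fix t assume "t \<in> {-r<..<r}"
      then have "upd x k t \<in> RB r" using elim(1) by (intro upd_in_RB) auto
      from r(2)[OF this] show "(\<Sum>j<Suc d. c j x * t^j) + t^Suc d * u (upd x k t) = fs 0 (upd x k t)"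
        using Suc.prems(3) by simp
    qed (use RB_nth[OF elim(1), of k] in auto)
    from DERIV_unique[OF elim(3) this] show ?case
      by (subst (asm) sum.lessThan_Suc_shift) (simp add: c'_def u'_def algebra_simps)
  qed
  moreover have "an u'" unfolding u'_def by (intro an_intros Suc.prems v)
  ultimately have IH: "(\<forall>i<d. \<forall>\<^sub>F x in nhds 0. x$k = 0 \<longrightarrow> fs (Suc i) x = fact i * c' i x) \<and> fs (Suc d) 0 = fact d * u' 0"
    using Suc.IH[of "\<lambda>i. fs (Suc i)" u' c'] Suc.prems by (auto simp: c'_def)
  have "\<forall>\<^sub>F x in nhds 0. x$k = 0 \<longrightarrow> fs i x = fact i * c i x" if "i < Suc d" for i
  proof (cases i)
    case 0
    show ?thesis using Suc.prems(4)
    proof eventually_elim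
      case (elim x)
      show ?case
      proof
        assume "x$k = 0"
        with elim show "fs i x = fact i * c i x"
          by (subst (asm) sum.lessThan_Suc_shift) (simp add: 0)
      qed
    qed
  next
    case (Suc i')
    with that IH have "\<forall>\<^sub>F x in nhds 0. x$k = 0 \<longrightarrow> fs (Suc i') x = fact i' * c' i' x" by simp
    then show ?thesis
      by eventually_elim (simp add: Suc c'_def algebra_simps)
  qed
  moreover have "fs (Suc d) 0 = fact (Suc d) * u 0"
    using IH by (simp add: u'_def algebra_simps)
  ultimately show ?case by blast
qed

text \<open>Records which coordinates a function uses. Functions of fewer variables stay in the
  fixed space \<open>real^'n\<close>, and the induction on the number of variables shrinks
  \<open>S\<close> instead of the space.\<close>

definition dep :: "'n::finite set \<Rightarrow> (real^'n \<Rightarrow> real) \<Rightarrow> bool" where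
  "dep S f \<longleftrightarrow> (\<forall>x y. (\<forall>i\<in>S. x$i = y$i) \<longrightarrow> f x = f y)"

definition proj :: "'n::finite set \<Rightarrow> real^'n \<Rightarrow> real^'n" where
  "proj S x = (\<chi> i. if i \<in> S then x$i else 0)"

lemma proj_nth [simp]: "proj S x $ i = (if i \<in> S then x$i else 0)"
  by (simp add: proj_def)

lemma proj_0 [simp]: "proj S 0 = 0"
  by (simp add: vec_eq_iff)

lemma depD: "dep S f \<Longrightarrow> (\<And>i. i \<in> S \<Longrightarrow> x$i = y$i) \<Longrightarrow> f x = f y"
  unfolding dep_def by blast

lemma depI: "(\<And>x y. (\<And>i. i \<in> S \<Longrightarrow> x$i = y$i) \<Longrightarrow> f x = f y) \<Longrightarrow> dep S f"
  unfolding dep_def by blast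

lemma dep_UNIV [simp]: "dep UNIV f"
  by (auto simp: dep_def vec_eq_iff[symmetric])

lemma dep_mono: "dep S f \<Longrightarrow> S \<subseteq> T \<Longrightarrow> dep T f"
  unfolding dep_def by blast

lemma dep_proj: "dep S f \<Longrightarrow> f (proj S x) = f x"
  by (erule depD) simp

lemma dep_compose_proj [simp]: "dep S (\<lambda>x. f (proj S x))"
  by (rule depI, rule arg_cong[of _ _ f]) (simp add: vec_eq_iff)

lemma an_proj_nth: "an (\<lambda>x. proj S x $ i)"
  by (cases "i \<in> S") auto

lemma an_compose_proj: "an f \<Longrightarrow> an (\<lambda>x. f (proj S x))"
  by (rule an_compose) (auto simp: an_proj_nth simp del: proj_nth)

lemma eventually_proj: "\<forall>\<^sub>F x in nhds 0. P x \<Longrightarrow> \<forall>\<^sub>F x in nhds 0. P (proj S x)"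
  by (rule an_eventually_compose[OF an_proj_nth]) auto

lemma dep_const [simp]: "dep S (\<lambda>x. c)"
  and dep_coord: "i \<in> S \<Longrightarrow> dep S (\<lambda>x. x$i)"
  and dep_add: "dep S f \<Longrightarrow> dep S g \<Longrightarrow> dep S (\<lambda>x. f x + g x)"
  and dep_diff: "dep S f \<Longrightarrow> dep S g \<Longrightarrow> dep S (\<lambda>x. f x - g x)"
  and dep_mult: "dep S f \<Longrightarrow> dep S g \<Longrightarrow> dep S (\<lambda>x. f x * g x)"
  and dep_power: "dep S f \<Longrightarrow> dep S (\<lambda>x. f x ^ n)"
  unfolding dep_def by metis+

lemma dep_prod: "(\<And>i. i \<in> I \<Longrightarrow> dep S (f i)) \<Longrightarrow> dep S (\<lambda>x. \<Prod>i\<in>I. f i x)"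
  by (induction I rule: infinite_finite_induct) (auto intro: dep_mult)

lemma dep_sum: "(\<And>i. i \<in> I \<Longrightarrow> dep S (f i)) \<Longrightarrow> dep S (\<lambda>x. \<Sum>i\<in>I. f i x)"
  by (induction I rule: infinite_finite_induct) (auto intro: dep_add)

lemma dep_compose: "dep T f \<Longrightarrow> (\<And>i. i \<in> T \<Longrightarrow> dep S (\<lambda>x. \<psi> x $ i)) \<Longrightarrow> dep S (\<lambda>x. f (\<psi> x))"
  unfolding dep_def by metis

lemmas dep_intros = dep_const dep_coord dep_add dep_diff dep_mult dep_power dep_prod dep_sum

text \<open>The coefficient of \<open>x\<^sub>k\<^sup>d\<^sup>-\<^sup>1\<close> is removed by shifting \<open>x\<^sub>k\<close> to the zero of
  the derivative of order \<open>d - 1\<close>.\<close>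

lemma tschirnhaus:
  fixes f :: "real^'n::finite \<Rightarrow> real"
  assumes f: "an f" "dep S f" and k: "k \<in> S" and reg: "reg k d f" and d: "d \<ge> 1"
  shows "\<exists>\<phi> c u. an \<phi> \<and> \<phi> 0 = 0 \<and> dep (S - {k}) \<phi> \<and>
    (\<forall>j. an (c j) \<and> dep (S - {k}) (c j)) \<and> (\<forall>j<d. c j 0 = 0) \<and>
    an u \<and> dep S u \<and> u 0 \<noteq> 0 \<and>
    (\<forall>\<^sub>F x in nhds 0. f (upd x k (x$k + \<phi> x)) = (\<Sum>j<d-1. c j x * (x$k)^j) + (x$k)^d * u x)"
proof -
  have "\<exists>fs. \<forall>n. (an (fs n) \<and> (n = 0 \<longrightarrow> fs n = f)) \<and> ddk k (fs n) (fs (Suc n))"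
    by (rule dependent_nat_choice) (use an_ddk f in auto)
  then obtain fs where fs: "\<And>i. an (fs i)" "fs 0 = f" "\<And>i. ddk k (fs i) (fs (Suc i))"
    by blast
  have upd00: "upd 0 k 0 = (0::real^'n)" by (simp add: vec_eq_iff)
  obtain u' where u': "an u'" "u' 0 \<noteq> 0" "\<forall>\<^sub>F x in nhds 0. f (axis k (x$k)) = (x$k)^d * u' x"
    using reg unfolding reg_def by blast
  \<comment> \<open>On the axis the order \<open>d\<close> is known. It shows that at 0 the
    derivatives of order below \<open>d\<close> vanish and the one of order \<open>d\<close> does
    not.\<close>
  define gs where "gs i x = fs i (axis k (x$k))" for i and x :: "real^'n"
  have an_ax: "an (\<lambda>x. axis k (x$k) $ i)" for i
    by (cases "i = k") (auto simp: axis_def)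
  have "ddk k (gs i) (gs (Suc i))" for i
    unfolding ddk_def
    using an_eventually_compose[where \<Phi> = "\<lambda>x. axis k (x$k)", OF an_ax _ fs(3)[of i, unfolded ddk_def]]
    by (simp add: gs_def axis_eq_upd upd00)
  from taylor_coeff[of k gs u' d "\<lambda>_ _. 0", OF this u'(1)]
  have gs: "\<And>i. i < d \<Longrightarrow> \<forall>\<^sub>F x in nhds 0. x$k = 0 \<longrightarrow> gs i x = 0" "gs d 0 = fact d * u' 0"
    using u'(3) fs(2) by (auto simp: gs_def)
  have fs0: "fs i 0 = 0" if "i < d" for i
    using eventually_nhds_x_imp_x[OF gs(1)[OF that]] by (simp add: gs_def axis_eq_upd upd00)
  have fsd: "fs d 0 \<noteq> 0"
    using gs(2) u'(2) by (simp add: gs_def axis_eq_upd upd00)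
  have "((\<lambda>t. fs (d - 1) (upd 0 k t)) has_real_derivative fs d 0) (at 0)"
    using eventually_nhds_x_imp_x[OF fs(3)[of "d - 1", unfolded ddk_def]] d by simp
  \<comment> \<open>At the origin the derivative of order d - 1 vanishes while its own derivative in
    x_k does not, so its zero set is a graph over the other coordinates.\<close>
  from an_implicit[OF fs(1) _ this fsd] fs0[of "d - 1"] d
  obtain \<phi> where \<phi>: "an \<phi>" "\<phi> 0 = 0" "\<And>x t. \<phi> (upd x k t) = \<phi> x"
    "\<forall>\<^sub>F x in nhds 0. fs (d - 1) (upd x k (\<phi> x)) = 0" by auto
  define ft where "ft i x = fs i (upd x k (x$k + \<phi> x))" for i x
  have an_sh: "an (\<lambda>x. upd x k (x$k + \<phi> x) $ i)" for i
    by (cases "i = k") (auto intro: an_intros \<phi>)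
  have sh0: "upd 0 k (0$k + \<phi> 0) = (0::real^'n)" by (simp add: \<phi> vec_eq_iff)
  have an_ft: "an (ft i)" for i
    unfolding ft_def by (rule an_compose[OF fs(1) an_sh sh0])
  have "ddk k (ft i) (ft (Suc i))" for i
    unfolding ddk_def
    using an_eventually_compose[OF an_sh sh0 fs(3)[of i, unfolded ddk_def]]
  proof eventually_elim
    case (elim x)
    then have "((\<lambda>t. fs i (upd x k t)) has_real_derivative fs (Suc i) (upd x k (x$k + \<phi> x))) (at (x$k + \<phi> x))"
      by simp
    then show ?case unfolding DERIV_shift by (simp add: ft_def \<phi>(3))
  qed
  note ft_ddk = this
  obtain c u where c': "\<forall>j. an (c j) \<and> (\<forall>x t. c j (upd x k t) = c j x)" and u: "an u"
    and ev: "\<forall>\<^sub>F x in nhds 0. ft 0 x = (\<Sum>j<d. c j x * (x$k)^j) + (x$k)^d * u x"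
    using an_taylor[OF an_ft[of 0], where k = k and d = d] by (elim exE conjE) (rule that)
  have c: "an (c j)" "c j (upd x k t) = c j x" for j x t using c' by auto
  from taylor_coeff[of k ft, OF ft_ddk u c(2) ev]
  have tc: "\<And>i. i < d \<Longrightarrow> \<forall>\<^sub>F x in nhds 0. x$k = 0 \<longrightarrow> ft i x = fact i * c i x" "ft d 0 = fact d * u 0"
    by auto
  have ft0: "ft i 0 = fs i 0" for i using sh0 by (simp add: ft_def)
  have c0: "c i 0 = 0" if "i < d" for i
    using eventually_nhds_x_imp_x[OF tc(1)[OF that]] fs0[OF that] ft0 by simp
  have u0: "u 0 \<noteq> 0" using tc(2) fsd ft0 by auto
  have an_u0: "an (\<lambda>x. upd x k 0 $ i)" for i by (cases "i = k") auto
  have "\<forall>\<^sub>F x in nhds 0. upd x k 0 $ k = 0 \<longrightarrow> ft (d - 1) (upd x k 0) = fact (d - 1) * c (d - 1) (upd x k 0)"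
    by (rule an_eventually_compose[OF an_u0 upd00 tc(1)]) (use d in auto)
  \<comment> \<open>After the shift the derivative of order d - 1 vanishes on x_k = 0, where it
    equals (d - 1)! times this coefficient.\<close>
  then have "\<forall>\<^sub>F x in nhds 0. c (d - 1) x = 0"
    using \<phi>(4)
  proof eventually_elim
    case (elim x)
    then show ?case by (simp add: ft_def \<phi>(3) c(2))
  qed
  then have main: "\<forall>\<^sub>F x in nhds 0. f (upd x k (x$k + \<phi> x)) = (\<Sum>j<d-1. c j x * (x$k)^j) + (x$k)^d * u x"
    using ev
  proof eventually_elim
    case (elim x)
    have "{..<d} = insert (d - 1) {..<d - 1}" using d by auto
    with elim show ?case by (simp add: ft_def fs(2))
  qed
  \<comment> \<open>Neither germ changes with x_k, so projecting to \<open>S\<close> has the same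
    effect as projecting to S - {k}.\<close>
  have pr: "\<phi> (proj S x) = \<phi> (proj (S - {k}) x)" "c j (proj S x) = c j (proj (S - {k}) x)" for x j
  proof -
    have "proj (S - {k}) x = upd (proj S x) k 0" by (simp add: vec_eq_iff)
    then show "\<phi> (proj S x) = \<phi> (proj (S - {k}) x)" "c j (proj S x) = c j (proj (S - {k}) x)"
      by (simp_all add: \<phi>(3) c(2))
  qed
  have "\<forall>\<^sub>F x in nhds 0. f (upd x k (x$k + \<phi> (proj (S - {k}) x))) =
      (\<Sum>j<d-1. c j (proj (S - {k}) x) * (x$k)^j) + (x$k)^d * u (proj S x)"
    using eventually_proj[OF main, of S]
  proof eventually_elim
    case (elim x)
    have "f (upd (proj S x) k (proj S x $ k + \<phi> (proj S x))) = f (upd x k (x$k + \<phi> (proj (S - {k}) x)))"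
      by (rule depD[OF f(2)]) (use k in \<open>simp add: pr\<close>)
    with elim k show ?case by (simp add: pr)
  qed
  moreover have "an (\<lambda>x. \<phi> (proj (S - {k}) x))" "\<And>j. an (\<lambda>x. c j (proj (S - {k}) x))" "an (\<lambda>x. u (proj S x))"
    by (intro an_compose_proj \<phi> c u)+
  ultimately show ?thesis
    by (intro exI[of _ "\<lambda>x. \<phi> (proj (S - {k}) x)"] exI[of _ "\<lambda>j x. c j (proj (S - {k}) x)"]
        exI[of _ "\<lambda>x. u (proj S x)"]) (auto simp: \<phi> c0 u0)
qed

section \<open>Monomials times units\<close>

definition mon :: "('n::finite \<Rightarrow> nat) \<Rightarrow> real^'n \<Rightarrow> real" where
  "mon \<alpha> x = (\<Prod>i\<in>UNIV. (x$i) ^ \<alpha> i)"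

lemma mon_0 [simp]: "mon (\<lambda>_. 0) x = 1"
  by (simp add: mon_def)

lemma mon_add: "mon (\<lambda>i. \<alpha> i + \<beta> i) x = mon \<alpha> x * mon \<beta> x"
  by (simp add: mon_def power_add prod.distrib)

lemma mon_single: "mon (\<lambda>j. if j = i then n else 0) x = (x$i)^n"
proof -
  have "mon (\<lambda>j. if j = i then n else 0) x = (\<Prod>j\<in>UNIV. if j = i then (x$i)^n else 1)"
    unfolding mon_def by (intro prod.cong) auto
  then show ?thesis by simp
qed

lemma mon_eq_0_iff: "mon \<alpha> x = 0 \<longleftrightarrow> (\<exists>i. \<alpha> i > 0 \<and> x$i = 0)"
  by (auto simp: mon_def)

lemma mon_mult_exp: "mon (\<lambda>i. n * \<alpha> i) x = mon \<alpha> x ^ n"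
  by (simp add: mon_def prod_power_distrib power_mult[symmetric] mult.commute)

lemma an_mon [simp]: "an (mon \<alpha>)"
  unfolding mon_def by (intro an_intros)

lemma dep_mon: "(\<And>i. i \<notin> S \<Longrightarrow> \<alpha> i = 0) \<Longrightarrow> dep S (mon \<alpha>)"
proof (rule depI)
  fix x y :: "real^'a" assume "\<And>i. i \<notin> S \<Longrightarrow> \<alpha> i = 0" "\<And>i. i \<in> S \<Longrightarrow> x$i = y$i"
  then show "mon \<alpha> x = mon \<alpha> y"
    unfolding mon_def by (intro prod.cong refl) (metis power_0)
qed

text \<open>Normal crossings at the origin in the coordinates of \<open>S\<close>. The unit is
  confined to \<open>S\<close> too, because the charts used later change only coordinates in
  \<open>S\<close>.\<close>

definition mono_germ :: "'n::finite set \<Rightarrow> (real^'n \<Rightarrow> real) \<Rightarrow> bool" where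
  "mono_germ S f \<longleftrightarrow> (\<exists>\<alpha> u. (\<forall>i. i \<notin> S \<longrightarrow> \<alpha> i = 0) \<and> an u \<and> dep S u \<and> u 0 \<noteq> 0 \<and>
     (\<forall>\<^sub>F x in nhds 0. f x = mon \<alpha> x * u x))"

lemma mono_germI:
  "(\<And>i. i \<notin> S \<Longrightarrow> \<alpha> i = 0) \<Longrightarrow> an u \<Longrightarrow> dep S u \<Longrightarrow> u 0 \<noteq> 0 \<Longrightarrow>
     \<forall>\<^sub>F x in nhds 0. f x = mon \<alpha> x * u x \<Longrightarrow> mono_germ S f"
  unfolding mono_germ_def by blast

lemma mono_germ_cong: "mono_germ S f \<Longrightarrow> \<forall>\<^sub>F x in nhds 0. g x = f x \<Longrightarrow> mono_germ S g"
  unfolding mono_germ_def by (elim exE conjE) (intro exI conjI, auto elim: eventually_elim2)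

lemma mono_germ_mono:
  assumes "mono_germ S f" "S \<subseteq> T"
  shows "mono_germ T f"
proof -
  obtain \<alpha> u where "\<And>i. i \<notin> S \<Longrightarrow> \<alpha> i = 0" "an u" "dep S u" "u 0 \<noteq> 0" "\<forall>\<^sub>F x in nhds 0. f x = mon \<alpha> x * u x"
    using assms(1) unfolding mono_germ_def by blast
  with assms(2) show ?thesis by (intro mono_germI[of T \<alpha> u]) (auto intro: dep_mono)
qed

lemma mono_germ_unit: "an u \<Longrightarrow> dep S u \<Longrightarrow> u 0 \<noteq> 0 \<Longrightarrow> mono_germ S u"
  by (rule mono_germI[of _ "\<lambda>_. 0"]) auto

lemma mono_germ_coord: "i \<in> S \<Longrightarrow> mono_germ S (\<lambda>x. x$i)"
  by (rule mono_germI[of _ "\<lambda>j. if j = i then 1 else 0" "\<lambda>_. 1"]) (auto simp: mon_single)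

lemma mono_germ_mult:
  assumes "mono_germ S f" "mono_germ S g"
  shows "mono_germ S (\<lambda>x. f x * g x)"
proof -
  obtain \<alpha> u \<beta> v where f: "\<And>i. i \<notin> S \<Longrightarrow> \<alpha> i = 0" "an u" "dep S u" "u 0 \<noteq> 0" "\<forall>\<^sub>F x in nhds 0. f x = mon \<alpha> x * u x"
    and g: "\<And>i. i \<notin> S \<Longrightarrow> \<beta> i = 0" "an v" "dep S v" "v 0 \<noteq> 0" "\<forall>\<^sub>F x in nhds 0. g x = mon \<beta> x * v x"
    using assms unfolding mono_germ_def by blast
  show ?thesis
  proof (rule mono_germI[of S "\<lambda>i. \<alpha> i + \<beta> i" "\<lambda>x. u x * v x"])
    show "\<forall>\<^sub>F x in nhds 0. f x * g x = mon (\<lambda>i. \<alpha> i + \<beta> i) x * (u x * v x)"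
      using f(5) g(5) by eventually_elim (simp add: mon_add)
  qed (use f g in \<open>auto intro: an_mult dep_mult\<close>)
qed

lemma mono_germ_power: "mono_germ S f \<Longrightarrow> mono_germ S (\<lambda>x. f x ^ n)"
  by (induction n) (auto intro: mono_germ_mult mono_germ_unit)

lemma mono_germ_prod: "(\<And>i. i \<in> I \<Longrightarrow> mono_germ S (f i)) \<Longrightarrow> mono_germ S (\<lambda>x. \<Prod>i\<in>I. f i x)"
  by (induction I rule: infinite_finite_induct) (auto intro: mono_germ_mult mono_germ_unit)

lemma mono_germ_mon: "(\<And>i. i \<notin> S \<Longrightarrow> \<alpha> i = 0) \<Longrightarrow> mono_germ S (mon \<alpha>)"
  by (rule mono_germI[of _ \<alpha> "\<lambda>_. 1"]) auto

text \<open>A monomial in germs that are monomials times units is again of this form, and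
  \<open>u\<close> stays a unit because \<psi> fixes the origin.\<close>

lemma mono_germ_compose:
  assumes g: "mono_germ T g" and \<psi>: "\<And>i. an (\<lambda>x. \<psi> x $ i)" "\<psi> 0 = 0"
    "\<And>i. i \<in> T \<Longrightarrow> dep S (\<lambda>x. \<psi> x $ i)" "\<And>i. i \<in> T \<Longrightarrow> mono_germ S (\<lambda>x. \<psi> x $ i)"
  shows "mono_germ S (\<lambda>x. g (\<psi> x))"
proof -
  obtain \<alpha> u where g: "\<And>i. i \<notin> T \<Longrightarrow> \<alpha> i = 0" "an u" "dep T u" "u 0 \<noteq> 0" "\<forall>\<^sub>F x in nhds 0. g x = mon \<alpha> x * u x"
    using g unfolding mono_germ_def by blast
  have "mono_germ S (\<lambda>x. (\<psi> x $ i) ^ \<alpha> i)" for i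
    using \<psi>(4) g(1) by (cases "i \<in> T") (auto intro: mono_germ_power mono_germ_unit)
  then have "mono_germ S (\<lambda>x. mon \<alpha> (\<psi> x))"
    unfolding mon_def by (rule mono_germ_prod)
  moreover have "mono_germ S (\<lambda>x. u (\<psi> x))"
    by (rule mono_germ_unit[OF an_compose[OF g(2) \<psi>(1,2)] dep_compose[OF g(3) \<psi>(3)]])
      (use g(4) \<psi>(2) in simp_all)
  ultimately have "mono_germ S (\<lambda>x. mon \<alpha> (\<psi> x) * u (\<psi> x))" by (rule mono_germ_mult)
  then show ?thesis
    by (rule mono_germ_cong) (rule an_eventually_compose[OF \<psi>(1,2) g(5)])
qed

text \<open>Test points for exponents: at such a point a monomial vanishes exactly when
  \<open>Z\<close> meets its support.\<close>

lemma eventually_diag: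
  fixes Z :: "'n::finite set"
  assumes "\<forall>\<^sub>F x in nhds (0::real^'n). P x"
  shows "\<exists>x. P x \<and> (\<forall>i. x$i = 0 \<longleftrightarrow> i \<in> Z)"
proof -
  obtain r where r: "r > 0" "\<And>x. x \<in> RB r \<Longrightarrow> P x" using assms unfolding eventually_RB by blast
  have "(\<chi> i. if i \<in> Z then 0 else r/2) \<in> RB r" using r(1) by (auto simp: RB_iff)
  from r(2)[OF this] show ?thesis using r(1) by (intro exI conjI) (auto split: if_splits)
qed

lemma mono_germ_not_0:
  assumes "mono_germ S f"
  shows "\<not> (\<forall>\<^sub>F x in nhds 0. f x = 0)"
proof
  assume 0: "\<forall>\<^sub>F x in nhds 0. f x = 0"
  obtain \<alpha> u where f: "an u" "u 0 \<noteq> 0" "\<forall>\<^sub>F x in nhds 0. f x = mon \<alpha> x * u x"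
    using assms unfolding mono_germ_def by blast
  have "\<forall>\<^sub>F x in nhds 0. mon \<alpha> x = 0"
    using 0 f(3) an_eventually_nz[OF f(1,2)] by eventually_elim simp
  from eventually_diag[OF this, of "{}"] show False by (auto simp: mon_eq_0_iff)
qed

lemma an_cancel:
  assumes "an f" "an a" "an b" "\<not> (\<forall>\<^sub>F x in nhds 0. f x = 0)" "\<forall>\<^sub>F x in nhds 0. f x * a x = f x * b x"
  shows "\<forall>\<^sub>F x in nhds 0. a x = b x"
proof -
  have "\<forall>\<^sub>F x in nhds 0. f x * (a x - b x) = 0"
    using assms(5) by eventually_elim (simp add: algebra_simps)
  from an_mult_eq_0[OF assms(1) an_diff[OF assms(2,3)] this] assms(4)
  show ?thesis by simp
qed

text \<open>A coordinate x_i is a prime in the ring of germs, because restriction to x_i = 0 lands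
  in an integral domain. So each coordinate in the monomial divides \<open>f\<close> or
  \<open>g\<close>, and the total degree drops. Thanks to this, making one product monomial makes
  all its factors monomial.\<close>

lemma mono_germ_factor:
  assumes "an f" "an g" "dep S f" "dep S g" "mono_germ S (\<lambda>x. f x * g x)"
  shows "mono_germ S f"
proof -
  have "mono_germ S f"
    if "an f" "an g" "dep S f" "dep S g" "\<forall>i. i \<notin> S \<longrightarrow> \<alpha> i = 0" "an u" "dep S u" "u 0 \<noteq> 0"
      "\<forall>\<^sub>F x in nhds 0. f x * g x = mon \<alpha> x * u x" for f g \<alpha> u
    using that
  proof (induction "\<Sum>i\<in>UNIV. \<alpha> i" arbitrary: f g \<alpha>)
    case 0
    then have "\<alpha> = (\<lambda>_. 0)" by (simp add: fun_eq_iff)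
    then have "f 0 * g 0 = u 0" using eventually_nhds_x_imp_x[OF 0(10)] by simp
    with 0 show ?case by (intro mono_germ_unit) auto
  next
    case (Suc n)
    from Suc(2) obtain i where i: "\<alpha> i > 0"
      by (metis Suc_neq_Zero neq0_conv sum.neutral)
    then have "i \<in> S" using Suc(7) by (cases "i \<in> S") auto
    define \<beta> where "\<beta> = \<alpha>(i := \<alpha> i - 1)"
    have \<alpha>: "\<alpha> = (\<lambda>j. (if j = i then 1 else 0) + \<beta> j)" using i by (auto simp: \<beta>_def)
    have mon_\<alpha>: "mon \<alpha> x = x$i * mon \<beta> x" for x by (subst \<alpha>) (simp add: mon_add mon_single)
    have "(\<Sum>j\<in>UNIV. \<alpha> j) = 1 + (\<Sum>j\<in>UNIV. \<beta> j)" by (subst \<alpha>) (simp add: sum.distrib)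
    then have n: "n = (\<Sum>j\<in>UNIV. \<beta> j)" using Suc(2) by simp
    have \<beta>S: "\<forall>j. j \<notin> S \<longrightarrow> \<beta> j = 0" using Suc(7) \<open>i \<in> S\<close> by (auto simp: \<beta>_def)
    have an_u: "an (\<lambda>x. upd x i 0 $ j)" for j by (cases "j = i") auto
    have upd00: "upd 0 i 0 = (0::real^'a)" by (simp add: vec_eq_iff)
    have red: "\<exists>h1. an h1 \<and> dep S h1 \<and> (\<forall>\<^sub>F x in nhds 0. h x = x$i * h1 x)"
      if h: "an h" "dep S h" "\<forall>\<^sub>F x in nhds 0. h (upd x i 0) = 0" for h
    proof -
      from h(3) have "\<forall>\<^sub>F x in nhds 0. x$i = 0 \<longrightarrow> h x = 0"
      proof eventually_elim
        case (elim x)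
        show ?case
        proof
          assume "x$i = 0"
          then have "upd x i 0 = x" by (simp add: vec_eq_iff)
          with elim show "h x = 0" by simp
        qed
      qed
      from an_divide_coord[OF h(1) this]
      obtain h1 where h1: "an h1" "\<forall>\<^sub>F x in nhds 0. h x = x$i * h1 x" by blast
      have "\<forall>\<^sub>F x in nhds 0. h x = x$i * h1 (proj S x)"
        using eventually_proj[OF h1(2), of S] \<open>i \<in> S\<close> by (simp add: dep_proj[OF h(2)])
      with an_compose_proj[OF h1(1)] show ?thesis
        by (intro exI[of _ "\<lambda>x. h1 (proj S x)"]) auto
    qed
    have cancel: "\<forall>\<^sub>F x in nhds 0. a x = mon \<beta> x * u x"
      if "an a" "\<forall>\<^sub>F x in nhds 0. x$i * a x = x$i * (mon \<beta> x * u x)" for a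
    proof (rule an_cancel[of "\<lambda>x. x$i"])
      show "an (\<lambda>x. mon \<beta> x * u x)" by (intro an_mult an_mon Suc(8))
      show "\<not> (\<forall>\<^sub>F x in nhds (0::real^'a). x$i = 0)"
        by (rule mono_germ_not_0[OF mono_germ_coord[of i UNIV]]) simp
    qed (use that in simp_all)
    have "\<forall>\<^sub>F x in nhds 0. f (upd x i 0) * g (upd x i 0) = 0"
      using an_eventually_compose[OF an_u upd00 Suc(11)] by (simp add: mon_\<alpha>)
    then consider "\<forall>\<^sub>F x in nhds 0. f (upd x i 0) = 0" | "\<forall>\<^sub>F x in nhds 0. g (upd x i 0) = 0"
      using an_mult_eq_0[OF an_upd[OF Suc(3), of "\<lambda>_. 0" i] an_upd[OF Suc(4), of "\<lambda>_. 0" i]] by auto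
    then show ?case
    proof cases
      case 1
      from red[OF Suc(3,5) this] obtain f1 where f1: "an f1" "dep S f1" "\<forall>\<^sub>F x in nhds 0. f x = x$i * f1 x"
        by blast
      have "\<forall>\<^sub>F x in nhds 0. x$i * (f1 x * g x) = x$i * (mon \<beta> x * u x)"
        using f1(3) Suc(11) by eventually_elim (simp add: mon_\<alpha> algebra_simps)
      from cancel[OF an_mult[OF f1(1) Suc(4)] this]
      have "mono_germ S f1" by (rule Suc(1)[OF n f1(1) Suc(4) f1(2) Suc(6) \<beta>S Suc(8-10)])
      from mono_germ_mult[OF mono_germ_coord[OF \<open>i \<in> S\<close>] this] f1(3)
      show ?thesis by (rule mono_germ_cong)
    next
      case 2
      from red[OF Suc(4,6) this] obtain g1 where g1: "an g1" "dep S g1" "\<forall>\<^sub>F x in nhds 0. g x = x$i * g1 x"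
        by blast
      have "\<forall>\<^sub>F x in nhds 0. x$i * (f x * g1 x) = x$i * (mon \<beta> x * u x)"
        using g1(3) Suc(11) by eventually_elim (simp add: mon_\<alpha> algebra_simps)
      from cancel[OF an_mult[OF Suc(3) g1(1)] this]
      show ?thesis by (rule Suc(1)[OF n Suc(3) g1(1) Suc(5) g1(2) \<beta>S Suc(8-10)])
    qed
  qed
  with assms show ?thesis unfolding mono_germ_def[of S "\<lambda>x. f x * g x"] by blast
qed

text \<open>After division by the common part \<mu>, the difference \<open>E\<close> vanishes where
  x_i = x_k = 0 but not at general points of x_i = 0 or of x_k = 0. A monomial times a unit cannot
  behave like this: near the origin its zero set is a union of coordinate hyperplanes.\<close>

lemma mono_germ_comparable:
  fixes u v :: "real^'n::finite \<Rightarrow> real"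
  assumes u: "an u" "u 0 \<noteq> 0" and v: "an v" "v 0 \<noteq> 0"
    and D: "(\<forall>\<^sub>F x in nhds 0. mon \<alpha> x * u x - mon \<beta> x * v x = 0) \<or>
      mono_germ UNIV (\<lambda>x. mon \<alpha> x * u x - mon \<beta> x * v x)"
  shows "(\<forall>i. \<alpha> i \<le> \<beta> i) \<or> (\<forall>i. \<beta> i \<le> \<alpha> i)"
proof (rule ccontr)
  assume "\<not> ?thesis"
  then obtain i k where ik: "\<beta> k < \<alpha> k" "\<alpha> i < \<beta> i" by (auto simp: not_le)
  define \<mu> \<alpha>' \<beta>' where "\<mu> j = min (\<alpha> j) (\<beta> j)" and "\<alpha>' j = \<alpha> j - \<mu> j" and "\<beta>' j = \<beta> j - \<mu> j" for j
  have "\<alpha> = (\<lambda>j. \<mu> j + \<alpha>' j)" "\<beta> = (\<lambda>j. \<mu> j + \<beta>' j)" by (auto simp: \<mu>_def \<alpha>'_def \<beta>'_def)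
  then have split: "mon \<alpha> x = mon \<mu> x * mon \<alpha>' x" "mon \<beta> x = mon \<mu> x * mon \<beta>' x" for x :: "real^'n"
    by (metis mon_add)+
  have ex: "\<alpha>' i = 0" "\<beta>' i > 0" "\<beta>' k = 0" "\<alpha>' k > 0" "i \<noteq> k"
    using ik by (auto simp: \<mu>_def \<alpha>'_def \<beta>'_def)
  define E where "E x = mon \<alpha>' x * u x - mon \<beta>' x * v x" for x
  have eq: "mon \<alpha> x * u x - mon \<beta> x * v x = E x * mon \<mu> x" for x
    by (simp add: split E_def algebra_simps)
  have "an E" unfolding E_def by (intro an_intros an_mon u v)
  have nzu: "\<forall>\<^sub>F x in nhds 0. u x \<noteq> 0" and nzv: "\<forall>\<^sub>F x in nhds 0. v x \<noteq> 0"
    by (rule an_eventually_nz[OF u] an_eventually_nz[OF v])+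
  have E1: "E x \<noteq> 0" if "u x \<noteq> 0" "\<forall>j. x$j = 0 \<longleftrightarrow> j = i" for x
  proof -
    have "mon \<alpha>' x \<noteq> 0" "mon \<beta>' x = 0" using that ex by (auto simp: mon_eq_0_iff)
    with that show ?thesis by (simp add: E_def)
  qed
  have E2: "E x \<noteq> 0" if "v x \<noteq> 0" "\<forall>j. x$j = 0 \<longleftrightarrow> j = k" for x
  proof -
    have "mon \<beta>' x \<noteq> 0" "mon \<alpha>' x = 0" using that ex by (auto simp: mon_eq_0_iff)
    with that show ?thesis by (simp add: E_def)
  qed
  have E3: "E x = 0" if "\<forall>j. x$j = 0 \<longleftrightarrow> j \<in> {i, k}" for x
  proof -
    have "mon \<beta>' x = 0" "mon \<alpha>' x = 0" using that ex by (auto simp: mon_eq_0_iff)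
    then show ?thesis by (simp add: E_def)
  qed
  from D show False
  proof
    assume "\<forall>\<^sub>F x in nhds 0. mon \<alpha> x * u x - mon \<beta> x * v x = 0"
    then have "\<forall>\<^sub>F x in nhds 0. E x * mon \<mu> x = 0" by (simp add: eq)
    from an_mult_eq_0[OF \<open>an E\<close> an_mon this] mono_germ_not_0[OF mono_germ_mon[of UNIV \<mu>]]
    have "\<forall>\<^sub>F x in nhds 0. E x = 0" by auto
    from eventually_diag[OF eventually_conj[OF this nzu], of "{i}"] E1 show False by auto
  next
    assume "mono_germ UNIV (\<lambda>x. mon \<alpha> x * u x - mon \<beta> x * v x)"
    then have "mono_germ UNIV (\<lambda>x. E x * mon \<mu> x)" by (simp add: eq)
    from mono_germ_factor[OF \<open>an E\<close> an_mon _ _ this] have "mono_germ UNIV E" by simp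
    then obtain \<gamma> w where w: "an w" "w 0 \<noteq> 0" "\<forall>\<^sub>F x in nhds 0. E x = mon \<gamma> x * w x"
      unfolding mono_germ_def by blast
    note nzw = an_eventually_nz[OF w(1,2)]
    from eventually_diag[OF eventually_conj[OF w(3) nzu], of "{i}"]
    obtain x where x: "E x = mon \<gamma> x * w x" "u x \<noteq> 0" "\<forall>j. x$j = 0 \<longleftrightarrow> j = i" by auto
    with E1[OF x(2,3)] have "\<gamma> i = 0" by (auto simp: mon_eq_0_iff)
    from eventually_diag[OF eventually_conj[OF w(3) nzv], of "{k}"]
    obtain x where x: "E x = mon \<gamma> x * w x" "v x \<noteq> 0" "\<forall>j. x$j = 0 \<longleftrightarrow> j = k" by auto
    with E2[OF x(2,3)] have "\<gamma> k = 0" by (auto simp: mon_eq_0_iff)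
    from eventually_diag[OF eventually_conj[OF w(3) nzw], of "{i, k}"]
    obtain x where x: "E x = mon \<gamma> x * w x" "w x \<noteq> 0" "\<forall>j. x$j = 0 \<longleftrightarrow> j \<in> {i, k}" by auto
    with E3[OF x(3)] have "mon \<gamma> x = 0" by simp
    with x(3) \<open>\<gamma> i = 0\<close> \<open>\<gamma> k = 0\<close> show False by (auto simp: mon_eq_0_iff)
  qed
qed

section \<open>Change of variables inequalities, one coordinate at a time\<close>

lemma borel_measurable_upd: "(\<lambda>p. upd (fst p) k (snd p)) \<in> borel_measurable (borel \<Otimes>\<^sub>M borel :: ((real^'n::finite) \<times> real) measure)"
  unfolding borel_prod by (intro borel_measurable_continuous_onI continuous_intros)

lemma borel_measurable_upd_slice [measurable]: "(\<lambda>t. upd (x::real^'n::finite) k t) \<in> borel_measurable borel"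
  by (intro borel_measurable_continuous_onI continuous_intros)

lemma borel_measurable_upd_fun:
  assumes [measurable]: "g \<in> borel_measurable borel"
  shows "(\<lambda>x::real^'n::finite. upd x k (g x)) \<in> borel_measurable borel"
  using measurable_compose[OF measurable_Pair[OF measurable_ident_sets[OF refl] assms] borel_measurable_upd]
  by simp

text \<open>Fubini in one coordinate without leaving the space: the other coordinates are integrated
  over the slab \<open>0 \<le> x\<^sub>k < 1\<close> of unit width.\<close>

lemma nn_integral_coord:
  fixes h :: "real^'n::finite \<Rightarrow> ennreal"
  assumes [measurable]: "h \<in> borel_measurable borel"
  shows "(\<integral>\<^sup>+x. h x \<partial>lborel) =
    (\<integral>\<^sup>+x. indicator {x. 0 \<le> x$k \<and> x$k < 1} x * (\<integral>\<^sup>+t. h (upd x k t) \<partial>lborel) \<partial>lborel)"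
proof -
  define I where "I = (indicator {x. 0 \<le> x$k \<and> x$k < 1} :: real^'n \<Rightarrow> ennreal)"
  have [measurable]: "I \<in> borel_measurable borel" unfolding I_def by measurable
  define e where "e = (axis k 1 :: real^'n)"
  have e: "x + s *\<^sub>R e = upd x k (x$k + s)" for x s
    by (auto simp: vec_eq_iff e_def axis_def)
  have shift: "(\<integral>\<^sup>+x. f (c + x) \<partial>lborel) = (\<integral>\<^sup>+x. f x \<partial>lborel)"
    if [measurable]: "f \<in> borel_measurable borel" for f and c :: "real^'n"
  proof -
    have "(\<integral>\<^sup>+x. f x \<partial>lborel) = (\<integral>\<^sup>+x. f x \<partial>distr lborel borel ((+) c))" by (simp add: lborel_distr_plus)
    also have "\<dots> = (\<integral>\<^sup>+x. f (c + x) \<partial>lborel)" by (subst nn_integral_distr) auto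
    finally show ?thesis ..
  qed
  have meas: "(\<lambda>(x, s). I x * h (x + s *\<^sub>R e)) \<in> borel_measurable (lborel \<Otimes>\<^sub>M lborel)" by measurable
  have meas2: "(\<lambda>(x, s). I (x - s *\<^sub>R e) * h x) \<in> borel_measurable (lborel \<Otimes>\<^sub>M lborel)" by measurable
  \<comment> \<open>Every point lies in the translated slab for a set of shifts of length exactly
    1.\<close>
  have unit: "(\<integral>\<^sup>+s. I (x - s *\<^sub>R e) \<partial>lborel) = 1" for x
  proof -
    have "I (x - s *\<^sub>R e) = indicator {x$k - 1<..x$k} s" for s
      by (auto simp: I_def indicator_def e_def axis_def)
    then show ?thesis by simp
  qed
  have "(\<integral>\<^sup>+x. I x * (\<integral>\<^sup>+t. h (upd x k t) \<partial>lborel) \<partial>lborel)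
      = (\<integral>\<^sup>+x. (\<integral>\<^sup>+s. I x * h (x + s *\<^sub>R e) \<partial>lborel) \<partial>lborel)"
  proof (rule nn_integral_cong)
    fix x
    have "(\<integral>\<^sup>+t. h (upd x k t) \<partial>lborel) = (\<integral>\<^sup>+s. h (x + s *\<^sub>R e) \<partial>lborel)"
      using nn_integral_real_affine[of "\<lambda>t. h (upd x k t)" 1 "x$k"] by (simp add: e)
    then show "I x * (\<integral>\<^sup>+t. h (upd x k t) \<partial>lborel) = (\<integral>\<^sup>+s. I x * h (x + s *\<^sub>R e) \<partial>lborel)"
      by (simp add: nn_integral_cmult)
  qed
  also have "\<dots> = (\<integral>\<^sup>+s. (\<integral>\<^sup>+x. I x * h (x + s *\<^sub>R e) \<partial>lborel) \<partial>lborel)"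
    by (rule lborel_pair.Fubini'[symmetric]) (use meas in simp)
  also have "\<dots> = (\<integral>\<^sup>+s. (\<integral>\<^sup>+x. I (x - s *\<^sub>R e) * h x \<partial>lborel) \<partial>lborel)"
  proof (rule nn_integral_cong)
    fix s
    show "(\<integral>\<^sup>+x. I x * h (x + s *\<^sub>R e) \<partial>lborel) = (\<integral>\<^sup>+x. I (x - s *\<^sub>R e) * h x \<partial>lborel)"
      using shift[of "\<lambda>x. I (x - s *\<^sub>R e) * h x" "s *\<^sub>R e"] by (simp add: add.commute)
  qed
  also have "\<dots> = (\<integral>\<^sup>+x. (\<integral>\<^sup>+s. I (x - s *\<^sub>R e) * h x \<partial>lborel) \<partial>lborel)"
    by (rule lborel_pair.Fubini') (use meas2 in simp)
  also have "\<dots> = (\<integral>\<^sup>+x. h x \<partial>lborel)"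
    by (simp add: nn_integral_multc unit)
  finally show ?thesis unfolding I_def ..
qed

text \<open>The one-variable form of the two inequalities asked of a chart. The constant 2 is the
  multiplicity of an even power, and compactness of \<open>K\<close> keeps the images Borel. In the
  two uses \<delta> is the derivative of \<gamma> up to sign.\<close>

definition cv1 :: "(real \<Rightarrow> real) \<Rightarrow> (real \<Rightarrow> real) \<Rightarrow> bool" where
  "cv1 \<gamma> \<delta> \<longleftrightarrow> (\<forall>h\<in>borel_measurable borel.
     (\<integral>\<^sup>+t. h (\<gamma> t) * ennreal \<bar>\<delta> t\<bar> \<partial>lborel) \<le> 2 * (\<integral>\<^sup>+t. h t \<partial>lborel) \<and>
     (\<forall>K. compact K \<longrightarrow> (\<integral>\<^sup>+t. h t * indicator (\<gamma> ` K) t \<partial>lborel)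
        \<le> (\<integral>\<^sup>+t. h (\<gamma> t) * ennreal \<bar>\<delta> t\<bar> * indicator K t \<partial>lborel)))"

lemma cv1D:
  assumes "cv1 \<gamma> \<delta>" "h \<in> borel_measurable borel"
  shows "(\<integral>\<^sup>+t. h (\<gamma> t) * ennreal \<bar>\<delta> t\<bar> \<partial>lborel) \<le> 2 * (\<integral>\<^sup>+t. h t \<partial>lborel)"
    and "compact K \<Longrightarrow> (\<integral>\<^sup>+t. h t * indicator (\<gamma> ` K) t \<partial>lborel)
        \<le> (\<integral>\<^sup>+t. h (\<gamma> t) * ennreal \<bar>\<delta> t\<bar> * indicator K t \<partial>lborel)"
  using bspec[OF assms(1)[unfolded cv1_def] assms(2)] by simp_all

text \<open>The slope p = 0 has to be included, since the slope of a blow-up chart vanishes on the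
  exceptional divisor; the image of the line is then a single point, a null set.\<close>

lemma cv1_affine: "cv1 (\<lambda>t. p * t + b) (\<lambda>t. p)"
  unfolding cv1_def
proof (intro ballI conjI allI impI)
  fix h :: "real \<Rightarrow> ennreal" assume [measurable]: "h \<in> borel_measurable borel"
  show "(\<integral>\<^sup>+t. h (p * t + b) * ennreal \<bar>p\<bar> \<partial>lborel) \<le> 2 * (\<integral>\<^sup>+t. h t \<partial>lborel)"
  proof (cases "p = 0")
    case False
    then have "(\<integral>\<^sup>+t. h t \<partial>lborel) = \<bar>p\<bar> * (\<integral>\<^sup>+t. h (b + p * t) \<partial>lborel)"
      by (intro nn_integral_real_affine) auto
    also have "\<dots> = (\<integral>\<^sup>+t. \<bar>p\<bar> * h (b + p * t) \<partial>lborel)"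
      by (rule nn_integral_cmult[symmetric]) measurable
    finally have "(\<integral>\<^sup>+t. h (p * t + b) * ennreal \<bar>p\<bar> \<partial>lborel) = (\<integral>\<^sup>+t. h t \<partial>lborel)"
      by (simp add: add.commute mult.commute)
    also have "\<dots> \<le> 2 * (\<integral>\<^sup>+t. h t \<partial>lborel)"
      by (simp add: mult_2)
    finally show ?thesis .
  qed simp
  fix K :: "real set" assume K: "compact K"
  show "(\<integral>\<^sup>+t. h t * indicator ((\<lambda>t. p * t + b) ` K) t \<partial>lborel)
        \<le> (\<integral>\<^sup>+t. h (p * t + b) * ennreal \<bar>p\<bar> * indicator K t \<partial>lborel)"
  proof (cases "p = 0")
    case True
    have "(\<integral>\<^sup>+t. h t * indicator ((\<lambda>t. p * t + b) ` K) t \<partial>lborel) = (\<integral>\<^sup>+t. 0 \<partial>(lborel::real measure))"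
    proof (rule nn_integral_cong_AE)
      show "AE t in lborel. h t * indicator ((\<lambda>t. p * t + b) ` K) t = 0"
        using AE_lborel_singleton[of b] by eventually_elim (auto simp: True indicator_def)
    qed
    then show ?thesis by simp
  next
    case False
    have "compact ((\<lambda>t. p * t + b) ` K)"
      by (intro compact_continuous_image continuous_intros K)
    then have [measurable]: "(\<lambda>t. p * t + b) ` K \<in> sets borel" by (simp add: borel_compact)
    have "(\<integral>\<^sup>+t. h t * indicator ((\<lambda>t. p * t + b) ` K) t \<partial>lborel) =
      \<bar>p\<bar> * (\<integral>\<^sup>+t. h (b + p * t) * indicator ((\<lambda>t. p * t + b) ` K) (b + p * t) \<partial>lborel)"
      by (rule nn_integral_real_affine) (use False in measurable)
    also have "\<dots> = (\<integral>\<^sup>+t. \<bar>p\<bar> * (h (b + p * t) * indicator ((\<lambda>t. p * t + b) ` K) (b + p * t)) \<partial>lborel)"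
      by (rule nn_integral_cmult[symmetric]) measurable
    also have "\<dots> = (\<integral>\<^sup>+t. h (p * t + b) * ennreal \<bar>p\<bar> * indicator K t \<partial>lborel)"
      using False by (intro nn_integral_cong) (auto simp: indicator_def add.commute mult_ac)
    finally show ?thesis by simp
  qed
qed

text \<open>\<tau> selects the half line and \<sigma> the sign of the map. Two reflections, which
  preserve the integral, reduce all cases to the increasing power on {0..B}.\<close>

lemma nn_integral_power_half:
  fixes h :: "real \<Rightarrow> ennreal"
  assumes h[measurable]: "h \<in> borel_measurable borel" and B: "B > 0" and N: "N \<ge> 1"
    and \<sigma>: "\<bar>\<sigma>\<bar> = 1" and \<tau>: "\<bar>\<tau>\<bar> = 1"
  shows "(\<integral>\<^sup>+t. h (\<sigma> * t^N) * ennreal \<bar>real N * t^(N-1)\<bar> * indicator {t. 0 \<le> \<tau> * t \<and> \<tau> * t \<le> B} t \<partial>lborel) =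
    (\<integral>\<^sup>+u. h u * indicator {u. 0 \<le> \<sigma> * \<tau>^N * u \<and> \<sigma> * \<tau>^N * u \<le> B^N} u \<partial>lborel)"
proof -
  define \<sigma>' where "\<sigma>' = \<sigma> * \<tau>^N"
  have \<sigma>': "\<bar>\<sigma>'\<bar> = 1" using \<sigma> \<tau> by (simp add: \<sigma>'_def abs_mult power_abs)
  have sq: "x * x = 1" if "\<bar>x\<bar> = 1" for x :: real
    using that by (metis abs_mult_self_eq mult_1)
  have "(\<integral>\<^sup>+t. h (\<sigma> * t^N) * ennreal \<bar>real N * t^(N-1)\<bar> * indicator {t. 0 \<le> \<tau> * t \<and> \<tau> * t \<le> B} t \<partial>lborel)
    = \<bar>\<tau>\<bar> * (\<integral>\<^sup>+s. h (\<sigma> * (0 + \<tau> * s)^N) * ennreal \<bar>real N * (0 + \<tau> * s)^(N-1)\<bar>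
        * indicator {t. 0 \<le> \<tau> * t \<and> \<tau> * t \<le> B} (0 + \<tau> * s) \<partial>lborel)"
    by (rule nn_integral_real_affine) (use \<tau> in \<open>auto\<close>)
  also have "\<dots> = (\<integral>\<^sup>+s. h (\<sigma>' * s^N) * ennreal (real N * s^(N-1)) * indicator {0..B} s \<partial>lborel)"
    unfolding \<tau> ennreal_1 mult_1
  proof (rule nn_integral_cong)
    fix s
    have e1: "\<tau> * (\<tau> * s) = s" using sq[OF \<tau>] by (simp add: mult.assoc[symmetric])
    show "h (\<sigma> * (0 + \<tau> * s)^N) * ennreal \<bar>real N * (0 + \<tau> * s)^(N-1)\<bar>
        * indicator {t. 0 \<le> \<tau> * t \<and> \<tau> * t \<le> B} (0 + \<tau> * s) =
        h (\<sigma>' * s^N) * ennreal (real N * s^(N-1)) * indicator {0..B} s"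
      using \<tau> by (auto simp: e1 indicator_def \<sigma>'_def power_mult_distrib abs_mult power_abs mult.assoc)
  qed
  also have "\<dots> = (\<integral>\<^sup>+v. h (\<sigma>' * v) * indicator {0^N..B^N} v \<partial>lborel)"
    by (rule nn_integral_substitution_aux[where g = "\<lambda>s. s^N", symmetric])
      (use B in \<open>auto intro!: continuous_intros DERIV_pow\<close>)
  also have "\<dots> = \<bar>\<sigma>'\<bar> * (\<integral>\<^sup>+v. h (0 + \<sigma>' * v) * indicator {u. 0 \<le> \<sigma>' * u \<and> \<sigma>' * u \<le> B^N} (0 + \<sigma>' * v) \<partial>lborel)"
    unfolding \<sigma>' ennreal_1 mult_1
  proof (rule nn_integral_cong)
    fix v
    have e1: "\<sigma>' * (\<sigma>' * v) = v" using sq[OF \<sigma>'] by (simp add: mult.assoc[symmetric])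
    show "h (\<sigma>' * v) * indicator {0^N..B^N} v = h (0 + \<sigma>' * v) * indicator {u. 0 \<le> \<sigma>' * u \<and> \<sigma>' * u \<le> B^N} (0 + \<sigma>' * v)"
      using N by (auto simp: e1 indicator_def power_0_left)
  qed
  also have "\<dots> = (\<integral>\<^sup>+u. h u * indicator {u. 0 \<le> \<sigma>' * u \<and> \<sigma>' * u \<le> B^N} u \<partial>lborel)"
    by (rule nn_integral_real_affine[symmetric]) (use \<sigma>' in auto)
  finally show ?thesis by (simp add: \<sigma>'_def)
qed

text \<open>A power map is injective on each half line. The two halves add up to the factor 2 in the
  first inequality; in the second they overlap only at 0, a null set.\<close>

lemma cv1_power:
  assumes \<sigma>: "\<bar>\<sigma>\<bar> = 1" and N: "N \<ge> 1"
  shows "cv1 (\<lambda>t. \<sigma> * t^N) (\<lambda>t. real N * t^(N-1))"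
  unfolding cv1_def
proof (intro ballI conjI allI impI)
  fix h :: "real \<Rightarrow> ennreal" assume [measurable]: "h \<in> borel_measurable borel"
  define G where "G = (\<lambda>h t. h (\<sigma> * t^N) * ennreal \<bar>real N * t^(N-1)\<bar>)" for h :: "real \<Rightarrow> ennreal"
  have G_meas: "G h \<in> borel_measurable borel" if [measurable]: "h \<in> borel_measurable borel" for h
    unfolding G_def by measurable
  note [measurable] = G_meas[OF \<open>h \<in> borel_measurable borel\<close>]
  define H where "H = (\<lambda>\<tau> B. {t. 0 \<le> \<tau> * t \<and> \<tau> * t \<le> (B::real)})"
  have [measurable]: "H \<tau> B \<in> sets borel" for \<tau> B unfolding H_def by measurable
  have half: "(\<integral>\<^sup>+t. G h t * indicator (H \<tau> B) t \<partial>lborel) =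
     (\<integral>\<^sup>+u. h u * indicator {u. 0 \<le> \<sigma> * \<tau>^N * u \<and> \<sigma> * \<tau>^N * u \<le> B^N} u \<partial>lborel)"
    if "B > 0" "\<bar>\<tau>\<bar> = 1" "h \<in> borel_measurable borel" for B \<tau> h
    using nn_integral_power_half[OF that(3,1) N \<sigma> that(2)] by (simp add: G_def H_def)
  \<comment> \<open>The substitution rule is for bounded intervals; monotone convergence along B = n
    + 1 reaches the whole half line.\<close>
  have half_le: "(\<integral>\<^sup>+t. G h t * indicator {t. 0 \<le> \<tau> * t} t \<partial>lborel) \<le> (\<integral>\<^sup>+t. h t \<partial>lborel)" if \<tau>: "\<bar>\<tau>\<bar> = 1" for \<tau>
  proof -
    have "(\<integral>\<^sup>+t. G h t * indicator {t. 0 \<le> \<tau> * t} t \<partial>lborel) =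
      (\<integral>\<^sup>+t. (SUP n. G h t * indicator (H \<tau> (real (Suc n))) t) \<partial>lborel)"
    proof (rule nn_integral_cong)
      fix t
      obtain m where m: "\<bar>t\<bar> \<le> real m" using real_arch_simple by blast
      show "G h t * indicator {t. 0 \<le> \<tau> * t} t = (SUP n. G h t * indicator (H \<tau> (real (Suc n))) t)"
      proof (rule antisym)
        have "\<tau> * t \<le> \<bar>\<tau> * t\<bar>" by simp
        also have "\<dots> = \<bar>t\<bar>" using \<tau> by (simp add: abs_mult)
        finally have "\<tau> * t \<le> real (Suc m)" using m by simp
        then have "G h t * indicator {t. 0 \<le> \<tau> * t} t = G h t * indicator (H \<tau> (real (Suc m))) t"
          by (auto simp: H_def indicator_def)
        also have "\<dots> \<le> (SUP n. G h t * indicator (H \<tau> (real (Suc n))) t)" by (rule SUP_upper) simp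
        finally show "G h t * indicator {t. 0 \<le> \<tau> * t} t \<le> (SUP n. G h t * indicator (H \<tau> (real (Suc n))) t)" .
        show "(SUP n. G h t * indicator (H \<tau> (real (Suc n))) t) \<le> G h t * indicator {t. 0 \<le> \<tau> * t} t"
          by (rule SUP_least) (auto simp: H_def indicator_def)
      qed
    qed
    also have "\<dots> = (SUP n. \<integral>\<^sup>+t. G h t * indicator (H \<tau> (real (Suc n))) t \<partial>lborel)"
    proof (rule nn_integral_monotone_convergence_SUP)
      show "incseq (\<lambda>n t. G h t * indicator (H \<tau> (real (Suc n))) t)"
        by (auto simp: incseq_def le_fun_def H_def indicator_def)
    qed simp
    also have "\<dots> \<le> (\<integral>\<^sup>+t. h t \<partial>lborel)"
    proof (rule SUP_least)
      fix n
      show "(\<integral>\<^sup>+t. G h t * indicator (H \<tau> (real (Suc n))) t \<partial>lborel) \<le> (\<integral>\<^sup>+t. h t \<partial>lborel)"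
        by (subst half) (auto simp: \<tau> indicator_def intro!: nn_integral_mono)
    qed
    finally show ?thesis .
  qed
  have "(\<integral>\<^sup>+t. G h t \<partial>lborel) \<le> (\<integral>\<^sup>+t. G h t * indicator {t. 0 \<le> 1 * t} t + G h t * indicator {t. 0 \<le> -1 * t} t \<partial>lborel)"
    by (rule nn_integral_mono) (auto simp: indicator_def)
  also have "\<dots> = (\<integral>\<^sup>+t. G h t * indicator {t. 0 \<le> 1 * t} t \<partial>lborel) + (\<integral>\<^sup>+t. G h t * indicator {t. 0 \<le> -1 * t} t \<partial>lborel)"
    by (rule nn_integral_add) auto
  also have "\<dots> \<le> 2 * (\<integral>\<^sup>+t. h t \<partial>lborel)"
    unfolding mult_2 by (intro add_mono half_le) auto
  finally show "(\<integral>\<^sup>+t. h (\<sigma> * t^N) * ennreal \<bar>real N * t^(N-1)\<bar> \<partial>lborel) \<le> 2 * (\<integral>\<^sup>+t. h t \<partial>lborel)"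
    by (simp add: G_def)
  fix K :: "real set" assume K: "compact K"
  obtain B where B: "B > 0" "\<And>t. t \<in> K \<Longrightarrow> \<bar>t\<bar> \<le> B"
    using compact_imp_bounded[OF K] unfolding bounded_pos by auto
  define \<gamma> where "\<gamma> t = \<sigma> * t^N" for t
  have KH: "compact (K \<inter> H \<tau> B)" for \<tau>
  proof (rule compact_Int_closed[OF K])
    show "closed (H \<tau> B)" unfolding H_def
      by (intro closed_Collect_conj closed_Collect_le continuous_intros)
  qed
  have img[measurable]: "\<gamma> ` (K \<inter> H \<tau> B) \<in> sets borel" for \<tau>
    unfolding \<gamma>_def by (intro borel_compact compact_continuous_image continuous_intros KH)
  have [measurable]: "K \<in> sets borel" using K by (rule borel_compact)
  have eq: "(\<integral>\<^sup>+t. h t * indicator (\<gamma> ` (K \<inter> H \<tau> B)) t \<partial>lborel) = (\<integral>\<^sup>+t. G h t * indicator (K \<inter> H \<tau> B) t \<partial>lborel)"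
    if \<tau>: "\<bar>\<tau>\<bar> = 1" for \<tau>
  proof -
    define h' where "h' t = h t * indicator (\<gamma> ` (K \<inter> H \<tau> B)) t" for t
    have sgn: "\<sigma> * \<tau>^N * (\<sigma> * t^N) = (\<tau> * t)^N" for t
    proof -
      have "\<sigma> * \<sigma> = 1" using \<sigma> by (metis abs_mult_self_eq mult_1)
      moreover have "\<sigma> * \<tau>^N * (\<sigma> * t^N) = (\<sigma> * \<sigma>) * (\<tau> * t)^N"
        by (simp add: power_mult_distrib mult_ac)
      ultimately show ?thesis by simp
    qed
    have inj: "t = s" if "\<gamma> t = \<gamma> s" "t \<in> H \<tau> B" "s \<in> H \<tau> B" for t s
    proof -
      have "\<sigma> * \<tau>^N * \<gamma> t = (\<tau> * t)^N" "\<sigma> * \<tau>^N * \<gamma> s = (\<tau> * s)^N"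
        by (simp_all only: \<gamma>_def sgn)
      then have "(\<tau> * t)^N = (\<tau> * s)^N" using that(1) by metis
      then have "\<tau> * t = \<tau> * s" using that N by (intro power_eq_imp_eq_base[of "\<tau> * t" N]) (auto simp: H_def)
      then show ?thesis using \<tau> by auto
    qed
    have "(\<integral>\<^sup>+t. h t * indicator (\<gamma> ` (K \<inter> H \<tau> B)) t \<partial>lborel) =
       (\<integral>\<^sup>+u. h' u * indicator {u. 0 \<le> \<sigma> * \<tau>^N * u \<and> \<sigma> * \<tau>^N * u \<le> B^N} u \<partial>lborel)"
    proof (rule nn_integral_cong)
      fix u
      have "0 \<le> \<sigma> * \<tau>^N * u \<and> \<sigma> * \<tau>^N * u \<le> B^N" if "u \<in> \<gamma> ` (K \<inter> H \<tau> B)"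
        using that sgn by (auto simp: \<gamma>_def H_def intro: power_mono)
      then show "h u * indicator (\<gamma> ` (K \<inter> H \<tau> B)) u =
          h' u * indicator {u. 0 \<le> \<sigma> * \<tau>^N * u \<and> \<sigma> * \<tau>^N * u \<le> B^N} u"
        by (auto simp: h'_def indicator_def)
    qed
    also have "\<dots> = (\<integral>\<^sup>+t. G h' t * indicator (H \<tau> B) t \<partial>lborel)"
      by (rule half[symmetric, OF B(1) \<tau>]) (simp add: h'_def)
    also have "\<dots> = (\<integral>\<^sup>+t. G h t * indicator (K \<inter> H \<tau> B) t \<partial>lborel)"
    proof (rule nn_integral_cong)
      fix t
      have "\<gamma> t \<in> \<gamma> ` (K \<inter> H \<tau> B) \<longleftrightarrow> t \<in> K" if "t \<in> H \<tau> B"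
        using inj that by blast
      then show "G h' t * indicator (H \<tau> B) t = G h t * indicator (K \<inter> H \<tau> B) t"
        by (auto simp: G_def h'_def indicator_def \<gamma>_def[symmetric])
    qed
    finally show ?thesis .
  qed
  have K_split: "t \<in> H 1 B \<or> t \<in> H (-1) B" if "t \<in> K" for t
    using B(2)[OF that] by (auto simp: H_def)
  have "(\<integral>\<^sup>+t. h t * indicator (\<gamma> ` K) t \<partial>lborel) \<le>
     (\<integral>\<^sup>+t. h t * indicator (\<gamma> ` (K \<inter> H 1 B)) t + h t * indicator (\<gamma> ` (K \<inter> H (-1) B)) t \<partial>lborel)"
    using K_split by (intro nn_integral_mono) (auto simp: indicator_def)
  also have "\<dots> = (\<integral>\<^sup>+t. h t * indicator (\<gamma> ` (K \<inter> H 1 B)) t \<partial>lborel) + (\<integral>\<^sup>+t. h t * indicator (\<gamma> ` (K \<inter> H (-1) B)) t \<partial>lborel)"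
    by (rule nn_integral_add) auto
  also have "\<dots> = (\<integral>\<^sup>+t. G h t * indicator (K \<inter> H 1 B) t \<partial>lborel) + (\<integral>\<^sup>+t. G h t * indicator (K \<inter> H (-1) B) t \<partial>lborel)"
    by (simp add: eq)
  also have "\<dots> = (\<integral>\<^sup>+t. G h t * indicator (K \<inter> H 1 B) t + G h t * indicator (K \<inter> H (-1) B) t \<partial>lborel)"
    by (rule nn_integral_add[symmetric]) auto
  also have "\<dots> \<le> (\<integral>\<^sup>+t. G h t * indicator K t \<partial>lborel)"
  proof (rule nn_integral_mono_AE)
    show "AE t in lborel. G h t * indicator (K \<inter> H 1 B) t + G h t * indicator (K \<inter> H (-1) B) t \<le> G h t * indicator K t"
      using AE_lborel_singleton[of 0] by eventually_elim (auto simp: indicator_def H_def)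
  qed
  finally show "(\<integral>\<^sup>+t. h t * indicator ((\<lambda>t. \<sigma> * t^N) ` K) t \<partial>lborel)
      \<le> (\<integral>\<^sup>+t. h (\<sigma> * t^N) * ennreal \<bar>real N * t^(N-1)\<bar> * indicator K t \<partial>lborel)"
    by (simp add: \<gamma>_def G_def)
qed

text \<open>\<open>j\<close> plays the role of the Jacobian determinant of \<open>\<psi>\<close>: the first inequality bounds the
  multiplicity of \<open>\<psi>\<close>, the second is the area inequality.\<close>

definition cv :: "(real^'n::finite \<Rightarrow> real^'n) \<Rightarrow> (real^'n \<Rightarrow> real) \<Rightarrow> bool" where
  "cv \<psi> j \<longleftrightarrow> \<psi> \<in> borel_measurable borel \<and> j \<in> borel_measurable borel \<and>
    (\<exists>M::real. \<forall>h\<in>borel_measurable borel.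
      (\<integral>\<^sup>+x. h (\<psi> x) * ennreal \<bar>j x\<bar> \<partial>lborel) \<le> ennreal M * (\<integral>\<^sup>+x. h x \<partial>lborel)) \<and>
    (\<exists>r>0. continuous_on (RB r) \<psi> \<and> (\<forall>K. \<forall>h\<in>borel_measurable borel. compact K \<longrightarrow> K \<subseteq> RB r \<longrightarrow>
      (\<integral>\<^sup>+x. h x * indicator (\<psi> ` K) x \<partial>lborel) \<le> (\<integral>\<^sup>+x. h (\<psi> x) * ennreal \<bar>j x\<bar> * indicator K x \<partial>lborel)))"

lemma cvE:
  fixes \<psi> :: "real^'n::finite \<Rightarrow> real^'n"
  assumes "cv \<psi> j"
  obtains M r where "\<psi> \<in> borel_measurable borel" "j \<in> borel_measurable borel"
    "\<And>h. h \<in> borel_measurable borel \<Longrightarrow>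
      (\<integral>\<^sup>+x. h (\<psi> x) * ennreal \<bar>j x\<bar> \<partial>lborel) \<le> ennreal M * (\<integral>\<^sup>+x. h x \<partial>lborel)"
    "r > 0" "continuous_on (RB r) \<psi>"
    "\<And>K h. h \<in> borel_measurable borel \<Longrightarrow> compact K \<Longrightarrow> K \<subseteq> RB r \<Longrightarrow>
      (\<integral>\<^sup>+x. h x * indicator (\<psi> ` K) x \<partial>lborel) \<le> (\<integral>\<^sup>+x. h (\<psi> x) * ennreal \<bar>j x\<bar> * indicator K x \<partial>lborel)"
  using assms unfolding cv_def
proof (elim conjE exE)
  fix M r
  assume m: "\<psi> \<in> borel_measurable borel" "j \<in> borel_measurable borel"
    and M: "\<forall>h\<in>borel_measurable borel.
      (\<integral>\<^sup>+x. h (\<psi> x) * ennreal \<bar>j x\<bar> \<partial>lborel) \<le> ennreal M * (\<integral>\<^sup>+x. h x \<partial>lborel)"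
    and r: "r > 0" "continuous_on (RB r) \<psi>"
    and b: "\<forall>K. \<forall>h\<in>borel_measurable borel. compact K \<longrightarrow> K \<subseteq> RB r \<longrightarrow>
      (\<integral>\<^sup>+x. h x * indicator (\<psi> ` K) x \<partial>lborel) \<le> (\<integral>\<^sup>+x. h (\<psi> x) * ennreal \<bar>j x\<bar> * indicator K x \<partial>lborel)"
  show thesis
    by (rule that[OF m bspec[OF M] r b[rule_format]])
qed

lemma cv_id: "cv (\<lambda>x. x) (\<lambda>x. 1)"
  unfolding cv_def by (intro conjI exI[of _ 1]) auto

text \<open>The map sends each line in direction \<open>k\<close> into itself, so
  \<open>nn_integral_coord\<close> reduces both inequalities to \<open>cv1\<close> on the
  lines.\<close>

lemma cv_coord:
  fixes g j :: "real^'n::finite \<Rightarrow> real"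
  assumes [measurable]: "g \<in> borel_measurable borel" "j \<in> borel_measurable borel"
    and cv1: "\<And>x. cv1 (\<lambda>t. g (upd x k t)) (\<lambda>t. j (upd x k t))"
    and r: "r > 0" "continuous_on (RB r) (\<lambda>x. upd x k (g x))"
  shows "cv (\<lambda>x. upd x k (g x)) j"
proof -
  define E where "E x = upd x k (g x)" for x
  have [measurable]: "E \<in> borel_measurable borel"
    unfolding E_def by (rule borel_measurable_upd_fun) measurable
  define I where "I = (indicator {x. 0 \<le> x$k \<and> x$k < 1} :: real^'n \<Rightarrow> ennreal)"
  note coord = nn_integral_coord[where k = k, folded I_def]
  have E_upd: "E (upd x k t) = upd x k (g (upd x k t))" for x t by (simp add: E_def)
  have meas_int: "(\<lambda>x. \<integral>\<^sup>+t. h (upd x k t) \<partial>lborel) \<in> borel_measurable borel"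
    if [measurable]: "h \<in> borel_measurable borel" for h :: "real^'n \<Rightarrow> ennreal"
  proof -
    have "(\<lambda>(x, t). h (upd x k t)) \<in> borel_measurable (borel \<Otimes>\<^sub>M lborel)"
      using measurable_compose[OF borel_measurable_upd that] by (simp add: split_beta)
    from lborel.borel_measurable_nn_integral[OF this] show ?thesis by simp
  qed
  have [measurable]: "I \<in> borel_measurable borel" unfolding I_def by measurable
  have "(\<integral>\<^sup>+x. h (E x) * ennreal \<bar>j x\<bar> \<partial>lborel) \<le> ennreal 2 * (\<integral>\<^sup>+x. h x \<partial>lborel)"
    if h[measurable]: "h \<in> borel_measurable borel" for h
  proof -
    have "(\<integral>\<^sup>+x. h (E x) * ennreal \<bar>j x\<bar> \<partial>lborel) =
      (\<integral>\<^sup>+x. I x * (\<integral>\<^sup>+t. h (upd x k (g (upd x k t))) * ennreal \<bar>j (upd x k t)\<bar> \<partial>lborel) \<partial>lborel)"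
      by (subst coord) (simp_all add: E_upd)
    also have "\<dots> \<le> (\<integral>\<^sup>+x. I x * (2 * (\<integral>\<^sup>+t. h (upd x k t) \<partial>lborel)) \<partial>lborel)"
    proof (intro nn_integral_mono mult_left_mono)
      fix x
      have "(\<lambda>t. h (upd x k t)) \<in> borel_measurable borel" by measurable
      from cv1D(1)[OF cv1[of x] this] show "(\<integral>\<^sup>+t. h (upd x k (g (upd x k t))) * ennreal \<bar>j (upd x k t)\<bar> \<partial>lborel)
          \<le> 2 * (\<integral>\<^sup>+t. h (upd x k t) \<partial>lborel)" .
    qed simp
    also have "\<dots> = (\<integral>\<^sup>+x. 2 * (I x * (\<integral>\<^sup>+t. h (upd x k t) \<partial>lborel)) \<partial>lborel)"
      by (simp add: mult_ac)
    also have "\<dots> = 2 * (\<integral>\<^sup>+x. I x * (\<integral>\<^sup>+t. h (upd x k t) \<partial>lborel) \<partial>lborel)"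
      by (rule nn_integral_cmult) (use meas_int[OF h] in measurable)
    also have "\<dots> = 2 * (\<integral>\<^sup>+x. h x \<partial>lborel)"
      by (subst coord[of h]) simp_all
    finally show ?thesis by simp
  qed
  moreover have "(\<integral>\<^sup>+x. h x * indicator (E ` K) x \<partial>lborel) \<le> (\<integral>\<^sup>+x. h (E x) * ennreal \<bar>j x\<bar> * indicator K x \<partial>lborel)"
    if h[measurable]: "h \<in> borel_measurable borel" and K: "compact K" "K \<subseteq> RB r" for h K
  proof -
    have "compact (E ` K)"
      using K r(2) by (intro compact_continuous_image) (auto simp: E_def[abs_def] intro: continuous_on_subset)
    then have [measurable]: "E ` K \<in> sets borel" "K \<in> sets borel" using K by (simp_all add: borel_compact)
    have "(\<integral>\<^sup>+x. h x * indicator (E ` K) x \<partial>lborel) =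
      (\<integral>\<^sup>+x. I x * (\<integral>\<^sup>+t. h (upd x k t) * indicator (E ` K) (upd x k t) \<partial>lborel) \<partial>lborel)"
      by (subst coord) simp_all
    also have "\<dots> \<le> (\<integral>\<^sup>+x. I x * (\<integral>\<^sup>+t. h (upd x k (g (upd x k t))) * ennreal \<bar>j (upd x k t)\<bar>
        * indicator K (upd x k t) \<partial>lborel) \<partial>lborel)"
    proof (rule nn_integral_mono, rule mult_left_mono)
      fix x
      define Kx where "Kx = {t. upd x k t \<in> K}"
      \<comment> \<open>The slice of the image is the image of the slice, because only the
        coordinate \<open>k\<close> is changed.\<close>
      have img: "upd x k t \<in> E ` K \<longleftrightarrow> t \<in> (\<lambda>t. g (upd x k t)) ` Kx" for t
      proof
        assume "upd x k t \<in> E ` K"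
        then obtain y where y: "y \<in> K" "upd x k t = upd y k (g y)" by (auto simp: E_def)
        then have "upd x k (y$k) = y" "t = g y"
          unfolding vec_eq_iff upd_nth by (metis, metis)
        with y(1) show "t \<in> (\<lambda>t. g (upd x k t)) ` Kx"
          by (intro image_eqI[of _ _ "y$k"]) (auto simp: Kx_def)
      next
        assume "t \<in> (\<lambda>t. g (upd x k t)) ` Kx"
        then obtain s where "upd x k s \<in> K" "t = g (upd x k s)" by (auto simp: Kx_def)
        then show "upd x k t \<in> E ` K" by (intro image_eqI[of _ _ "upd x k s"]) (auto simp: E_def)
      qed
      have "compact Kx"
        unfolding compact_eq_bounded_closed
      proof
        obtain b where b: "\<And>y. y \<in> K \<Longrightarrow> norm y \<le> b" using compact_imp_bounded[OF K(1)] unfolding bounded_iff by blast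
        have "\<bar>t\<bar> \<le> b" if "t \<in> Kx" for t
        proof -
          have "\<bar>upd x k t $ k\<bar> \<le> norm (upd x k t)" by (rule component_le_norm_cart)
          also have "\<dots> \<le> b" using that b by (simp add: Kx_def)
          finally show ?thesis by simp
        qed
        then show "bounded Kx" unfolding bounded_iff by auto
        have "closed ((\<lambda>t. upd x k t) -` K)"
          by (intro closed_vimage compact_imp_closed K continuous_intros)
        then show "closed Kx" by (simp add: Kx_def vimage_def)
      qed
      have "(\<lambda>t. h (upd x k t)) \<in> borel_measurable borel" by measurable
      from cv1D(2)[OF cv1[of x] this \<open>compact Kx\<close>]
      have "(\<integral>\<^sup>+t. h (upd x k t) * indicator ((\<lambda>t. g (upd x k t)) ` Kx) t \<partial>lborel)
          \<le> (\<integral>\<^sup>+t. h (upd x k (g (upd x k t))) * ennreal \<bar>j (upd x k t)\<bar> * indicator Kx t \<partial>lborel)" .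
      moreover have "indicator (E ` K) (upd x k t) = (indicator ((\<lambda>t. g (upd x k t)) ` Kx) t :: ennreal)"
          "indicator K (upd x k t) = (indicator Kx t :: ennreal)" for t
        unfolding indicator_def img by (simp_all add: Kx_def)
      ultimately show "(\<integral>\<^sup>+t. h (upd x k t) * indicator (E ` K) (upd x k t) \<partial>lborel) \<le>
         (\<integral>\<^sup>+t. h (upd x k (g (upd x k t))) * ennreal \<bar>j (upd x k t)\<bar> * indicator K (upd x k t) \<partial>lborel)"
        by simp
    qed simp
    also have "\<dots> = (\<integral>\<^sup>+x. h (E x) * ennreal \<bar>j x\<bar> * indicator K x \<partial>lborel)"
      by (subst coord[of "\<lambda>x. h (E x) * ennreal \<bar>j x\<bar> * indicator K x"]) (simp_all add: E_upd)
    finally show ?thesis .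
  qed
  moreover have "continuous_on (RB r) E" using r(2) by (simp add: E_def[abs_def])
  ultimately have "cv E j"
    unfolding cv_def using r(1) by (intro conjI exI[of _ 2] exI[of _ r] ballI allI impI) simp_all
  then show ?thesis by (simp add: E_def[abs_def])
qed

text \<open>The multiplicity bounds multiply, and the area inequalities chain: the compact set for
  the outer map is the image of \<open>K\<close> under the inner one.\<close>

lemma cv_compose:
  fixes \<psi> \<psi>' :: "real^'n::finite \<Rightarrow> real^'n"
  assumes 1: "cv \<psi> j" and 2: "cv \<psi>' j'" and 0: "\<psi>' 0 = 0"
  shows "cv (\<lambda>x. \<psi> (\<psi>' x)) (\<lambda>x. j (\<psi>' x) * j' x)"
proof -
  show ?thesis
  proof (rule cvE[OF 1], rule cvE[OF 2])
  fix M r M' r'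
  assume [measurable]: "\<psi> \<in> borel_measurable borel" "j \<in> borel_measurable borel"
    and M: "\<And>h. h \<in> borel_measurable borel \<Longrightarrow>
      (\<integral>\<^sup>+x. h (\<psi> x) * ennreal \<bar>j x\<bar> \<partial>lborel) \<le> ennreal M * (\<integral>\<^sup>+x. h x \<partial>lborel)"
    and r: "r > 0" "continuous_on (RB r) \<psi>"
      "\<And>K h. h \<in> borel_measurable borel \<Longrightarrow> compact K \<Longrightarrow> K \<subseteq> RB r \<Longrightarrow>
      (\<integral>\<^sup>+x. h x * indicator (\<psi> ` K) x \<partial>lborel) \<le> (\<integral>\<^sup>+x. h (\<psi> x) * ennreal \<bar>j x\<bar> * indicator K x \<partial>lborel)"
  assume [measurable]: "\<psi>' \<in> borel_measurable borel" "j' \<in> borel_measurable borel"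
    and M': "\<And>h. h \<in> borel_measurable borel \<Longrightarrow>
      (\<integral>\<^sup>+x. h (\<psi>' x) * ennreal \<bar>j' x\<bar> \<partial>lborel) \<le> ennreal M' * (\<integral>\<^sup>+x. h x \<partial>lborel)"
    and r': "r' > 0" "continuous_on (RB r') \<psi>'"
      "\<And>K h. h \<in> borel_measurable borel \<Longrightarrow> compact K \<Longrightarrow> K \<subseteq> RB r' \<Longrightarrow>
      (\<integral>\<^sup>+x. h x * indicator (\<psi>' ` K) x \<partial>lborel) \<le> (\<integral>\<^sup>+x. h (\<psi>' x) * ennreal \<bar>j' x\<bar> * indicator K x \<partial>lborel)"
  have "open (RB r' \<inter> \<psi>' -` RB r)"
    by (intro continuous_open_preimage open_RB r'(2))
  moreover have "0 \<in> RB r' \<inter> \<psi>' -` RB r" using r(1) r'(1) 0 by simp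
  ultimately obtain d where d: "d > 0" "ball 0 d \<subseteq> RB r' \<inter> \<psi>' -` RB r"
    unfolding open_contains_ball by blast
  define s where "s = d / CARD('n)"
  have s: "s > 0" "RB s \<subseteq> RB r' \<inter> \<psi>' -` RB r"
    using d RB_subset_ball[of d, where 'n = 'n] by (auto simp: s_def)
  have jj: "ennreal \<bar>j (\<psi>' x) * j' x\<bar> = ennreal \<bar>j (\<psi>' x)\<bar> * ennreal \<bar>j' x\<bar>" for x
    by (simp add: abs_mult ennreal_mult)
  have "(\<integral>\<^sup>+x. h (\<psi> (\<psi>' x)) * ennreal \<bar>j (\<psi>' x) * j' x\<bar> \<partial>lborel) \<le> ennreal (\<bar>M'\<bar> * \<bar>M\<bar>) * (\<integral>\<^sup>+x. h x \<partial>lborel)"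
    if [measurable]: "h \<in> borel_measurable borel" for h
  proof -
    have "(\<integral>\<^sup>+x. h (\<psi> (\<psi>' x)) * ennreal \<bar>j (\<psi>' x) * j' x\<bar> \<partial>lborel)
       \<le> ennreal M' * (\<integral>\<^sup>+x. h (\<psi> x) * ennreal \<bar>j x\<bar> \<partial>lborel)"
      using M'[of "\<lambda>x. h (\<psi> x) * ennreal \<bar>j x\<bar>"] by (simp add: jj mult.assoc)
    also have "\<dots> \<le> ennreal M' * (ennreal M * (\<integral>\<^sup>+x. h x \<partial>lborel))"
      by (intro mult_left_mono M) auto
    also have "\<dots> \<le> ennreal \<bar>M'\<bar> * (ennreal \<bar>M\<bar> * (\<integral>\<^sup>+x. h x \<partial>lborel))"
      by (intro mult_mono ennreal_leI) auto
    finally show ?thesis by (simp add: ennreal_mult mult.assoc)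
  qed
  moreover have "(\<integral>\<^sup>+x. h x * indicator ((\<lambda>x. \<psi> (\<psi>' x)) ` K) x \<partial>lborel)
      \<le> (\<integral>\<^sup>+x. h (\<psi> (\<psi>' x)) * ennreal \<bar>j (\<psi>' x) * j' x\<bar> * indicator K x \<partial>lborel)"
    if [measurable]: "h \<in> borel_measurable borel" and K: "compact K" "K \<subseteq> RB s" for h K
  proof -
    have K': "K \<subseteq> RB r'" "\<psi>' ` K \<subseteq> RB r" using K s by blast+
    have "compact (\<psi>' ` K)"
      by (rule compact_continuous_image[OF continuous_on_subset[OF r'(2) K'(1)] K(1)])
    then have "(\<integral>\<^sup>+x. h x * indicator (\<psi> ` (\<psi>' ` K)) x \<partial>lborel)
       \<le> (\<integral>\<^sup>+x. h (\<psi> x) * ennreal \<bar>j x\<bar> * indicator (\<psi>' ` K) x \<partial>lborel)"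
      using K' by (intro r(3)) auto
    also have "\<dots> \<le> (\<integral>\<^sup>+x. h (\<psi> (\<psi>' x)) * ennreal \<bar>j (\<psi>' x)\<bar> * ennreal \<bar>j' x\<bar> * indicator K x \<partial>lborel)"
      using K K' by (intro r'(3)) auto
    finally show ?thesis by (simp add: jj mult.assoc image_image)
  qed
  moreover have "continuous_on (RB s) (\<lambda>x. \<psi> (\<psi>' x))"
    by (rule continuous_on_compose2[OF r(2) continuous_on_subset[OF r'(2)]]) (use s in auto)
  ultimately show "cv (\<lambda>x. \<psi> (\<psi>' x)) (\<lambda>x. j (\<psi>' x) * j' x)"
    unfolding cv_def using s(1) by (intro conjI exI[of _ "\<bar>M'\<bar> * \<bar>M\<bar>"] exI[of _ s] ballI allI impI) simp_all
  qed
qed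

section \<open>Charts and families of charts that cover a neighbourhood\<close>

text \<open>Injectivity is not asked for; \<open>cv\<close> is all that integration requires. Acting
  as the identity off \<open>S\<close> lets a chart for fewer variables serve for more.\<close>

definition chart :: "'n::finite set \<Rightarrow> (real^'n \<Rightarrow> real^'n) \<Rightarrow> (real^'n \<Rightarrow> real) \<Rightarrow> bool" where
  "chart S \<psi> j \<longleftrightarrow> \<psi> 0 = 0 \<and> (\<forall>i. an (\<lambda>x. \<psi> x $ i)) \<and> (\<forall>i. i \<notin> S \<longrightarrow> (\<forall>x. \<psi> x $ i = x $ i)) \<and>
     (\<forall>i\<in>S. dep S (\<lambda>x. \<psi> x $ i)) \<and> an j \<and> dep S j \<and> cv \<psi> j"

lemma chartD:
  assumes "chart S \<psi> j"
  shows "\<psi> 0 = 0" "\<And>i. an (\<lambda>x. \<psi> x $ i)" "\<And>i x. i \<notin> S \<Longrightarrow> \<psi> x $ i = x $ i"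
    "\<And>i. i \<in> S \<Longrightarrow> dep S (\<lambda>x. \<psi> x $ i)" "an j" "dep S j" "cv \<psi> j"
  using assms by (auto simp: chart_def)

lemma chart_id: "chart S (\<lambda>x. x) (\<lambda>x. 1)"
  by (auto simp: chart_def cv_id intro: dep_coord)

lemma chart_mono:
  assumes "chart S \<psi> j" "S \<subseteq> T"
  shows "chart T \<psi> j"
proof -
  have "dep T (\<lambda>x. \<psi> x $ i)" if "i \<in> T" for i
  proof (cases "i \<in> S")
    case True
    then show ?thesis using assms by (auto simp: chart_def intro: dep_mono)
  next
    case False
    then have "(\<lambda>x. \<psi> x $ i) = (\<lambda>x. x $ i)" using assms by (auto simp: chart_def)
    then show ?thesis using that by (simp add: dep_coord)
  qed
  with assms show ?thesis by (auto simp: chart_def intro: dep_mono)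
qed

lemma chart_dep_compose: "chart S \<psi> j \<Longrightarrow> dep S f \<Longrightarrow> dep S (\<lambda>x. f (\<psi> x))"
  by (erule dep_compose) (rule chartD)

lemma chart_an_compose: "chart S \<psi> j \<Longrightarrow> an f \<Longrightarrow> an (\<lambda>x. f (\<psi> x))"
  by (rule an_compose) (auto dest: chartD)

lemma chart_eventually: "chart S \<psi> j \<Longrightarrow> \<forall>\<^sub>F x in nhds 0. P x \<Longrightarrow> \<forall>\<^sub>F x in nhds 0. P (\<psi> x)"
  by (rule an_eventually_compose) (auto dest: chartD)

lemma chart_compose:
  assumes 1: "chart S \<psi> j" and 2: "chart S \<psi>' j'"
  shows "chart S (\<lambda>x. \<psi> (\<psi>' x)) (\<lambda>x. j (\<psi>' x) * j' x)"
  unfolding chart_def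
proof (intro conjI allI ballI impI)
  show "\<psi> (\<psi>' 0) = 0" using chartD(1)[OF 1] chartD(1)[OF 2] by simp
  show "an (\<lambda>x. \<psi> (\<psi>' x) $ i)" for i by (rule chart_an_compose[OF 2 chartD(2)[OF 1]])
  show "\<psi> (\<psi>' x) $ i = x $ i" if "i \<notin> S" for i x using chartD(3)[OF 1 that] chartD(3)[OF 2 that] by simp
  show "dep S (\<lambda>x. \<psi> (\<psi>' x) $ i)" if "i \<in> S" for i by (rule chart_dep_compose[OF 2 chartD(4)[OF 1 that]])
  show "an (\<lambda>x. j (\<psi>' x) * j' x)" by (intro an_mult chart_an_compose[OF 2] chartD(5)[OF 1] chartD(5)[OF 2])
  show "dep S (\<lambda>x. j (\<psi>' x) * j' x)" by (intro dep_mult chart_dep_compose[OF 2] chartD(6)[OF 1] chartD(6)[OF 2])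
  show "cv (\<lambda>x. \<psi> (\<psi>' x)) (\<lambda>x. j (\<psi>' x) * j' x)"
    by (rule cv_compose[OF chartD(7)[OF 1] chartD(7)[OF 2] chartD(1)[OF 2]])
qed

type_synonym 'n jchart = "(real^'n \<Rightarrow> real^'n) \<times> (real^'n \<Rightarrow> real)"

text \<open>The radii \<open>U\<close> are prescribed before the finite subfamily is chosen: germ
  identities hold on boxes whose size depends on the chart, and a blow-up has one chart for every
  real centre, so finiteness can only come last.\<close>

definition fam :: "'n::finite set \<Rightarrow> 'n jchart set \<Rightarrow> bool" where
  "fam S A \<longleftrightarrow> (\<forall>c\<in>A. chart S (fst c) (snd c)) \<and>
    (\<forall>U. (\<forall>c\<in>A. U c > (0::real)) \<longrightarrow>
      (\<exists>A0\<subseteq>A. finite A0 \<and> (\<exists>r>0. RB r \<subseteq> (\<Union>c\<in>A0. fst c ` RB (U c)))))"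

definition covers :: "'n::finite set \<Rightarrow> ((real^'n \<Rightarrow> real^'n) \<Rightarrow> (real^'n \<Rightarrow> real) \<Rightarrow> bool) \<Rightarrow> bool" where
  "covers S P \<longleftrightarrow> (\<exists>A. fam S A \<and> (\<forall>c\<in>A. P (fst c) (snd c)))"

lemma fam_chart: "fam S A \<Longrightarrow> c \<in> A \<Longrightarrow> chart S (fst c) (snd c)"
  by (simp add: fam_def)

lemma fam_cover:
  assumes "fam S A" "\<And>c. c \<in> A \<Longrightarrow> U c > (0::real)"
  shows "\<exists>A0 r. A0 \<subseteq> A \<and> finite A0 \<and> r > 0 \<and> RB r \<subseteq> (\<Union>c\<in>A0. fst c ` RB (U c))"
proof -
  have "(\<forall>c\<in>A. U c > 0) \<longrightarrow> (\<exists>A0\<subseteq>A. finite A0 \<and> (\<exists>r>0. RB r \<subseteq> (\<Union>c\<in>A0. fst c ` RB (U c))))"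
    using assms(1) unfolding fam_def by (elim conjE) (erule spec)
  with assms(2) show ?thesis by blast
qed

lemma fam_mono: "fam S A \<Longrightarrow> S \<subseteq> T \<Longrightarrow> fam T A"
  unfolding fam_def using chart_mono by blast

text \<open>The radii of the composed charts are used up by the inner families; the boxes that these
  cover then serve as radii for the outer family.\<close>

lemma fam_comp:
  assumes A: "fam S A" and B: "\<And>c. c \<in> A \<Longrightarrow> fam S (B c)"
  shows "fam S ((\<lambda>(c, b). (\<lambda>x. fst c (fst b x), \<lambda>x. snd c (fst b x) * snd b x)) ` (SIGMA c:A. B c))"
    (is "fam S (?m ` _)")
  unfolding fam_def
proof (intro conjI ballI allI impI)
  fix d assume "d \<in> ?m ` (SIGMA c:A. B c)"
  then obtain c b where "c \<in> A" "b \<in> B c" "d = ?m (c, b)" by blast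
  then show "chart S (fst d) (snd d)"
    using chart_compose[OF fam_chart[OF A] fam_chart[OF B]] by simp
next
  fix U :: "'a jchart \<Rightarrow> real" assume U: "\<forall>c\<in>?m ` (SIGMA c:A. B c). U c > 0"
  have "\<forall>c\<in>A. \<exists>A0 r. A0 \<subseteq> B c \<and> finite A0 \<and> r > 0 \<and> RB r \<subseteq> (\<Union>b\<in>A0. fst b ` RB (U (?m (c, b))))"
  proof
    fix c assume c: "c \<in> A"
    show "\<exists>A0 r. A0 \<subseteq> B c \<and> finite A0 \<and> r > 0 \<and> RB r \<subseteq> (\<Union>b\<in>A0. fst b ` RB (U (?m (c, b))))"
    proof (rule fam_cover[OF B[OF c]])
      fix b assume "b \<in> B c"
      with c have "?m (c, b) \<in> ?m ` (SIGMA c:A. B c)" by blast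
      then show "U (?m (c, b)) > 0" by (rule bspec[OF U])
    qed
  qed
  then obtain B0 where "\<forall>c\<in>A. \<exists>r. B0 c \<subseteq> B c \<and> finite (B0 c) \<and> r > 0 \<and> RB r \<subseteq> (\<Union>b\<in>B0 c. fst b ` RB (U (?m (c, b))))"
    by (rule bchoice[THEN exE])
  then obtain r where "\<forall>c\<in>A. B0 c \<subseteq> B c \<and> finite (B0 c) \<and> r c > 0 \<and> RB (r c) \<subseteq> (\<Union>b\<in>B0 c. fst b ` RB (U (?m (c, b))))"
    by (rule bchoice[THEN exE])
  note B0' = bspec[OF this]
  have B0: "B0 c \<subseteq> B c" "finite (B0 c)" "r c > 0"
     "RB (r c) \<subseteq> (\<Union>b\<in>B0 c. fst b ` RB (U (?m (c, b))))" if "c \<in> A" for c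
    using B0'[OF that] by simp_all
  obtain A0 s where A0: "A0 \<subseteq> A" "finite A0" "s > 0" "RB s \<subseteq> (\<Union>c\<in>A0. fst c ` RB (r c))"
  proof -
    have "\<exists>A0 s. A0 \<subseteq> A \<and> finite A0 \<and> s > 0 \<and> RB s \<subseteq> (\<Union>c\<in>A0. fst c ` RB (r c))"
      by (rule fam_cover[OF A]) (erule B0(3))
    then show thesis by (elim exE conjE) (rule that)
  qed
  show "\<exists>A0\<subseteq>?m ` (SIGMA c:A. B c). finite A0 \<and> (\<exists>r>0. RB r \<subseteq> (\<Union>c\<in>A0. fst c ` RB (U c)))"
  proof (intro exI[of _ "?m ` (SIGMA c:A0. B0 c)"] conjI exI[of _ s])
    show "?m ` (SIGMA c:A0. B0 c) \<subseteq> ?m ` (SIGMA c:A. B c)"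
      using A0(1) B0(1) by (intro image_mono Sigma_mono) auto
    show "finite (?m ` (SIGMA c:A0. B0 c))"
      using A0 B0(2) by (intro finite_imageI finite_SigmaI) auto
    show "s > 0" by fact
    show "RB s \<subseteq> (\<Union>c\<in>?m ` (SIGMA c:A0. B0 c). fst c ` RB (U c))"
    proof
      fix x :: "real^'a" assume "x \<in> RB s"
      then obtain c y where c: "c \<in> A0" "x = fst c y" "y \<in> RB (r c)" using A0(4) by blast
      then obtain b z where b: "b \<in> B0 c" "y = fst b z" "z \<in> RB (U (?m (c, b)))"
        using B0(4)[of c] A0(1) by blast
      show "x \<in> (\<Union>c\<in>?m ` (SIGMA c:A0. B0 c). fst c ` RB (U c))"
      proof (rule UN_I)
        show "?m (c, b) \<in> ?m ` (SIGMA c:A0. B0 c)" using b c by blast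
        show "x \<in> fst (?m (c, b)) ` RB (U (?m (c, b)))"
          by (rule image_eqI[OF _ b(3)]) (use b c in simp)
      qed
    qed
  qed
qed

lemma fam_id: "fam S {(\<lambda>x. x, \<lambda>x. 1)}"
  unfolding fam_def
proof (intro conjI allI impI)
  fix U :: "'a jchart \<Rightarrow> real" assume "\<forall>c\<in>{(\<lambda>x. x, \<lambda>x. 1)}. U c > 0"
  then show "\<exists>A0\<subseteq>{(\<lambda>x. x, \<lambda>x. 1)}. finite A0 \<and> (\<exists>r>0. RB r \<subseteq> (\<Union>c\<in>A0. fst c ` RB (U c)))"
    by (intro exI[of _ "{(\<lambda>x. x, \<lambda>x. 1)}"] conjI exI[of _ "U (\<lambda>x. x, \<lambda>x. 1)"]) auto
qed (simp add: chart_id)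

lemma coversI_id: "P (\<lambda>x. x) (\<lambda>x. 1) \<Longrightarrow> covers S P"
  unfolding covers_def using fam_id by (intro exI[of _ "{(\<lambda>x. x, \<lambda>x. 1)}"]) auto

lemma covers_weaken:
  assumes "covers S P" "\<And>\<psi> j. chart S \<psi> j \<Longrightarrow> P \<psi> j \<Longrightarrow> Q \<psi> j"
  shows "covers S Q"
proof -
  obtain A where A: "fam S A" "\<forall>c\<in>A. P (fst c) (snd c)" using assms(1) unfolding covers_def by blast
  have "\<forall>c\<in>A. Q (fst c) (snd c)"
    using assms(2)[OF fam_chart[OF A(1)] A(2)[rule_format]] by (intro ballI)
  with A(1) show ?thesis unfolding covers_def by (intro exI conjI)
qed

lemma covers_step:
  assumes "fam S A" "\<And>c. c \<in> A \<Longrightarrow> covers S (\<lambda>\<psi> j. Q (\<lambda>x. fst c (\<psi> x)) (\<lambda>x. snd c (\<psi> x) * j x))"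
  shows "covers S Q"
proof -
  have "\<forall>c\<in>A. \<exists>B. fam S B \<and> (\<forall>b\<in>B. Q (\<lambda>x. fst c (fst b x)) (\<lambda>x. snd c (fst b x) * snd b x))"
    using assms(2) unfolding covers_def by (intro ballI)
  then obtain B where B: "\<forall>c\<in>A. fam S (B c) \<and> (\<forall>b\<in>B c. Q (\<lambda>x. fst c (fst b x)) (\<lambda>x. snd c (fst b x) * snd b x))"
    by (rule bchoice[THEN exE])
  let ?C = "(\<lambda>(c, b). (\<lambda>x. fst c (fst b x), \<lambda>x. snd c (fst b x) * snd b x)) ` (SIGMA c:A. B c)"
  have "fam S ?C"
    by (rule fam_comp[OF assms(1)]) (use B in simp)
  moreover have "\<forall>d\<in>?C. Q (fst d) (snd d)" using B by auto
  ultimately show ?thesis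
    unfolding covers_def by (intro exI[of _ ?C] conjI)
qed

text \<open>Two-stage construction: the second family may depend on the chart reached in the first
  stage and may involve more variables.\<close>

lemma covers_trans:
  assumes "covers S P" "S \<subseteq> T"
    "\<And>\<psi> j. chart S \<psi> j \<Longrightarrow> P \<psi> j \<Longrightarrow> covers T (\<lambda>\<psi>' j'. Q (\<lambda>x. \<psi> (\<psi>' x)) (\<lambda>x. j (\<psi>' x) * j' x))"
  shows "covers T Q"
proof -
  obtain A where A: "fam S A" "\<forall>c\<in>A. P (fst c) (snd c)" using assms(1) unfolding covers_def by blast
  show ?thesis
  proof (rule covers_step[OF fam_mono[OF A(1) assms(2)]])
    fix c assume c: "c \<in> A"
    show "covers T (\<lambda>\<psi> j. Q (\<lambda>x. fst c (\<psi> x)) (\<lambda>x. snd c (\<psi> x) * j x))"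
      by (rule assms(3)[OF fam_chart[OF A(1) c] bspec[OF A(2) c]])
  qed
qed

lemma an_map_continuous:
  fixes \<psi> :: "real^'m::finite \<Rightarrow> real^'n::finite"
  assumes "\<And>i. an (\<lambda>x. \<psi> x $ i)"
  shows "\<exists>r>0. continuous_on (RB r) \<psi>"
proof -
  have "\<exists>r>0. \<forall>i. continuous_on (RB r) (\<lambda>x. \<psi> x $ i)"
  proof (rule uniform_radius)
    show "\<exists>r>0. continuous_on (RB r) (\<lambda>x. \<psi> x $ i)" for i
      by (rule an_continuous[OF assms[of i]]) blast
    show "continuous_on (RB s) (\<lambda>x. \<psi> x $ i)"
      if "continuous_on (RB r) (\<lambda>x. \<psi> x $ i)" "s \<le> r" for i r s
      using that by (auto intro: continuous_on_subset RB_mono)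
  qed
  then obtain r where r: "r > 0" "\<And>i. continuous_on (RB r) (\<lambda>x. \<psi> x $ i)" by blast
  have "continuous_on (RB r) (\<lambda>x. \<chi> i. \<psi> x $ i)" by (intro continuous_on_vec_lambda r)
  with r(1) show ?thesis by (auto simp: vec_lambda_eta)
qed

lemma chart_coord:
  assumes k: "k \<in> S" and g: "an g" "dep S g" "g \<in> borel_measurable borel" "g 0 = 0"
    and j: "an j" "dep S j" "j \<in> borel_measurable borel"
    and cv1: "\<And>x. cv1 (\<lambda>t. g (upd x k t)) (\<lambda>t. j (upd x k t))"
  shows "chart S (\<lambda>x. upd x k (g x)) j"
  unfolding chart_def
proof (intro conjI allI ballI impI)
  show an: "an (\<lambda>x. upd x k (g x) $ i)" for i by (cases "i = k") (auto intro: g)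
  show "dep S (\<lambda>x. upd x k (g x) $ i)" if "i \<in> S" for i
    using g that by (cases "i = k") (auto intro: dep_coord)
  obtain r where r: "r > 0" "continuous_on (RB r) (\<lambda>x. upd x k (g x))"
    using an_map_continuous[of "\<lambda>x. upd x k (g x)", OF an] by blast
  show "cv (\<lambda>x. upd x k (g x)) j"
    by (rule cv_coord[OF g(3) j(3) cv1 r])
qed (use k g j in \<open>auto simp: vec_eq_iff\<close>)

lemma dep_upd: "dep (S - {k}) f \<Longrightarrow> f (upd x k t) = f x"
  by (erule depD) auto

lemma chart_affine:
  assumes k: "k \<in> S" and p: "an p" "dep (S - {k}) p" "p \<in> borel_measurable borel"
    and b: "an b" "dep (S - {k}) b" "b \<in> borel_measurable borel" "b 0 = 0"
  shows "chart S (\<lambda>x. upd x k (p x * x$k + b x)) p"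
proof (rule chart_coord[OF k])
  have [measurable]: "p \<in> borel_measurable borel" "b \<in> borel_measurable borel" by fact+
  show "(\<lambda>x. p x * x$k + b x) \<in> borel_measurable borel" by measurable
  show "an (\<lambda>x. p x * x$k + b x)" by (intro an_intros p b)
  show "dep S (\<lambda>x. p x * x$k + b x)" "dep S p"
    using p b k by (auto intro!: dep_intros intro: dep_mono)
  show "cv1 (\<lambda>t. p (upd x k t) * upd x k t $ k + b (upd x k t)) (\<lambda>t. p (upd x k t))" for x
    by (simp add: dep_upd[OF p(2)] dep_upd[OF b(2)] cv1_affine)
qed (use p b in auto)

text \<open>A germ is arbitrary away from 0 and may fail to be measurable there. Cutting it off
  outside a box repairs this, and composition with \<open>proj T\<close> keeps the dependence on
  \<open>T\<close>.\<close>

lemma an_borel_version: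
  fixes \<phi> :: "real^'n::finite \<Rightarrow> real"
  assumes "an \<phi>" "dep T \<phi>"
  obtains \<phi>' where "an \<phi>'" "dep T \<phi>'" "\<phi>' \<in> borel_measurable borel" "\<phi>' 0 = \<phi> 0" "\<forall>\<^sub>F x in nhds 0. \<phi>' x = \<phi> x"
proof -
  obtain r where r: "r > 0" "continuous_on (RB r) \<phi>" using an_continuous[OF assms(1)] by blast
  define F where "F x = (if x \<in> RB r then \<phi> x else 0)" for x
  have "(\<lambda>x. indicator (RB r) x *\<^sub>R \<phi> x) \<in> borel_measurable borel"
    by (rule borel_measurable_continuous_on_indicator) (simp_all add: r borel_open open_RB)
  also have "(\<lambda>x. indicator (RB r) x *\<^sub>R \<phi> x) = F" by (auto simp: F_def)
  finally have F: "F \<in> borel_measurable borel" .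
  have ev: "\<forall>\<^sub>F x in nhds 0. F (proj T x) = \<phi> x"
  proof (rule eventually_RBI[OF r(1)])
    fix x :: "real^'n" assume "x \<in> RB r"
    then have "proj T x \<in> RB r" using r(1) by (auto simp: RB_iff)
    then show "F (proj T x) = \<phi> x" by (simp add: F_def dep_proj[OF assms(2)])
  qed
  show ?thesis
  proof (rule that[of "\<lambda>x. F (proj T x)"])
    have "proj T \<in> borel_measurable borel"
      unfolding proj_def
    proof (intro borel_measurable_continuous_onI continuous_on_vec_lambda)
      show "continuous_on UNIV (\<lambda>x. if i \<in> T then x $ i else 0)" for i
        by (cases "i \<in> T") (auto intro: continuous_intros)
    qed
    then show "(\<lambda>x. F (proj T x)) \<in> borel_measurable borel" using F by (rule measurable_compose)
    show "dep T (\<lambda>x. F (proj T x))" by (rule dep_compose_proj)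
    show "an (\<lambda>x. F (proj T x))"
      by (rule an_cong[OF assms(1)]) (use ev in eventually_elim, simp)
  qed (use ev r(1) in \<open>auto simp: F_def\<close>)
qed

text \<open>The shear is inverted by subtracting \<phi>, which does not involve x_k.\<close>

lemma fam_shift:
  fixes \<phi> :: "real^'n::finite \<Rightarrow> real"
  assumes k: "k \<in> S" and \<phi>: "an \<phi>" "dep (S - {k}) \<phi>" "\<phi> \<in> borel_measurable borel" "\<phi> 0 = 0"
  shows "fam S {(\<lambda>x. upd x k (x$k + \<phi> x), \<lambda>x. 1)}"
  unfolding fam_def
proof (intro conjI allI impI)
  have "chart S (\<lambda>x. upd x k (1 * x$k + \<phi> x)) (\<lambda>x. 1)"
    by (rule chart_affine[OF k]) (use \<phi> in auto)
  then show "\<forall>c\<in>{(\<lambda>x. upd x k (x$k + \<phi> x), \<lambda>x. 1)}. chart S (fst c) (snd c)" by simp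
  fix U :: "'n jchart \<Rightarrow> real" assume U: "\<forall>c\<in>{(\<lambda>x. upd x k (x$k + \<phi> x), \<lambda>x. 1)}. U c > 0"
  define u where "u = U (\<lambda>x. upd x k (x$k + \<phi> x), \<lambda>x. 1)"
  have "u > 0" using U by (simp add: u_def)
  have "\<forall>\<^sub>F x in nhds (0::real^'n). x \<in> RB u" by (rule eventually_RBI[OF \<open>u > 0\<close>])
  then have "\<forall>\<^sub>F x in nhds 0. upd x k (x$k - \<phi> x) \<in> RB u"
  proof (rule an_eventually_compose[rotated 2])
    show "an (\<lambda>x. upd x k (x$k - \<phi> x) $ i)" for i by (cases "i = k") (auto intro: an_intros \<phi>)
  qed (simp add: vec_eq_iff \<phi>)
  then obtain r where r: "r > 0" "\<And>x. x \<in> RB r \<Longrightarrow> upd x k (x$k - \<phi> x) \<in> RB u"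
    unfolding eventually_RB by blast
  have "RB r \<subseteq> (\<lambda>x. upd x k (x$k + \<phi> x)) ` RB u"
  proof
    fix y :: "real^'n" assume "y \<in> RB r"
    then show "y \<in> (\<lambda>x. upd x k (x$k + \<phi> x)) ` RB u"
      by (intro image_eqI[OF _ r(2)]) (simp_all add: dep_upd[OF \<phi>(2)])
  qed
  with r(1) show "\<exists>A0\<subseteq>{(\<lambda>x. upd x k (x$k + \<phi> x), \<lambda>x. 1)}. finite A0 \<and> (\<exists>r>0. RB r \<subseteq> (\<Union>c\<in>A0. fst c ` RB (U c)))"
    by (intro exI[of _ "{(\<lambda>x. upd x k (x$k + \<phi> x), \<lambda>x. 1)}"] conjI exI[of _ r]) (auto simp: u_def)
qed

text \<open>The blow-up of \<open>x\<^sub>i = x\<^sub>k = 0\<close>: the charts \<open>x\<^sub>k := x\<^sub>i (x\<^sub>k + a)\<close> are centred at the points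
  \<open>a\<close> of the exceptional projective line, and \<open>x\<^sub>i := x\<^sub>k x\<^sub>i\<close> at its point at infinity.\<close>

lemma fam_blowup:
  fixes i k :: "'n::finite"
  assumes S: "i \<in> S" "k \<in> S" "i \<noteq> k"
  shows "fam S (insert (\<lambda>x. upd x i (x$k * x$i), \<lambda>x. x$k)
    (range (\<lambda>a. (\<lambda>x. upd x k (x$i * x$k + a * x$i), \<lambda>x. x$i))))" (is "fam S (insert ?inf (range ?c))")
  unfolding fam_def
proof (intro conjI allI impI)
  have "chart S (\<lambda>x. upd x i (x$k * x$i + 0)) (\<lambda>x. x$k)"
    by (rule chart_affine) (use S in \<open>auto intro: dep_coord\<close>)
  moreover have "chart S (\<lambda>x. upd x k (x$i * x$k + a * x$i)) (\<lambda>x. x$i)" for a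
    by (rule chart_affine) (use S in \<open>auto intro!: dep_intros an_intros\<close>)
  ultimately show "\<forall>c\<in>insert ?inf (range ?c). chart S (fst c) (snd c)" by auto
  fix U :: "'n jchart \<Rightarrow> real" assume U: "\<forall>c\<in>insert ?inf (range ?c). U c > 0"
  define u where "u = U ?inf"
  \<comment> \<open>On its box of radius \<open>u\<close> the chart at infinity covers the
    directions with |x_k| > R |x_i|. The remaining slopes x_k / x_i form the compact interval
    {-R..R}, so finitely many centres suffice.\<close>
  define R where "R = 1 / u"
  have u: "u > 0" "R > 0" using U by (auto simp: u_def R_def)
  have Ua: "U (?c a) > 0" for a using U by auto
  have "{-R..R} \<subseteq> (\<Union>a\<in>{-R..R}. ball a (U (?c a)))"
  proof
    fix a assume "a \<in> {-R..R}"
    then show "a \<in> (\<Union>a\<in>{-R..R}. ball a (U (?c a)))" using Ua[of a] by (intro UN_I[of a]) auto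
  qed
  then obtain D where D: "D \<subseteq> {-R..R}" "finite D" "{-R..R} \<subseteq> (\<Union>a\<in>D. ball a (U (?c a)))"
    using compactE_image[OF compact_Icc[of "-R" R], of "{-R..R}" "\<lambda>a. ball a (U (?c a))"] by auto
  define r where "r = Min (insert u ((\<lambda>a. U (?c a)) ` D))"
  have r: "r > 0" "r \<le> u" "\<And>a. a \<in> D \<Longrightarrow> r \<le> U (?c a)"
  proof -
    show "r > 0" unfolding r_def using D(2) Ua u by (subst Min_gr_iff) auto
    show "r \<le> u" "\<And>a. a \<in> D \<Longrightarrow> r \<le> U (?c a)"
      unfolding r_def using D(2) by (auto intro!: Min_le)
  qed
  show "\<exists>A0\<subseteq>insert ?inf (range ?c). finite A0 \<and> (\<exists>r>0. RB r \<subseteq> (\<Union>c\<in>A0. fst c ` RB (U c)))"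
  proof (intro exI[of _ "insert ?inf (?c ` D)"] conjI exI[of _ r])
    show "RB r \<subseteq> (\<Union>c\<in>insert ?inf (?c ` D). fst c ` RB (U c))"
    proof
      fix x :: "real^'n" assume x: "x \<in> RB r"
      consider "x$k = 0" "x$i = 0" | "x$i \<noteq> 0" "\<bar>x$k\<bar> \<le> R * \<bar>x$i\<bar>" | "x$k \<noteq> 0" "R * \<bar>x$i\<bar> < \<bar>x$k\<bar>"
      proof (cases "x$i = 0")
        case True
        then show ?thesis using that(1,3) by (cases "x$k = 0") auto
      next
        case False
        have "0 \<le> R * \<bar>x$i\<bar>" using u(2) by simp
        with False show ?thesis using that(2,3)
          by (cases "x$k = 0"; cases "\<bar>x$k\<bar> \<le> R * \<bar>x$i\<bar>") auto
      qed
      then show "x \<in> (\<Union>c\<in>insert ?inf (?c ` D). fst c ` RB (U c))"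
      proof cases
        case 1
        have "x \<in> RB u" using x r(2) by (auto intro: RB_mono)
        moreover have "x = upd x i (x$k * x$i)" using 1 by (auto simp: vec_eq_iff)
        ultimately have "x \<in> fst ?inf ` RB (U ?inf)" by (auto simp: u_def)
        then show ?thesis by blast
      next
        case 2
        then have "x$k / x$i \<in> {-R..R}" by (simp add: divide_simps abs_le_iff) (auto simp: abs_if field_simps split: if_splits)
        then obtain a where a: "a \<in> D" "\<bar>x$k / x$i - a\<bar> < U (?c a)" using D(3) by (auto simp: dist_real_def abs_minus_commute)
        have "upd x k (x$k / x$i - a) \<in> RB (U (?c a))"
          using a x r(3)[OF a(1)] by (intro upd_in_RB) (auto intro: RB_mono)
        moreover have "x = fst (?c a) (upd x k (x$k / x$i - a))"
          using 2 S by (auto simp: vec_eq_iff field_simps)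
        ultimately have "x \<in> fst (?c a) ` RB (U (?c a))" by (rule image_eqI[rotated])
        with a(1) show ?thesis by blast
      next
        case 3
        have "\<bar>x$i / x$k\<bar> < u" using 3 u by (simp add: R_def abs_divide field_simps)
        then have "upd x i (x$i / x$k) \<in> RB u"
          using x r(2) by (intro upd_in_RB) (auto intro: RB_mono)
        moreover have "x = fst ?inf (upd x i (x$i / x$k))"
          using 3 S by (auto simp: vec_eq_iff)
        ultimately have "x \<in> fst ?inf ` RB (U ?inf)" unfolding u_def by (rule image_eqI[rotated])
        then show ?thesis by blast
      qed
    qed
  qed (use D r in auto)
qed

text \<open>Both signs are needed because an even power reaches only one half line.\<close>

lemma fam_power:
  fixes k :: "'n::finite"
  assumes k: "k \<in> S" and N: "N \<ge> 1"
  shows "fam S ((\<lambda>\<sigma>. (\<lambda>x. upd x k (\<sigma> * (x$k)^N), \<lambda>x. real N * (x$k)^(N-1))) ` {1, -1})"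
    (is "fam S (?c ` _)")
  unfolding fam_def
proof (intro conjI allI impI)
  have ch: "chart S (\<lambda>x. upd x k (\<sigma> * (x$k)^N)) (\<lambda>x. real N * (x$k)^(N-1))" if "\<sigma> \<in> {1, -1}" for \<sigma>
  proof (rule chart_coord[OF k])
    show "cv1 (\<lambda>t. \<sigma> * (upd x k t $ k)^N) (\<lambda>t. real N * (upd x k t $ k)^(N-1))" for x
      using cv1_power[of \<sigma> N] that N by auto
  qed (use k N in \<open>auto intro!: an_intros dep_intros\<close>)
  show "\<forall>c\<in>?c ` {1, -1}. chart S (fst c) (snd c)"
    using ch[of 1] ch[of "-1"] by simp
  fix U :: "'n jchart \<Rightarrow> real" assume U: "\<forall>c\<in>?c ` {1, -1}. U c > 0"
  define u where "u = min (U (?c 1)) (U (?c (-1)))"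
  have u: "u > 0" using U by (simp add: u_def)
  define r where "r = min u (u^N)"
  have "r > 0" using u by (simp add: r_def)
  moreover have "RB r \<subseteq> (\<Union>c\<in>?c ` {1, -1}. fst c ` RB (U c))"
  proof
    fix x :: "real^'n" assume x: "x \<in> RB r"
    define \<sigma> :: real where "\<sigma> = (if x$k \<ge> 0 then 1 else -1)"
    have \<sigma>: "\<sigma> \<in> {1, -1}" "\<sigma> * \<bar>x$k\<bar> = x$k" by (auto simp: \<sigma>_def)
    define t where "t = root N \<bar>x$k\<bar>"
    have t: "t \<ge> 0" "t^N = \<bar>x$k\<bar>" using N by (auto simp: t_def)
    have "t^N < u^N" using t RB_nth[OF x, of k] by (simp add: r_def)
    then have "t < u" by (rule power_less_imp_less_base) (use u in simp)
    then have "upd x k t \<in> RB u"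
      using RB_mono[OF _ x, of u] t by (intro upd_in_RB) (auto simp: r_def)
    moreover have "u \<le> U (?c \<sigma>)" using \<sigma>(1) by (auto simp: u_def)
    ultimately have "upd x k t \<in> RB (U (?c \<sigma>))" by (rule RB_mono[rotated])
    moreover have "x = fst (?c \<sigma>) (upd x k t)"
      using t \<sigma>(2) by (simp add: vec_eq_iff)
    ultimately have "x \<in> fst (?c \<sigma>) ` RB (U (?c \<sigma>))" by (rule image_eqI[rotated])
    with \<sigma>(1) show "x \<in> (\<Union>c\<in>?c ` {1, -1}. fst c ` RB (U c))" by blast
  qed
  ultimately show "\<exists>A0\<subseteq>?c ` {1, -1}. finite A0 \<and> (\<exists>r>0. RB r \<subseteq> (\<Union>c\<in>A0. fst c ` RB (U c)))"
    by (intro exI[of _ "?c ` {1, -1}"] conjI exI[of _ r]) auto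
qed

text \<open>The substitution x_i := \<sigma>_i x_i^N multiplies exponents by \<open>N\<close>, so
  that they can afterwards be divided by the factors of \<open>N\<close>. Its Jacobian is a monomial
  up to a constant.\<close>

lemma covers_power:
  fixes S T :: "'n::finite set"
  assumes "T \<subseteq> S" "N \<ge> 1"
  shows "covers S (\<lambda>\<psi> j. mono_germ S j \<and>
     (\<exists>\<sigma>. (\<forall>i. \<sigma> i \<noteq> 0) \<and> (\<forall>x. \<psi> x = (\<chi> i. if i \<in> T then \<sigma> i * (x$i)^N else x$i))))"
  using finite[of T] assms(1)
proof (induction T rule: finite_induct)
  case empty
  show ?case by (rule coversI_id) (auto intro!: mono_germ_unit exI[of _ "\<lambda>_. 1"])
next
  case (insert k T)
  show ?case
  proof (rule covers_trans[OF insert.IH order_refl])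
    show "T \<subseteq> S" using insert by simp
    fix \<psi> j assume ch: "chart S \<psi> j" and P: "mono_germ S j \<and>
     (\<exists>\<sigma>. (\<forall>i. \<sigma> i \<noteq> 0) \<and> (\<forall>x. \<psi> x = (\<chi> i. if i \<in> T then \<sigma> i * (x$i)^N else x$i)))"
    then obtain \<sigma> where \<sigma>: "\<And>i. \<sigma> i \<noteq> 0" "\<And>x. \<psi> x = (\<chi> i. if i \<in> T then \<sigma> i * (x$i)^N else x$i)" by blast
    have k: "k \<in> S" using insert by simp
    show "covers S (\<lambda>\<psi>' j'. mono_germ S (\<lambda>x. j (\<psi>' x) * j' x) \<and>
      (\<exists>\<sigma>. (\<forall>i. \<sigma> i \<noteq> 0) \<and> (\<forall>x. \<psi> (\<psi>' x) = (\<chi> i. if i \<in> insert k T then \<sigma> i * (x$i)^N else x$i))))"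
    proof (rule covers_step[OF fam_power[OF k assms(2)]], rule coversI_id, elim imageE, simp only: fst_conv snd_conv mult_1_right)
      fix c and \<tau> :: real assume \<tau>: "\<tau> \<in> {1, -1}"
      let ?p = "\<lambda>x::real^'n. upd x k (\<tau> * (x$k)^N)"
      have \<tau>0: "\<tau> \<noteq> 0" using \<tau> by auto
      have mk: "mono_germ S (\<lambda>x. (c::real) * (x$k)^n)" if "c \<noteq> 0" for c n
        using that k by (intro mono_germ_mult mono_germ_unit mono_germ_power mono_germ_coord) auto
      have "mono_germ S (\<lambda>x. j (?p x))"
      proof (rule mono_germ_compose[OF P[THEN conjunct1]])
        show "an (\<lambda>x. ?p x $ i)" for i by (cases "i = k") (auto intro!: an_mult an_power)
        show "?p 0 = 0" using assms(2) by (auto simp: vec_eq_iff)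
        show "dep S (\<lambda>x. ?p x $ i)" if "i \<in> S" for i using that k by (cases "i = k") (auto intro!: dep_mult dep_power dep_coord)
        show "mono_germ S (\<lambda>x. ?p x $ i)" if "i \<in> S" for i
          using that mk[OF \<tau>0] by (cases "i = k") (auto intro: mono_germ_coord)
      qed
      moreover have "mono_germ S (\<lambda>x. real N * (x$k)^(N-1))" using assms(2) by (intro mk) auto
      ultimately have "mono_germ S (\<lambda>x. j (?p x) * (real N * (x$k)^(N-1)))" by (rule mono_germ_mult)
      moreover have "\<psi> (?p x) = (\<chi> i. if i \<in> insert k T then (\<sigma>(k := \<tau>)) i * (x$i)^N else x$i)" for x
        using insert(2) by (auto simp: vec_eq_iff \<sigma>(2))
      ultimately show "mono_germ S (\<lambda>x. j (?p x) * (real N * (x$k)^(N-1))) \<and>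
        (\<exists>\<sigma>. (\<forall>i. \<sigma> i \<noteq> 0) \<and> (\<forall>x. \<psi> (?p x) = (\<chi> i. if i \<in> insert k T then \<sigma> i * (x$i)^N else x$i)))"
        using \<sigma>(1) \<tau>0 by (intro conjI exI[of _ "\<sigma>(k := \<tau>)"]) auto
    qed
  qed
qed

text \<open>Sends the k-th axis to a line of prescribed direction: k-th coordinate 1, and
  \<open>w\<close> at the indices in \<open>T\<close>. This will make a germ regular in x_k.\<close>

lemma covers_shear:
  fixes S T :: "'n::finite set" and w :: "'n \<Rightarrow> real"
  assumes "T \<subseteq> S - {k}" "k \<in> S"
  shows "covers S (\<lambda>\<psi> j. (\<forall>x. j x = 1) \<and> (\<forall>x. \<psi> x = (\<chi> i. if i \<in> T then x$i + w i * x$k else x$i)))"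
  using finite[of T] assms(1)
proof (induction T rule: finite_induct)
  case empty
  show ?case by (rule coversI_id) auto
next
  case (insert l T)
  show ?case
  proof (rule covers_trans[OF insert.IH order_refl])
    show "T \<subseteq> S - {k}" using insert by simp
    fix \<psi> :: "real^'n \<Rightarrow> real^'n" and j :: "real^'n \<Rightarrow> real"
    assume P: "(\<forall>x. j x = (1::real)) \<and> (\<forall>x. \<psi> x = (\<chi> i. if i \<in> T then x$i + w i * x$k else x$i))"
    have "fam S {(\<lambda>x. upd x l (x$l + w l * x$k), \<lambda>x. 1)}"
      by (rule fam_shift) (use insert assms in \<open>auto intro!: an_intros dep_intros\<close>)
    then show "covers S (\<lambda>\<psi>' j'. (\<forall>x. j (\<psi>' x) * j' x = 1) \<and>
      (\<forall>x. \<psi> (\<psi>' x) = (\<chi> i. if i \<in> insert l T then x$i + w i * x$k else x$i)))"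
      by (rule covers_step, intro coversI_id) (use P insert in \<open>auto simp: vec_eq_iff\<close>)
  qed
qed

section \<open>Making a single germ monomial\<close>

text \<open>The coordinate \<open>k\<close> is translated by the blow-up centres and need not stay
  monomial. The coordinates in S - {k} must, because powers of them are split off from
  \<open>f\<close> on the way.\<close>

definition res :: "'n::finite set \<Rightarrow> 'n \<Rightarrow> (real^'n \<Rightarrow> real) \<Rightarrow> (real^'n \<Rightarrow> real^'n) \<Rightarrow> (real^'n \<Rightarrow> real) \<Rightarrow> bool" where
  "res S k f \<psi> j \<longleftrightarrow> mono_germ S (\<lambda>x. f (\<psi> x)) \<and> mono_germ S j \<and> (\<forall>i\<in>S-{k}. mono_germ S (\<lambda>x. \<psi> x $ i))"

text \<open>Since the coefficient of degree \<open>d - 1\<close> vanishes, \<open>P\<close> is not a multiple of a \<open>d\<close>-th power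
  \<open>(y - a)\<^sup>d\<close>, so its order at every point is smaller than \<open>d\<close>.\<close>

lemma poly_order_drop:
  fixes c a :: real and w :: "nat \<Rightarrow> real"
  assumes c: "c \<noteq> 0" and j0: "j0 < d - 1" "w j0 \<noteq> 0"
  shows "\<exists>d'<d. \<exists>q. poly q 0 \<noteq> 0 \<and> (\<forall>t. (t + a)^d * c + (\<Sum>j<d-1. w j * (t + a)^j) = t^d' * poly q t)"
proof -
  define P where "P = monom c d + (\<Sum>j<d-1. monom (w j) j)"
  have poly_P: "poly P y = y^d * c + (\<Sum>j<d-1. w j * y^j)" for y
    by (simp add: P_def poly_monom poly_sum mult.commute)
  have coeff_P: "coeff P i = (if i = d then c else 0) + (if i < d - 1 then w i else 0)" for i
    by (auto simp: P_def coeff_sum)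
  have "degree P = d"
  proof (rule antisym)
    show "degree P \<le> d" by (rule degree_le) (auto simp: coeff_P)
    show "d \<le> degree P" by (rule le_degree) (use c in \<open>auto simp: coeff_P\<close>)
  qed
  define p where "p = pcompose P [:a, 1:]"
  have poly_p: "poly p t = poly P (t + a)" for t by (simp add: p_def poly_pcompose add.commute)
  have deg_p: "degree p = d" by (simp add: p_def degree_pcompose \<open>degree P = d\<close>)
  have "p \<noteq> 0"
  proof
    assume "p = 0"
    then have "d = 0" using deg_p by simp
    with j0 show False by simp
  qed
  from order_decomp[OF this, of 0] obtain q where q: "p = [:0, 1:] ^ order 0 p * q" "\<not> [:0, 1:] dvd q" by auto
  have q0: "poly q 0 \<noteq> 0" using q(2) by (simp add: dvd_iff_poly_eq_0[of 0, simplified])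
  have pq: "poly p t = t ^ order 0 p * poly q t" for t by (subst q(1)) simp
  have "order 0 p < d"
  proof (rule ccontr)
    assume "\<not> order 0 p < d"
    moreover have "degree p = order 0 p + degree q"
      using \<open>p \<noteq> 0\<close> q(1) by (metis degree_mult_eq degree_linear_power mult_eq_0_iff)
    ultimately have od: "order 0 p = d" "degree q = 0" using deg_p by auto
    then obtain e where "q = [:e:]" by (metis degree_eq_zeroE)
    then have "poly P y = poly (smult e ([:-a, 1:]^d)) y" for y
      using pq[of "y - a"] poly_p[of "y - a"] od by simp
    \<comment> \<open>If the order were \<open>d\<close>, then P = e (y - a)^d. Its coefficient of
      degree d - 1 is -d e a, which vanishes only for a = 0; but then the coefficient
      \<open>w j0\<close> would vanish too.\<close>
    then have P: "P = smult e ([:-a, 1:]^d)" by (simp add: poly_eq_poly_eq_iff[symmetric] fun_eq_iff)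
    have cP: "coeff P i = e * (real (d choose i) * (-a)^(d - i))" if "i \<le> d" for i
      unfolding P using that by (simp add: coeff_linear_poly_power)
    have nd: "\<not> d < d - 1" by arith
    have "e = c" using cP[of d] coeff_P[of d] nd by simp
    moreover have "coeff P (d - 1) = 0" using j0 by (auto simp: coeff_P)
    moreover have "d choose (d - 1) = d" using j0 by (cases d) auto
    ultimately have "a = 0" using cP[of "d - 1"] c j0 by auto
    then have "coeff P j0 = 0" using cP[of j0] j0 by auto
    moreover have "j0 \<noteq> d" using j0 by arith
    ultimately show False using coeff_P[of j0] j0 by simp
  qed
  with q0 pq show ?thesis
    unfolding poly_p poly_P by blast
qed

lemma an_poly: "an (\<lambda>x. poly q (x$k))"
  unfolding poly_altdef by (intro an_sum an_mult an_const an_power an_coord)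

lemma mon_upd: "mon \<beta> (upd x i y) = y ^ \<beta> i * mon (\<beta>(i := 0)) x"
proof -
  have "mon \<beta> (upd x i y) = (\<Prod>l\<in>insert i (UNIV - {i}). (upd x i y $ l) ^ \<beta> l)"
    by (simp add: mon_def insert_absorb)
  also have "\<dots> = y ^ \<beta> i * (\<Prod>l\<in>UNIV - {i}. (upd x i y $ l) ^ \<beta> l)"
    by (subst prod.insert) auto
  also have "(\<Prod>l\<in>UNIV - {i}. (upd x i y $ l) ^ \<beta> l) = (\<Prod>l\<in>insert i (UNIV - {i}). (x $ l) ^ (\<beta>(i := 0)) l)"
    by (subst prod.insert) (auto intro!: prod.cong)
  also have "\<dots> = mon (\<beta>(i := 0)) x"
    by (simp add: mon_def insert_absorb)
  finally show ?thesis .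
qed

lemma mon_upd_0: "\<beta> i = 0 \<Longrightarrow> mon \<beta> (upd x i y) = mon \<beta> x"
  using mon_upd[of \<beta> x i y] by (simp add: fun_upd_idem)

lemma mon_decr:
  assumes "\<beta> i \<ge> 1"
  shows "mon \<beta> x = x$i * mon (\<beta>(i := \<beta> i - 1)) x"
proof -
  have "\<beta> = (\<lambda>l. (if l = i then 1 else 0) + (\<beta>(i := \<beta> i - 1)) l)" using assms by auto
  then have "mon \<beta> x = mon (\<lambda>l. (if l = i then 1 else 0) + (\<beta>(i := \<beta> i - 1)) l) x" by simp
  then show ?thesis by (simp only: mon_add mon_single power_one_right)
qed

lemma reg_0:
  assumes "an g" "g 0 \<noteq> 0"
  shows "reg k 0 g"
proof -
  have "an (\<lambda>x. g (axis k (x$k)))"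
  proof (rule an_compose[OF assms(1)])
    show "an (\<lambda>x. axis k (x $ k) $ i)" for i by (cases "i = k") (auto simp: axis_def)
  qed (simp add: iffD2[OF axis_eq_0_iff])
  with assms(2) show ?thesis
    unfolding reg_def by (intro exI[of _ "\<lambda>x. g (axis k (x$k))"]) (simp add: iffD2[OF axis_eq_0_iff])
qed

text \<open>For i \<noteq> k the coordinate x_i remains monomial under the charts that resolve
  \<open>g\<close>. So do the factor x_i^d split off from \<open>f\<close> and the new Jacobian
  factor x_i.\<close>

lemma covers_res_upd:
  assumes i: "i \<in> S - {k}" and \<psi>: "\<And>x l. l \<noteq> k \<Longrightarrow> \<psi> x $ l = x $ l"
    and ev: "\<forall>\<^sub>F x in nhds 0. f (\<psi> x) = (x$i)^d * g x" and g: "covers S (res S k g)"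
  shows "covers S (\<lambda>\<psi>' j'. res S k f (\<lambda>x. \<psi> (\<psi>' x)) (\<lambda>x. \<psi>' x $ i * j' x))"
proof (rule covers_weaken[OF g])
  fix \<psi>' j' assume ch: "chart S \<psi>' j'" and r: "res S k g \<psi>' j'"
  have mi: "mono_germ S (\<lambda>x. \<psi>' x $ i)" and mg: "mono_germ S (\<lambda>x. g (\<psi>' x))" and mj: "mono_germ S j'"
    and ml: "\<And>l. l \<in> S - {k} \<Longrightarrow> mono_germ S (\<lambda>x. \<psi>' x $ l)"
    using r i by (auto simp: res_def)
  have "mono_germ S (\<lambda>x. (\<psi>' x $ i)^d * g (\<psi>' x))"
    by (intro mono_germ_mult mono_germ_power mi mg)
  then have "mono_germ S (\<lambda>x. f (\<psi> (\<psi>' x)))"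
    by (rule mono_germ_cong) (rule chart_eventually[OF ch ev])
  then show "res S k f (\<lambda>x. \<psi> (\<psi>' x)) (\<lambda>x. \<psi>' x $ i * j' x)"
    unfolding res_def using mono_germ_mult[OF mi mj] ml by (simp add: \<psi>)
qed

text \<open>Blowing up x_i = x_k = 0 with i in the support of \<beta> removes one factor x_i from
  \<open>mon \<beta>\<close> and x_i^d from \<open>f\<close>. In the chart at infinity the rest is a
  unit. As long as \<beta> is not exhausted, the centre 0 keeps the shape with smaller degree and
  the other centres give units. Once it is exhausted, the order in x_k drops at every centre,
  because \<open>v j0\<close> is a unit.\<close>

lemma blowup_descent:
  fixes k :: "'n::finite"
  assumes k: "k \<in> S"
    and IHd: "\<And>d' g. d' < d \<Longrightarrow> an g \<Longrightarrow> dep S g \<Longrightarrow> reg k d' g \<Longrightarrow> covers S (res S k g)"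
    and j0: "j0 < d - 1"
  shows "(\<And>i. i \<notin> S - {k} \<Longrightarrow> \<beta> i = 0) \<Longrightarrow> (\<Sum>i\<in>UNIV. \<beta> i) = Suc n \<Longrightarrow>
    an u \<Longrightarrow> dep S u \<Longrightarrow> u 0 \<noteq> 0 \<Longrightarrow> (\<And>j. an (v j)) \<Longrightarrow> (\<And>j. dep S (v j)) \<Longrightarrow> v j0 0 \<noteq> 0 \<Longrightarrow>
    \<forall>\<^sub>F x in nhds 0. f x = (x$k)^d * u x + (\<Sum>j<d-1. mon \<beta> x ^ (d - j) * v j x * (x$k)^j) \<Longrightarrow>
    covers S (res S k f)"
proof (induction n arbitrary: f \<beta> u v rule: less_induct)
  case (less n)
  note \<beta>S = less.prems(1) and \<beta>n = less.prems(2) and u = less.prems(3-5) and v = less.prems(6-8) and ev = less.prems(9)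
  have "\<exists>i. \<beta> i \<noteq> 0"
  proof (rule ccontr)
    assume "\<not> (\<exists>i. \<beta> i \<noteq> 0)"
    with \<beta>n show False by simp
  qed
  then obtain i where "\<beta> i \<noteq> 0" by blast
  then have i1: "\<beta> i \<ge> 1" and i: "i \<in> S - {k}" using \<beta>S[of i] by auto
  then have iS: "i \<in> S" and ik: "i \<noteq> k" by auto
  define \<beta>' where "\<beta>' = \<beta>(i := \<beta> i - 1)"
  have mon_\<beta>: "mon \<beta> x = x$i * mon \<beta>' x" for x :: "real^'n"
    unfolding \<beta>'_def by (rule mon_decr[of \<beta> i, OF i1])
  have "\<beta> = (\<lambda>l. (if l = i then 1 else 0) + \<beta>' l)" using i1 by (auto simp: \<beta>'_def)
  then have "(\<Sum>l\<in>UNIV. \<beta> l) = (\<Sum>l\<in>UNIV. (if l = i then 1 else 0) + \<beta>' l)" by simp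
  then have \<beta>'n: "(\<Sum>l\<in>UNIV. \<beta>' l) = n" using \<beta>n by (simp add: sum.distrib)
  have \<beta>'S: "\<beta>' l = 0" if "l \<notin> S - {k}" for l using \<beta>S[OF that] i that by (auto simp: \<beta>'_def)
  have \<beta>k: "\<beta> k = 0" by (rule \<beta>S) simp
  have split_pow: "y ^ (d - j) * y ^ j = y ^ d" if "j < d - 1" for y :: real and j
    using that by (simp add: power_add[symmetric])
  show ?case
  proof (rule covers_step[OF fam_blowup[OF iS k ik]], elim insertE imageE, goal_cases)
    case (1 c)
    define \<psi> where "\<psi> x = upd x i (x$k * x$i)" for x :: "real^'n"
    \<comment> \<open>The strict transform at infinity. The chart gives \<open>mon \<beta>\<close> a
      factor x_k, so every term carries x_k^d; at the origin only \<open>u\<close> survives because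
      the remaining monomial still contains x_i.\<close>
    define W where "W x = u (\<psi> x) + (\<Sum>j<d-1. ((x$k) ^ (\<beta> i - 1) * mon \<beta> x) ^ (d - j) * v j (\<psi> x))" for x
    have ch: "chart S \<psi> (\<lambda>x. x$k)"
      using fam_chart[OF fam_blowup[OF iS k ik] insertI1] by (simp add: \<psi>_def[abs_def])
    have mon_\<psi>: "mon \<beta> (\<psi> x) = x$k * ((x$k) ^ (\<beta> i - 1) * mon \<beta> x)" for x
    proof -
      have "mon \<beta> x = (x$i) ^ \<beta> i * mon (\<beta>(i := 0)) x" using mon_upd[of \<beta> x i "x$i"] by simp
      moreover have "mon \<beta> (\<psi> x) = (x$k) ^ \<beta> i * ((x$i) ^ \<beta> i * mon (\<beta>(i := 0)) x)"
        by (simp add: \<psi>_def mon_upd power_mult_distrib)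
      moreover have "(x$k) ^ \<beta> i = x$k * (x$k) ^ (\<beta> i - 1)" using i1 by (simp add: power_eq_if)
      ultimately show ?thesis by simp
    qed
    have "\<forall>\<^sub>F x in nhds 0. f (\<psi> x) = (x$k)^d * W x"
      using chart_eventually[OF ch ev]
    proof eventually_elim
      case (elim x)
      have "mon \<beta> (\<psi> x) ^ (d - j) * v j (\<psi> x) * (x$k)^j =
          (x$k)^d * (((x$k) ^ (\<beta> i - 1) * mon \<beta> x) ^ (d - j) * v j (\<psi> x))" if "j < d - 1" for j
        unfolding mon_\<psi> power_mult_distrib[of "x$k"] split_pow[OF that, of "x$k", symmetric] by (simp only: mult_ac)
      then have sum_eq: "(\<Sum>j<d-1. mon \<beta> (\<psi> x) ^ (d - j) * v j (\<psi> x) * (x$k)^j) =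
          (\<Sum>j<d-1. (x$k)^d * (((x$k) ^ (\<beta> i - 1) * mon \<beta> x) ^ (d - j) * v j (\<psi> x)))"
        by (intro sum.cong refl) simp_all
      have "\<psi> x $ k = x$k" using ik by (simp add: \<psi>_def)
      then show ?case
        unfolding W_def distrib_left sum_distrib_left sum_eq[symmetric] using elim by simp
    qed
    moreover have "mono_germ S (\<lambda>x. (x$k)^d * W x)"
    proof (intro mono_germ_mult mono_germ_power mono_germ_coord mono_germ_unit k)
      show "an W" unfolding W_def
        by (intro an_add an_sum an_mult an_power an_coord an_mon chart_an_compose[OF ch] u v)
      have dm: "dep S (mon \<beta>)" by (rule dep_mon) (use \<beta>S in auto)
      show "dep S W" unfolding W_def
        by (intro dep_add dep_sum dep_mult dep_power dep_coord k dm chart_dep_compose[OF ch] u v)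
      have "mon \<beta> 0 = (0::real)" using i1 by (auto simp: mon_eq_0_iff intro!: exI[of _ i])
      then have "W 0 = u 0" using chartD(1)[OF ch] by (auto simp: W_def intro!: sum.neutral)
      then show "W 0 \<noteq> 0" using u by simp
    qed
    ultimately have "mono_germ S (\<lambda>x. f (\<psi> x))" by (rule mono_germ_cong[rotated])
    moreover have "mono_germ S (\<lambda>x. \<psi> x $ l)" if "l \<in> S - {k}" for l
      using that k iS by (cases "l = i") (auto simp: \<psi>_def intro!: mono_germ_mult mono_germ_coord)
    ultimately have "res S k f \<psi> (\<lambda>x. x$k * 1)"
      using k by (auto simp: res_def intro: mono_germ_coord)
    then have "covers S (\<lambda>\<psi>' j'. res S k f (\<lambda>x. \<psi> (\<psi>' x)) (\<lambda>x. \<psi>' x $ k * j' x))"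
      by (intro coversI_id)
    with 1 show ?case by (simp add: \<psi>_def)
  next
    case (2 c a)
    define \<psi> where "\<psi> x = upd x k (x$i * x$k + a * x$i)" for x :: "real^'n"
    define g where "g x = (x$k + a)^d * u (\<psi> x) + (\<Sum>j<d-1. mon \<beta>' x ^ (d - j) * v j (\<psi> x) * (x$k + a)^j)" for x
    have ch: "chart S \<psi> (\<lambda>x. x$i)"
      using fam_chart[OF fam_blowup[OF iS k ik] insertI2[OF rangeI], of a] by (simp add: \<psi>_def[abs_def])
    have mon_\<psi>: "mon \<beta> (\<psi> x) = x$i * mon \<beta>' x" for x
      unfolding \<psi>_def mon_upd_0[of \<beta> k, OF \<beta>k] by (rule mon_\<beta>)
    have \<psi>k: "\<psi> x $ k = x$i * (x$k + a)" for x by (simp add: \<psi>_def algebra_simps)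
    have evg: "\<forall>\<^sub>F x in nhds 0. f (\<psi> x) = (x$i)^d * g x"
      using chart_eventually[OF ch ev]
    proof eventually_elim
      case (elim x)
      have "mon \<beta> (\<psi> x) ^ (d - j) * v j (\<psi> x) * (\<psi> x $ k)^j =
          (x$i)^d * (mon \<beta>' x ^ (d - j) * v j (\<psi> x) * (x$k + a)^j)" if "j < d - 1" for j
        unfolding mon_\<psi> \<psi>k power_mult_distrib split_pow[OF that, of "x$i", symmetric] by (simp only: mult_ac)
      then have sum_eq: "(\<Sum>j<d-1. mon \<beta> (\<psi> x) ^ (d - j) * v j (\<psi> x) * (\<psi> x $ k)^j) =
          (\<Sum>j<d-1. (x$i)^d * (mon \<beta>' x ^ (d - j) * v j (\<psi> x) * (x$k + a)^j))"
        by (intro sum.cong refl) simp_all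
      have "(\<psi> x $ k)^d * u (\<psi> x) = (x$i)^d * ((x$k + a)^d * u (\<psi> x))"
        unfolding \<psi>k power_mult_distrib by simp
      then show ?case
        unfolding g_def distrib_left sum_distrib_left sum_eq[symmetric] using elim by simp
    qed
    have "an g" unfolding g_def
      by (intro an_add an_sum an_mult an_power an_coord an_const an_mon chart_an_compose[OF ch] u v)
    have dm: "dep S (mon \<beta>')" by (rule dep_mon) (use \<beta>'S in auto)
    have "dep S g" unfolding g_def
      by (intro dep_add dep_sum dep_mult dep_power dep_coord dep_const k dm chart_dep_compose[OF ch] u v)
    have "covers S (res S k g)"
    proof (cases n)
      case 0
      then have "\<beta>' = (\<lambda>_. 0)" using \<beta>'n by (simp add: fun_eq_iff)
      then have m1: "mon \<beta>' x = 1" for x :: "real^'n" by simp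
      \<comment> \<open>Now \<beta> is exhausted, and on the axis \<open>g\<close> is exactly a
        polynomial in x_k + a, since the chart maps the whole axis to the origin.\<close>
      obtain d' q where q: "d' < d" "poly q 0 \<noteq> 0"
        "\<And>t. (t + a)^d * u 0 + (\<Sum>j<d-1. v j 0 * (t + a)^j) = t^d' * poly q t"
        using poly_order_drop[OF u(3) j0, of "\<lambda>j. v j 0" a] v(3) by blast
      have "g (axis k t) = t^d' * poly q t" for t
      proof -
        have "\<psi> (axis k t) = 0" using ik by (simp add: \<psi>_def vec_eq_iff axis_def)
        then show ?thesis using q(3)[of t] by (simp add: g_def m1)
      qed
      then have "reg k d' g"
        unfolding reg_def using q(2) by (intro exI[of _ "\<lambda>x. poly q (x$k)"]) (simp add: an_poly)
      then show ?thesis by (rule IHd[OF q(1) \<open>an g\<close> \<open>dep S g\<close>])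
    next
      case (Suc m)
      show ?thesis
      proof (cases "a = 0")
        case True
        show ?thesis
        proof (rule less.IH[of m \<beta>' "\<lambda>x. u (\<psi> x)" "\<lambda>j x. v j (\<psi> x)"])
          show "\<forall>\<^sub>F x in nhds 0. g x = (x$k)^d * u (\<psi> x) + (\<Sum>j<d-1. mon \<beta>' x ^ (d - j) * v j (\<psi> x) * (x$k)^j)"
            by (simp add: g_def True)
        qed (use Suc \<beta>'n \<beta>'S u v chartD(1)[OF ch] in \<open>auto intro: chart_an_compose[OF ch] chart_dep_compose[OF ch]\<close>)
      next
        case False
        have "\<exists>l. \<beta>' l \<noteq> 0"
        proof (rule ccontr)
          assume "\<not> (\<exists>l. \<beta>' l \<noteq> 0)"
          with \<beta>'n Suc show False by simp
        qed
        \<comment> \<open>A remaining factor of \<open>mon \<beta>'\<close> kills the lower terms at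
          the origin, where only a^d u(0) is left.\<close>
        then have "mon \<beta>' 0 = (0::real)" by (auto simp: mon_eq_0_iff)
        then have "g 0 = a^d * u 0" using chartD(1)[OF ch] by (auto simp: g_def intro!: sum.neutral)
        then have "g 0 \<noteq> 0" using False u by simp
        then have "reg k 0 g" by (rule reg_0[OF \<open>an g\<close>])
        from IHd[OF _ \<open>an g\<close> \<open>dep S g\<close> this] show ?thesis using j0 by simp
      qed
    qed
    from covers_res_upd[of i S k \<psi> f d g, OF i _ evg this]
    have "covers S (\<lambda>\<psi>' j'. res S k f (\<lambda>x. \<psi> (\<psi>' x)) (\<lambda>x. \<psi>' x $ i * j' x))"
      by (simp add: \<psi>_def)
    with 2 show ?case by (simp add: \<psi>_def)
  qed
qed

lemma an_mult_nonzero: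
  assumes "an f" "an g" "\<not> (\<forall>\<^sub>F x in nhds 0. f x = 0)" "\<not> (\<forall>\<^sub>F x in nhds 0. g x = 0)"
  shows "\<not> (\<forall>\<^sub>F x in nhds 0. f x * g x = 0)"
  using an_mult_eq_0[OF assms(1,2)] assms(3,4) by blast

lemma an_prod_nonzero:
  assumes "finite I" "\<And>i. i \<in> I \<Longrightarrow> an (f i)" "\<And>i. i \<in> I \<Longrightarrow> \<not> (\<forall>\<^sub>F x in nhds (0::real^'n::finite). f i x = 0)"
  shows "\<not> (\<forall>\<^sub>F x in nhds 0. (\<Prod>i\<in>I. f i x) = 0)"
  using assms
proof (induction I rule: finite_induct)
  case (insert i I)
  have "\<not> (\<forall>\<^sub>F x in nhds 0. f i x * (\<Prod>i\<in>I. f i x) = 0)"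
    by (rule an_mult_nonzero) (use insert in \<open>auto intro: an_prod\<close>)
  with insert show ?case by simp
qed simp

lemma mono_germ_prod_factor:
  assumes "finite I" "\<And>i. i \<in> I \<Longrightarrow> an (f i)" "\<And>i. i \<in> I \<Longrightarrow> dep S (f i)"
    "mono_germ S (\<lambda>x. \<Prod>i\<in>I. f i x)" "i \<in> I"
  shows "mono_germ S (f i)"
proof (rule mono_germ_factor)
  show "an (\<lambda>x. \<Prod>l\<in>I-{i}. f l x)" "dep S (\<lambda>x. \<Prod>l\<in>I-{i}. f l x)"
    using assms by (auto intro: an_prod dep_prod)
  have "(\<Prod>i\<in>I. f i x) = f i x * (\<Prod>l\<in>I-{i}. f l x)" for x
    by (rule prod.remove) (use assms in auto)
  with assms(4) show "mono_germ S (\<lambda>x. f i x * (\<Prod>l\<in>I-{i}. f l x))" by simp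
qed (use assms in auto)

text \<open>Total degree is strictly monotone, so nothing lies strictly below an element that
  minimizes it; comparability does the rest.\<close>

lemma chain_min:
  fixes \<beta> :: "'a \<Rightarrow> 'n::finite \<Rightarrow> nat"
  assumes "z \<in> Z" and cmp: "\<And>a b. a \<in> Z \<Longrightarrow> b \<in> Z \<Longrightarrow> (\<forall>l. \<beta> a l \<le> \<beta> b l) \<or> (\<forall>l. \<beta> b l \<le> \<beta> a l)"
  obtains j where "j \<in> Z" "\<And>b l. b \<in> Z \<Longrightarrow> \<beta> j l \<le> \<beta> b l"
proof -
  obtain j where j: "j \<in> Z" "\<And>b. b \<in> Z \<Longrightarrow> (\<Sum>l\<in>UNIV. \<beta> j l) \<le> (\<Sum>l\<in>UNIV. \<beta> b l)"
    using ex_has_least_nat[of "\<lambda>j. j \<in> Z" z "\<lambda>j. \<Sum>l\<in>UNIV. \<beta> j l"] assms(1) by blast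
  show ?thesis
  proof (rule that[OF j(1)], rule ccontr)
    fix b l assume b: "b \<in> Z" and l: "\<not> \<beta> j l \<le> \<beta> b l"
    then have "\<forall>l. \<beta> b l \<le> \<beta> j l" using cmp[OF j(1) b] by blast
    then have "(\<Sum>l\<in>UNIV. \<beta> b l) < (\<Sum>l\<in>UNIV. \<beta> j l)"
      using l by (intro sum_strict_mono_ex1) (auto simp: not_le)
    with j(2)[OF b] show False by simp
  qed
qed

text \<open>All requirements go into one product: the germs, the differences of their powers with
  exponents \<open>m\<close>, and the coordinates. Making it monomial makes every factor monomial,
  and monomial differences force comparable exponents. The coordinates are included so that
  monomials pull back to monomials under the chart.\<close>

lemma covers_comparable:
  fixes c :: "'i \<Rightarrow> real^'n::finite \<Rightarrow> real" and m :: "'i \<Rightarrow> nat"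
  assumes mon_S: "\<And>f. an f \<Longrightarrow> dep S f \<Longrightarrow> \<not> (\<forall>\<^sub>F x in nhds 0. f x = 0) \<Longrightarrow>
      covers S (\<lambda>\<psi> j. mono_germ S (\<lambda>x. f (\<psi> x)) \<and> mono_germ S j)"
    and Z: "finite Z" and c: "\<And>j. j \<in> Z \<Longrightarrow> an (c j)" "\<And>j. j \<in> Z \<Longrightarrow> dep S (c j)"
      "\<And>j. j \<in> Z \<Longrightarrow> \<not> (\<forall>\<^sub>F x in nhds 0. c j x = 0)"
  shows "covers S (\<lambda>\<psi> j. mono_germ S j \<and> (\<forall>i\<in>S. mono_germ S (\<lambda>x. \<psi> x $ i)) \<and>
    (\<exists>\<gamma> U. (\<forall>j\<in>Z. (\<forall>i. i \<notin> S \<longrightarrow> \<gamma> j i = 0) \<and> an (U j) \<and> dep S (U j) \<and> U j 0 \<noteq> 0 \<and>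
        (\<forall>\<^sub>F x in nhds 0. c j (\<psi> x) = mon (\<gamma> j) x * U j x)) \<and>
      (\<forall>a\<in>Z. \<forall>b\<in>Z. (\<forall>l. m a * \<gamma> a l \<le> m b * \<gamma> b l) \<or> (\<forall>l. m b * \<gamma> b l \<le> m a * \<gamma> a l))))"
proof -
  define e where "e j x = c j x ^ m j" for j x
  \<comment> \<open>An identically vanishing difference would make the whole product vanish. It is
    replaced by 1; \<open>mono_germ_comparable\<close> covers that case as well.\<close>
  define E where "E a b = (if (\<forall>\<^sub>F x in nhds 0. e a x - e b x = 0) then (\<lambda>x. 1) else (\<lambda>x. e a x - e b x))" for a b
  have an_E: "an (E a b)" "dep S (E a b)" "\<not> (\<forall>\<^sub>F x in nhds 0. E a b x = 0)" if "a \<in> Z" "b \<in> Z" for a b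
    using that by (auto simp: E_def e_def intro!: an_diff an_power dep_diff dep_power c)
  define G1 where "G1 x = (\<Prod>j\<in>Z. c j x)" for x
  define G2 where "G2 x = (\<Prod>p\<in>Z\<times>Z. E (fst p) (snd p) x)" for x
  define G3 where "G3 x = (\<Prod>i\<in>S. x$i)" for x :: "real^'n"
  have an_G: "an G1" "an G2" "an G3" "dep S G1" "dep S G2" "dep S G3"
    unfolding G1_def G2_def G3_def
    using an_E c by (auto intro!: an_prod dep_prod dep_coord)
  have "\<not> (\<forall>\<^sub>F x in nhds 0. G1 x = 0)"
    unfolding G1_def by (rule an_prod_nonzero[OF Z c(1,3)])
  moreover have "\<not> (\<forall>\<^sub>F x in nhds 0. G2 x = 0)"
    unfolding G2_def by (rule an_prod_nonzero) (use Z an_E in auto)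
  moreover have "\<not> (\<forall>\<^sub>F x in nhds 0. G3 x = 0)"
    unfolding G3_def by (rule mono_germ_not_0[of S]) (intro mono_germ_prod mono_germ_coord)
  ultimately have nz: "\<not> (\<forall>\<^sub>F x in nhds 0. G1 x * (G2 x * G3 x) = 0)"
    by (intro an_mult_nonzero an_mult an_G)
  show ?thesis
  proof (rule covers_weaken[OF mon_S[OF _ _ nz]])
    show "an (\<lambda>x. G1 x * (G2 x * G3 x))" "dep S (\<lambda>x. G1 x * (G2 x * G3 x))"
      by (intro an_mult dep_mult an_G)+
    fix \<psi>1 j1 assume ch1: "chart S \<psi>1 j1"
      and P1: "mono_germ S (\<lambda>x. G1 (\<psi>1 x) * (G2 (\<psi>1 x) * G3 (\<psi>1 x))) \<and> mono_germ S j1"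
    note aG = chart_an_compose[OF ch1 an_G(1)] chart_an_compose[OF ch1 an_G(2)] chart_an_compose[OF ch1 an_G(3)]
    note dG = chart_dep_compose[OF ch1 an_G(4)] chart_dep_compose[OF ch1 an_G(5)] chart_dep_compose[OF ch1 an_G(6)]
    have mG1: "mono_germ S (\<lambda>x. G1 (\<psi>1 x))"
      by (rule mono_germ_factor[OF aG(1) an_mult[OF aG(2,3)] dG(1) dep_mult[OF dG(2,3)] P1[THEN conjunct1]])
    have mG23: "mono_germ S (\<lambda>x. G2 (\<psi>1 x) * G3 (\<psi>1 x))"
      by (rule mono_germ_factor[OF an_mult[OF aG(2,3)] aG(1) dep_mult[OF dG(2,3)] dG(1)])
        (use P1 in \<open>simp add: mult.commute\<close>)
    have mG2: "mono_germ S (\<lambda>x. G2 (\<psi>1 x))"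
      by (rule mono_germ_factor[OF aG(2,3) dG(2,3) mG23])
    have mG3: "mono_germ S (\<lambda>x. G3 (\<psi>1 x))"
      by (rule mono_germ_factor[OF aG(3,2) dG(3,2)]) (use mG23 in \<open>simp add: mult.commute\<close>)
    have mc: "mono_germ S (\<lambda>x. c j (\<psi>1 x))" if "j \<in> Z" for j
      by (rule mono_germ_prod_factor[OF Z _ _ mG1[unfolded G1_def] that])
        (auto intro: chart_an_compose[OF ch1] chart_dep_compose[OF ch1] c)
    have mE: "mono_germ S (\<lambda>x. E a b (\<psi>1 x))" if "a \<in> Z" "b \<in> Z" for a b
    proof -
      have "mono_germ S (\<lambda>x. E (fst (a, b)) (snd (a, b)) (\<psi>1 x))"
        by (rule mono_germ_prod_factor[where f = "\<lambda>p x. E (fst p) (snd p) (\<psi>1 x)" and I = "Z \<times> Z"])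
          (use mG2[unfolded G2_def] Z that in
            \<open>auto intro!: chart_an_compose[OF ch1 an_E(1)] chart_dep_compose[OF ch1 an_E(2)]\<close>)
      then show ?thesis by simp
    qed
    have mx: "mono_germ S (\<lambda>x. \<psi>1 x $ i)" if "i \<in> S" for i
      by (rule mono_germ_prod_factor[OF _ _ _ mG3[unfolded G3_def] that])
        (auto intro: chartD(2)[OF ch1] chartD(4)[OF ch1])
    have "\<forall>j\<in>Z. \<exists>\<gamma>. \<exists>u. (\<forall>i. i \<notin> S \<longrightarrow> \<gamma> i = 0) \<and> an u \<and> dep S u \<and> u 0 \<noteq> 0 \<and>
        (\<forall>\<^sub>F x in nhds 0. c j (\<psi>1 x) = mon \<gamma> x * u x)"
      using mc unfolding mono_germ_def by (intro ballI)
    then obtain \<gamma> where "\<forall>j\<in>Z. \<exists>u. (\<forall>i. i \<notin> S \<longrightarrow> \<gamma> j i = 0) \<and> an u \<and> dep S u \<and> u 0 \<noteq> 0 \<and>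
        (\<forall>\<^sub>F x in nhds 0. c j (\<psi>1 x) = mon (\<gamma> j) x * u x)"
      by (rule bchoice[THEN exE])
    then obtain U where "\<forall>j\<in>Z. (\<forall>i. i \<notin> S \<longrightarrow> \<gamma> j i = 0) \<and> an (U j) \<and> dep S (U j) \<and> U j 0 \<noteq> 0 \<and>
        (\<forall>\<^sub>F x in nhds 0. c j (\<psi>1 x) = mon (\<gamma> j) x * U j x)"
      by (rule bchoice[THEN exE])
    note \<gamma>U' = bspec[OF this]
    have \<gamma>U: "\<And>i. i \<notin> S \<Longrightarrow> \<gamma> j i = 0" "an (U j)" "dep S (U j)" "U j 0 \<noteq> 0"
        "\<forall>\<^sub>F x in nhds 0. c j (\<psi>1 x) = mon (\<gamma> j) x * U j x" if "j \<in> Z" for j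
      using \<gamma>U'[OF that] by simp_all
    define \<beta> where "\<beta> j l = m j * \<gamma> j l" for j l
    have ev_e: "\<forall>\<^sub>F x in nhds 0. e j (\<psi>1 x) = mon (\<beta> j) x * U j x ^ m j" if "j \<in> Z" for j
      using \<gamma>U(5)[OF that] by eventually_elim (simp add: e_def power_mult_distrib \<beta>_def[abs_def] mon_mult_exp)
    have cmp: "(\<forall>l. \<beta> a l \<le> \<beta> b l) \<or> (\<forall>l. \<beta> b l \<le> \<beta> a l)" if a: "a \<in> Z" and b: "b \<in> Z" for a b
    proof (rule mono_germ_comparable)
      show "an (\<lambda>x. U a x ^ m a)" "an (\<lambda>x. U b x ^ m b)" using \<gamma>U(2) a b by (auto intro: an_power)
      show "U a 0 ^ m a \<noteq> 0" "U b 0 ^ m b \<noteq> 0" using \<gamma>U(4) a b by auto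
      have eq: "\<forall>\<^sub>F x in nhds 0. mon (\<beta> a) x * U a x ^ m a - mon (\<beta> b) x * U b x ^ m b = e a (\<psi>1 x) - e b (\<psi>1 x)"
        using ev_e[OF a] ev_e[OF b] by eventually_elim simp
      show "(\<forall>\<^sub>F x in nhds 0. mon (\<beta> a) x * U a x ^ m a - mon (\<beta> b) x * U b x ^ m b = 0) \<or>
        mono_germ UNIV (\<lambda>x. mon (\<beta> a) x * U a x ^ m a - mon (\<beta> b) x * U b x ^ m b)"
      proof (cases "\<forall>\<^sub>F x in nhds 0. e a x - e b x = 0")
        case True
        from chart_eventually[OF ch1 this] eq
        have "\<forall>\<^sub>F x in nhds 0. mon (\<beta> a) x * U a x ^ m a - mon (\<beta> b) x * U b x ^ m b = 0"
          by eventually_elim simp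
        then show ?thesis ..
      next
        case False
        then have "mono_germ S (\<lambda>x. e a (\<psi>1 x) - e b (\<psi>1 x))" using mE[OF a b] by (simp add: E_def)
        from mono_germ_cong[OF mono_germ_mono[OF this subset_UNIV] eq] show ?thesis ..
      qed
    qed
    show "mono_germ S j1 \<and> (\<forall>i\<in>S. mono_germ S (\<lambda>x. \<psi>1 x $ i)) \<and>
      (\<exists>\<gamma> U. (\<forall>j\<in>Z. (\<forall>i. i \<notin> S \<longrightarrow> \<gamma> j i = 0) \<and> an (U j) \<and> dep S (U j) \<and> U j 0 \<noteq> 0 \<and>
          (\<forall>\<^sub>F x in nhds 0. c j (\<psi>1 x) = mon (\<gamma> j) x * U j x)) \<and>
        (\<forall>a\<in>Z. \<forall>b\<in>Z. (\<forall>l. m a * \<gamma> a l \<le> m b * \<gamma> b l) \<or> (\<forall>l. m b * \<gamma> b l \<le> m a * \<gamma> a l)))"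
      using P1 mx \<gamma>U cmp by (intro conjI exI[of _ \<gamma>] exI[of _ U]) (simp_all add: \<beta>_def)
  qed
qed

text \<open>The Newton polygon in several variables: each \<open>c j\<close> is to become the power
  d - j of one monomial times a germ, with a unit for some j0. Comparing the powers
  \<open>c j\<close> to the exponent d!/(d - j) finds the least slope, and the power map with N = d!
  makes the slopes integral, because N = (d - j) * m j.\<close>

lemma covers_prepared:
  fixes c :: "nat \<Rightarrow> real^'n::finite \<Rightarrow> real"
  assumes mon_S: "\<And>f. an f \<Longrightarrow> dep S f \<Longrightarrow> \<not> (\<forall>\<^sub>F x in nhds 0. f x = 0) \<Longrightarrow>
      covers S (\<lambda>\<psi> j. mono_germ S (\<lambda>x. f (\<psi> x)) \<and> mono_germ S j)"
    and c: "\<And>j. an (c j)" "\<And>j. dep S (c j)" "\<And>j. j < d \<Longrightarrow> c j 0 = 0"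
    and jz: "jz < d - 1" "\<not> (\<forall>\<^sub>F x in nhds 0. c jz x = 0)"
  shows "covers S (\<lambda>\<psi> j. mono_germ S j \<and> (\<forall>i\<in>S. mono_germ S (\<lambda>x. \<psi> x $ i)) \<and>
    (\<exists>\<beta> j0 v n. j0 < d - 1 \<and> (\<forall>i. i \<notin> S \<longrightarrow> \<beta> i = 0) \<and> (\<Sum>i\<in>UNIV. \<beta> i) = Suc n \<and>
      (\<forall>j. an (v j) \<and> dep S (v j)) \<and> v j0 0 \<noteq> 0 \<and>
      (\<forall>\<^sub>F x in nhds 0. \<forall>j<d-1. c j (\<psi> x) = mon \<beta> x ^ (d - j) * v j x)))"
    (is "covers S ?Q")
proof -
  define Z where "Z = {j. j < d - 1 \<and> \<not> (\<forall>\<^sub>F x in nhds 0. c j x = 0)}"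
  have finZ: "finite Z" by (simp add: Z_def)
  have Zd: "j < d" "j < d - 1" if "j \<in> Z" for j using that by (auto simp: Z_def)
  define N :: nat where "N = fact d"
  define m where "m j = N div (d - j)" for j
  have mN: "(d - j) * m j = N" if "j < d" for j
    using that by (simp add: m_def N_def dvd_fact)
  have m_pos: "m j > 0" if "j < d" for j
    using mN[OF that] by (intro Nat.gr0I) (simp add: N_def)
  have N1: "N \<ge> 1" by (simp add: N_def)
  have nzZ: "\<not> (\<forall>\<^sub>F x in nhds 0. c j x = 0)" if "j \<in> Z" for j using that by (simp add: Z_def)
  show ?thesis
  proof (rule covers_trans[OF covers_comparable[of S Z c m, OF mon_S finZ c(1,2) nzZ] order_refl], goal_cases)
    case (5 \<psi>1 j1)
    note ch1 = 5(1) and P1 = 5(2)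
    have mj1: "mono_germ S j1" and mx: "\<And>i. i \<in> S \<Longrightarrow> mono_germ S (\<lambda>x. \<psi>1 x $ i)" using P1 by auto
    obtain \<gamma> U where \<gamma>U': "\<forall>j\<in>Z. (\<forall>i. i \<notin> S \<longrightarrow> \<gamma> j i = 0) \<and> an (U j) \<and> dep S (U j) \<and> U j 0 \<noteq> 0 \<and>
          (\<forall>\<^sub>F x in nhds 0. c j (\<psi>1 x) = mon (\<gamma> j) x * U j x)"
        and cmp': "\<forall>a\<in>Z. \<forall>b\<in>Z. (\<forall>l. m a * \<gamma> a l \<le> m b * \<gamma> b l) \<or> (\<forall>l. m b * \<gamma> b l \<le> m a * \<gamma> a l)"
      using P1 by (elim exE conjE) (rule that)
    have \<gamma>U: "\<And>i. i \<notin> S \<Longrightarrow> \<gamma> j i = 0" "an (U j)" "dep S (U j)" "U j 0 \<noteq> 0"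
        "\<forall>\<^sub>F x in nhds 0. c j (\<psi>1 x) = mon (\<gamma> j) x * U j x" if "j \<in> Z" for j
      using bspec[OF \<gamma>U' that] by simp_all
    define \<beta> where "\<beta> j l = m j * \<gamma> j l" for j l
    have cmp: "(\<forall>l. \<beta> a l \<le> \<beta> b l) \<or> (\<forall>l. \<beta> b l \<le> \<beta> a l)" if a: "a \<in> Z" and b: "b \<in> Z" for a b
      using cmp' a b by (simp add: \<beta>_def)
    have "jz \<in> Z" using jz by (simp add: Z_def)
    then obtain j0 where j0: "j0 \<in> Z" "\<And>b l. b \<in> Z \<Longrightarrow> \<beta> j0 l \<le> \<beta> b l"
      using chain_min[of jz Z \<beta>, OF _ cmp] by blast
    show ?case
    proof (rule covers_weaken[OF covers_power[of S S N, OF order_refl N1]])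
      fix \<psi>2 j2 assume ch2: "chart S \<psi>2 j2" and P2: "mono_germ S j2 \<and>
         (\<exists>\<sigma>. (\<forall>i. \<sigma> i \<noteq> 0) \<and> (\<forall>x. \<psi>2 x = (\<chi> i. if i \<in> S then \<sigma> i * (x$i)^N else x$i)))"
      then obtain \<sigma> where \<sigma>: "\<And>i. \<sigma> i \<noteq> 0" "\<And>x. \<psi>2 x = (\<chi> i. if i \<in> S then \<sigma> i * (x$i)^N else x$i)" by blast
      have m2: "mono_germ S (\<lambda>x. \<psi>2 x $ i)" if "i \<in> S" for i
      proof -
        have "mono_germ S (\<lambda>x. \<sigma> i * (x$i)^N)"
          using that \<sigma>(1) by (intro mono_germ_mult mono_germ_unit mono_germ_power mono_germ_coord) auto
        then show ?thesis using that by (simp add: \<sigma>(2))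
      qed
      have mcomp: "mono_germ S (\<lambda>x. g (\<psi>2 x))" if "mono_germ S g" for g
        by (rule mono_germ_compose[OF that chartD(2)[OF ch2] chartD(1)[OF ch2] chartD(4)[OF ch2] m2])
      define s where "s j = (\<Prod>l\<in>UNIV. (if l \<in> S then \<sigma> l else 1) ^ \<gamma> j l)" for j
      have s: "s j \<noteq> 0" for j using \<sigma>(1) by (simp add: s_def)
      have mon_\<psi>2: "mon (\<gamma> j) (\<psi>2 x) = s j * mon (\<beta> j) x ^ (d - j)" if "j \<in> Z" for j x
      proof -
        have "mon (\<gamma> j) (\<psi>2 x) = (\<Prod>l\<in>UNIV. (if l \<in> S then \<sigma> l else 1) ^ \<gamma> j l * (x$l) ^ (N * \<gamma> j l))"
          unfolding mon_def using \<gamma>U(1)[OF that]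
          by (intro prod.cong refl) (auto simp: \<sigma>(2) power_mult_distrib power_mult)
        also have "\<dots> = s j * mon (\<lambda>l. N * \<gamma> j l) x" by (simp add: prod.distrib s_def mon_def)
        also have "(\<lambda>l. N * \<gamma> j l) = (\<lambda>l. (d - j) * \<beta> j l)"
          using mN[OF Zd(1)[OF that]] by (auto simp: \<beta>_def)
        finally show ?thesis by (simp add: mon_mult_exp)
      qed
      \<comment> \<open>Coefficients that vanish identically are outside \<open>Z\<close> and get
        the quotient 0.\<close>
      define v where "v j x = (if j \<in> Z then s j * (mon (\<lambda>l. \<beta> j l - \<beta> j0 l) x ^ (d - j) * U j (\<psi>2 x)) else 0)" for j x
      have ev_c: "\<forall>\<^sub>F x in nhds 0. c j (\<psi>1 (\<psi>2 x)) = mon (\<beta> j0) x ^ (d - j) * v j x" if "j < d - 1" for j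
      proof (cases "j \<in> Z")
        case True
        have "\<beta> j = (\<lambda>l. \<beta> j0 l + (\<beta> j l - \<beta> j0 l))" using j0(2)[OF True] by auto
        then have "mon (\<beta> j) x = mon (\<lambda>l. \<beta> j0 l + (\<beta> j l - \<beta> j0 l)) x" for x by simp
        then have "mon (\<beta> j) x = mon (\<beta> j0) x * mon (\<lambda>l. \<beta> j l - \<beta> j0 l) x" for x by (simp only: mon_add)
        then show ?thesis
          using chart_eventually[OF ch2 \<gamma>U(5)[OF True]] True
          by (auto elim!: eventually_mono simp: mon_\<psi>2 v_def power_mult_distrib)
      next
        case False
        then have "\<forall>\<^sub>F x in nhds 0. c j x = 0" using that by (simp add: Z_def)
        from chart_eventually[OF ch2 chart_eventually[OF ch1 this]] show ?thesis
          using False by (simp add: v_def)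
      qed
      have av: "an (v j) \<and> dep S (v j)" for j
      proof (cases "j \<in> Z")
        case True
        have "an (\<lambda>x. U j (\<psi>2 x))" "dep S (\<lambda>x. U j (\<psi>2 x))"
          by (rule chart_an_compose[OF ch2 \<gamma>U(2)[OF True]] chart_dep_compose[OF ch2 \<gamma>U(3)[OF True]])+
        moreover have "dep S (mon (\<lambda>l. \<beta> j l - \<beta> j0 l))"
          by (rule dep_mon) (use \<gamma>U(1)[OF True] in \<open>simp add: \<beta>_def\<close>)
        ultimately show ?thesis
          unfolding v_def using True by (simp add: an_mult an_power dep_mult dep_power)
      qed (simp add: v_def[abs_def])
      then have "\<forall>j. an (v j) \<and> dep S (v j)" by blast
      moreover have "v j0 0 \<noteq> 0"
        using j0(1) s \<gamma>U(4)[OF j0(1)] chartD(1)[OF ch2] by (simp add: v_def)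
      \<comment> \<open>\<open>c j0\<close> vanishes at the origin while its unit does not, so its
        monomial is not constant and the descent starts with positive degree.\<close>
      moreover have "\<exists>n. (\<Sum>i\<in>UNIV. \<beta> j0 i) = Suc n"
      proof -
        have "mon (\<gamma> j0) 0 * U j0 0 = c j0 0"
          using eventually_nhds_x_imp_x[OF \<gamma>U(5)[OF j0(1)]] chartD(1)[OF ch1] by simp
        then have "mon (\<gamma> j0) (0::real^'n) = 0" using c(3)[OF Zd(1)[OF j0(1)]] \<gamma>U(4)[OF j0(1)] by simp
        then obtain l where "\<gamma> j0 l > 0" by (auto simp: mon_eq_0_iff)
        then have "\<beta> j0 l > 0" using m_pos[OF Zd(1)[OF j0(1)]] by (simp add: \<beta>_def)
        moreover have "\<beta> j0 l \<le> (\<Sum>i\<in>UNIV. \<beta> j0 i)" by (rule member_le_sum) auto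
        ultimately show ?thesis by (intro exI[of _ "(\<Sum>i\<in>UNIV. \<beta> j0 i) - 1"]) simp
      qed
      moreover have "\<forall>i. i \<notin> S \<longrightarrow> \<beta> j0 i = 0" using \<gamma>U(1)[OF j0(1)] by (simp add: \<beta>_def)
      moreover have "\<forall>\<^sub>F x in nhds 0. \<forall>j\<in>{..<d-1}. c j (\<psi>1 (\<psi>2 x)) = mon (\<beta> j0) x ^ (d - j) * v j x"
        by (rule eventually_ball_finite) (use ev_c in auto)
      then have "\<forall>\<^sub>F x in nhds 0. \<forall>j<d-1. c j (\<psi>1 (\<psi>2 x)) = mon (\<beta> j0) x ^ (d - j) * v j x"
        by (simp add: lessThan_def)
      moreover have "mono_germ S (\<lambda>x. j1 (\<psi>2 x) * j2 x)"
        using mcomp[OF mj1] P2 by (intro mono_germ_mult) auto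
      moreover have "\<forall>i\<in>S. mono_germ S (\<lambda>x. \<psi>1 (\<psi>2 x) $ i)" using mcomp[OF mx] by blast
      ultimately show "?Q (\<lambda>x. \<psi>1 (\<psi>2 x)) (\<lambda>x. j1 (\<psi>2 x) * j2 x)"
        using Zd(2)[OF j0(1)] by (intro conjI) (assumption | elim exE, intro exI conjI, assumption+)+
    qed
  qed (use c Z_def in auto)
qed

text \<open>Induction on the order \<open>d\<close>. After the Tschirnhaus shift the coefficients
  involve only S - {k}; the hypothesis for fewer variables prepares them, and the blow-up descent
  leads to germs of smaller order in x_k.\<close>

lemma covers_res:
  fixes f :: "real^'n::finite \<Rightarrow> real"
  assumes k: "k \<in> S"
    and mon_S: "\<And>f. an f \<Longrightarrow> dep (S - {k}) f \<Longrightarrow> \<not> (\<forall>\<^sub>F x in nhds 0. f x = 0) \<Longrightarrow>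
      covers (S - {k}) (\<lambda>\<psi> j. mono_germ (S - {k}) (\<lambda>x. f (\<psi> x)) \<and> mono_germ (S - {k}) j)"
  shows "an f \<Longrightarrow> dep S f \<Longrightarrow> reg k d f \<Longrightarrow> covers S (res S k f)"
proof (induction d arbitrary: f rule: less_induct)
  case (less d)
  have coord: "mono_germ S (\<lambda>x::real^'n. x$i)" if "i \<in> S" for i by (rule mono_germ_coord[OF that])
  show ?case
  proof (cases "d = 0")
    case True
    then obtain u where "u 0 \<noteq> 0" "\<forall>\<^sub>F x in nhds 0. f (axis k (x$k)) = u x"
      using less.prems(3) unfolding reg_def by auto
    from this(1) eventually_nhds_x_imp_x[OF this(2)] have "f 0 \<noteq> 0" by (simp add: iffD2[OF axis_eq_0_iff])
    then show ?thesis
      by (intro coversI_id) (auto simp: res_def intro!: mono_germ_unit less.prems coord)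
  next
    case False
    then have d: "d \<ge> 1" by simp
    obtain \<phi>0 c u where \<phi>0: "an \<phi>0" "\<phi>0 0 = 0" "dep (S - {k}) \<phi>0"
      and c': "\<forall>j. an (c j) \<and> dep (S - {k}) (c j)" "\<forall>j<d. c j 0 = 0" and u: "an u" "dep S u" "u 0 \<noteq> 0"
      and ev0: "\<forall>\<^sub>F x in nhds 0. f (upd x k (x$k + \<phi>0 x)) = (\<Sum>j<d-1. c j x * (x$k)^j) + (x$k)^d * u x"
      using tschirnhaus[OF less.prems(1,2) k less.prems(3) d] by (elim exE conjE) (rule that)
    have c: "an (c j)" "dep (S - {k}) (c j)" "j < d \<Longrightarrow> c j 0 = 0" for j using c' by auto
    \<comment> \<open>Charts have to be Borel maps, so the shift is replaced by a measurable version
      of the same germ.\<close>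
    obtain \<phi> where \<phi>: "an \<phi>" "dep (S - {k}) \<phi>" "\<phi> \<in> borel_measurable borel" "\<phi> 0 = \<phi>0 0" "\<forall>\<^sub>F x in nhds 0. \<phi> x = \<phi>0 x"
      by (rule an_borel_version[OF \<phi>0(1,3)])
    define f1 where "f1 x = f (upd x k (x$k + \<phi> x))" for x
    have ev1: "\<forall>\<^sub>F x in nhds 0. f1 x = (\<Sum>j<d-1. c j x * (x$k)^j) + (x$k)^d * u x"
      using ev0 \<phi>(5) by eventually_elim (simp add: f1_def)
    have "covers S (res S k f1)"
    proof (cases "\<forall>j<d-1. \<forall>\<^sub>F x in nhds 0. c j x = 0")
      case True
      then have "\<forall>\<^sub>F x in nhds 0. \<forall>j\<in>{..<d-1}. c j x = 0"
        by (intro eventually_ball_finite) auto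
      with ev1 have "\<forall>\<^sub>F x in nhds 0. f1 x = (x$k)^d * u x"
        by eventually_elim simp
      then have "mono_germ S f1"
        by (rule mono_germ_cong[rotated]) (intro mono_germ_mult mono_germ_power coord k mono_germ_unit u)
      then show ?thesis
        by (intro coversI_id) (auto simp: res_def intro!: mono_germ_unit coord)
    next
      case False
      then obtain jz where jz: "jz < d - 1" "\<not> (\<forall>\<^sub>F x in nhds 0. c jz x = 0)" by blast
      show ?thesis
      proof (rule covers_trans[OF covers_prepared[of "S - {k}" c d jz, OF mon_S c(1,2,3) jz]], goal_cases)
        case (6 \<psi> j)
        note ch = 6(1)
        have mj: "mono_germ (S - {k}) j" and mx: "\<And>i. i \<in> S - {k} \<Longrightarrow> mono_germ (S - {k}) (\<lambda>x. \<psi> x $ i)"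
          using 6(2) by auto
        obtain \<beta> j0 v n where P: "j0 < d - 1" "\<forall>i. i \<notin> S - {k} \<longrightarrow> \<beta> i = 0" "(\<Sum>i\<in>UNIV. \<beta> i) = Suc n"
          "\<forall>j. an (v j) \<and> dep (S - {k}) (v j)" "v j0 0 \<noteq> 0"
          "\<forall>\<^sub>F x in nhds 0. \<forall>j<d-1. c j (\<psi> x) = mon \<beta> x ^ (d - j) * v j x"
          using 6(2) by (elim exE conjE) (rule that)
        have ch': "chart S \<psi> j" by (rule chart_mono[OF ch]) auto
        have "covers S (res S k (\<lambda>x. f1 (\<psi> x)))"
        proof (rule blowup_descent[OF k _ P(1), of \<beta> n "\<lambda>x. u (\<psi> x)" v])
          show "covers S (res S k g)" if "d' < d" "an g" "dep S g" "reg k d' g" for d' g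
            by (rule less.IH[OF that])
          show "an (\<lambda>x. u (\<psi> x))" "dep S (\<lambda>x. u (\<psi> x))"
            by (rule chart_an_compose[OF ch' u(1)] chart_dep_compose[OF ch' u(2)])+
          show "u (\<psi> 0) \<noteq> 0" using u(3) chartD(1)[OF ch] by simp
          show "dep S (v j)" for j using P(4) by (auto intro: dep_mono)
          have \<psi>k: "\<psi> x $ k = x$k" for x by (rule chartD(3)[OF ch]) simp
          show "\<forall>\<^sub>F x in nhds 0. f1 (\<psi> x) = (x$k)^d * u (\<psi> x) + (\<Sum>j<d-1. mon \<beta> x ^ (d - j) * v j x * (x$k)^j)"
            using chart_eventually[OF ch ev1] P(6) by eventually_elim (simp add: \<psi>k)
        qed (use P in auto)
        then show ?case
        proof (rule covers_weaken)
          fix \<psi>' j' assume ch3: "chart S \<psi>' j'" and r: "res S k (\<lambda>x. f1 (\<psi> x)) \<psi>' j'"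
          \<comment> \<open>The k-th coordinate of \<psi>' need not be monomial, but a germ in S -
            {k} does not see it.\<close>
          have mcomp: "mono_germ S (\<lambda>x. g (\<psi>' x))" if "mono_germ (S - {k}) g" for g
            by (rule mono_germ_compose[OF that chartD(2)[OF ch3] chartD(1)[OF ch3]])
              (use chartD(4)[OF ch3] r in \<open>auto simp: res_def\<close>)
          show "res S k f1 (\<lambda>x. \<psi> (\<psi>' x)) (\<lambda>x. j (\<psi>' x) * j' x)"
            unfolding res_def using r mcomp[OF mj] mcomp[OF mx] by (auto simp: res_def intro!: mono_germ_mult)
        qed
      qed auto
    qed
    moreover have "fam S {(\<lambda>x. upd x k (x$k + \<phi> x), \<lambda>x. 1)}"
      by (rule fam_shift[OF k \<phi>(1-3)]) (simp add: \<phi> \<phi>0)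
    ultimately show ?thesis
      by (elim covers_step) (auto simp: res_def f1_def elim!: covers_weaken)
  qed
qed

text \<open>Induction on the number of variables in use: a linear shear makes \<open>f\<close>
  regular in the new variable \<open>k\<close>, and the induction hypothesis is what
  \<open>covers_res\<close> asks for in the remaining ones.\<close>

theorem covers_mono_germ:
  fixes f :: "real^'n::finite \<Rightarrow> real"
  shows "an f \<Longrightarrow> dep S f \<Longrightarrow> \<not> (\<forall>\<^sub>F x in nhds 0. f x = 0) \<Longrightarrow>
      covers S (\<lambda>\<psi> j. mono_germ S (\<lambda>x. f (\<psi> x)) \<and> mono_germ S j)"
  using finite[of S]
proof (induction S arbitrary: f rule: finite_induct)
  case empty
  have "f x = f 0" for x by (rule depD[OF empty(2)]) simp
  with empty have "f 0 \<noteq> 0" by auto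
  with empty show ?case by (intro coversI_id conjI mono_germ_unit) auto
next
  case (insert k S)
  have ins: "insert k S - {k} = S" using insert.hyps by auto
  obtain r where r: "r > 0"
    "\<And>p w. p \<in> RB r \<Longrightarrow> w \<in> RB r \<Longrightarrow> \<forall>\<^sub>F t in nhds 0. f (w + t *\<^sub>R (p - w)) = 0 \<Longrightarrow> f p = 0"
    by (rule an_line[OF insert.prems(1)]) (rule that)
  \<comment> \<open>Multiplication by x_k yields a point \<open>p\<close> off the hyperplane x_k = 0
    with f(p) \<noteq> 0, so that a shear can map the k-th axis to the line through
    \<open>p\<close>.\<close>
  have "\<not> (\<forall>\<^sub>F x in nhds 0. x$k * f x = 0)"
  proof (rule an_mult_nonzero)
    show "\<not> (\<forall>\<^sub>F x in nhds (0::real^'n). x$k = 0)"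
      by (rule mono_germ_not_0[OF mono_germ_coord[of k UNIV]]) simp
  qed (use insert.prems in auto)
  then obtain p where p: "p \<in> RB r" "p$k \<noteq> 0" "f p \<noteq> 0"
    using r(1) unfolding eventually_RB by auto
  define w where "w i = p$i / p$k" for i
  show ?case
  proof (rule covers_trans[OF covers_shear[of S "insert k S" k w] order_refl])
    fix \<psi> j assume ch: "chart (insert k S) \<psi> j"
      and P: "(\<forall>x. j x = 1) \<and> (\<forall>x. \<psi> x = (\<chi> i. if i \<in> S then x$i + w i * x$k else x$i))"
    define g where "g x = f (\<psi> x)" for x
    have g: "an g" "dep (insert k S) g"
      unfolding g_def by (rule chart_an_compose[OF ch insert.prems(1)] chart_dep_compose[OF ch insert.prems(2)])+
    have g_axis: "g (axis k t) = f (0 + (t / p$k) *\<^sub>R (p - 0))" for t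
      unfolding g_def by (rule depD[OF insert.prems(2)]) (use P insert.hyps p(2) in \<open>auto simp: axis_def w_def\<close>)
    \<comment> \<open>If \<open>g\<close> vanished on the axis near 0, then \<open>f\<close> would
      vanish on the line through \<open>p\<close> near 0, hence at \<open>p\<close> by the identity
      theorem.\<close>
    have "\<not> (\<forall>\<^sub>F t in nhds 0. g (axis k t) = 0)"
    proof
      assume ev: "\<forall>\<^sub>F t in nhds 0. g (axis k t) = 0"
      have "((\<lambda>t. t * p$k) \<longlongrightarrow> 0 * p$k) (nhds 0)" by (intro tendsto_intros filterlim_ident)
      then have "((\<lambda>t. t * p$k) \<longlongrightarrow> 0) (nhds 0)" by simp
      from eventually_compose_filterlim[OF ev this]
      have "\<forall>\<^sub>F t in nhds 0. f (0 + t *\<^sub>R (p - 0)) = 0" using p(2) by (simp add: g_axis)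
      from r(2)[OF p(1) _ this] r(1) p(3) show False by simp
    qed
    then obtain d where "reg k d g" using reg_exists[OF g(1)] by blast
    moreover have "covers S (\<lambda>\<psi> j. mono_germ S (\<lambda>x. f' (\<psi> x)) \<and> mono_germ S j)"
      if "an f'" "dep S f'" "\<not> (\<forall>\<^sub>F x in nhds 0. f' x = 0)" for f' :: "real^'n \<Rightarrow> real"
      by (rule insert.IH[OF that])
    ultimately have "covers (insert k S) (res (insert k S) k g)"
      using g by (intro covers_res) (simp_all add: ins)
    then show "covers (insert k S) (\<lambda>\<psi>' j'. mono_germ (insert k S) (\<lambda>x. f (\<psi> (\<psi>' x))) \<and>
        mono_germ (insert k S) (\<lambda>x. j (\<psi>' x) * j' x))"
      by (rule covers_weaken) (use P in \<open>auto simp: res_def g_def\<close>)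
  qed (use insert.hyps in auto)
qed

section \<open>A common chain of generators for finitely many germs\<close>

text \<open>The coefficients \<open>c\<close> are constants and the generators do not depend on
  \<open>h\<close>. Every linear combination of members of \<open>H\<close> thus expands in the same
  generators, with coefficients that are linear in the parameters.\<close>

definition chain_span :: "(real^'n::finite \<Rightarrow> real) set \<Rightarrow> nat \<Rightarrow> (real^'n \<Rightarrow> real^'n) \<Rightarrow> bool" where
  "chain_span H N \<psi> \<longleftrightarrow> (\<exists>M\<le>N. \<exists>\<beta> u. (\<forall>i k. i < k \<longrightarrow> k < M \<longrightarrow> (\<forall>l. \<beta> i l \<le> \<beta> k l) \<and> \<beta> i \<noteq> \<beta> k) \<and>
     (\<forall>i. an (u i) \<and> u i 0 \<noteq> 0) \<and>
     (\<forall>h\<in>H. \<exists>c. \<forall>\<^sub>F x in nhds 0. h (\<psi> x) = (\<Sum>i<M. c i * (mon (\<beta> i) x * u i x))))"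

lemma chain_spanE:
  assumes "chain_span H N \<psi>"
  obtains M \<beta> u where "M \<le> N" "\<And>i k l. i < k \<Longrightarrow> k < M \<Longrightarrow> \<beta> i l \<le> \<beta> k l" "\<And>i k. i < k \<Longrightarrow> k < M \<Longrightarrow> \<beta> i \<noteq> \<beta> k"
    "\<And>i. an (u i)" "\<And>i. u i 0 \<noteq> 0"
    "\<forall>h\<in>H. \<exists>c. \<forall>\<^sub>F x in nhds 0. h (\<psi> x) = (\<Sum>i<M. c i * (mon (\<beta> i) x * u i x))"
proof -
  obtain M \<beta> u where *: "M \<le> N" "\<forall>i k. i < k \<longrightarrow> k < M \<longrightarrow> (\<forall>l. \<beta> i l \<le> \<beta> k l) \<and> \<beta> i \<noteq> \<beta> k"
    "\<forall>i. an (u i) \<and> u i 0 \<noteq> 0"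
    "\<forall>h\<in>H. \<exists>c. \<forall>\<^sub>F x in nhds 0. h (\<psi> x) = (\<Sum>i<M. c i * (mon (\<beta> i) x * u i x))"
    using assms unfolding chain_span_def by (elim exE conjE) (rule that)
  show ?thesis
    by (rule that[OF *(1) _ _ _ _ *(4)]) (use *(2,3) in auto)
qed

lemma sum_lessThan_add: "(\<Sum>i<s + m. f i) = (\<Sum>i<s. f i) + (\<Sum>i<m. f (i + s :: nat) :: real)"
  by (induction m) (simp_all add: add_ac)

text \<open>Divide by the smallest generator, subtract the values at the origin, and repeat with one
  function less: the quotients vanish at the origin, so the next generator is strictly larger.\<close>

lemma covers_chain:
  fixes H :: "(real^'n::finite \<Rightarrow> real) set"
  assumes "finite H" "card H \<le> N" "\<And>h. h \<in> H \<Longrightarrow> an h"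
  shows "covers UNIV (\<lambda>\<psi> j. mono_germ UNIV j \<and> (\<forall>i. mono_germ UNIV (\<lambda>x. \<psi> x $ i)) \<and> chain_span H N \<psi>)"
  using assms
proof (induction N arbitrary: H)
  case 0
  then have "H = {}" by simp
  then have "chain_span H 0 (\<lambda>x. x)"
    unfolding chain_span_def by (intro exI[of _ 0] conjI exI[of _ "\<lambda>_ _. 0"] exI[of _ "\<lambda>_ _. 1"]) auto
  then show ?case
    by (intro coversI_id conjI mono_germ_unit allI mono_germ_coord) auto
next
  case (Suc N)
  define H' where "H' = {h \<in> H. \<not> (\<forall>\<^sub>F x in nhds 0. h x = 0)}"
  have H': "finite H'" "\<And>h. h \<in> H' \<Longrightarrow> an h" "\<And>h. h \<in> H' \<Longrightarrow> \<not> (\<forall>\<^sub>F x in nhds 0. h x = 0)" "H' \<subseteq> H"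
    using Suc.prems by (auto simp: H'_def)
  show ?case
  proof (cases "H' = {}")
    case True
    then have "\<forall>\<^sub>F x in nhds 0. h x = 0" if "h \<in> H" for h using that by (auto simp: H'_def)
    then have "chain_span H (Suc N) (\<lambda>x. x)"
      unfolding chain_span_def by (intro exI[of _ 0] conjI exI[of _ "\<lambda>_ _. 0"] exI[of _ "\<lambda>_ _. 1"]) auto
    then show ?thesis
      by (intro coversI_id conjI mono_germ_unit allI mono_germ_coord) auto
  next
    case False
    then obtain hz where hz: "hz \<in> H'" by blast
    have cg: "covers UNIV (\<lambda>\<psi> j. mono_germ UNIV (\<lambda>x. f (\<psi> x)) \<and> mono_germ UNIV j)"
      if "an f" "dep UNIV f" "\<not> (\<forall>\<^sub>F x in nhds 0. f x = 0)" for f :: "real^'n \<Rightarrow> real"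
      by (rule covers_mono_germ[OF that])
    have H'3: "\<not> (\<forall>\<^sub>F x in nhds 0. id h x = 0)" "an (id h)" "dep UNIV (id h)" if "h \<in> H'" for h
      using H' that by auto
    show ?thesis
    proof (rule covers_trans[OF covers_comparable[of UNIV H' id "\<lambda>_. 1", OF cg H'(1) H'3(2,3,1)] order_refl], goal_cases)
      case (7 \<psi>1 j1)
      note ch1 = 7(1)
      have mj1: "mono_germ UNIV j1" and mx1: "\<And>i. mono_germ UNIV (\<lambda>x. \<psi>1 x $ i)" using 7(2) by auto
      obtain \<gamma> U where \<gamma>U': "\<forall>h\<in>H'. (\<forall>i. i \<notin> UNIV \<longrightarrow> \<gamma> h i = 0) \<and> an (U h) \<and> dep UNIV (U h) \<and> U h 0 \<noteq> 0 \<and>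
            (\<forall>\<^sub>F x in nhds 0. id h (\<psi>1 x) = mon (\<gamma> h) x * U h x)"
          and cmp': "\<forall>a\<in>H'. \<forall>b\<in>H'. (\<forall>l. 1 * \<gamma> a l \<le> 1 * \<gamma> b l) \<or> (\<forall>l. 1 * \<gamma> b l \<le> 1 * \<gamma> a l)"
        using 7(2) by (elim exE conjE) (rule that)
      have \<gamma>U: "an (U h)" "U h 0 \<noteq> 0" "\<forall>\<^sub>F x in nhds 0. h (\<psi>1 x) = mon (\<gamma> h) x * U h x" if "h \<in> H'" for h
        using bspec[OF \<gamma>U' that] by simp_all
      have cmp: "(\<forall>l. \<gamma> a l \<le> \<gamma> b l) \<or> (\<forall>l. \<gamma> b l \<le> \<gamma> a l)" if "a \<in> H'" "b \<in> H'" for a b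
        using cmp' that by simp
      obtain h0 where h0: "h0 \<in> H'" "\<And>h l. h \<in> H' \<Longrightarrow> \<gamma> h0 l \<le> \<gamma> h l"
        using chain_min[of hz H' \<gamma>, OF hz cmp] by blast
      \<comment> \<open>The quotient by the least element \<open>h0\<close>; by minimality the
        truncated difference of exponents is the true one.\<close>
      define W where "W h x = mon (\<lambda>l. \<gamma> h l - \<gamma> h0 l) x * (U h x * inverse (U h0 x))" for h x
      define W0 where "W0 h x = W h x - W h 0" for h x
      have an_W: "an (W h)" if "h \<in> H'" for h
        unfolding W_def by (intro an_mult an_mon an_inverse \<gamma>U that h0)
      have ev_W: "\<forall>\<^sub>F x in nhds 0. h (\<psi>1 x) = (mon (\<gamma> h0) x * U h0 x) * W h x" if "h \<in> H'" for h
        using \<gamma>U(3)[OF that] an_eventually_nz[OF \<gamma>U(1,2)[OF h0(1)]]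
      proof eventually_elim
        case (elim x)
        have "\<gamma> h = (\<lambda>l. \<gamma> h0 l + (\<gamma> h l - \<gamma> h0 l))" using h0(2)[OF that] by auto
        then have "mon (\<gamma> h) x = mon (\<lambda>l. \<gamma> h0 l + (\<gamma> h l - \<gamma> h0 l)) x" by simp
        then have "mon (\<gamma> h) x = mon (\<gamma> h0) x * mon (\<lambda>l. \<gamma> h l - \<gamma> h0 l) x" by (simp only: mon_add)
        with elim show ?case by (simp add: W_def)
      qed
      \<comment> \<open>The quotient of \<open>h0\<close> by itself is 1 and needs no generator of
        its own, so one function fewer remains.\<close>
      define K where "K = W0 ` (H' - {h0})"
      have "card K \<le> N"
      proof -
        have "card K \<le> card (H' - {h0})" unfolding K_def by (rule card_image_le) (use H' in simp)
        also have "\<dots> = card H' - 1" using h0(1) H'(1) by simp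
        also have "\<dots> \<le> card H - 1" using card_mono[OF Suc.prems(1) H'(4)] by simp
        finally show ?thesis using Suc.prems(2) by simp
      qed
      moreover have "finite K" "\<And>h. h \<in> K \<Longrightarrow> an h"
        using H'(1) an_W by (auto simp: K_def W0_def[abs_def] intro!: an_diff)
      ultimately have cov: "covers UNIV (\<lambda>\<psi> j. mono_germ UNIV j \<and> (\<forall>i. mono_germ UNIV (\<lambda>x. \<psi> x $ i)) \<and> chain_span K N \<psi>)"
        by (intro Suc.IH)
      show ?case
      proof (rule covers_weaken[OF cov])
        fix \<psi>2 j2 assume ch2: "chart UNIV \<psi>2 j2"
          and P2: "mono_germ UNIV j2 \<and> (\<forall>i. mono_germ UNIV (\<lambda>x. \<psi>2 x $ i)) \<and> chain_span K N \<psi>2"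
        have mcomp: "mono_germ UNIV (\<lambda>x. g (\<psi>2 x))" if "mono_germ UNIV g" for g
          by (rule mono_germ_compose[OF that chartD(2)[OF ch2] chartD(1)[OF ch2]]) (use P2 in auto)
        obtain M \<beta> u where M: "M \<le> N" "\<And>i k l. i < k \<Longrightarrow> k < M \<Longrightarrow> \<beta> i l \<le> \<beta> k l" "\<And>i k. i < k \<Longrightarrow> k < M \<Longrightarrow> \<beta> i \<noteq> \<beta> k"
          "\<And>i. an (u i)" "\<And>i. u i 0 \<noteq> 0"
          "\<forall>h\<in>K. \<exists>c. \<forall>\<^sub>F x in nhds 0. h (\<psi>2 x) = (\<Sum>i<M. c i * (mon (\<beta> i) x * u i x))"
          by (rule chain_spanE[OF P2[THEN conjunct2, THEN conjunct2]]) (rule that)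
        \<comment> \<open>\<open>s\<close> is 1 if the recursive chain starts with exponent 0. That
          generator has coefficient 0 in every member of \<open>K\<close>, since these vanish at the
          origin and its unit does not. It is skipped, so that all later exponents of the new chain
          exceed \<delta> strictly.\<close>
        define s :: nat where "s = (if M > 0 \<and> \<beta> 0 = (\<lambda>_. 0) then 1 else 0)"
        define M' where "M' = M - s"
        have sM: "s + M' = M" by (auto simp: M'_def s_def)
        have \<beta>0: "\<beta> (i + s) \<noteq> (\<lambda>_. 0)" if "i < M'" for i
        proof
          assume 0: "\<beta> (i + s) = (\<lambda>_. 0)"
          have lt: "i + s < M" using that sM by simp
          have "\<beta> 0 = (\<lambda>_. 0)"
          proof (cases "i + s = 0")
            case False
            then have "\<beta> 0 l \<le> \<beta> (i + s) l" for l using M(2)[of 0 "i + s" l] lt by simp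
            then show ?thesis using 0 by (auto simp: fun_eq_iff)
          qed (use 0 in simp)
          then have "s = 1" using lt by (simp add: s_def)
          then show False using M(3)[of 0 "i + s"] lt 0 \<open>\<beta> 0 = (\<lambda>_. 0)\<close> by simp
        qed
        have span': "\<exists>c. \<forall>\<^sub>F x in nhds 0. W0 h (\<psi>2 x) = (\<Sum>i<M'. c i * (mon (\<beta> (i + s)) x * u (i + s) x))"
          if h: "h \<in> H' - {h0}" for h
        proof -
          have "W0 h \<in> K" using h by (auto simp: K_def)
          then obtain c where c: "\<forall>\<^sub>F x in nhds 0. W0 h (\<psi>2 x) = (\<Sum>i<M. c i * (mon (\<beta> i) x * u i x))"
            using M(6) by blast
          have split: "(\<Sum>i<M. c i * (mon (\<beta> i) x * u i x)) =
            (\<Sum>i<s. c i * (mon (\<beta> i) x * u i x)) + (\<Sum>i<M'. c (i + s) * (mon (\<beta> (i + s)) x * u (i + s) x))" for x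
            unfolding sM[symmetric] by (rule sum_lessThan_add)
          have "(\<Sum>i<s. c i * (mon (\<beta> i) x * u i x)) = 0" for x
          proof (cases "s = 0")
            case False
            then have s1: "s = 1" "M > 0" "\<beta> 0 = (\<lambda>_. 0)" by (auto simp: s_def split: if_splits)
            have "mon (\<beta> (i + s)) (0::real^'n) = 0" if "i < M'" for i
              using \<beta>0[OF that] by (auto simp: mon_eq_0_iff fun_eq_iff)
            then have "(\<Sum>i<M'. c (i + s) * (mon (\<beta> (i + s)) 0 * u (i + s) (0::real^'n))) = 0"
              by (intro sum.neutral) auto
            moreover have "W0 h (\<psi>2 0) = 0" using chartD(1)[OF ch2] by (simp add: W0_def)
            ultimately have "c 0 * u 0 0 = 0"
              using eventually_nhds_x_imp_x[OF c] split[of 0] s1 by simp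
            then have "c 0 = 0" using M(5)[of 0] by simp
            then show ?thesis using s1 by simp
          qed simp
          then show ?thesis using c by (intro exI[of _ "\<lambda>i. c (i + s)"]) (simp add: split)
        qed
        have "mono_germ UNIV (\<lambda>x. mon (\<gamma> h0) (\<psi>2 x) * U h0 (\<psi>2 x))"
          using mcomp[OF mono_germ_mult[OF mono_germ_mon mono_germ_unit[OF \<gamma>U(1)[OF h0(1)] dep_UNIV \<gamma>U(2)[OF h0(1)]]]]
          by simp
        then obtain \<delta> w where w: "an w" "w 0 \<noteq> 0"
          "\<forall>\<^sub>F x in nhds 0. mon (\<gamma> h0) (\<psi>2 x) * U h0 (\<psi>2 x) = mon \<delta> x * w x"
          unfolding mono_germ_def by blast
        \<comment> \<open>The monomial form of \<open>h0\<close> becomes the first generator and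
          multiplies all generators of the quotients.\<close>
        define \<beta>' where "\<beta>' i = (case i of 0 \<Rightarrow> \<delta> | Suc i \<Rightarrow> (\<lambda>l. \<delta> l + \<beta> (i + s) l))" for i
        define u' where "u' i = (case i of 0 \<Rightarrow> w | Suc i \<Rightarrow> (\<lambda>x. w x * u (i + s) x))" for i
        have gen: "(\<Sum>i<Suc M'. c i * (mon (\<beta>' i) x * u' i x)) =
           (mon \<delta> x * w x) * (c 0 + (\<Sum>i<M'. c (Suc i) * (mon (\<beta> (i + s)) x * u (i + s) x)))" for c x
          by (subst sum.lessThan_Suc_shift)
            (simp add: \<beta>'_def u'_def mon_add algebra_simps sum_distrib_left)
        have ch: "(\<forall>l. \<beta>' i l \<le> \<beta>' k l) \<and> \<beta>' i \<noteq> \<beta>' k" if ik: "i < k" "k < Suc M'" for i k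
        proof (cases i)
          case 0
          then obtain k' where k': "k = Suc k'" "k' < M'" using ik by (cases k) auto
          show ?thesis using \<beta>0[OF k'(2)] by (auto simp: \<beta>'_def 0 k'(1) fun_eq_iff)
        next
          case (Suc i')
          then obtain k' where k': "k = Suc k'" "k' < M'" "i' < k'" using ik by (cases k) auto
          have "i' + s < k' + s" "k' + s < M" using k' sM by auto
          from M(2)[OF this] M(3)[OF this] show ?thesis by (auto simp: \<beta>'_def Suc k'(1) fun_eq_iff)
        qed
        have span: "\<exists>c. \<forall>\<^sub>F x in nhds 0. h (\<psi>1 (\<psi>2 x)) = (\<Sum>i<Suc M'. c i * (mon (\<beta>' i) x * u' i x))" if "h \<in> H" for h
        proof -
          consider "h \<notin> H'" | "h = h0" | "h \<in> H' - {h0}" by blast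
          then show ?thesis
          proof cases
            case 1
            then have "\<forall>\<^sub>F x in nhds 0. h x = 0" using that by (simp add: H'_def)
            from chart_eventually[OF ch2 chart_eventually[OF ch1 this]]
            show ?thesis by (intro exI[of _ "\<lambda>_. 0"]) simp
          next
            case 2
            have "\<forall>\<^sub>F x in nhds 0. h (\<psi>1 (\<psi>2 x)) = mon \<delta> x * w x"
              using chart_eventually[OF ch2 \<gamma>U(3)[OF h0(1)]] w(3) by eventually_elim (simp add: 2)
            then show ?thesis
              unfolding gen by (intro exI[of _ "\<lambda>i. if i = 0 then 1 else 0"]) simp
          next
            case 3
            then obtain c where c: "\<forall>\<^sub>F x in nhds 0. W0 h (\<psi>2 x) = (\<Sum>i<M'. c i * (mon (\<beta> (i + s)) x * u (i + s) x))"
              using span' by blast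
            have "\<forall>\<^sub>F x in nhds 0. h (\<psi>1 (\<psi>2 x)) = (mon \<delta> x * w x) *
                (W h 0 + (\<Sum>i<M'. c i * (mon (\<beta> (i + s)) x * u (i + s) x)))"
              using chart_eventually[OF ch2 ev_W[OF DiffD1[OF 3]]] w(3) c
            proof eventually_elim
              case (elim x)
              have "W h (\<psi>2 x) = W h 0 + W0 h (\<psi>2 x)" by (simp add: W0_def)
              with elim show ?case by simp
            qed
            then show ?thesis
              unfolding gen by (intro exI[of _ "\<lambda>i. case i of 0 \<Rightarrow> W h 0 | Suc i \<Rightarrow> c i"]) simp
          qed
        qed
        have "chain_span H (Suc N) (\<lambda>x. \<psi>1 (\<psi>2 x))"
          unfolding chain_span_def
        proof (intro exI[of _ "Suc M'"] conjI exI[of _ \<beta>'] exI[of _ u'])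
          show "Suc M' \<le> Suc N" using M(1) by (simp add: M'_def)
          show "\<forall>i. an (u' i) \<and> u' i 0 \<noteq> 0"
            using M(4,5) w by (auto simp: u'_def split: nat.splits intro: an_mult)
        qed (use ch span in auto)
        moreover have "mono_germ UNIV (\<lambda>x. j1 (\<psi>2 x) * j2 x)"
          using mcomp[OF mj1] P2 by (intro mono_germ_mult) auto
        moreover have "\<forall>i. mono_germ UNIV (\<lambda>x. \<psi>1 (\<psi>2 x) $ i)" using mcomp[OF mx1] by blast
        ultimately show "mono_germ UNIV (\<lambda>x. j1 (\<psi>2 x) * j2 x) \<and> (\<forall>i. mono_germ UNIV (\<lambda>x. \<psi>1 (\<psi>2 x) $ i)) \<and>
            chain_span H (Suc N) (\<lambda>x. \<psi>1 (\<psi>2 x))" by blast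
      qed
    qed (use H' in auto)
  qed
qed

section \<open>One-dimensional sublevel estimates and the Vandermonde bound\<close>

text \<open>Greedy choice: a point within \<open>s\<close> of the infimum is taken and everything up
  to distance \<open>s\<close> beyond it is discarded, at a cost of measure at most 2 s per
  point.\<close>

lemma spaced_points:
  fixes T :: "real set"
  assumes "s > 0" "T \<in> sets borel" "T \<subseteq> {a..b}" "emeasure lborel T > ennreal (2 * real N * s)"
  shows "\<exists>p. (\<forall>i\<le>N. p i \<in> T) \<and> (\<forall>i<N. p i + s \<le> p (Suc i))"
  using assms(2-4)
proof (induction N arbitrary: T)
  case 0
  then have "T \<noteq> {}" by auto
  then obtain t where "t \<in> T" by blast
  then show ?case by (intro exI[of _ "\<lambda>_. t"]) auto
next
  case (Suc N)
  have "T \<noteq> {}" using Suc.prems(3) by auto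
  have bdd: "bdd_below T" using Suc.prems(2) by (rule bdd_below_mono[rotated]) simp
  obtain t where t: "t \<in> T" "t < Inf T + s"
    using cInf_lessD[OF \<open>T \<noteq> {}\<close>, of "Inf T + s"] assms(1) by auto
  define T' where "T' = T \<inter> {t + s..}"
  have [measurable]: "T \<in> sets borel" "T' \<in> sets borel" using Suc.prems(1) by (auto simp: T'_def)
  have "T \<subseteq> T' \<union> {Inf T..t + s}" using cInf_lower[OF _ bdd] by (auto simp: T'_def)
  then have "emeasure lborel T \<le> emeasure lborel (T' \<union> {Inf T..t + s})" by (intro emeasure_mono) auto
  also have "\<dots> \<le> emeasure lborel T' + emeasure lborel {Inf T..t + s}" by (intro emeasure_subadditive) auto
  also have "emeasure lborel {Inf T..t + s} \<le> ennreal (2 * s)"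
  proof -
    have "Inf T \<le> t" using t(1) bdd by (rule cInf_lower)
    then have "emeasure lborel {Inf T..t + s} = ennreal (t + s - Inf T)" using assms(1) by simp
    also have "\<dots> \<le> ennreal (2 * s)" using t by (intro ennreal_leI) simp
    finally show ?thesis .
  qed
  finally have "emeasure lborel T \<le> emeasure lborel T' + ennreal (2 * s)" by (simp add: add_left_mono)
  with Suc.prems(3) have "ennreal (2 * real (Suc N) * s) < emeasure lborel T' + ennreal (2 * s)" by (rule less_le_trans)
  moreover have "ennreal (2 * real (Suc N) * s) = ennreal (2 * real N * s) + ennreal (2 * s)"
    using assms(1) by (simp add: ennreal_plus[symmetric] algebra_simps del: ennreal_plus)
  ultimately have "ennreal (2 * real N * s) < emeasure lborel T'"
    by (metis add_right_mono not_le)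
  then obtain p where p: "\<forall>i\<le>N. p i \<in> T'" "\<forall>i<N. p i + s \<le> p (Suc i)"
    using Suc.IH[of T'] Suc.prems(2) by (auto simp: T'_def)
  show ?case
  proof (intro exI[of _ "\<lambda>i. case i of 0 \<Rightarrow> t | Suc i \<Rightarrow> p i"] conjI allI impI)
    show "(case i of 0 \<Rightarrow> t | Suc i \<Rightarrow> p i) \<in> T" if "i \<le> Suc N" for i
      using that t p by (cases i) (auto simp: T'_def)
    show "(case i of 0 \<Rightarrow> t | Suc i \<Rightarrow> p i) + s \<le> (case Suc i of 0 \<Rightarrow> t | Suc i \<Rightarrow> p i)" if "i < Suc N" for i
      using that p by (cases i) (auto simp: T'_def)
  qed
qed

text \<open>Each round applies the mean value theorem to the disjoint pairs p(2i), p(2i+1). The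
  number of points halves, the bound gains the factor 2 / s, and the gap between consecutive pairs
  keeps the new points \<open>s\<close> apart.\<close>

lemma spaced_small_deriv:
  fixes \<phi> :: "nat \<Rightarrow> real \<Rightarrow> real"
  assumes "s > 0" "\<And>k t. t \<in> {a..b} \<Longrightarrow> k < K \<Longrightarrow> (\<phi> k has_real_derivative \<phi> (Suc k) t) (at t)"
    "\<And>i. i < 2^K \<Longrightarrow> p i \<in> {a..b}" "\<And>i. Suc i < 2^K \<Longrightarrow> p i + s \<le> p (Suc i)"
    "\<And>i. i < 2^K \<Longrightarrow> \<bar>\<phi> 0 (p i)\<bar> < \<epsilon>"
  shows "\<exists>\<xi>\<in>{a..b}. \<bar>\<phi> K \<xi>\<bar> < \<epsilon> * (2 / s)^K"
  using assms(2-)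
proof (induction K arbitrary: \<phi> p \<epsilon>)
  case 0
  then show ?case using 0(2)[of 0] 0(4)[of 0] by (intro bexI[of _ "p 0"]) auto
next
  case (Suc K)
  have "\<exists>q. p (2 * i) < q \<and> q < p (Suc (2 * i)) \<and> \<bar>\<phi> 1 q\<bar> < 2 * \<epsilon> / s" if i: "i < 2^K" for i
  proof -
    have i2: "Suc (2 * i) < 2 ^ Suc K" using i by simp
    have gap: "p (2 * i) + s \<le> p (Suc (2 * i))" by (rule Suc.prems(3)[OF i2])
    have in_ab: "p (2 * i) \<in> {a..b}" "p (Suc (2 * i)) \<in> {a..b}" using Suc.prems(2)[of "2 * i"] Suc.prems(2)[OF i2] i2 by auto
    have "p (2 * i) < p (Suc (2 * i))" using gap assms(1) by simp
    then obtain q where q: "p (2 * i) < q" "q < p (Suc (2 * i))"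
      "\<phi> 0 (p (Suc (2 * i))) - \<phi> 0 (p (2 * i)) = (p (Suc (2 * i)) - p (2 * i)) * \<phi> 1 q"
      using MVT2[of "p (2 * i)" "p (Suc (2 * i))" "\<phi> 0" "\<phi> 1"] Suc.prems(1)[of _ 0] in_ab by auto
    have "s * \<bar>\<phi> 1 q\<bar> \<le> (p (Suc (2 * i)) - p (2 * i)) * \<bar>\<phi> 1 q\<bar>"
      using gap by (intro mult_right_mono) auto
    also have "\<dots> = \<bar>\<phi> 0 (p (Suc (2 * i))) - \<phi> 0 (p (2 * i))\<bar>"
      unfolding q(3) using gap assms(1) by (simp add: abs_mult)
    also have "\<dots> < 2 * \<epsilon>"
      using Suc.prems(4)[of "2 * i"] Suc.prems(4)[OF i2] i2 by linarith
    finally show ?thesis using q assms(1) by (intro exI[of _ q]) (simp add: field_simps)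
  qed
  then obtain q where q: "\<And>i. i < 2^K \<Longrightarrow> p (2 * i) < q i \<and> q i < p (Suc (2 * i)) \<and> \<bar>\<phi> 1 (q i)\<bar> < 2 * \<epsilon> / s"
    by metis
  have "\<exists>\<xi>\<in>{a..b}. \<bar>\<phi> (Suc K) \<xi>\<bar> < (2 * \<epsilon> / s) * (2 / s)^K"
  proof (rule Suc.IH[of "\<lambda>k. \<phi> (Suc k)" q])
    show "(\<phi> (Suc k) has_real_derivative \<phi> (Suc (Suc k)) t) (at t)" if "t \<in> {a..b}" "k < K" for k t
      using Suc.prems(1)[OF that(1), of "Suc k"] that(2) by simp
    show "q i \<in> {a..b}" if "i < 2^K" for i
      using q[OF that] Suc.prems(2)[of "2 * i"] Suc.prems(2)[of "Suc (2 * i)"] that by auto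
    show "q i + s \<le> q (Suc i)" if "Suc i < 2^K" for i
    proof -
      have "q i < p (Suc (2 * i))" "p (2 * Suc i) < q (Suc i)" using q[of i] q[OF that] that by auto
      moreover have "p (Suc (2 * i)) + s \<le> p (Suc (Suc (2 * i)))" by (rule Suc.prems(3)) (use that in simp)
      ultimately show ?thesis by simp
    qed
    show "\<bar>\<phi> (Suc 0) (q i)\<bar> < 2 * \<epsilon> / s" if "i < 2^K" for i using q[OF that] by simp
  qed
  then show ?case by (simp add: field_simps)
qed

text \<open>A larger set would contain 2^K points with gaps \<open>s\<close>, and then the K-th
  derivative would somewhere fall below \<open>A\<close>.\<close>

lemma sublevel_1d:
  fixes \<phi> :: "nat \<Rightarrow> real \<Rightarrow> real"
  assumes K: "K \<ge> 1" and A: "A > 0" and \<epsilon>: "\<epsilon> > 0"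
    and der: "\<And>k t. t \<in> {a..b} \<Longrightarrow> k < K \<Longrightarrow> (\<phi> k has_real_derivative \<phi> (Suc k) t) (at t)"
    and low: "\<And>t. t \<in> {a..b} \<Longrightarrow> A \<le> \<bar>\<phi> K t\<bar>"
    and T: "T \<in> sets borel" "T \<subseteq> {a..b}" "\<And>t. t \<in> T \<Longrightarrow> \<bar>\<phi> 0 t\<bar> < \<epsilon>"
  shows "emeasure lborel T \<le> ennreal (4 * 2^K * (\<epsilon> / A) powr (1 / K))"
proof (rule ccontr)
  \<comment> \<open>The solution of \<epsilon> (2 / s)^K = A.\<close>
  define s where "s = 2 * (\<epsilon> / A) powr (1 / K)"
  have s: "s > 0" using A \<epsilon> by (simp add: s_def)
  assume "\<not> ?thesis"
  then have "emeasure lborel T > ennreal (2 * real (2^K) * s)" by (simp add: s_def not_le mult_ac)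
  from spaced_points[OF s T(1,2) this] obtain p where p: "\<forall>i\<le>2^K. p i \<in> T" "\<forall>i<2^K. p i + s \<le> p (Suc i)" by blast
  have "\<exists>\<xi>\<in>{a..b}. \<bar>\<phi> K \<xi>\<bar> < \<epsilon> * (2 / s)^K"
    by (rule spaced_small_deriv[where \<phi> = \<phi> and p = p and s = s and K = K, OF s der]) (use p T in \<open>auto simp: subset_eq\<close>)
  moreover have "\<epsilon> * (2 / s)^K = A"
  proof -
    have "((\<epsilon> / A) powr (1 / K))^K = \<epsilon> / A"
      using A \<epsilon> K by (simp add: powr_realpow[symmetric] powr_powr)
    then show ?thesis using A \<epsilon> by (simp add: s_def power_divide field_simps)
  qed
  ultimately show False using low by force
qed

text \<open>Lagrange interpolation: \<open>p l\<close> vanishes at all nodes except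
  \<open>b l\<close>, so \<open>X l\<close> is recovered from the moments with the coefficients of
  \<open>p l\<close>. If all moments were small, all \<open>X l\<close> would be.\<close>

lemma vandermonde_lower:
  fixes b :: "nat \<Rightarrow> real"
  assumes inj: "inj_on b {..<M}" and M: "M \<ge> 1"
  shows "\<exists>c>0. \<forall>X. \<exists>k<M. c * (\<Sum>i<M. \<bar>X i\<bar>) \<le> \<bar>\<Sum>i<M. X i * b i ^ k\<bar>"
proof -
  define p where "p l = (\<Prod>i\<in>{..<M}-{l}. [:- b i, 1:])" for l
  have poly_p: "poly (p l) x = (\<Prod>i\<in>{..<M}-{l}. x - b i)" for l x
    by (simp add: p_def poly_prod)
  have deg: "degree (p l) < M" if "l < M" for l
  proof -
    have "degree (p l) \<le> (\<Sum>i\<in>{..<M}-{l}. degree [:- b i, 1:])"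
      unfolding p_def using degree_prod_sum_le[of "{..<M}-{l}" "\<lambda>i. [:- b i, 1:]"] by (simp add: o_def)
    also have "\<dots> = M - 1" using that by simp
    finally show ?thesis using M by simp
  qed
  have poly_sum': "poly (p l) x = (\<Sum>k<M. coeff (p l) k * x ^ k)" if "l < M" for l x
    unfolding poly_altdef
    by (rule sum.mono_neutral_left) (use deg[OF that] in \<open>auto simp: coeff_eq_0\<close>)
  have nz: "poly (p l) (b l) \<noteq> 0" if "l < M" for l
    using inj that by (auto simp: poly_p inj_on_def)
  define C where "C = (\<Sum>l<M. (\<Sum>k<M. \<bar>coeff (p l) k\<bar>) / \<bar>poly (p l) (b l)\<bar>) + 1"
  have "C > 0" unfolding C_def by (intro add_nonneg_pos sum_nonneg divide_nonneg_nonneg) auto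
  show ?thesis
  proof (intro exI[of _ "1 / C"] conjI allI)
    show "1 / C > 0" using \<open>C > 0\<close> by simp
    fix X :: "nat \<Rightarrow> real"
    define S where "S k = \<bar>\<Sum>i<M. X i * b i ^ k\<bar>" for k
    have "finite (S ` {..<M})" "S ` {..<M} \<noteq> {}" using M by (auto simp: lessThan_empty_iff)
    from Max_in[OF this] obtain k where k: "k < M" "S k = Max (S ` {..<M})" by auto
    have S_le: "S k' \<le> S k" if "k' < M" for k' unfolding k(2) using that by (intro Max_ge) auto
    have X_le: "\<bar>X l\<bar> \<le> (\<Sum>k<M. \<bar>coeff (p l) k\<bar>) / \<bar>poly (p l) (b l)\<bar> * S k" if l: "l < M" for l
    proof -
      have "X l * poly (p l) (b l) = (\<Sum>i<M. X i * poly (p l) (b i))"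
      proof -
        have "poly (p l) (b i) = 0" if "i < M" "i \<noteq> l" for i
          unfolding poly_p using that by auto
        then have "(\<Sum>i<M. X i * poly (p l) (b i)) = (\<Sum>i\<in>{l}. X i * poly (p l) (b i))"
          by (intro sum.mono_neutral_right) (use l in auto)
        then show ?thesis by simp
      qed
      also have "\<dots> = (\<Sum>i<M. \<Sum>k<M. coeff (p l) k * (X i * b i ^ k))"
        by (simp add: poly_sum'[OF l] sum_distrib_left mult_ac)
      also have "\<dots> = (\<Sum>k<M. coeff (p l) k * (\<Sum>i<M. X i * b i ^ k))"
        by (subst sum.swap) (simp add: sum_distrib_left)
      finally have "\<bar>X l\<bar> * \<bar>poly (p l) (b l)\<bar> = \<bar>\<Sum>k<M. coeff (p l) k * (\<Sum>i<M. X i * b i ^ k)\<bar>"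
        by (simp flip: abs_mult)
      also have "\<dots> \<le> (\<Sum>k<M. \<bar>coeff (p l) k\<bar> * S k)"
        unfolding S_def abs_mult[symmetric] by (rule sum_abs)
      also have "\<dots> \<le> (\<Sum>k'<M. \<bar>coeff (p l) k'\<bar> * S k)"
        by (intro sum_mono mult_left_mono S_le) auto
      also have "\<dots> = (\<Sum>k<M. \<bar>coeff (p l) k\<bar>) * S k" by (simp add: sum_distrib_right)
      finally show ?thesis using nz[OF l] by (simp add: field_simps)
    qed
    have "(\<Sum>l<M. \<bar>X l\<bar>) \<le> (\<Sum>l<M. (\<Sum>k<M. \<bar>coeff (p l) k\<bar>) / \<bar>poly (p l) (b l)\<bar> * S k)"
      by (intro sum_mono X_le) simp
    also have "\<dots> = (C - 1) * S k" by (simp add: C_def sum_distrib_right)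
    also have "\<dots> \<le> C * S k" by (intro mult_right_mono) (auto simp: S_def)
    finally show "\<exists>k<M. 1 / C * (\<Sum>i<M. \<bar>X i\<bar>) \<le> \<bar>\<Sum>i<M. X i * b i ^ k\<bar>"
      using k(1) \<open>C > 0\<close> by (intro exI[of _ k]) (simp add: S_def field_simps)
  qed
qed

section \<open>Derivatives along the dilation flow\<close>

text \<open>The derivative along the Euler field. It vanishes at the origin, so near 0 a unit is
  almost constant along the flow.\<close>

lemma an_euler:
  fixes w :: "real^'n::finite \<Rightarrow> real"
  assumes "an w"
  shows "\<exists>w'. an w' \<and> w' 0 = 0 \<and> (\<forall>\<^sub>F z in nhds 0. ((\<lambda>t. w (t *\<^sub>R z)) has_real_derivative w' z) (at 1))"
proof -
  obtain D where D: "\<forall>i. an (D i)"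
    "\<forall>\<^sub>F x in nhds 0. (w has_derivative (\<lambda>v. \<Sum>i\<in>UNIV. v$i * D i x)) (at x)"
    using an_deriv[OF assms] by (elim exE conjE) (rule that)
  define w' where "w' z = (\<Sum>i\<in>UNIV. z$i * D i z)" for z
  have "\<forall>\<^sub>F z in nhds 0. ((\<lambda>t. w (t *\<^sub>R z)) has_real_derivative w' z) (at 1)"
    using D(2)
  proof eventually_elim
    case (elim z)
    have "((\<lambda>t::real. t *\<^sub>R z) has_derivative (\<lambda>h. h *\<^sub>R z)) (at 1)"
      by (rule bounded_linear_imp_has_derivative[OF bounded_linear_scaleR_left])
    moreover have "(w has_derivative (\<lambda>v. \<Sum>i\<in>UNIV. v$i * D i z)) (at (1 *\<^sub>R z))" using elim by simp
    ultimately have "((\<lambda>t. w (t *\<^sub>R z)) has_derivative (\<lambda>h. \<Sum>i\<in>UNIV. (h *\<^sub>R z)$i * D i z)) (at 1)"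
      by (rule has_derivative_compose)
    moreover have "(\<lambda>h. \<Sum>i\<in>UNIV. (h *\<^sub>R z)$i * D i z) = (*) (w' z)"
      by (auto simp: w'_def sum_distrib_right sum_distrib_left mult_ac)
    ultimately show ?case by (simp add: has_field_derivative_def)
  qed
  moreover have "an w'" unfolding w'_def using D(1) by (intro an_sum an_mult an_coord) auto
  ultimately show ?thesis by (intro exI[of _ w']) (simp add: w'_def)
qed

lemma mon_scaleR: "mon \<beta> (c *\<^sub>R z) = c ^ (\<Sum>i\<in>UNIV. \<beta> i) * mon \<beta> z"
  by (simp add: mon_def power_mult_distrib prod.distrib power_sum)

text \<open>Along the flow the i-th term is a constant times exp(b_i t) u_i. Its k-th derivative is
  governed by \<open>W i k\<close>, whose value at 0 is b_i^k u_i(0) because Euler derivatives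
  vanish there. On a small box the derivatives at t = 0 are thus Vandermonde combinations up to a
  small error. The order of the large derivative depends on \<open>a\<close> and \<open>z\<close>,
  but \<rho>, \<tau> and \<open>c\<close> do not.\<close>

lemma flow_sublevel:
  fixes u :: "nat \<Rightarrow> real^'n::finite \<Rightarrow> real"
  assumes M: "1 \<le> M" "M \<le> m + 1" and m: "m \<ge> 1"
    and chain: "\<forall>i k. i < k \<longrightarrow> k < M \<longrightarrow> (\<forall>l. \<beta> i l \<le> \<beta> k l) \<and> \<beta> i \<noteq> \<beta> k"
    and u: "\<And>i. an (u i)" "\<And>i. u i 0 \<noteq> 0"
  shows "\<exists>\<rho>>0. \<exists>\<tau>>0. \<tau> \<le> 1 \<and> (\<exists>c>0. \<forall>z\<in>RB \<rho>. \<forall>a. \<forall>\<epsilon>>0. \<forall>T.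
    T \<in> sets borel \<longrightarrow> T \<subseteq> {0..\<tau>} \<longrightarrow> (\<Sum>i<M. \<bar>a i * mon (\<beta> i) z\<bar>) > 0 \<longrightarrow>
    (\<forall>t\<in>T. \<bar>\<Sum>i<M. a i * (mon (\<beta> i) (exp t *\<^sub>R z) * u i (exp t *\<^sub>R z))\<bar> < \<epsilon>) \<longrightarrow>
    emeasure lborel T \<le> ennreal (4 * 2^m * (\<epsilon> / (c * (\<Sum>i<M. \<bar>a i * mon (\<beta> i) z\<bar>))) powr (1 / m)))"
proof -
  have \<beta>: "\<And>i k l. i < k \<Longrightarrow> k < M \<Longrightarrow> \<beta> i l \<le> \<beta> k l" "\<And>i k. i < k \<Longrightarrow> k < M \<Longrightarrow> \<beta> i \<noteq> \<beta> k"
    using chain by simp_all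
  define bn where "bn i = (\<Sum>l\<in>UNIV. \<beta> i l)" for i
  define b where "b i = real (bn i)" for i
  have bn_less: "bn i < bn k" if "i < k" "k < M" for i k
  proof -
    have "\<exists>l. \<beta> i l < \<beta> k l"
    proof (rule ccontr)
      assume "\<not> (\<exists>l. \<beta> i l < \<beta> k l)"
      then have "\<beta> i = \<beta> k" using \<beta>(1)[OF that] by (intro ext antisym) (auto simp: not_less)
      with \<beta>(2)[OF that] show False ..
    qed
    then show ?thesis unfolding bn_def using \<beta>(1)[OF that] by (intro sum_strict_mono_ex1) auto
  qed
  have "inj_on b {..<M}"
  proof (rule inj_onI)
    fix i k assume "i \<in> {..<M}" "k \<in> {..<M}" "b i = b k"
    then show "i = k" using bn_less[of i k] bn_less[of k i] by (cases i k rule: linorder_cases) (auto simp: b_def)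
  qed
  from vandermonde_lower[OF this M(1)] obtain c0 where c0: "c0 > 0"
    "\<forall>X. \<exists>k<M. c0 * (\<Sum>i<M. \<bar>X i\<bar>) \<le> \<bar>\<Sum>i<M. X i * b i ^ k\<bar>" by blast
  have "\<forall>w::real^'n \<Rightarrow> real. \<exists>w'. an w \<longrightarrow> (an w' \<and> w' 0 = 0 \<and>
      (\<forall>\<^sub>F z in nhds 0. ((\<lambda>t. w (t *\<^sub>R z)) has_real_derivative w' z) (at 1)))"
    using an_euler by blast
  then obtain \<theta> where \<theta>': "\<forall>w::real^'n \<Rightarrow> real. an w \<longrightarrow> (an (\<theta> w) \<and> \<theta> w 0 = 0 \<and>
      (\<forall>\<^sub>F z in nhds 0. ((\<lambda>t. w (t *\<^sub>R z)) has_real_derivative \<theta> w z) (at 1)))"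
    by (rule choice[THEN exE])
  have \<theta>: "an (\<theta> w)" "\<theta> w 0 = 0" "\<forall>\<^sub>F z in nhds 0. ((\<lambda>t. w (t *\<^sub>R z)) has_real_derivative \<theta> w z) (at 1)"
    if "an w" for w :: "real^'n \<Rightarrow> real" using spec[OF \<theta>', of w] that by simp_all
  \<comment> \<open>Chosen so that the derivative of exp(b_i t) * W i k (exp t z) in
    \<open>t\<close> is the same expression with \<open>Suc k\<close>.\<close>
  define W where "W i = rec_nat (u i) (\<lambda>k w z. b i * w z + \<theta> w z)" for i
  have W0: "W i 0 = u i" and WS: "W i (Suc k) = (\<lambda>z. b i * W i k z + \<theta> (W i k) z)" for i k
    by (simp_all add: W_def)
  have an_W: "an (W i k)" for i k
    by (induction k) (auto simp: W0 WS u intro!: an_add an_mult \<theta>)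
  have W_0: "W i k 0 = b i ^ k * u i 0" for i k
    by (induction k) (simp_all add: W0 WS \<theta>(2)[OF an_W])
  define um where "um = Min ((\<lambda>i. \<bar>u i 0\<bar>) ` {..<M})"
  have um: "um > 0" "\<And>i. i < M \<Longrightarrow> um \<le> \<bar>u i 0\<bar>"
  proof -
    have "finite ((\<lambda>i. \<bar>u i 0\<bar>) ` {..<M})" "(\<lambda>i. \<bar>u i 0\<bar>) ` {..<M} \<noteq> {}" using M by (auto simp: lessThan_empty_iff)
    then show "um > 0" unfolding um_def using u(2) by (subst Min_gr_iff) auto
    show "um \<le> \<bar>u i 0\<bar>" if "i < M" for i unfolding um_def using that by (intro Min_le) auto
  qed
  \<comment> \<open>Half of the Vandermonde bound c0 * um; the deviations of \<open>W i k\<close>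
    from its value at 0 may consume the other half.\<close>
  define \<kappa> where "\<kappa> = c0 * um / 2"
  have \<kappa>: "\<kappa> > 0" using c0 um by (simp add: \<kappa>_def)
  have "\<forall>\<^sub>F z in nhds 0. \<bar>W i k z - W i k 0\<bar> < \<kappa> \<and> ((\<lambda>t. W i k (t *\<^sub>R z)) has_real_derivative \<theta> (W i k) z) (at 1)" for i k
    using tendstoD[OF an_tendsto[OF an_W] \<kappa>] \<theta>(3)[OF an_W] by eventually_elim (simp add: dist_real_def)
  then have "\<forall>\<^sub>F z in nhds 0. \<forall>i\<in>{..<M}. \<forall>k\<in>{..M}.
      \<bar>W i k z - W i k 0\<bar> < \<kappa> \<and> ((\<lambda>t. W i k (t *\<^sub>R z)) has_real_derivative \<theta> (W i k) z) (at 1)"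
    by (intro eventually_ball_finite ballI) auto
  then obtain \<rho>1 where \<rho>1: "\<rho>1 > 0" "\<forall>z\<in>RB \<rho>1. \<forall>i\<in>{..<M}. \<forall>k\<in>{..M}.
      \<bar>W i k z - W i k 0\<bar> < \<kappa> \<and> ((\<lambda>t. W i k (t *\<^sub>R z)) has_real_derivative \<theta> (W i k) z) (at 1)"
    unfolding eventually_RB by blast
  have W_near: "\<bar>W i k z - W i k 0\<bar> < \<kappa>"
    and W_der: "((\<lambda>t. W i k (t *\<^sub>R z)) has_real_derivative \<theta> (W i k) z) (at 1)"
    if "z \<in> RB \<rho>1" "i < M" "k \<le> M" for z i k
    using \<rho>1(2)[rule_format, OF that(1), of i k] that(2,3) by auto
  define Bd where "Bd = (\<Sum>i<M. \<Sum>k\<le>M. \<bar>W i k 0\<bar>) + \<kappa>"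
  have W_bd: "\<bar>W i k z\<bar> \<le> Bd" if "z \<in> RB \<rho>1" "i < M" "k \<le> M" for z i k
  proof -
    have "\<bar>W i k 0\<bar> \<le> (\<Sum>k\<le>M. \<bar>W i k 0\<bar>)"
      by (rule member_le_sum) (use that in auto)
    also have "\<dots> \<le> (\<Sum>i<M. \<Sum>k\<le>M. \<bar>W i k 0\<bar>)"
      by (rule member_le_sum[of i "{..<M}" "\<lambda>i. \<Sum>k\<le>M. \<bar>W i k 0\<bar>"]) (use that in \<open>auto intro: sum_nonneg\<close>)
    finally show ?thesis using W_near[OF that] by (simp add: Bd_def)
  qed
  have "Bd > 0" using \<kappa> by (simp add: Bd_def add_nonneg_pos sum_nonneg)
  define eb where "eb = exp (\<Sum>i<M. b i)"
  have eb: "exp (b i * t) \<le> eb" if "i < M" "t \<le> 1" for i t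
  proof -
    have "b i * t \<le> b i" using that by (simp add: b_def mult_left_le)
    also have "\<dots> \<le> (\<Sum>i<M. b i)" by (rule member_le_sum) (use that in \<open>auto simp: b_def\<close>)
    finally show ?thesis by (simp add: eb_def)
  qed
  have "eb > 0" by (simp add: eb_def)
  \<comment> \<open>On an interval of this length the chosen derivative loses at most half of its
    lower bound \<kappa> L at t = 0, since eb * Bd * L bounds the next derivative.\<close>
  define \<tau> where "\<tau> = min 1 (\<kappa> / (2 * (eb * Bd)))"
  have \<tau>: "\<tau> > 0" "\<tau> \<le> 1" "\<tau> * (eb * Bd) \<le> \<kappa> / 2"
  proof -
    show "\<tau> > 0" "\<tau> \<le> 1" using \<kappa> \<open>eb > 0\<close> \<open>Bd > 0\<close> by (auto simp: \<tau>_def)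
    have "\<tau> * (eb * Bd) \<le> \<kappa> / (2 * (eb * Bd)) * (eb * Bd)"
      by (rule mult_right_mono) (use \<open>eb > 0\<close> \<open>Bd > 0\<close> in \<open>auto simp: \<tau>_def\<close>)
    also have "\<dots> = \<kappa> / 2" using \<open>eb > 0\<close> \<open>Bd > 0\<close> by simp
    finally show "\<tau> * (eb * Bd) \<le> \<kappa> / 2" .
  qed
  \<comment> \<open>For t \<le> 1 the flow expands by at most \<open>exp 1\<close>, which is at most
    3: orbits starting in the box of radius \<rho>1 / 3 stay in the box of radius \<rho>1.\<close>
  have pos: "\<rho>1 / 3 > 0" "\<kappa> / 2 > 0" using \<rho>1 \<kappa> by auto
  show ?thesis
  proof (rule exI[of _ "\<rho>1 / 3"], rule conjI[OF pos(1)], rule exI[of _ \<tau>], rule conjI[OF \<tau>(1)], rule conjI[OF \<tau>(2)],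
      rule exI[of _ "\<kappa> / 2"], rule conjI[OF pos(2)], intro ballI allI impI)
    fix z :: "real^'n" and a :: "nat \<Rightarrow> real" and \<epsilon> :: real and T
    assume z: "z \<in> RB (\<rho>1 / 3)" and \<epsilon>: "\<epsilon> > 0" and T: "T \<in> sets borel" "T \<subseteq> {0..\<tau>}"
      and L0: "(\<Sum>i<M. \<bar>a i * mon (\<beta> i) z\<bar>) > 0"
      and Tl: "\<forall>t\<in>T. \<bar>\<Sum>i<M. a i * (mon (\<beta> i) (exp t *\<^sub>R z) * u i (exp t *\<^sub>R z))\<bar> < \<epsilon>"
    define X where "X i = a i * mon (\<beta> i) z" for i
    define L where "L = (\<Sum>i<M. \<bar>X i\<bar>)"
    have L: "L > 0" using L0 by (simp add: L_def X_def)
    define \<phi> where "\<phi> k t = (\<Sum>i<M. X i * (exp (b i * t) * W i k (exp t *\<^sub>R z)))" for k t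
    have inR: "exp t *\<^sub>R z \<in> RB \<rho>1" if "t \<in> {0..\<tau>}" for t
    proof -
      have "exp t \<le> exp 1" using that \<tau>(2) by simp
      then have "exp t \<le> 3" using exp_le by linarith
      then have "\<bar>exp t * z$i\<bar> < \<rho>1" for i
      proof -
        have "\<bar>exp t * z$i\<bar> = exp t * \<bar>z$i\<bar>" by (simp add: abs_mult)
        also have "\<dots> \<le> 3 * \<bar>z$i\<bar>" using \<open>exp t \<le> 3\<close> by (intro mult_right_mono) auto
        also have "\<dots> < \<rho>1" using RB_nth[OF z, of i] by simp
        finally show ?thesis .
      qed
      then show ?thesis by (simp add: RB_iff)
    qed
    have \<phi>0: "\<phi> 0 t = (\<Sum>i<M. a i * (mon (\<beta> i) (exp t *\<^sub>R z) * u i (exp t *\<^sub>R z)))" for t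
      by (simp add: \<phi>_def X_def W0 mon_scaleR bn_def[symmetric] b_def exp_of_nat_mult[symmetric] mult_ac)
    have der: "(\<phi> k has_real_derivative \<phi> (Suc k) t) (at t)" if t: "t \<in> {0..\<tau>}" and k: "k < M" for k t
      unfolding \<phi>_def
    proof (rule DERIV_sum)
      fix i assume "i \<in> {..<M}"
      then have i: "i < M" by simp
      have "((\<lambda>s. exp (s - t)) has_real_derivative exp (t - t) * (1 - 0)) (at t)"
        by (intro DERIV_fun_exp DERIV_diff DERIV_ident DERIV_const)
      then have "((\<lambda>s. exp (s - t)) has_real_derivative 1) (at t)" by simp
      moreover have "((\<lambda>s. W i k (s *\<^sub>R (exp t *\<^sub>R z))) has_real_derivative \<theta> (W i k) (exp t *\<^sub>R z)) (at (exp (t - t)))"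
        using W_der[OF inR[OF t] i] k by simp
      ultimately have "((\<lambda>s. W i k (exp (s - t) *\<^sub>R (exp t *\<^sub>R z))) has_real_derivative \<theta> (W i k) (exp t *\<^sub>R z) * 1) (at t)"
        by (rule DERIV_chain2[rotated])
      then have d1: "((\<lambda>s. W i k (exp s *\<^sub>R z)) has_real_derivative \<theta> (W i k) (exp t *\<^sub>R z)) (at t)"
        by (simp add: exp_diff)
      have d2: "((\<lambda>s. exp (b i * s)) has_real_derivative exp (b i * t) * (b i * 1)) (at t)"
        by (intro DERIV_fun_exp DERIV_cmult DERIV_ident)
      from DERIV_cmult[OF DERIV_mult[OF d2 d1], of "X i"]
      show "((\<lambda>t. X i * (exp (b i * t) * W i k (exp t *\<^sub>R z))) has_real_derivative
          X i * (exp (b i * t) * W i (Suc k) (exp t *\<^sub>R z))) (at t)"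
        by (simp add: WS algebra_simps)
    qed
    have bound: "\<bar>\<phi> k t\<bar> \<le> eb * Bd * L" if t: "t \<in> {0..\<tau>}" and k: "k \<le> M" for k t
    proof -
      have "\<bar>\<phi> k t\<bar> \<le> (\<Sum>i<M. \<bar>X i\<bar> * (exp (b i * t) * \<bar>W i k (exp t *\<^sub>R z)\<bar>))"
        unfolding \<phi>_def by (rule order_trans[OF sum_abs]) (simp add: abs_mult)
      also have "\<dots> \<le> (\<Sum>i<M. \<bar>X i\<bar> * (eb * Bd))"
        using t \<tau>(2) k \<open>eb > 0\<close> by (intro sum_mono mult_left_mono mult_mono eb W_bd inR) auto
      finally show ?thesis by (simp add: L_def sum_distrib_left mult_ac)
    qed
    obtain k where k: "k < M" "c0 * (\<Sum>i<M. \<bar>X i * u i 0\<bar>) \<le> \<bar>\<Sum>i<M. X i * u i 0 * b i ^ k\<bar>"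
      using c0(2)[rule_format, of "\<lambda>i. X i * u i 0"] by blast
    have "\<kappa> * L \<le> \<bar>\<phi> k 0\<bar>"
    proof -
      have "c0 * (um * L) \<le> c0 * (\<Sum>i<M. \<bar>X i * u i 0\<bar>)"
        unfolding L_def sum_distrib_left[of um] abs_mult
        using c0 um by (intro mult_left_mono sum_mono) (auto simp: mult.commute[of um] intro!: mult_left_mono)
      also note k(2)
      also have "\<bar>\<Sum>i<M. X i * u i 0 * b i ^ k\<bar> \<le> \<bar>\<phi> k 0\<bar> + \<bar>\<phi> k 0 - (\<Sum>i<M. X i * u i 0 * b i ^ k)\<bar>" by linarith
      also have "\<bar>\<phi> k 0 - (\<Sum>i<M. X i * u i 0 * b i ^ k)\<bar> = \<bar>\<Sum>i<M. X i * (W i k z - W i k 0)\<bar>"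
        by (simp add: \<phi>_def W_0 sum_subtractf[symmetric] algebra_simps)
      also have "\<dots> \<le> (\<Sum>i<M. \<bar>X i\<bar> * \<bar>W i k z - W i k 0\<bar>)"
        by (rule order_trans[OF sum_abs]) (simp add: abs_mult)
      also have "\<dots> \<le> (\<Sum>i<M. \<bar>X i\<bar> * \<kappa>)"
      proof (intro sum_mono mult_left_mono)
        fix i assume "i \<in> {..<M}"
        moreover have "z \<in> RB \<rho>1" using inR[of 0] \<tau>(1) by simp
        ultimately show "\<bar>W i k z - W i k 0\<bar> \<le> \<kappa>" using W_near[of z i k] k(1) by simp
      qed auto
      also have "\<dots> = \<kappa> * L" by (simp add: L_def sum_distrib_left mult.commute)
      finally show ?thesis by (simp add: \<kappa>_def field_simps)
    qed
    have low: "\<kappa> / 2 * L \<le> \<bar>\<phi> k t\<bar>" if t: "t \<in> {0..\<tau>}" for t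
    proof -
      have "norm (\<phi> k t - \<phi> k 0) \<le> (eb * Bd * L) * norm (t - 0)"
      proof (rule field_differentiable_bound[of "{0..\<tau>}"])
        show "(\<phi> k has_real_derivative \<phi> (Suc k) s) (at s within {0..\<tau>})" if "s \<in> {0..\<tau>}" for s
          using der[OF that k(1)] by (rule has_field_derivative_at_within)
        show "norm (\<phi> (Suc k) s) \<le> eb * Bd * L" if "s \<in> {0..\<tau>}" for s
          using bound[OF that, of "Suc k"] k(1) by simp
      qed (use t \<tau> in auto)
      also have "\<dots> \<le> (eb * Bd * L) * \<tau>"
        using t \<open>eb > 0\<close> \<open>Bd > 0\<close> L by (intro mult_left_mono) auto
      also have "\<dots> \<le> \<kappa> / 2 * L"
        using mult_right_mono[OF \<tau>(3), of L] L by (simp add: mult_ac)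
      finally have "\<bar>\<phi> k t - \<phi> k 0\<bar> \<le> \<kappa> / 2 * L" by simp
      then show ?thesis using \<open>\<kappa> * L \<le> \<bar>\<phi> k 0\<bar>\<close> by linarith
    qed
    \<comment> \<open>For y \<ge> 1 the trivial bound \<tau> \<le> 1 suffices; for y < 1 the
      exponent 1/k may be lowered to 1/m, since k \<le> M - 1 \<le> m.\<close>
    define y where "y = \<epsilon> / (\<kappa> / 2 * L)"
    have y: "y > 0" using \<epsilon> \<kappa> L by (simp add: y_def)
    have "emeasure lborel T \<le> ennreal (4 * 2^m * y powr (1 / m))"
    proof (cases "y \<ge> 1")
      case True
      have "emeasure lborel T \<le> emeasure lborel {0..\<tau>}" using T by (intro emeasure_mono) auto
      also have "\<dots> = ennreal \<tau>" using \<tau> by simp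
      also have "\<dots> \<le> ennreal (4 * 2^m * y powr (1 / m))"
      proof (rule ennreal_leI)
        have "1 \<le> y powr (1 / m)" using True by (intro ge_one_powr_ge_zero) auto
        moreover have "(1::real) \<le> 4 * 2^m" using one_le_power[of "2::real" m] by linarith
        ultimately have "1 * 1 \<le> 4 * 2^m * y powr (1 / m)" by (intro mult_mono) auto
        then show "\<tau> \<le> 4 * 2^m * y powr (1 / m)" using \<tau>(2) by simp
      qed
      finally show ?thesis .
    next
      case False
      then have "\<epsilon> < \<kappa> / 2 * L" using \<kappa> L by (simp add: y_def divide_simps)
      show ?thesis
      proof (cases "k = 0")
        case True
        \<comment> \<open>For order 0 the lower bound concerns the function itself and exceeds
          \<epsilon>, so no time qualifies.\<close>
        have "T = {}"
        proof (rule ccontr)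
          assume "T \<noteq> {}"
          then obtain t where "t \<in> T" by blast
          then have "\<bar>\<phi> 0 t\<bar> < \<epsilon>" "\<kappa> / 2 * L \<le> \<bar>\<phi> 0 t\<bar>" using Tl low[of t] T(2) True by (auto simp: \<phi>0)
          with \<open>\<epsilon> < \<kappa> / 2 * L\<close> show False by simp
        qed
        then show ?thesis by simp
      next
        case False
        then have k1: "1 \<le> k" by simp
        have "emeasure lborel T \<le> ennreal (4 * 2^k * (\<epsilon> / (\<kappa> / 2 * L)) powr (1 / k))"
        proof (rule sublevel_1d[where \<phi> = \<phi> and a = 0 and b = \<tau>, OF k1 _ \<epsilon> _ low T])
          show "(\<phi> l has_real_derivative \<phi> (Suc l) t) (at t)" if "t \<in> {0..\<tau>}" "l < k" for l t
            using der[OF that(1)] that(2) k(1) by simp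
          show "\<bar>\<phi> 0 t\<bar> < \<epsilon>" if "t \<in> T" for t using Tl that by (simp add: \<phi>0)
        qed (use \<kappa> L in auto)
        also have "\<dots> \<le> ennreal (4 * 2^m * y powr (1 / m))"
        proof (rule ennreal_leI)
          have "k \<le> m" using k(1) M(2) by simp
          then have "1 / real m \<le> 1 / real k" using k1 by (simp add: frac_le)
          then have "y powr (1 / k) \<le> y powr (1 / m)" using y \<open>\<not> y \<ge> 1\<close> by (intro powr_mono') auto
          moreover have "(2::real)^k \<le> 2^m" using \<open>k \<le> m\<close> by (intro power_increasing) auto
          ultimately show "4 * 2^k * (\<epsilon> / (\<kappa> / 2 * L)) powr (1 / k) \<le> 4 * 2^m * y powr (1 / m)"
            unfolding y_def[symmetric] by (intro mult_mono) auto
        qed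
        finally show ?thesis .
      qed
    qed
    then show "emeasure lborel T \<le> ennreal (4 * 2^m * (\<epsilon> / (\<kappa> / 2 * (\<Sum>i<M. \<bar>a i * mon (\<beta> i) z\<bar>))) powr (1 / m))"
      by (simp add: y_def L_def X_def)
  qed
qed

text \<open>Undoing a dilation by exp t with t \<le> 1 costs at most the factor 3^n. Averaging over
  \<open>t\<close> and exchanging the integrals turns a bound for every orbit into a bound for the
  whole space.\<close>

lemma dilation_average:
  fixes f g :: "real^'n::finite \<Rightarrow> ennreal"
  assumes [measurable]: "f \<in> borel_measurable borel" "g \<in> borel_measurable borel"
    and \<tau>: "0 < \<tau>" "\<tau> \<le> 1" and B: "B \<ge> 0"
    and le: "\<And>z. (\<integral>\<^sup>+t. f (exp t *\<^sub>R z) * indicator {0..\<tau>} t \<partial>lborel) \<le> ennreal B * g z"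
  shows "(\<integral>\<^sup>+z. f z \<partial>lborel) \<le> ennreal (3 ^ CARD('n) * B / \<tau>) * (\<integral>\<^sup>+z. g z \<partial>lborel)"
proof -
  have dil: "(\<integral>\<^sup>+z. f z \<partial>lborel) \<le> ennreal (3 ^ CARD('n)) * (\<integral>\<^sup>+z. f (exp t *\<^sub>R z) \<partial>lborel)" if t: "t \<in> {0..\<tau>}" for t
  proof -
    have "(\<integral>\<^sup>+z. f z \<partial>lborel) = (\<integral>\<^sup>+z. f z \<partial>density (distr lborel borel (\<lambda>x. 0 + exp t *\<^sub>R x)) (\<lambda>_. \<bar>exp t\<bar> ^ DIM(real^'n)))"
      by (subst lborel_affine[of "exp t" 0]) auto
    also have "\<dots> = ennreal (exp t ^ CARD('n)) * (\<integral>\<^sup>+z. f (exp t *\<^sub>R z) \<partial>lborel)"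
      by (simp add: nn_integral_density nn_integral_distr nn_integral_cmult)
    also have "\<dots> \<le> ennreal (3 ^ CARD('n)) * (\<integral>\<^sup>+z. f (exp t *\<^sub>R z) \<partial>lborel)"
    proof (intro mult_right_mono ennreal_leI power_mono)
      have "exp t \<le> exp 1" using t \<tau> by simp
      then show "exp t \<le> 3" using exp_le by linarith
    qed auto
    finally show ?thesis .
  qed
  have meas: "(\<lambda>(z::real^'n, t::real). f (exp t *\<^sub>R z) * indicator {0..\<tau>} t) \<in> borel_measurable (lborel \<Otimes>\<^sub>M lborel)"
    by measurable
  have "ennreal \<tau> * (\<integral>\<^sup>+z. f z \<partial>lborel) = (\<integral>\<^sup>+t. (\<integral>\<^sup>+z. f z \<partial>lborel) * indicator {0..\<tau>} t \<partial>lborel)"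
    using \<tau> by (simp add: nn_integral_cmult_indicator mult.commute)
  also have "\<dots> \<le> (\<integral>\<^sup>+t. ennreal (3 ^ CARD('n)) * (\<integral>\<^sup>+z. f (exp t *\<^sub>R z) * indicator {0..\<tau>} t \<partial>lborel) \<partial>lborel)"
    using dil by (intro nn_integral_mono) (auto simp: indicator_def)
  also have "\<dots> = ennreal (3 ^ CARD('n)) * (\<integral>\<^sup>+t. (\<integral>\<^sup>+z. f (exp t *\<^sub>R z) * indicator {0..\<tau>} t \<partial>lborel) \<partial>lborel)"
    by (rule nn_integral_cmult) measurable
  also have "(\<integral>\<^sup>+t. (\<integral>\<^sup>+z. f (exp t *\<^sub>R z) * indicator {0..\<tau>} t \<partial>lborel) \<partial>lborel)
      = (\<integral>\<^sup>+z. (\<integral>\<^sup>+t. f (exp t *\<^sub>R z) * indicator {0..\<tau>} t \<partial>lborel) \<partial>lborel)"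
    by (rule lborel_pair.Fubini') (use meas in simp)
  also have "\<dots> \<le> (\<integral>\<^sup>+z. ennreal B * g z \<partial>lborel)" by (rule nn_integral_mono) (rule le)
  also have "\<dots> = ennreal B * (\<integral>\<^sup>+z. g z \<partial>lborel)" by (rule nn_integral_cmult) simp
  finally have main: "ennreal \<tau> * (\<integral>\<^sup>+z. f z \<partial>lborel) \<le> ennreal (3 ^ CARD('n)) * (ennreal B * (\<integral>\<^sup>+z. g z \<partial>lborel))"
    by (simp add: mult_left_mono)
  have "(\<integral>\<^sup>+z. f z \<partial>lborel) = ennreal (1 / \<tau>) * (ennreal \<tau> * (\<integral>\<^sup>+z. f z \<partial>lborel))"
    using \<tau> by (simp add: mult.assoc[symmetric] ennreal_mult[symmetric])
  also have "\<dots> \<le> ennreal (1 / \<tau>) * (ennreal (3 ^ CARD('n)) * (ennreal B * (\<integral>\<^sup>+z. g z \<partial>lborel)))"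
    by (intro mult_left_mono main) simp
  also have "\<dots> = ennreal (3 ^ CARD('n) * B / \<tau>) * (\<integral>\<^sup>+z. g z \<partial>lborel)"
  proof -
    have "ennreal (3 ^ CARD('n) * B / \<tau>) = ennreal (1 / \<tau> * (3 ^ CARD('n) * B))" by simp
    also have "\<dots> = ennreal (1 / \<tau>) * (ennreal (3 ^ CARD('n)) * ennreal B)"
      using \<tau> B by (subst ennreal_mult, simp, simp, subst ennreal_mult) simp_all
    finally show ?thesis by (simp only: mult.assoc)
  qed
  finally show ?thesis .
qed

section \<open>The estimate in one chart and its transfer to a neighbourhood\<close>

definition CB :: "real \<Rightarrow> (real^'n::finite) set" where
  "CB r = {x. \<forall>i. \<bar>x$i\<bar> \<le> r}"

lemma CB_iff: "x \<in> CB r \<longleftrightarrow> (\<forall>i. \<bar>x$i\<bar> \<le> r)"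
  by (simp add: CB_def)

lemma CB_subset_RB: "r < s \<Longrightarrow> CB r \<subseteq> RB s"
  by (rule subsetI) (unfold CB_iff RB_iff, meson le_less_trans)

lemma RB_subset_CB: "RB r \<subseteq> CB r"
  by (auto simp: CB_iff RB_iff less_imp_le)

lemma compact_CB: "compact (CB r :: (real^'n::finite) set)"
proof -
  have "CB r = cbox (\<chi> i. - r) (\<chi> i. r :: real^'n)"
    by (auto simp: CB_iff mem_box_cart abs_le_iff minus_le_iff)
  then show ?thesis by simp
qed

lemma CB_borel [measurable]: "(CB r :: (real^'n::finite) set) \<in> sets borel"
  by (rule borel_compact[OF compact_CB])

lemma exp_dilation:
  assumes "t \<in> {0..\<tau>}" "\<tau> \<le> 1"
  shows "1 \<le> exp t" "exp t \<le> (3::real)"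
proof -
  have "exp t \<le> exp 1" using assms by simp
  then show "exp t \<le> 3" using exp_le by linarith
qed (use assms in simp)

lemma mon_dilation:
  fixes z :: "real^'n::finite"
  assumes "t \<in> {0..\<tau>}" "\<tau> \<le> 1"
  shows "\<bar>mon \<alpha> z\<bar> \<le> \<bar>mon \<alpha> (exp t *\<^sub>R z)\<bar>" "\<bar>mon \<alpha> (exp t *\<^sub>R z)\<bar> \<le> 3 ^ (\<Sum>i\<in>UNIV. \<alpha> i) * \<bar>mon \<alpha> z\<bar>"
proof -
  note e = exp_dilation[OF assms]
  have "1 \<le> exp t ^ (\<Sum>i\<in>UNIV. \<alpha> i)" using e by (intro one_le_power)
  from mult_right_mono[OF this, of "\<bar>mon \<alpha> z\<bar>"]
  show "\<bar>mon \<alpha> z\<bar> \<le> \<bar>mon \<alpha> (exp t *\<^sub>R z)\<bar>" by (simp add: mon_scaleR abs_mult)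
  have "exp t ^ (\<Sum>i\<in>UNIV. \<alpha> i) \<le> 3 ^ (\<Sum>i\<in>UNIV. \<alpha> i)" using e by (intro power_mono) auto
  from mult_right_mono[OF this, of "\<bar>mon \<alpha> z\<bar>"]
  show "\<bar>mon \<alpha> (exp t *\<^sub>R z)\<bar> \<le> 3 ^ (\<Sum>i\<in>UNIV. \<alpha> i) * \<bar>mon \<alpha> z\<bar>" by (simp add: mon_scaleR abs_mult)
qed

lemma an_near_value:
  assumes "an w" "w 0 \<noteq> 0"
  shows "\<forall>\<^sub>F x in nhds 0. \<bar>w 0\<bar> / 2 \<le> \<bar>w x\<bar> \<and> \<bar>w x\<bar> \<le> 2 * \<bar>w 0\<bar>"
proof -
  have "\<forall>\<^sub>F x in nhds 0. dist (w x) (w 0) < \<bar>w 0\<bar> / 2"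
    using assms(2) by (intro tendstoD[OF an_tendsto[OF assms(1)]]) auto
  then show ?thesis
  proof eventually_elim
    case (elim x)
    then have "\<bar>w x - w 0\<bar> < \<bar>w 0\<bar> / 2" by (simp add: dist_real_def)
    then show ?case by linarith
  qed
qed

text \<open>The first generator with nonzero coefficient divides all later ones up to units, and by
  strictness the monomial quotients vanish at 0.\<close>

lemma chain_leading:
  fixes u :: "nat \<Rightarrow> real^'n::finite \<Rightarrow> real"
  assumes \<beta>: "\<And>i k l. i < k \<Longrightarrow> k < M \<Longrightarrow> \<beta> i l \<le> \<beta> k l" "\<And>i k. i < k \<Longrightarrow> k < M \<Longrightarrow> \<beta> i \<noteq> \<beta> k"
    and u: "\<And>i. an (u i)"
    and i0: "i0 < M" "\<And>i. i < i0 \<Longrightarrow> d i = 0"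
  shows "\<exists>w. an w \<and> w 0 = d i0 * u i0 0 \<and> (\<forall>x. (\<Sum>i<M. d i * (mon (\<beta> i) x * u i x)) = mon (\<beta> i0) x * w x)"
proof (intro exI conjI allI)
  define w where "w x = (\<Sum>i\<in>{i0..<M}. d i * (mon (\<lambda>l. \<beta> i l - \<beta> i0 l) x * u i x))" for x
  show "an w" unfolding w_def by (intro an_sum an_mult u an_mon an_const)
  have "mon (\<lambda>l. \<beta> i l - \<beta> i0 l) 0 = 0" if "i \<in> {i0..<M} - {i0}" for i
  proof -
    have "\<exists>l. \<beta> i0 l < \<beta> i l"
    proof (rule ccontr)
      assume "\<not> (\<exists>l. \<beta> i0 l < \<beta> i l)"
      then have "\<beta> i0 = \<beta> i" using \<beta>(1)[of i0 i] that by (intro ext antisym) (auto simp: not_less)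
      with \<beta>(2)[of i0 i] that show False by auto
    qed
    then show ?thesis by (auto simp: mon_eq_0_iff)
  qed
  then have "w 0 = (\<Sum>i\<in>{i0}. d i * (mon (\<lambda>l. \<beta> i l - \<beta> i0 l) 0 * u i 0))"
    unfolding w_def using i0 by (intro sum.mono_neutral_right) auto
  then show "w 0 = d i0 * u i0 0" by simp
  fix x
  have "(\<Sum>i<M. d i * (mon (\<beta> i) x * u i x)) = (\<Sum>i\<in>{i0..<M}. d i * (mon (\<beta> i) x * u i x))"
    by (rule sum.mono_neutral_right) (use i0 in \<open>auto simp: not_le\<close>)
  also have "\<dots> = mon (\<beta> i0) x * w x"
    unfolding w_def sum_distrib_left
  proof (rule sum.cong[OF refl])
    fix i assume i: "i \<in> {i0..<M}"
    have "\<beta> i0 l \<le> \<beta> i l" for l using \<beta>(1)[of i0 i] i by (cases "i = i0") auto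
    then have "mon (\<beta> i) x = mon (\<beta> i0) x * mon (\<lambda>l. \<beta> i l - \<beta> i0 l) x"
      by (subst mon_add[symmetric]) simp
    then show "d i * (mon (\<beta> i) x * u i x) = mon (\<beta> i0) x * (d i * (mon (\<lambda>l. \<beta> i l - \<beta> i0 l) x * u i x))"
      by simp
  qed
  finally show "(\<Sum>i<M. d i * (mon (\<beta> i) x * u i x)) = mon (\<beta> i0) x * w x" .
qed

text \<open>Where |Q| is of size \<sigma>, its leading monomial is at least of that order. A small
  \<eta> changes the leading coefficient by at most half, so the sum of the absolute terms is at
  least \<kappa> \<sigma>, whatever \<eta> contributes at the other indices.
  \<open>flow_sublevel\<close> bounds the time that an orbit spends in the set, and the average over
  dilations finishes.\<close>

lemma chart_estimate:
  fixes u :: "nat \<Rightarrow> real^'n::finite \<Rightarrow> real" and m M :: nat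
  assumes m: "m \<ge> 1" and M: "M \<le> m + 1"
    and chain: "\<forall>i k. i < k \<longrightarrow> k < M \<longrightarrow> (\<forall>l. \<beta> i l \<le> \<beta> k l) \<and> \<beta> i \<noteq> \<beta> k"
    and u: "\<And>i. an (u i)" "\<And>i. u i 0 \<noteq> 0"
    and j: "mono_germ UNIV j" and [measurable]: "j \<in> borel_measurable borel" "Q \<in> borel_measurable borel"
    and S: "\<forall>l\<in>{1..m}. S l \<in> borel_measurable borel"
    and Qd: "\<forall>\<^sub>F z in nhds 0. Q z = (\<Sum>i<M. d i * (mon (\<beta> i) z * u i z))"
    and Se: "\<forall>l\<in>{1..m}. \<forall>\<^sub>F z in nhds 0. S l z = (\<Sum>i<M. e l i * (mon (\<beta> i) z * u i z))"
  shows "\<exists>\<rho>>0. \<exists>C>0. \<exists>\<delta>>0. \<forall>r \<eta> \<sigma> \<epsilon>. 0 < r \<longrightarrow> r < \<rho> \<longrightarrow> (\<forall>l\<in>{1..m}. \<bar>\<eta> l\<bar> < \<delta>) \<longrightarrow> 0 < \<sigma> \<longrightarrow> 0 < \<epsilon> \<longrightarrow>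
    (\<integral>\<^sup>+z. indicator {z \<in> CB r. \<sigma> \<le> \<bar>Q z\<bar> \<and> \<bar>Q z\<bar> < 2 * \<sigma> \<and> \<bar>Q z + (\<Sum>l=1..m. \<eta> l * S l z)\<bar> < \<epsilon>} z * ennreal \<bar>j z\<bar> \<partial>lborel)
    \<le> ennreal (C * (\<epsilon> / \<sigma>) powr (1 / m)) * (\<integral>\<^sup>+z. indicator {z \<in> CB r. \<bar>Q z\<bar> < 8 * \<sigma>} z * ennreal \<bar>j z\<bar> \<partial>lborel)"
proof -
  have \<beta>: "\<And>i k l. i < k \<Longrightarrow> k < M \<Longrightarrow> \<beta> i l \<le> \<beta> k l" "\<And>i k. i < k \<Longrightarrow> k < M \<Longrightarrow> \<beta> i \<noteq> \<beta> k"
    using chain by simp_all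
  have "\<forall>\<^sub>F z in nhds 0. \<forall>l\<in>{1..m}. S l z = (\<Sum>i<M. e l i * (mon (\<beta> i) z * u i z))"
    by (intro eventually_ball_finite Se finite_atLeastAtMost)
  with Qd have "\<forall>\<^sub>F z in nhds 0. Q z = (\<Sum>i<M. d i * (mon (\<beta> i) z * u i z)) \<and>
      (\<forall>l\<in>{1..m}. S l z = (\<Sum>i<M. e l i * (mon (\<beta> i) z * u i z)))"
    by (rule eventually_conj)
  then obtain \<rho>0 where \<rho>0: "\<rho>0 > 0" and \<rho>0': "\<forall>z\<in>RB \<rho>0. Q z = (\<Sum>i<M. d i * (mon (\<beta> i) z * u i z)) \<and>
      (\<forall>l\<in>{1..m}. S l z = (\<Sum>i<M. e l i * (mon (\<beta> i) z * u i z)))"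
    unfolding eventually_RB by (elim exE conjE) (rule that)
  have Q: "Q z = (\<Sum>i<M. d i * (mon (\<beta> i) z * u i z))"
    and F: "Q z + (\<Sum>l=1..m. \<eta> l * S l z) = (\<Sum>i<M. (d i + (\<Sum>l=1..m. \<eta> l * e l i)) * (mon (\<beta> i) z * u i z))"
    if "z \<in> RB \<rho>0" for z \<eta>
  proof -
    show 1: "Q z = (\<Sum>i<M. d i * (mon (\<beta> i) z * u i z))" using \<rho>0' that by simp
    have "(\<Sum>l=1..m. \<eta> l * S l z) = (\<Sum>l=1..m. \<Sum>i<M. \<eta> l * e l i * (mon (\<beta> i) z * u i z))"
      using \<rho>0' that by (intro sum.cong) (auto simp: sum_distrib_left mult_ac)
    also have "\<dots> = (\<Sum>i<M. (\<Sum>l=1..m. \<eta> l * e l i) * (mon (\<beta> i) z * u i z))"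
      by (subst sum.swap) (simp add: sum_distrib_right)
    finally show "Q z + (\<Sum>l=1..m. \<eta> l * S l z) = (\<Sum>i<M. (d i + (\<Sum>l=1..m. \<eta> l * e l i)) * (mon (\<beta> i) z * u i z))"
      by (simp add: 1 distrib_right sum.distrib)
  qed
  show ?thesis
  proof (cases "\<exists>i<M. d i \<noteq> 0")
    case False
    \<comment> \<open>All coefficients of \<open>Q\<close> vanish, so the shell \<sigma> \<le> |Q|
      is empty in a small box.\<close>
    then have Q0: "Q z = 0" if "z \<in> RB \<rho>0" for z using Q[OF that] by simp
    show ?thesis
    proof (rule exI[of _ \<rho>0], rule conjI[OF \<rho>0], rule exI[of _ 1], rule conjI[OF zero_less_one],
        rule exI[of _ 1], rule conjI[OF zero_less_one], intro allI impI)
      fix r \<eta> and \<sigma> \<epsilon> :: real assume r: "0 < r" "r < \<rho>0" and "0 < \<sigma>"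
      have "{z \<in> CB r. \<sigma> \<le> \<bar>Q z\<bar> \<and> \<bar>Q z\<bar> < 2 * \<sigma> \<and> \<bar>Q z + (\<Sum>l=1..m. \<eta> l * S l z)\<bar> < \<epsilon>} = {}"
        using Q0 CB_subset_RB[OF r(2)] \<open>0 < \<sigma>\<close> by force
      then show "(\<integral>\<^sup>+z. indicator {z \<in> CB r. \<sigma> \<le> \<bar>Q z\<bar> \<and> \<bar>Q z\<bar> < 2 * \<sigma> \<and> \<bar>Q z + (\<Sum>l=1..m. \<eta> l * S l z)\<bar> < \<epsilon>} z * ennreal \<bar>j z\<bar> \<partial>lborel)
        \<le> ennreal (1 * (\<epsilon> / \<sigma>) powr (1 / m)) * (\<integral>\<^sup>+z. indicator {z \<in> CB r. \<bar>Q z\<bar> < 8 * \<sigma>} z * ennreal \<bar>j z\<bar> \<partial>lborel)"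
        by (simp only:) simp
    qed
  next
    case True
    define i0 where "i0 = (LEAST i. i < M \<and> d i \<noteq> 0)"
    from True have "\<exists>i. i < M \<and> d i \<noteq> 0" by blast
    from LeastI_ex[OF this] have i0: "i0 < M" "d i0 \<noteq> 0" by (simp_all add: i0_def)
    have before: "d i = 0" if "i < i0" for i
      using not_less_Least[of i "\<lambda>i. i < M \<and> d i \<noteq> 0"] that i0(1) by (auto simp: i0_def)
    have M1: "1 \<le> M" using i0 by simp
    have "\<exists>w. an w \<and> w 0 = d i0 * u i0 0 \<and> (\<forall>x. (\<Sum>i<M. d i * (mon (\<beta> i) x * u i x)) = mon (\<beta> i0) x * w x)"
    proof (rule chain_leading[where d = d and \<beta> = \<beta> and u = u])
      show "\<beta> i l \<le> \<beta> k l" "\<beta> i \<noteq> \<beta> k" if "i < k" "k < M" for i k l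
        using \<beta>(1)[OF that] \<beta>(2)[OF that] by simp_all
    qed (use u i0 before in simp_all)
    then obtain w where w: "an w" "w 0 = d i0 * u i0 0"
      and wQ': "\<forall>x. (\<Sum>i<M. d i * (mon (\<beta> i) x * u i x)) = mon (\<beta> i0) x * w x"
      by (elim exE conjE) (rule that)
    note wQ = spec[OF wQ']
    have w0: "w 0 \<noteq> 0" using w(2) i0 u(2) by simp
    obtain \<alpha> v where v: "an v" "v 0 \<noteq> 0" and jv: "\<forall>\<^sub>F z in nhds 0. j z = mon \<alpha> z * v z"
      using j unfolding mono_germ_def by (elim exE conjE) (rule that)
    have "\<forall>\<^sub>F z in nhds 0. (\<bar>w 0\<bar> / 2 \<le> \<bar>w z\<bar> \<and> \<bar>w z\<bar> \<le> 2 * \<bar>w 0\<bar>) \<and>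
        (\<bar>v 0\<bar> / 2 \<le> \<bar>v z\<bar> \<and> \<bar>v z\<bar> \<le> 2 * \<bar>v 0\<bar>) \<and> j z = mon \<alpha> z * v z"
      by (intro eventually_conj an_near_value w v w0 jv)
    then obtain \<rho>1 where \<rho>1: "\<rho>1 > 0" and \<rho>1': "\<forall>z\<in>RB \<rho>1. (\<bar>w 0\<bar> / 2 \<le> \<bar>w z\<bar> \<and> \<bar>w z\<bar> \<le> 2 * \<bar>w 0\<bar>) \<and>
        (\<bar>v 0\<bar> / 2 \<le> \<bar>v z\<bar> \<and> \<bar>v z\<bar> \<le> 2 * \<bar>v 0\<bar>) \<and> j z = mon \<alpha> z * v z"
      unfolding eventually_RB by (elim exE conjE) (rule that)
    obtain \<rho>2 \<tau> c where \<rho>2: "\<rho>2 > 0" and \<tau>: "\<tau> > 0" "\<tau> \<le> 1" and c: "c > 0" and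
      flow: "\<forall>z\<in>RB \<rho>2. \<forall>a. \<forall>\<epsilon>>0. \<forall>T.
        T \<in> sets borel \<longrightarrow> T \<subseteq> {0..\<tau>} \<longrightarrow> (\<Sum>i<M. \<bar>a i * mon (\<beta> i) z\<bar>) > 0 \<longrightarrow>
        (\<forall>t\<in>T. \<bar>\<Sum>i<M. a i * (mon (\<beta> i) (exp t *\<^sub>R z) * u i (exp t *\<^sub>R z))\<bar> < \<epsilon>) \<longrightarrow>
        emeasure lborel T \<le> ennreal (4 * 2^m * (\<epsilon> / (c * (\<Sum>i<M. \<bar>a i * mon (\<beta> i) z\<bar>))) powr (1 / m))"
      using flow_sublevel[where \<beta> = \<beta> and u = u, OF M1 M m chain u] by (elim exE conjE) (rule that)
    define b where "b = (\<Sum>i\<in>UNIV. \<beta> i0 i)"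
    \<comment> \<open>Collects the growth 3^b of the leading monomial along the flow, the bound 2 |w
      0| for the unit, and the halved coefficient.\<close>
    define \<kappa> where "\<kappa> = \<bar>d i0\<bar> / (4 * 3^b * \<bar>w 0\<bar>)"
    have \<kappa>: "\<kappa> > 0" using i0 w0 by (simp add: \<kappa>_def)
    \<comment> \<open>For |\<eta>_l| < \<delta> the coefficient \<open>d i0\<close> moves by at most
      half of its size; the summand 1 keeps the denominator positive.\<close>
    define \<delta> where "\<delta> = \<bar>d i0\<bar> / (2 * (1 + (\<Sum>l=1..m. \<bar>e l i0\<bar>)))"
    have sum_pos: "0 < 1 + (\<Sum>l=1..m. \<bar>e l i0\<bar>)" by (intro add_pos_nonneg sum_nonneg) auto
    have \<delta>: "\<delta> > 0" using i0 sum_pos by (simp add: \<delta>_def)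
    \<comment> \<open>4 bounds the quotient of two values of the unit \<open>v\<close>, and the
      power of 3 the growth of the Jacobian monomial along the flow.\<close>
    define J :: real where "J = 4 * 3 ^ (\<Sum>i\<in>UNIV. \<alpha> i)"
    define C where "C = 3 ^ CARD('n) * (J * (4 * 2^m * (1 / (c * \<kappa>)) powr (1 / m))) / \<tau>"
    have pos: "min \<rho>0 (min \<rho>1 \<rho>2) > 0" "C > 0" using \<rho>0 \<rho>1 \<rho>2 \<tau> c \<kappa> by (auto simp: C_def J_def)
    show ?thesis
    proof (rule exI[of _ "min \<rho>0 (min \<rho>1 \<rho>2)"], rule conjI[OF pos(1)], rule exI[of _ C], rule conjI[OF pos(2)],
        rule exI[of _ \<delta>], rule conjI[OF \<delta>], intro allI impI)
      fix r and \<eta> :: "nat \<Rightarrow> real" and \<sigma> \<epsilon> :: real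
      assume r: "0 < r" "r < min \<rho>0 (min \<rho>1 \<rho>2)" and \<eta>: "\<forall>l\<in>{1..m}. \<bar>\<eta> l\<bar> < \<delta>" and \<sigma>: "0 < \<sigma>" and \<epsilon>: "0 < \<epsilon>"
      define E where "E = {z \<in> CB r. \<sigma> \<le> \<bar>Q z\<bar> \<and> \<bar>Q z\<bar> < 2 * \<sigma> \<and> \<bar>Q z + (\<Sum>l=1..m. \<eta> l * S l z)\<bar> < \<epsilon>}"
      define G where "G = {z \<in> CB r. \<bar>Q z\<bar> < 8 * \<sigma>}"
      have [measurable]: "(\<lambda>z. \<Sum>l=1..m. \<eta> l * S l z) \<in> borel_measurable borel"
        by (intro borel_measurable_sum borel_measurable_times S[rule_format]) auto
      have [measurable]: "E \<in> sets borel" "G \<in> sets borel" unfolding E_def G_def by measurable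
      define a where "a i = d i + (\<Sum>l=1..m. \<eta> l * e l i)" for i
      have a0: "\<bar>d i0\<bar> / 2 \<le> \<bar>a i0\<bar>"
      proof -
        have "\<bar>\<Sum>l=1..m. \<eta> l * e l i0\<bar> \<le> (\<Sum>l=1..m. \<bar>\<eta> l\<bar> * \<bar>e l i0\<bar>)"
          by (rule order_trans[OF sum_abs]) (simp add: abs_mult)
        also have "\<dots> \<le> (\<Sum>l=1..m. \<delta> * \<bar>e l i0\<bar>)"
          using \<eta> by (intro sum_mono mult_right_mono) (auto simp: less_imp_le)
        also have "\<dots> \<le> \<delta> * (1 + (\<Sum>l=1..m. \<bar>e l i0\<bar>))" using \<delta> by (simp add: sum_distrib_left distrib_left)
        also have "\<dots> = \<bar>d i0\<bar> / 2"
        proof -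
          have "\<bar>d i0\<bar> / (2 * X) * X = \<bar>d i0\<bar> / 2" if "0 < X" for X :: real using that by simp
          from this[OF sum_pos] show ?thesis unfolding \<delta>_def .
        qed
        finally show ?thesis unfolding a_def by linarith
      qed
      have CB: "z \<in> RB \<rho>0" "z \<in> RB \<rho>1" "z \<in> RB \<rho>2" if "z \<in> CB r" for z :: "real^'n"
        using that r CB_subset_RB[of r \<rho>0] CB_subset_RB[of r \<rho>1] CB_subset_RB[of r \<rho>2] by auto
      have wb: "\<bar>w 0\<bar> / 2 \<le> \<bar>w z\<bar>" "\<bar>w z\<bar> \<le> 2 * \<bar>w 0\<bar>" "\<bar>v 0\<bar> / 2 \<le> \<bar>v z\<bar>" "\<bar>v z\<bar> \<le> 2 * \<bar>v 0\<bar>" "j z = mon \<alpha> z * v z"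
        if "z \<in> CB r" for z using bspec[OF \<rho>1' CB(2)[OF that]] by simp_all
      have QR: "Q z = mon (\<beta> i0) z * w z" if "z \<in> CB r" for z using Q[OF CB(1)[OF that]] wQ by simp
      \<comment> \<open>Compares a point of the set with an earlier point \<open>z\<close> of its
        orbit. Dilations expand, so \<open>z\<close> stays in the box; |Q z| is at most four times
        the later value, whence 8 \<sigma> in place of 2 \<sigma>.\<close>
      have bk: "z \<in> G" "\<bar>j (exp t *\<^sub>R z)\<bar> \<le> J * \<bar>j z\<bar>" "\<kappa> * \<sigma> \<le> (\<Sum>i<M. \<bar>a i * mon (\<beta> i) z\<bar>)"
        if t: "t \<in> {0..\<tau>}" and zE: "exp t *\<^sub>R z \<in> E" for z t
      proof -
        note md = mon_dilation[OF t \<tau>(2)]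
        have y: "exp t *\<^sub>R z \<in> CB r" using zE by (simp add: E_def)
        have z: "z \<in> CB r"
          unfolding CB_iff
        proof
          fix i
          have "1 * \<bar>z$i\<bar> \<le> exp t * \<bar>z$i\<bar>" using exp_dilation(1)[OF t \<tau>(2)] by (intro mult_right_mono) auto
          also have "\<dots> = \<bar>(exp t *\<^sub>R z)$i\<bar>" by (simp add: abs_mult)
          also have "\<dots> \<le> r" using y unfolding CB_iff by blast
          finally show "\<bar>z$i\<bar> \<le> r" by simp
        qed
        have "\<bar>Q z\<bar> = \<bar>mon (\<beta> i0) z\<bar> * \<bar>w z\<bar>" by (simp add: QR[OF z] abs_mult)
        also have "\<dots> \<le> \<bar>mon (\<beta> i0) (exp t *\<^sub>R z)\<bar> * (4 * \<bar>w (exp t *\<^sub>R z)\<bar>)"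
          using wb(1)[OF y] wb(2)[OF z] by (intro mult_mono md) auto
        also have "\<dots> = 4 * \<bar>Q (exp t *\<^sub>R z)\<bar>" by (simp add: QR[OF y] abs_mult)
        also have "\<dots> < 8 * \<sigma>" using zE by (simp add: E_def)
        finally show "z \<in> G" using z by (simp add: G_def)
        have "\<bar>j (exp t *\<^sub>R z)\<bar> = \<bar>mon \<alpha> (exp t *\<^sub>R z)\<bar> * \<bar>v (exp t *\<^sub>R z)\<bar>"
          by (simp add: wb(5)[OF y] abs_mult)
        also have "\<dots> \<le> (3 ^ (\<Sum>i\<in>UNIV. \<alpha> i) * \<bar>mon \<alpha> z\<bar>) * (4 * \<bar>v z\<bar>)"
          using wb(4)[OF y] wb(3)[OF z] by (intro mult_mono md) auto
        also have "\<dots> = J * \<bar>j z\<bar>" by (simp add: wb(5)[OF z] abs_mult J_def)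
        finally show "\<bar>j (exp t *\<^sub>R z)\<bar> \<le> J * \<bar>j z\<bar>" .
        have "\<sigma> \<le> \<bar>Q (exp t *\<^sub>R z)\<bar>" using zE by (simp add: E_def)
        also have "\<dots> \<le> (3^b * \<bar>mon (\<beta> i0) z\<bar>) * (2 * \<bar>w 0\<bar>)"
          unfolding QR[OF y] abs_mult b_def using wb(2)[OF y] by (intro mult_mono md) auto
        finally have "\<kappa> * \<sigma> \<le> \<kappa> * ((3^b * \<bar>mon (\<beta> i0) z\<bar>) * (2 * \<bar>w 0\<bar>))" using \<kappa> by simp
        also have "\<dots> = \<bar>d i0\<bar> / 2 * \<bar>mon (\<beta> i0) z\<bar>" using w0 by (simp add: \<kappa>_def)
        also have "\<dots> \<le> \<bar>a i0 * mon (\<beta> i0) z\<bar>" unfolding abs_mult using a0 by (intro mult_right_mono) auto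
        also have "\<dots> \<le> (\<Sum>i<M. \<bar>a i * mon (\<beta> i) z\<bar>)"
          by (rule member_le_sum) (use i0 in auto)
        finally show "\<kappa> * \<sigma> \<le> (\<Sum>i<M. \<bar>a i * mon (\<beta> i) z\<bar>)" .
      qed
      define B where "B = J * (4 * 2^m * (\<epsilon> / (c * (\<kappa> * \<sigma>))) powr (1 / m))"
      have "(\<integral>\<^sup>+z. indicator E z * ennreal \<bar>j z\<bar> \<partial>lborel)
          \<le> ennreal (3 ^ CARD('n) * B / \<tau>) * (\<integral>\<^sup>+z. indicator G z * ennreal \<bar>j z\<bar> \<partial>lborel)"
      proof (rule dilation_average[OF _ _ \<tau>])
        show "B \<ge> 0" by (simp add: B_def J_def)
        fix z :: "real^'n"
        define T where "T = {t \<in> {0..\<tau>}. exp t *\<^sub>R z \<in> E}"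
        have [measurable]: "T \<in> sets borel" unfolding T_def by measurable
        show "(\<integral>\<^sup>+t. (indicator E (exp t *\<^sub>R z) * ennreal \<bar>j (exp t *\<^sub>R z)\<bar>) * indicator {0..\<tau>} t \<partial>lborel)
          \<le> ennreal B * (indicator G z * ennreal \<bar>j z\<bar>)"
        proof (cases "T = {}")
          case True
          then have "(indicator E (exp t *\<^sub>R z) * ennreal \<bar>j (exp t *\<^sub>R z)\<bar>) * indicator {0..\<tau>} t = (0::ennreal)" for t
            by (auto simp: T_def indicator_def)
          then show ?thesis by (simp only:) simp
        next
          case False
          then obtain t0 where t0: "t0 \<in> {0..\<tau>}" "exp t0 *\<^sub>R z \<in> E" by (auto simp: T_def)
          note b0 = bk[OF t0]
          have zG: "z \<in> CB r" using b0(1) by (simp add: G_def)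
          have L: "0 < \<kappa> * \<sigma>" using \<kappa> \<sigma> by simp
          have "emeasure lborel T \<le> ennreal (4 * 2^m * (\<epsilon> / (c * (\<Sum>i<M. \<bar>a i * mon (\<beta> i) z\<bar>))) powr (1 / m))"
          proof (rule flow[rule_format, OF CB(3)[OF zG] \<epsilon>])
            show "T \<subseteq> {0..\<tau>}" by (auto simp: T_def)
            show "0 < (\<Sum>i<M. \<bar>a i * mon (\<beta> i) z\<bar>)" using L b0(3) by linarith
            fix t assume t: "t \<in> T"
            then have "exp t *\<^sub>R z \<in> E" by (simp add: T_def)
            then have "exp t *\<^sub>R z \<in> CB r" "\<bar>Q (exp t *\<^sub>R z) + (\<Sum>l=1..m. \<eta> l * S l (exp t *\<^sub>R z))\<bar> < \<epsilon>"
              by (auto simp: E_def)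
            then show "\<bar>\<Sum>i<M. a i * (mon (\<beta> i) (exp t *\<^sub>R z) * u i (exp t *\<^sub>R z))\<bar> < \<epsilon>"
              using F[OF CB(1), of "exp t *\<^sub>R z" \<eta>] by (simp add: a_def)
          qed simp
          also have "\<dots> \<le> ennreal (4 * 2^m * (\<epsilon> / (c * (\<kappa> * \<sigma>))) powr (1 / m))"
            using c \<kappa> \<sigma> \<epsilon> L b0(3) less_le_trans[OF L b0(3)] by (intro ennreal_leI mult_left_mono powr_mono2 divide_left_mono mult_pos_pos) auto
          finally have eT: "emeasure lborel T \<le> ennreal (4 * 2^m * (\<epsilon> / (c * (\<kappa> * \<sigma>))) powr (1 / m))" .
          have "(\<integral>\<^sup>+t. (indicator E (exp t *\<^sub>R z) * ennreal \<bar>j (exp t *\<^sub>R z)\<bar>) * indicator {0..\<tau>} t \<partial>lborel)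
            \<le> (\<integral>\<^sup>+t. ennreal (J * \<bar>j z\<bar>) * indicator T t \<partial>lborel)"
          proof (rule nn_integral_mono)
            fix t
            show "(indicator E (exp t *\<^sub>R z) * ennreal \<bar>j (exp t *\<^sub>R z)\<bar>) * indicator {0..\<tau>} t
              \<le> ennreal (J * \<bar>j z\<bar>) * indicator T t"
            proof (cases "t \<in> T")
              case True
              then have "ennreal \<bar>j (exp t *\<^sub>R z)\<bar> \<le> ennreal (J * \<bar>j z\<bar>)"
                by (intro ennreal_leI bk(2)) (auto simp: T_def)
              then show ?thesis using True by (simp add: T_def)
            qed (auto simp: T_def indicator_def)
          qed
          also have "\<dots> = ennreal (J * \<bar>j z\<bar>) * emeasure lborel T"
            by (rule nn_integral_cmult_indicator) simp
          also have "\<dots> \<le> ennreal (J * \<bar>j z\<bar>) * ennreal (4 * 2^m * (\<epsilon> / (c * (\<kappa> * \<sigma>))) powr (1 / m))"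
            by (rule mult_left_mono[OF eT]) simp
          also have "\<dots> = ennreal B * (indicator G z * ennreal \<bar>j z\<bar>)"
            using b0(1) by (simp add: B_def J_def ennreal_mult[symmetric] mult_ac)
          finally show ?thesis .
        qed
      qed measurable
      also have "3 ^ CARD('n) * B / \<tau> = C * (\<epsilon> / \<sigma>) powr (1 / m)"
      proof -
        have "(\<epsilon> / (c * (\<kappa> * \<sigma>))) powr (1 / m) = (1 / (c * \<kappa>)) powr (1 / m) * (\<epsilon> / \<sigma>) powr (1 / m)"
          using c \<kappa> \<sigma> \<epsilon> by (subst powr_mult[symmetric]) (auto simp: mult_ac)
        then show ?thesis by (simp add: B_def C_def)
      qed
      finally show "(\<integral>\<^sup>+z. indicator {z \<in> CB r. \<sigma> \<le> \<bar>Q z\<bar> \<and> \<bar>Q z\<bar> < 2 * \<sigma> \<and> \<bar>Q z + (\<Sum>l=1..m. \<eta> l * S l z)\<bar> < \<epsilon>} z * ennreal \<bar>j z\<bar> \<partial>lborel)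
        \<le> ennreal (C * (\<epsilon> / \<sigma>) powr (1 / m)) * (\<integral>\<^sup>+z. indicator {z \<in> CB r. \<bar>Q z\<bar> < 8 * \<sigma>} z * ennreal \<bar>j z\<bar> \<partial>lborel)"
        unfolding E_def G_def .
    qed
  qed
qed

text \<open>The area inequality pulls the set up to the chart, and the multiplicity bound pushes the
  right-hand side down again. The comparison is thus with a sublevel set of \<open>q\<close> itself
  near the origin.\<close>

lemma chart_measure_estimate:
  fixes q :: "real^'n::finite \<Rightarrow> real" and s :: "nat \<Rightarrow> real^'n \<Rightarrow> real" and m :: nat
  assumes m: "m \<ge> 1" and ch: "chart UNIV \<psi> j" and j: "mono_germ UNIV j" and span: "chain_span H (m + 1) \<psi>"
    and H: "q \<in> H" "\<And>l. l \<in> {1..m} \<Longrightarrow> s l \<in> H"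
    and q[measurable]: "q \<in> borel_measurable borel" and s: "\<And>l. l \<in> {1..m} \<Longrightarrow> s l \<in> borel_measurable borel"
    and a: "a > 0"
  shows "\<exists>r C \<delta>. r > 0 \<and> C \<ge> 0 \<and> \<delta> > 0 \<and> \<psi> ` CB r \<in> sets borel \<and>
    (\<forall>\<eta> \<sigma> \<epsilon>. (\<forall>l\<in>{1..m}. \<bar>\<eta> l\<bar> < \<delta>) \<longrightarrow> 0 < \<sigma> \<longrightarrow> 0 < \<epsilon> \<longrightarrow>
    emeasure lborel (\<psi> ` CB r \<inter> {x. \<sigma> \<le> \<bar>q x\<bar> \<and> \<bar>q x\<bar> < 2 * \<sigma> \<and> \<bar>q x + (\<Sum>l=1..m. \<eta> l * s l x)\<bar> < \<epsilon>})
    \<le> ennreal (C * (\<epsilon> / \<sigma>) powr (1 / m)) * emeasure lborel {x \<in> RB a. \<bar>q x\<bar> < 8 * \<sigma>})"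
proof -
  obtain M \<beta> u where M: "M \<le> m + 1" and chain: "\<forall>i k. i < k \<longrightarrow> k < M \<longrightarrow> (\<forall>l. \<beta> i l \<le> \<beta> k l) \<and> \<beta> i \<noteq> \<beta> k"
    and u': "\<forall>i. an (u i) \<and> u i 0 \<noteq> 0"
    and gen: "\<forall>h\<in>H. \<exists>c. \<forall>\<^sub>F x in nhds 0. h (\<psi> x) = (\<Sum>i<M. c i * (mon (\<beta> i) x * u i x))"
    using span unfolding chain_span_def by (elim exE conjE) (rule that)
  have u: "an (u i)" "u i 0 \<noteq> 0" for i using u' by simp_all
  obtain d where d: "\<forall>\<^sub>F x in nhds 0. q (\<psi> x) = (\<Sum>i<M. d i * (mon (\<beta> i) x * u i x))"
    using bspec[OF gen H(1)] by (elim exE) (rule that)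
  have "\<forall>l\<in>{1..m}. \<exists>c. \<forall>\<^sub>F x in nhds 0. s l (\<psi> x) = (\<Sum>i<M. c i * (mon (\<beta> i) x * u i x))"
    using bspec[OF gen H(2)] by (intro ballI)
  then obtain e where e: "\<forall>l\<in>{1..m}. \<forall>\<^sub>F x in nhds 0. s l (\<psi> x) = (\<Sum>i<M. e l i * (mon (\<beta> i) x * u i x))"
    by (rule bchoice[THEN exE])
  obtain B r0 where [measurable]: "\<psi> \<in> borel_measurable borel" "j \<in> borel_measurable borel" and
    B: "\<And>h. h \<in> borel_measurable borel \<Longrightarrow>
      (\<integral>\<^sup>+x. h (\<psi> x) * ennreal \<bar>j x\<bar> \<partial>lborel) \<le> ennreal B * (\<integral>\<^sup>+x. h x \<partial>lborel)" and
    r0: "r0 > 0" and cont: "continuous_on (RB r0) \<psi>" and low: "\<And>K h. h \<in> borel_measurable borel \<Longrightarrow> compact K \<Longrightarrow> K \<subseteq> RB r0 \<Longrightarrow>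
      (\<integral>\<^sup>+x. h x * indicator (\<psi> ` K) x \<partial>lborel) \<le> (\<integral>\<^sup>+x. h (\<psi> x) * ennreal \<bar>j x\<bar> * indicator K x \<partial>lborel)"
    by (rule cvE[OF chartD(7)[OF ch]]) (rule that)
  obtain \<rho> C \<delta> where \<rho>: "\<rho> > 0" and C: "C > 0" and \<delta>: "\<delta> > 0" and
    est: "\<forall>r \<eta> \<sigma> \<epsilon>. 0 < r \<longrightarrow> r < \<rho> \<longrightarrow> (\<forall>l\<in>{1..m}. \<bar>\<eta> l\<bar> < \<delta>) \<longrightarrow> 0 < \<sigma> \<longrightarrow> 0 < \<epsilon> \<longrightarrow>
    (\<integral>\<^sup>+z. indicator {z \<in> CB r. \<sigma> \<le> \<bar>q (\<psi> z)\<bar> \<and> \<bar>q (\<psi> z)\<bar> < 2 * \<sigma> \<and> \<bar>q (\<psi> z) + (\<Sum>l=1..m. \<eta> l * s l (\<psi> z))\<bar> < \<epsilon>} z * ennreal \<bar>j z\<bar> \<partial>lborel)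
    \<le> ennreal (C * (\<epsilon> / \<sigma>) powr (1 / m)) * (\<integral>\<^sup>+z. indicator {z \<in> CB r. \<bar>q (\<psi> z)\<bar> < 8 * \<sigma>} z * ennreal \<bar>j z\<bar> \<partial>lborel)"
  proof -
    have qm: "(\<lambda>z. q (\<psi> z)) \<in> borel_measurable borel" by measurable
    have sm: "\<forall>l\<in>{1..m}. (\<lambda>z. s l (\<psi> z)) \<in> borel_measurable borel"
      using measurable_compose[OF \<open>\<psi> \<in> borel_measurable borel\<close> s] by blast
    show thesis
      using chart_estimate[where \<beta> = \<beta> and u = u and j = j and Q = "\<lambda>z. q (\<psi> z)" and S = "\<lambda>l z. s l (\<psi> z)" and d = d and e = e,
          OF m M chain u j \<open>j \<in> borel_measurable borel\<close> qm sm d e]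
      by (elim exE conjE) (rule that)
  qed
  have "\<forall>\<^sub>F x in nhds 0. \<psi> x \<in> RB a"
    by (rule chart_eventually[OF ch]) (rule eventually_RBI[OF a])
  then obtain \<rho>' where \<rho>': "\<rho>' > 0" "\<forall>x\<in>RB \<rho>'. \<psi> x \<in> RB a" unfolding eventually_RB by (elim exE conjE) (rule that)
  \<comment> \<open>Halved so that the closed box \<open>CB r\<close> lies in all three open
    boxes.\<close>
  define r where "r = min r0 (min \<rho> \<rho>') / 2"
  have r: "r > 0" "r < r0" "r < \<rho>" "r < \<rho>'" using r0 \<rho> \<rho>' by (auto simp: r_def)
  have "compact (\<psi> ` CB r)"
    by (rule compact_continuous_image[OF continuous_on_subset[OF cont] compact_CB]) (rule CB_subset_RB[OF r(2)])
  then have K[measurable]: "\<psi> ` CB r \<in> sets borel" by (rule borel_compact)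
  show ?thesis
  proof (rule exI[of _ r], rule exI[of _ "C * \<bar>B\<bar>"], rule exI[of _ \<delta>], intro conjI allI impI)
    fix \<eta> and \<sigma> \<epsilon> :: real assume \<eta>: "\<forall>l\<in>{1..m}. \<bar>\<eta> l\<bar> < \<delta>" and \<sigma>: "0 < \<sigma>" and \<epsilon>: "0 < \<epsilon>"
    define E where "E = {x. \<sigma> \<le> \<bar>q x\<bar> \<and> \<bar>q x\<bar> < 2 * \<sigma> \<and> \<bar>q x + (\<Sum>l=1..m. \<eta> l * s l x)\<bar> < \<epsilon>}"
    define G where "G = {x \<in> RB a. \<bar>q x\<bar> < 8 * \<sigma>}"
    have [measurable]: "(\<lambda>x. \<Sum>l=1..m. \<eta> l * s l x) \<in> borel_measurable borel"
      by (intro borel_measurable_sum borel_measurable_times s) auto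
    have [measurable]: "RB a \<in> sets (borel :: (real^'n) measure)" by (simp add: open_RB borel_open)
    have [measurable]: "E \<in> sets borel" "G \<in> sets borel" unfolding E_def G_def by measurable
    have "emeasure lborel (\<psi> ` CB r \<inter> E) = (\<integral>\<^sup>+x. indicator E x * indicator (\<psi> ` CB r) x \<partial>lborel)"
    proof -
      have "emeasure lborel (\<psi> ` CB r \<inter> E) = (\<integral>\<^sup>+x. indicator (\<psi> ` CB r \<inter> E) x \<partial>lborel)" by simp
      also have "\<dots> = (\<integral>\<^sup>+x. indicator E x * indicator (\<psi> ` CB r) x \<partial>lborel)"
        by (intro nn_integral_cong) (simp add: indicator_inter_arith mult.commute)
      finally show ?thesis .
    qed
    also have "\<dots> \<le> (\<integral>\<^sup>+x. indicator E (\<psi> x) * ennreal \<bar>j x\<bar> * indicator (CB r) x \<partial>lborel)"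
      by (rule low[OF _ compact_CB CB_subset_RB[OF r(2)]]) simp
    also have "\<dots> = (\<integral>\<^sup>+z. indicator {z \<in> CB r. \<sigma> \<le> \<bar>q (\<psi> z)\<bar> \<and> \<bar>q (\<psi> z)\<bar> < 2 * \<sigma> \<and> \<bar>q (\<psi> z) + (\<Sum>l=1..m. \<eta> l * s l (\<psi> z))\<bar> < \<epsilon>} z * ennreal \<bar>j z\<bar> \<partial>lborel)"
      by (intro nn_integral_cong) (auto simp: E_def indicator_def)
    also have "\<dots> \<le> ennreal (C * (\<epsilon> / \<sigma>) powr (1 / m)) * (\<integral>\<^sup>+z. indicator {z \<in> CB r. \<bar>q (\<psi> z)\<bar> < 8 * \<sigma>} z * ennreal \<bar>j z\<bar> \<partial>lborel)"
      using est[rule_format, of r \<eta> \<sigma> \<epsilon>] r \<eta> \<sigma> \<epsilon> by simp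
    also have "\<dots> \<le> ennreal (C * (\<epsilon> / \<sigma>) powr (1 / m)) * (\<integral>\<^sup>+z. indicator G (\<psi> z) * ennreal \<bar>j z\<bar> \<partial>lborel)"
      using \<rho>'(2) CB_subset_RB[OF r(4)] by (intro mult_left_mono nn_integral_mono) (auto simp: G_def indicator_def)
    also have "\<dots> \<le> ennreal (C * (\<epsilon> / \<sigma>) powr (1 / m)) * (ennreal B * (\<integral>\<^sup>+z. indicator G z \<partial>lborel))"
      by (intro mult_left_mono B) auto
    also have "(\<integral>\<^sup>+z. indicator G z \<partial>lborel) = emeasure lborel G" by simp
    also have "ennreal (C * (\<epsilon> / \<sigma>) powr (1 / m)) * (ennreal B * emeasure lborel G)
        \<le> ennreal (C * (\<epsilon> / \<sigma>) powr (1 / m)) * (ennreal \<bar>B\<bar> * emeasure lborel G)"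
      by (intro mult_left_mono mult_right_mono ennreal_leI) auto
    also have "\<dots> = ennreal (C * \<bar>B\<bar> * (\<epsilon> / \<sigma>) powr (1 / m)) * emeasure lborel G"
    proof -
      have "ennreal (C * \<bar>B\<bar> * (\<epsilon> / \<sigma>) powr (1 / m)) = ennreal ((C * (\<epsilon> / \<sigma>) powr (1 / m)) * \<bar>B\<bar>)"
        by (simp add: mult_ac)
      also have "\<dots> = ennreal (C * (\<epsilon> / \<sigma>) powr (1 / m)) * ennreal \<bar>B\<bar>" using C by (intro ennreal_mult) auto
      finally show ?thesis by (simp only: mult.assoc)
    qed
    finally show "emeasure lborel (\<psi> ` CB r \<inter> {x. \<sigma> \<le> \<bar>q x\<bar> \<and> \<bar>q x\<bar> < 2 * \<sigma> \<and> \<bar>q x + (\<Sum>l=1..m. \<eta> l * s l x)\<bar> < \<epsilon>})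
      \<le> ennreal (C * \<bar>B\<bar> * (\<epsilon> / \<sigma>) powr (1 / m)) * emeasure lborel {x \<in> RB a. \<bar>q x\<bar> < 8 * \<sigma>}"
      unfolding E_def G_def .
  qed (use r C \<delta> K in auto)
qed

text \<open>The radii prescribed to the covering are those at which the chart estimates hold. For
  the finitely many charts that remain, the constants are added and the smallest \<delta> is
  taken.\<close>

lemma local_estimate:
  fixes q :: "real^'n::finite \<Rightarrow> real" and s :: "nat \<Rightarrow> real^'n \<Rightarrow> real" and m :: nat
  assumes m: "m \<ge> 1" and an: "an q" "\<And>l. l \<in> {1..m} \<Longrightarrow> an (s l)"
    and q[measurable]: "q \<in> borel_measurable borel" and s: "\<And>l. l \<in> {1..m} \<Longrightarrow> s l \<in> borel_measurable borel"
    and a: "a > 0"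
  shows "\<exists>r C \<delta>. r > 0 \<and> C \<ge> 0 \<and> \<delta> > 0 \<and> (\<forall>\<eta> \<sigma> \<epsilon>. (\<forall>l\<in>{1..m}. \<bar>\<eta> l\<bar> < \<delta>) \<longrightarrow> 0 < \<sigma> \<longrightarrow> 0 < \<epsilon> \<longrightarrow>
    emeasure lborel {x \<in> RB r. \<sigma> \<le> \<bar>q x\<bar> \<and> \<bar>q x\<bar> < 2 * \<sigma> \<and> \<bar>q x + (\<Sum>l=1..m. \<eta> l * s l x)\<bar> < \<epsilon>}
    \<le> ennreal (C * (\<epsilon> / \<sigma>) powr (1 / m)) * emeasure lborel {x \<in> RB a. \<bar>q x\<bar> < 8 * \<sigma>})"
proof -
  define P where "P K C \<delta> \<longleftrightarrow> (\<forall>\<eta> \<sigma> \<epsilon>. (\<forall>l\<in>{1..m}. \<bar>\<eta> l\<bar> < \<delta>) \<longrightarrow> 0 < \<sigma> \<longrightarrow> 0 < \<epsilon> \<longrightarrow>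
    emeasure lborel (K \<inter> {x. \<sigma> \<le> \<bar>q x\<bar> \<and> \<bar>q x\<bar> < 2 * \<sigma> \<and> \<bar>q x + (\<Sum>l=1..m. \<eta> l * s l x)\<bar> < \<epsilon>})
    \<le> ennreal (C * (\<epsilon> / \<sigma>) powr (1 / m)) * emeasure lborel {x \<in> RB a. \<bar>q x\<bar> < 8 * \<sigma>})" for K and C \<delta> :: real
  define H where "H = insert q (s ` {1..m})"
  have H: "finite H" "card H \<le> m + 1" "\<And>h. h \<in> H \<Longrightarrow> an h"
  proof -
    have "card (s ` {1..m}) \<le> m" using card_image_le[of "{1..m}" s] by simp
    then show "card H \<le> m + 1" unfolding H_def by (intro order_trans[OF card_insert_le_m1]) auto
  qed (use an in \<open>auto simp: H_def\<close>)
  obtain A where A: "fam UNIV A" and PA: "\<forall>c\<in>A. mono_germ UNIV (snd c) \<and> (\<forall>i. mono_germ UNIV (\<lambda>x. fst c x $ i)) \<and> chain_span H (m + 1) (fst c)"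
  proof -
    have "covers UNIV (\<lambda>\<psi> j. mono_germ UNIV j \<and> (\<forall>i. mono_germ UNIV (\<lambda>x. \<psi> x $ i)) \<and> chain_span H (m + 1) \<psi>)"
      using H by (rule covers_chain)
    then show thesis unfolding covers_def by (elim exE conjE) (rule that)
  qed
  have "\<forall>c\<in>A. \<exists>r C \<delta>. r > 0 \<and> C \<ge> 0 \<and> \<delta> > 0 \<and> fst c ` CB r \<in> sets borel \<and> P (fst c ` CB r) C \<delta>"
  proof
    fix c assume c: "c \<in> A"
    show "\<exists>r C \<delta>. r > 0 \<and> C \<ge> 0 \<and> \<delta> > 0 \<and> fst c ` CB r \<in> sets borel \<and> P (fst c ` CB r) C \<delta>"
      unfolding P_def
      by (rule chart_measure_estimate[OF m fam_chart[OF A c] _ _ _ _ q s a, of H])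
        (use bspec[OF PA c] in \<open>auto simp: H_def\<close>)
  qed
  then obtain \<rho> where "\<forall>c\<in>A. \<exists>C \<delta>. \<rho> c > 0 \<and> C \<ge> 0 \<and> \<delta> > 0 \<and> fst c ` CB (\<rho> c) \<in> sets borel \<and> P (fst c ` CB (\<rho> c)) C \<delta>"
    by (rule bchoice[THEN exE])
  then obtain C where "\<forall>c\<in>A. \<exists>\<delta>. \<rho> c > 0 \<and> C c \<ge> 0 \<and> \<delta> > 0 \<and> fst c ` CB (\<rho> c) \<in> sets borel \<and> P (fst c ` CB (\<rho> c)) (C c) \<delta>"
    by (rule bchoice[THEN exE])
  then obtain \<delta> where pars: "\<forall>c\<in>A. \<rho> c > 0 \<and> C c \<ge> 0 \<and> \<delta> c > 0 \<and> fst c ` CB (\<rho> c) \<in> sets borel \<and> P (fst c ` CB (\<rho> c)) (C c) (\<delta> c)"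
    by (rule bchoice[THEN exE])
  have \<rho>: "\<rho> c > 0" and C: "C c \<ge> 0" and \<delta>: "\<delta> c > 0" and K: "fst c ` CB (\<rho> c) \<in> sets borel" if "c \<in> A" for c
    using bspec[OF pars that] by simp_all
  have est: "emeasure lborel (fst c ` CB (\<rho> c) \<inter> {x. \<sigma> \<le> \<bar>q x\<bar> \<and> \<bar>q x\<bar> < 2 * \<sigma> \<and> \<bar>q x + (\<Sum>l=1..m. \<eta> l * s l x)\<bar> < \<epsilon>})
    \<le> ennreal (C c * (\<epsilon> / \<sigma>) powr (1 / m)) * emeasure lborel {x \<in> RB a. \<bar>q x\<bar> < 8 * \<sigma>}"
    if "c \<in> A" "\<forall>l\<in>{1..m}. \<bar>\<eta> l\<bar> < \<delta> c" "0 < \<sigma>" "0 < \<epsilon>" for c \<eta> \<sigma> \<epsilon>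
    using bspec[OF pars that(1)] that(2-4) unfolding P_def by simp
  obtain A0 r where A0: "A0 \<subseteq> A" "finite A0" and r: "r > 0" and cover: "RB r \<subseteq> (\<Union>c\<in>A0. fst c ` RB (\<rho> c))"
  proof -
    have "\<exists>A0 r. A0 \<subseteq> A \<and> finite A0 \<and> r > 0 \<and> RB r \<subseteq> (\<Union>c\<in>A0. fst c ` RB (\<rho> c))"
      by (rule fam_cover[OF A]) (erule \<rho>)
    then show thesis by (elim exE conjE) (rule that)
  qed
  define \<delta>0 where "\<delta>0 = Min (insert 1 (\<delta> ` A0))"
  have \<delta>0: "\<delta>0 > 0" "\<And>c. c \<in> A0 \<Longrightarrow> \<delta>0 \<le> \<delta> c"
    using A0 \<delta> by (auto simp: \<delta>0_def)
  show ?thesis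
  proof (rule exI[of _ r], rule exI[of _ "\<Sum>c\<in>A0. C c"], rule exI[of _ \<delta>0], intro conjI allI impI)
    fix \<eta> and \<sigma> \<epsilon> :: real assume \<eta>: "\<forall>l\<in>{1..m}. \<bar>\<eta> l\<bar> < \<delta>0" and \<sigma>: "0 < \<sigma>" and \<epsilon>: "0 < \<epsilon>"
    define E where "E = {x. \<sigma> \<le> \<bar>q x\<bar> \<and> \<bar>q x\<bar> < 2 * \<sigma> \<and> \<bar>q x + (\<Sum>l=1..m. \<eta> l * s l x)\<bar> < \<epsilon>}"
    define G where "G = {x \<in> RB a. \<bar>q x\<bar> < 8 * \<sigma>}"
    have [measurable]: "(\<lambda>x. \<Sum>l=1..m. \<eta> l * s l x) \<in> borel_measurable borel"
      by (intro borel_measurable_sum borel_measurable_times s) auto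
    have E[measurable]: "E \<in> sets borel" unfolding E_def by measurable
    have "emeasure lborel (RB r \<inter> E) \<le> (\<Sum>c\<in>A0. ennreal (C c * (\<epsilon> / \<sigma>) powr (1 / m)) * emeasure lborel G)"
    proof -
      have "RB r \<inter> E \<subseteq> (\<Union>c\<in>A0. fst c ` CB (\<rho> c) \<inter> E)"
      proof
        fix x assume x: "x \<in> RB r \<inter> E"
        then have "x \<in> RB r" by simp
        from subsetD[OF cover this] obtain c where "c \<in> A0" "x \<in> fst c ` RB (\<rho> c)" by (elim UN_E) (rule that)
        then show "x \<in> (\<Union>c\<in>A0. fst c ` CB (\<rho> c) \<inter> E)"
          using x subsetD[OF RB_subset_CB, of _ "\<rho> c"] by (intro UN_I) auto
      qed
      then have "emeasure lborel (RB r \<inter> E) \<le> emeasure lborel (\<Union>c\<in>A0. fst c ` CB (\<rho> c) \<inter> E)"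
      proof (rule emeasure_mono)
        show "(\<Union>c\<in>A0. fst c ` CB (\<rho> c) \<inter> E) \<in> sets lborel"
          using K[OF subsetD[OF A0(1)]] A0(2) by (intro sets.finite_UN) auto
      qed
      also have "\<dots> \<le> (\<Sum>c\<in>A0. emeasure lborel (fst c ` CB (\<rho> c) \<inter> E))"
        using K[OF subsetD[OF A0(1)]] A0(2) by (intro emeasure_subadditive_finite) auto
      also have "\<dots> \<le> (\<Sum>c\<in>A0. ennreal (C c * (\<epsilon> / \<sigma>) powr (1 / m)) * emeasure lborel G)"
      proof (rule sum_mono)
        fix c assume c: "c \<in> A0"
        then have "\<forall>l\<in>{1..m}. \<bar>\<eta> l\<bar> < \<delta> c" using \<eta> \<delta>0(2) by (meson less_le_trans)
        moreover have "c \<in> A" using c A0 by blast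
        ultimately show "emeasure lborel (fst c ` CB (\<rho> c) \<inter> E) \<le> ennreal (C c * (\<epsilon> / \<sigma>) powr (1 / m)) * emeasure lborel G"
          unfolding E_def G_def by (intro est \<sigma> \<epsilon>)
      qed
      finally show ?thesis .
    qed
    also have "\<dots> = ennreal ((\<Sum>c\<in>A0. C c) * (\<epsilon> / \<sigma>) powr (1 / m)) * emeasure lborel G"
    proof -
      have "0 \<le> C c * (\<epsilon> / \<sigma>) powr (1 / m)" if "c \<in> A0" for c
        using C[OF subsetD[OF A0(1) that]] by simp
      from sum_ennreal[of A0 "\<lambda>c. C c * (\<epsilon> / \<sigma>) powr (1 / m)", OF this] show ?thesis unfolding sum_distrib_right by (simp only: sum_distrib_right[symmetric])
    qed
    finally show "emeasure lborel {x \<in> RB r. \<sigma> \<le> \<bar>q x\<bar> \<and> \<bar>q x\<bar> < 2 * \<sigma> \<and> \<bar>q x + (\<Sum>l=1..m. \<eta> l * s l x)\<bar> < \<epsilon>}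
      \<le> ennreal ((\<Sum>c\<in>A0. C c) * (\<epsilon> / \<sigma>) powr (1 / m)) * emeasure lborel {x \<in> RB a. \<bar>q x\<bar> < 8 * \<sigma>}"
      by (simp only: E_def G_def Int_def mem_Collect_eq)
  qed (use r \<delta>0 A0 C in \<open>auto intro!: sum_nonneg\<close>)
qed

section \<open>Dyadic summation and integrability of negative powers\<close>

text \<open>Half of the exponential decay absorbs the polynomial factor.\<close>

lemma summable_poly_geometric:
  assumes "\<theta> > 0"
  shows "summable (\<lambda>k::nat. 2 powr (- \<theta> * real k) * (4 + real k) ^ l)"
proof (rule summable_comparison_test_bigo)
  show "summable (\<lambda>k. norm ((2 powr (- \<theta> / 2)) ^ k :: real))"
    using assms summable_geometric[of "2 powr (- \<theta> / 2) :: real"] by (simp add: norm_power powr_less_one)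
  have "(\<lambda>k. 2 powr (- \<theta> * real k) * (4 + real k) ^ l) \<in> O(\<lambda>k. 2 powr (- \<theta> / 2 * real k))"
    using assms by real_asymp
  also have "(\<lambda>k. 2 powr (- \<theta> / 2 * real k)) = (\<lambda>k. (2 powr (- \<theta> / 2)) ^ k)"
    by (simp add: powr_realpow[symmetric] powr_powr)
  finally show "(\<lambda>k. 2 powr (- \<theta> * real k) * (4 + real k) ^ l) \<in> O(\<lambda>k. (2 powr (- \<theta> / 2)) ^ k)" .
qed

text \<open>On the shell at \<sigma> = 2^k \<epsilon> the gain 2^(-k/m) competes with the growth
  2^(k h) of \<mu>. The surplus \<theta> = 1/m - h > 0 makes the series geometric up to a polynomial
  in \<open>k\<close> that comes from the logarithm, so the order in \<epsilon> is that of the first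
  term.\<close>

lemma dyadic_sum_bound:
  fixes \<mu> :: "real \<Rightarrow> ennreal"
  assumes m: "m \<ge> 1" and h: "0 < h" "h < 1 / real m" and C1: "C1 \<ge> 0" and K: "K \<ge> 0"
    and \<mu>: "\<And>\<sigma>. \<sigma> > 0 \<Longrightarrow> \<mu> \<sigma> \<le> ennreal (C1 * \<sigma> powr h * (1 + \<bar>ln \<sigma>\<bar>) ^ l)"
  shows "\<exists>C>0. \<forall>\<epsilon>. 0 < \<epsilon> \<longrightarrow> \<epsilon> < 1/2 \<longrightarrow>
    \<mu> \<epsilon> + (\<Sum>k. ennreal (K * (\<epsilon> / (2^k * \<epsilon>)) powr (1 / m)) * \<mu> (8 * (2^k * \<epsilon>))) \<le> ennreal (C * \<epsilon> powr h * \<bar>ln \<epsilon>\<bar> ^ l)"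
proof -
  define \<theta> where "\<theta> = 1 / real m - h"
  have \<theta>: "\<theta> > 0" using h by (simp add: \<theta>_def)
  define f where "f k = 2 powr (- \<theta> * real k) * (4 + real k) ^ l" for k :: nat
  have f: "summable f" unfolding f_def[abs_def] using \<theta> by (rule summable_poly_geometric)
  have f0: "f k \<ge> 0" for k by (simp add: f_def)
  define C where "C = C1 * 3 ^ l + K * C1 * 3 ^ l * 8 powr h * suminf f + 1"
  have "C > 0" unfolding C_def using C1 K suminf_nonneg[OF f f0] by (intro add_nonneg_pos) auto
  show ?thesis
  proof (intro exI[of _ C] conjI allI impI)
    fix \<epsilon> :: real assume \<epsilon>: "0 < \<epsilon>" "\<epsilon> < 1/2"
    define L where "L = \<bar>ln \<epsilon>\<bar>"
    \<comment> \<open>From \<epsilon> < 1/2 the logarithm is at least ln 2 in size, so additive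
      constants can be absorbed into multiples of \<open>L\<close>.\<close>
    have L: "1 \<le> 2 * L"
    proof -
      have "ln \<epsilon> \<le> ln (1/2)" using \<epsilon> by simp
      also have "\<dots> = - ln 2" by (simp add: ln_div)
      finally have "ln 2 \<le> L" by (simp add: L_def)
      moreover have "1/2 \<le> ln (2::real)" using ln2_ge_two_thirds by linarith
      ultimately show ?thesis by simp
    qed
    have "\<mu> \<epsilon> \<le> ennreal (C1 * 3 ^ l * \<epsilon> powr h * L ^ l)"
    proof (rule order_trans[OF \<mu>[OF \<epsilon>(1)]], rule ennreal_leI)
      have "(1 + L) ^ l \<le> (3 * L) ^ l" using L by (intro power_mono) auto
      then show "C1 * \<epsilon> powr h * (1 + \<bar>ln \<epsilon>\<bar>) ^ l \<le> C1 * 3 ^ l * \<epsilon> powr h * L ^ l"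
        using C1 mult_left_mono[of "(1 + L)^l" "(3*L)^l" "C1 * \<epsilon> powr h"] by (simp add: L_def power_mult_distrib mult_ac)
    qed
    moreover have "(\<Sum>k. ennreal (K * (\<epsilon> / (2^k * \<epsilon>)) powr (1 / m)) * \<mu> (8 * (2^k * \<epsilon>)))
        \<le> (\<Sum>k. ennreal (K * C1 * 3 ^ l * 8 powr h * \<epsilon> powr h * L ^ l * f k))"
    proof (rule suminf_le)
      fix k :: nat
      have pk: "2 ^ k = 2 powr real k" by (simp add: powr_realpow)
      have "ennreal (K * (\<epsilon> / (2^k * \<epsilon>)) powr (1 / m)) * \<mu> (8 * (2^k * \<epsilon>))
          \<le> ennreal (K * (\<epsilon> / (2^k * \<epsilon>)) powr (1 / m)) * ennreal (C1 * (8 * (2^k * \<epsilon>)) powr h * (1 + \<bar>ln (8 * (2^k * \<epsilon>))\<bar>) ^ l)"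
        using \<epsilon> by (intro mult_left_mono \<mu>) auto
      also have "\<dots> \<le> ennreal (K * (\<epsilon> / (2^k * \<epsilon>)) powr (1 / m)) * ennreal (C1 * (8 * (2^k * \<epsilon>)) powr h * (3 * ((4 + real k) * L)) ^ l)"
      proof (intro mult_left_mono ennreal_leI power_mono)
        have "ln (8 * (2^k * \<epsilon>)) = ln 8 + (real k * ln 2 + ln \<epsilon>)"
          using \<epsilon> by (simp add: ln_mult ln_realpow)
        moreover have "ln (8::real) = 3 * ln 2" using ln_realpow[of 2 3] by simp
        ultimately have e: "ln (8 * (2^k * \<epsilon>)) = (3 + real k) * ln 2 + ln \<epsilon>" by (simp add: algebra_simps)
        define X where "X = (3 + real k) * ln 2"
        have "X \<le> (3 + real k) * 1" unfolding X_def using ln2_le_25_over_36 by (intro mult_left_mono) auto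
        moreover have "\<bar>X + ln \<epsilon>\<bar> \<le> X + \<bar>ln \<epsilon>\<bar>"
          using abs_triangle_ineq[of X "ln \<epsilon>"] by (simp add: X_def)
        \<comment> \<open>The shift 4 in \<open>f\<close>: the factor 8 gives 3 and the summand 1
          before the logarithm gives the rest.\<close>
        ultimately have "1 + \<bar>ln (8 * (2^k * \<epsilon>))\<bar> \<le> (4 + real k) * 1 + L"
          unfolding e L_def X_def[symmetric] by simp
        also have "\<dots> \<le> (4 + real k) * (2 * L) + (4 + real k) * L"
          using L by (intro add_mono mult_left_mono mult_right_le_one_le) (auto simp: mult_le_cancel_right1 L_def)
        also have "\<dots> = 3 * ((4 + real k) * L)" by (simp add: algebra_simps)
        finally show "1 + \<bar>ln (8 * (2^k * \<epsilon>))\<bar> \<le> 3 * ((4 + real k) * L)" .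
      qed (use C1 in auto)
      also have "\<dots> = ennreal (K * C1 * 3 ^ l * 8 powr h * \<epsilon> powr h * L ^ l * f k)"
      proof -
        have e1: "(\<epsilon> / (2^k * \<epsilon>)) powr (1 / m) = 2 powr (- (1 / m) * real k)"
          using \<epsilon> by (simp add: pk powr_minus_divide[symmetric] powr_powr mult.commute)
        have e2: "(8 * (2^k * \<epsilon>)) powr h = 8 powr h * (2 powr (h * real k) * \<epsilon> powr h)"
          using \<epsilon> by (simp add: pk powr_mult powr_powr mult.commute)
        have e3: "2 powr (- \<theta> * real k) = 2 powr (- (1 / m) * real k) * 2 powr (h * real k)"
          by (simp add: \<theta>_def powr_add[symmetric] algebra_simps)
        have "K * C1 * 3 ^ l * E * G * L ^ l * (A * B * F ^ l) = K * A * (C1 * (E * (B * G)) * (3 * (F * L)) ^ l)" for A B E F G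
          by (simp add: power_mult_distrib mult_ac)
        then have "K * C1 * 3 ^ l * 8 powr h * \<epsilon> powr h * L ^ l * f k =
          (K * (\<epsilon> / (2^k * \<epsilon>)) powr (1 / m)) * (C1 * (8 * (2^k * \<epsilon>)) powr h * (3 * ((4 + real k) * L)) ^ l)"
          unfolding f_def e1 e2 e3 .
        then show ?thesis by (simp only:) (intro ennreal_mult[symmetric] mult_nonneg_nonneg zero_le_power, use K C1 in \<open>auto simp: L_def\<close>)
      qed
      finally show "ennreal (K * (\<epsilon> / (2^k * \<epsilon>)) powr (1 / m)) * \<mu> (8 * (2^k * \<epsilon>))
        \<le> ennreal (K * C1 * 3 ^ l * 8 powr h * \<epsilon> powr h * L ^ l * f k)" .
    qed auto
    moreover have "(\<Sum>k. ennreal (K * C1 * 3 ^ l * 8 powr h * \<epsilon> powr h * L ^ l * f k)) = ennreal (K * C1 * 3 ^ l * 8 powr h * \<epsilon> powr h * L ^ l * suminf f)"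
    proof -
      have "(\<Sum>k. ennreal (K * C1 * 3 ^ l * 8 powr h * \<epsilon> powr h * L ^ l * f k)) = ennreal (\<Sum>k. K * C1 * 3 ^ l * 8 powr h * \<epsilon> powr h * L ^ l * f k)"
        using f f0 K C1 by (intro suminf_ennreal2 summable_mult) (auto simp: L_def)
      also have "(\<Sum>k. K * C1 * 3 ^ l * 8 powr h * \<epsilon> powr h * L ^ l * f k) = K * C1 * 3 ^ l * 8 powr h * \<epsilon> powr h * L ^ l * suminf f"
        by (rule suminf_mult[OF f])
      finally show ?thesis .
    qed
    ultimately have "\<mu> \<epsilon> + (\<Sum>k. ennreal (K * (\<epsilon> / (2^k * \<epsilon>)) powr (1 / m)) * \<mu> (8 * (2^k * \<epsilon>)))
       \<le> ennreal (C1 * 3 ^ l * \<epsilon> powr h * L ^ l) + ennreal (K * C1 * 3 ^ l * 8 powr h * \<epsilon> powr h * L ^ l * suminf f)"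
      by (simp add: add_mono)
    also have "\<dots> = ennreal ((C - 1) * (\<epsilon> powr h * L ^ l))"
      using C1 K suminf_nonneg[OF f f0]
      by (subst ennreal_plus[symmetric]) (auto simp: L_def C_def algebra_simps)
    also have "\<dots> \<le> ennreal (C * \<epsilon> powr h * \<bar>ln \<epsilon>\<bar> ^ l)"
      by (intro ennreal_leI) (simp add: L_def mult.assoc mult_right_mono)
    finally show "\<mu> \<epsilon> + (\<Sum>k. ennreal (K * (\<epsilon> / (2^k * \<epsilon>)) powr (1 / m)) * \<mu> (8 * (2^k * \<epsilon>))) \<le> ennreal (C * \<epsilon> powr h * \<bar>ln \<epsilon>\<bar> ^ l)" .
  qed fact
qed

text \<open>The asymptotics control \<mu> only near 0; for larger \<sigma> the bound
  \<open>V\<close> takes over. The weight is 1 + |ln \<sigma>| because |ln \<sigma>| vanishes at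
  \<sigma> = 1.\<close>

lemma log_powr_upper_bound:
  fixes \<mu> :: "real \<Rightarrow> real"
  assumes c: "c > 0" and h: "h > 0" and V: "\<And>\<sigma>. \<mu> \<sigma> \<le> V"
    and asym: "(\<lambda>\<epsilon>. \<mu> \<epsilon> - c * \<epsilon> powr h * \<bar>ln \<epsilon>\<bar> ^ l) \<in> o[at_right 0](\<lambda>\<epsilon>. \<epsilon> powr h * \<bar>ln \<epsilon>\<bar> ^ l)"
  shows "\<exists>C\<ge>0. \<forall>\<sigma>>0. \<mu> \<sigma> \<le> C * \<sigma> powr h * (1 + \<bar>ln \<sigma>\<bar>) ^ l"
    and "\<forall>\<^sub>F \<sigma> in at_right 0. c / 2 * (\<sigma> powr h * \<bar>ln \<sigma>\<bar> ^ l) \<le> \<mu> \<sigma>"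
proof -
  have *: "\<forall>\<^sub>F \<sigma> in at_right 0. norm (\<mu> \<sigma> - c * \<sigma> powr h * \<bar>ln \<sigma>\<bar> ^ l) \<le> c / 2 * norm (\<sigma> powr h * \<bar>ln \<sigma>\<bar> ^ l)"
    by (rule landau_o.smallD[OF asym]) (use c in simp)
  then have ev: "\<forall>\<^sub>F \<sigma> in at_right 0. c / 2 * (\<sigma> powr h * \<bar>ln \<sigma>\<bar> ^ l) \<le> \<mu> \<sigma> \<and> \<mu> \<sigma> \<le> 2 * c * (\<sigma> powr h * \<bar>ln \<sigma>\<bar> ^ l)"
  proof eventually_elim
    case (elim \<sigma>)
    define X where "X = \<sigma> powr h * \<bar>ln \<sigma>\<bar> ^ l"
    have "X \<ge> 0" by (simp add: X_def)
    moreover have "\<bar>\<mu> \<sigma> - c * X\<bar> \<le> c * X / 2" using elim by (simp add: X_def abs_mult mult.assoc)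
    moreover have "0 \<le> c * X" using c \<open>X \<ge> 0\<close> by simp
    ultimately have "c * X / 2 \<le> \<mu> \<sigma> \<and> \<mu> \<sigma> \<le> 2 * (c * X)" unfolding abs_le_iff by linarith
    then show ?case by (simp add: X_def)
  qed
  then show "\<forall>\<^sub>F \<sigma> in at_right 0. c / 2 * (\<sigma> powr h * \<bar>ln \<sigma>\<bar> ^ l) \<le> \<mu> \<sigma>"
    by eventually_elim simp
  obtain e where e: "e > 0" "\<And>\<sigma>. 0 < \<sigma> \<Longrightarrow> \<sigma> < e \<Longrightarrow> \<mu> \<sigma> \<le> 2 * c * (\<sigma> powr h * \<bar>ln \<sigma>\<bar> ^ l)"
    using ev unfolding eventually_at_right_field by auto
  define C where "C = max (2 * c) (\<bar>V\<bar> / e powr h)"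
  show "\<exists>C\<ge>0. \<forall>\<sigma>>0. \<mu> \<sigma> \<le> C * \<sigma> powr h * (1 + \<bar>ln \<sigma>\<bar>) ^ l"
  proof (intro exI[of _ C] conjI allI impI)
    show "C \<ge> 0" using c by (simp add: C_def)
    fix \<sigma> :: real assume \<sigma>: "\<sigma> > 0"
    show "\<mu> \<sigma> \<le> C * \<sigma> powr h * (1 + \<bar>ln \<sigma>\<bar>) ^ l"
    proof (cases "\<sigma> < e")
      case True
      have "\<mu> \<sigma> \<le> 2 * c * (\<sigma> powr h * \<bar>ln \<sigma>\<bar> ^ l)" by (rule e(2)[OF \<sigma> True])
      also have "\<dots> \<le> C * (\<sigma> powr h * (1 + \<bar>ln \<sigma>\<bar>) ^ l)"
        using c by (intro mult_mono power_mono) (auto simp: C_def)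
      finally show ?thesis by (simp add: mult.assoc)
    next
      case False
      have "\<mu> \<sigma> \<le> \<bar>V\<bar>" using V[of \<sigma>] by simp
      also have "\<dots> = \<bar>V\<bar> / e powr h * e powr h" using e by simp
      also have "\<dots> \<le> C * (\<sigma> powr h * (1 + \<bar>ln \<sigma>\<bar>) ^ l)"
      proof (intro mult_mono)
        have "e powr h * 1 \<le> \<sigma> powr h * (1 + \<bar>ln \<sigma>\<bar>) ^ l"
          using e False h by (intro mult_mono powr_mono2 one_le_power) auto
        then show "e powr h \<le> \<sigma> powr h * (1 + \<bar>ln \<sigma>\<bar>) ^ l" by simp
      qed (use c in \<open>auto simp: C_def\<close>)
      finally show ?thesis by (simp add: mult.assoc)
    qed
  qed
qed

lemma inverse_ennreal_antimono:
  fixes a b :: real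
  assumes "a \<le> b" "0 < b"
  shows "inverse (ennreal b) \<le> inverse (ennreal a)"
proof (cases "a \<le> 0")
  case True
  then show ?thesis by (simp add: ennreal_neg)
next
  case False
  then show ?thesis using assms by (simp add: inverse_ennreal ennreal_leI le_imp_inverse_le)
qed

text \<open>For t \<ge> h the integral of |q|^(-t) over {|q| < \<sigma>} is at least \<sigma>^(-t)
  times the measure of that set, which stays above \<open>c\<close> for small \<sigma>. For an
  integrable function these integrals tend to 0 with \<sigma>.\<close>

lemma exponent_less_of_integrable:
  fixes q :: "real^'n::finite \<Rightarrow> real"
  assumes [measurable]: "q \<in> borel_measurable borel" and c: "c > 0" and t: "t > 0"
    and low: "\<forall>\<^sub>F \<sigma> in at_right 0. c * (\<sigma> powr h * \<bar>ln \<sigma>\<bar> ^ l) \<le> measure lborel {x \<in> ball 0 a. \<bar>q x\<bar> < \<sigma>}"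
    and int: "(\<integral>\<^sup>+x\<in>ball 0 a. inverse (ennreal (\<bar>q x\<bar> powr t)) \<partial>lborel) < \<infinity>"
  shows "t < h"
proof (rule ccontr)
  assume "\<not> t < h"
  then have ht: "h \<le> t" by simp
  have [measurable]: "ball (0::real^'n) a \<in> sets borel" by simp
  define f where "f x = inverse (ennreal (\<bar>q x\<bar> powr t)) * indicator (ball 0 a) x" for x
  have [measurable]: "f \<in> borel_measurable borel" unfolding f_def by measurable
  define A where "A n = {x. \<bar>q x\<bar> < 1 / real (Suc n)}" for n
  have [measurable]: "A n \<in> sets borel" for n unfolding A_def by measurable
  define \<nu> where "\<nu> = density lborel f"
  have fin: "(\<integral>\<^sup>+x. f x \<partial>lborel) < \<infinity>" using int by (simp add: f_def)
  have \<nu>: "emeasure \<nu> S = (\<integral>\<^sup>+x. f x * indicator S x \<partial>lborel)" if "S \<in> sets borel" for S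
    using that by (simp add: \<nu>_def emeasure_density)
  have "(\<lambda>n. emeasure \<nu> (A n)) \<longlonglongrightarrow> emeasure \<nu> (\<Inter>n. A n)"
  proof (rule Lim_emeasure_decseq)
    show "range A \<subseteq> sets \<nu>" by (auto simp: \<nu>_def)
    show "decseq A"
    proof (rule decseq_SucI, rule subsetI)
      fix n x assume "x \<in> A (Suc n)"
      moreover have "1 / real (Suc (Suc n)) \<le> 1 / real (Suc n)" by (intro divide_left_mono) auto
      ultimately show "x \<in> A n" by (simp add: A_def)
    qed
    show "emeasure \<nu> (A n) \<noteq> \<infinity>" for n
    proof -
      have "emeasure \<nu> (A n) \<le> (\<integral>\<^sup>+x. f x \<partial>lborel)"
        by (subst \<nu>) (auto intro!: nn_integral_mono simp: indicator_def)
      then show ?thesis using fin by (auto simp: less_top)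
    qed
  qed
  moreover have "emeasure \<nu> (\<Inter>n. A n) = 0"
  proof -
    \<comment> \<open>In the limit only zeros of \<open>q\<close> remain. Inside the ball the
      integrand is infinite there, so by integrability they form a null set.\<close>
    have Z: "x \<in> (\<Inter>n. A n) \<Longrightarrow> q x = 0" for x
    proof (rule ccontr)
      assume x: "x \<in> (\<Inter>n. A n)" and "q x \<noteq> 0"
      then obtain n where "1 / real (Suc n) < \<bar>q x\<bar>"
        using reals_Archimedean[of "\<bar>q x\<bar>"] by (auto simp: inverse_eq_divide)
      moreover have "x \<in> A n" using x by blast
      ultimately show False by (simp add: A_def)
    qed
    have "AE x in lborel. f x \<noteq> \<infinity>" using fin by (intro nn_integral_PInf_AE) auto
    then have "AE x in lborel. f x * indicator (\<Inter>n. A n) x = 0"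
    proof eventually_elim
      case (elim x)
      show ?case
      proof (cases "x \<in> (\<Inter>n. A n)")
        case True
        then have "q x = 0" by (rule Z)
        then have "x \<notin> ball 0 a" using elim t by (auto simp: f_def)
        then show ?thesis by (simp add: f_def)
      qed simp
    qed
    then show ?thesis by (subst \<nu>) (auto simp: nn_integral_0_iff_AE)
  qed
  ultimately have lim: "(\<lambda>n. emeasure \<nu> (A n)) \<longlonglongrightarrow> 0" by simp
  have "filterlim (\<lambda>n. 1 / real (Suc n)) (at_right 0) sequentially" by real_asymp
  moreover have "\<forall>\<^sub>F \<sigma> in at_right 0. c \<le> \<sigma> powr (- t) * measure lborel {x \<in> ball 0 a. \<bar>q x\<bar> < \<sigma>} \<and> 0 < \<sigma>"
  proof -
    have "\<forall>\<^sub>F \<sigma>::real in at_right 0. \<bar>ln \<sigma>\<bar> \<ge> 1" "\<forall>\<^sub>F \<sigma>::real in at_right 0. 0 < \<sigma> \<and> \<sigma> < 1"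
      by real_asymp (auto simp: eventually_at_right_field intro!: exI[of _ 1])
    with low show ?thesis
    proof eventually_elim
      case (elim \<sigma>)
      have "1 \<le> \<sigma> powr (h - t)" using powr_mono'[of "h - t" 0 \<sigma>] elim ht by simp
      then have "c * (1 * 1) \<le> c * (\<sigma> powr (h - t) * \<bar>ln \<sigma>\<bar> ^ l)"
        using c elim by (intro mult_left_mono mult_mono one_le_power) auto
      also have "\<dots> = \<sigma> powr (- t) * (c * (\<sigma> powr h * \<bar>ln \<sigma>\<bar> ^ l))"
        by (simp add: powr_diff powr_minus field_simps)
      also have "\<dots> \<le> \<sigma> powr (- t) * measure lborel {x \<in> ball 0 a. \<bar>q x\<bar> < \<sigma>}"
        using elim by (intro mult_left_mono) auto
      finally show ?case using elim by simp
    qed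
  qed
  ultimately have "\<forall>\<^sub>F n in sequentially. c \<le> (1 / real (Suc n)) powr (- t) * measure lborel {x \<in> ball 0 a. \<bar>q x\<bar> < 1 / real (Suc n)} \<and> 0 < 1 / real (Suc n)"
    by (rule eventually_compose_filterlim[rotated])
  then have "\<forall>\<^sub>F n in sequentially. ennreal c \<le> emeasure \<nu> (A n)"
  proof eventually_elim
    case (elim n)
    define \<sigma> where "\<sigma> = 1 / real (Suc n)"
    have \<sigma>: "\<sigma> > 0" by (simp add: \<sigma>_def)
    have S: "{x \<in> ball 0 a. \<bar>q x\<bar> < \<sigma>} \<in> sets lborel" by measurable
    have "emeasure lborel {x \<in> ball 0 a. \<bar>q x\<bar> < \<sigma>} < \<infinity>"
      by (rule emeasure_bounded_finite) (rule bounded_subset[OF bounded_ball], blast)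
    then have em: "emeasure lborel {x \<in> ball 0 a. \<bar>q x\<bar> < \<sigma>} = ennreal (measure lborel {x \<in> ball 0 a. \<bar>q x\<bar> < \<sigma>})"
      by (intro emeasure_eq_ennreal_measure) auto
    have "ennreal c \<le> ennreal (\<sigma> powr (- t)) * emeasure lborel {x \<in> ball 0 a. \<bar>q x\<bar> < \<sigma>}"
      unfolding em using elim by (subst ennreal_mult[symmetric]) (auto simp: \<sigma>_def intro!: ennreal_leI)
    also have "\<dots> = (\<integral>\<^sup>+x. ennreal (\<sigma> powr (- t)) * indicator {x \<in> ball 0 a. \<bar>q x\<bar> < \<sigma>} x \<partial>lborel)"
      using S by (rule nn_integral_cmult_indicator[symmetric])
    also have "\<dots> \<le> (\<integral>\<^sup>+x. f x * indicator (A n) x \<partial>lborel)"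
    proof (rule nn_integral_mono)
      fix x
      show "ennreal (\<sigma> powr (- t)) * indicator {x \<in> ball 0 a. \<bar>q x\<bar> < \<sigma>} x \<le> f x * indicator (A n) x"
      proof (cases "x \<in> ball 0 a \<and> \<bar>q x\<bar> < \<sigma>")
        case True
        have "ennreal (\<sigma> powr (- t)) = inverse (ennreal (\<sigma> powr t))"
          using \<sigma> by (simp add: powr_minus inverse_ennreal)
        also have "\<dots> \<le> inverse (ennreal (\<bar>q x\<bar> powr t))"
          using True t by (intro inverse_ennreal_antimono powr_mono2) auto
        finally show ?thesis using True by (auto simp: f_def A_def \<sigma>_def)
      qed (auto simp: indicator_def)
    qed
    finally show ?case by (simp add: \<nu>)
  qed
  then have "ennreal c \<le> 0"
    by (intro tendsto_lowerbound[OF lim]) auto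
  then show False using c by simp
qed

text \<open>For 0 < |y| < 1/4 the layer with 2^(-(k+3)) \<le> |y| < 2^(-(k+2)) alone suffices, and
  for y = 0 every layer counts, so the sum diverges as it must. The layers start at 1/4, inside the
  range \<epsilon> < 1/2 of the sublevel bound.\<close>

lemma inverse_powr_le_dyadic_sum:
  fixes y :: real
  assumes t: "t > 0"
  shows "inverse (ennreal (\<bar>y\<bar> powr t)) \<le> ennreal (4 powr t) +
    (\<Sum>k. ennreal (2 powr (t * real (k + 3))) * indicator {y. \<bar>y\<bar> < 2 powr (- real (k + 2))} y)"
    (is "_ \<le> _ + ?S")
proof -
  consider "1/4 \<le> \<bar>y\<bar>" | "0 < \<bar>y\<bar>" "\<bar>y\<bar> < 1/4" | "y = 0" by linarith
  then show ?thesis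
  proof cases
    case 1
    then have "inverse (ennreal (\<bar>y\<bar> powr t)) \<le> inverse (ennreal ((1/4) powr t))"
      using t by (intro inverse_ennreal_antimono powr_mono2) auto
    also have "\<dots> = ennreal (4 powr t)" by (simp add: inverse_ennreal powr_divide)
    also have "\<dots> \<le> ennreal (4 powr t) + ?S" by simp
    finally show ?thesis .
  next
    case 2
    define z where "z = - log 2 \<bar>y\<bar>"
    have y: "\<bar>y\<bar> = 2 powr (- z)" using 2 by (simp add: z_def)
    have "2 < z"
    proof -
      have "2 powr (- z) < 2 powr (- 2)" using 2 y by (simp add: powr_minus)
      then show ?thesis by simp
    qed
    define k where "k = nat (\<lceil>z\<rceil> - 3)"
    have k: "real (k + 2) < z" "z \<le> real (k + 3)"
    proof -
      have "\<lceil>z\<rceil> \<ge> 3" using \<open>2 < z\<close> by linarith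
      then have "real (k + 3) = of_int \<lceil>z\<rceil>" by (simp add: k_def)
      then show "real (k + 2) < z" "z \<le> real (k + 3)" by (auto, linarith+)
    qed
    have "\<bar>y\<bar> < 2 powr (- real (k + 2))" unfolding y using k(1) by (intro powr_less_mono) auto
    have "inverse (ennreal (\<bar>y\<bar> powr t)) = ennreal (2 powr (t * z))"
      using y by (simp add: inverse_ennreal powr_powr powr_minus[symmetric] mult.commute)
    also have "\<dots> \<le> ennreal (2 powr (t * real (k + 3)))"
      using k(2) t by (intro ennreal_leI powr_mono mult_left_mono) auto
    also have "\<dots> = (\<Sum>i\<in>{k}. ennreal (2 powr (t * real (i + 3))) * indicator {y. \<bar>y\<bar> < 2 powr (- real (i + 2))} y)"
      using \<open>\<bar>y\<bar> < 2 powr (- real (k + 2))\<close> by simp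
    also have "\<dots> \<le> ?S" by (rule sum_le_suminf) auto
    also have "\<dots> \<le> ennreal (4 powr t) + ?S" by simp
    finally show ?thesis .
  next
    case 3
    have "of_nat N \<le> ?S" for N
    proof -
      have "of_nat N = (\<Sum>k<N. (1::ennreal))" by simp
      also have "\<dots> \<le> (\<Sum>k<N. ennreal (2 powr (t * real (k + 3))) * indicator {y. \<bar>y\<bar> < 2 powr (- real (k + 2))} y)"
      proof (rule sum_mono)
        fix k
        have "(1::ennreal) = ennreal 1" by simp
        also have "\<dots> \<le> ennreal (2 powr (t * real (k + 3)))" using t by (intro ennreal_leI ge_one_powr_ge_zero) auto
        finally show "1 \<le> ennreal (2 powr (t * real (k + 3))) * indicator {y. \<bar>y\<bar> < 2 powr (- real (k + 2))} y"
          using 3 by simp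
      qed
      also have "\<dots> \<le> ?S" by (rule sum_le_suminf) auto
      finally show ?thesis .
    qed
    then have "\<not> (\<exists>N. ?S < of_nat N)" unfolding not_ex not_less by (rule allI)
    then have "\<not> ?S < top" using ennreal_Ex_less_of_nat[of ?S] by (rule contrapos_nn)
    then have "?S = \<infinity>" unfolding less_top[symmetric] infinity_ennreal_def by (rule notnotD)
    then show ?thesis by simp
  qed
qed

lemma nn_integral_layers:
  fixes w :: "nat \<Rightarrow> ennreal"
  assumes A: "A \<in> sets M" and B: "\<And>k. B k \<in> sets M"
  shows "(\<integral>\<^sup>+x. c * indicator A x + (\<Sum>k. w k * indicator (B k) x) \<partial>M) = c * emeasure M A + (\<Sum>k. w k * emeasure M (B k))"
proof -
  have m: "(\<lambda>x. w k * indicator (B k) x) \<in> borel_measurable M" for k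
    using B by (intro borel_measurable_times_ennreal borel_measurable_const borel_measurable_indicator)
  have "(\<integral>\<^sup>+x. c * indicator A x + (\<Sum>k. w k * indicator (B k) x) \<partial>M)
    = (\<integral>\<^sup>+x. c * indicator A x \<partial>M) + (\<integral>\<^sup>+x. (\<Sum>k. w k * indicator (B k) x) \<partial>M)"
    using A B m by (intro nn_integral_add borel_measurable_suminf_order borel_measurable_times_ennreal borel_measurable_const borel_measurable_indicator)
  also have "(\<integral>\<^sup>+x. c * indicator A x \<partial>M) = c * emeasure M A"
    using A by (rule nn_integral_cmult_indicator)
  also have "(\<integral>\<^sup>+x. (\<Sum>k. w k * indicator (B k) x) \<partial>M) = (\<Sum>k. \<integral>\<^sup>+x. w k * indicator (B k) x \<partial>M)"
    by (rule nn_integral_suminf) (rule m)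
  also have "(\<lambda>k. \<integral>\<^sup>+x. w k * indicator (B k) x \<partial>M) = (\<lambda>k. w k * emeasure M (B k))"
    by (rule ext) (rule nn_integral_cmult_indicator[OF B])
  finally show ?thesis .
qed

text \<open>\<open>D\<close> is built from \<open>C\<close>, h, \<open>t\<close>, \<open>l\<close>
  and the volume of the ball alone, which gives the uniformity over all perturbations. The final 1
  in it makes the inequality strict.\<close>

lemma layer_cake_bound:
  fixes r :: real
  assumes t: "0 < t" "t < h" and C: "C \<ge> 0"
  shows "\<exists>D. \<forall>F \<in> borel_measurable borel.
    (\<forall>\<epsilon>. 0 < \<epsilon> \<and> \<epsilon> < 1/2 \<longrightarrow> emeasure lborel {x \<in> ball (0::real^'n::finite) r. \<bar>F x\<bar> < \<epsilon>} \<le> ennreal (C * \<epsilon> powr h * \<bar>ln \<epsilon>\<bar> ^ l)) \<longrightarrow>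
    (\<integral>\<^sup>+x\<in>ball 0 r. inverse (ennreal (\<bar>F x\<bar> powr t)) \<partial>lborel) < ennreal D"
proof -
  define f where "f k = 2 powr (- (h - t) * real k) * (4 + real k) ^ l" for k :: nat
  have f: "summable f" unfolding f_def[abs_def] using t by (intro summable_poly_geometric) simp
  have f0: "f k \<ge> 0" for k by (simp add: f_def)
  \<comment> \<open>The layer \<open>k\<close> contributes 2^(t(k+3)) 2^(-h(k+2)); after the decay
    2^(-(h-t)k) is split off, the power of 2 in \<open>K\<close> remains.\<close>
  define K where "K = C * 2 powr (3 * t - 2 * h)"
  have K: "K \<ge> 0" using C by (simp add: K_def)
  define V where "V = measure lborel (ball (0::real^'n) r)"
  have "emeasure lborel (ball (0::real^'n) r) < \<infinity>" by (rule emeasure_bounded_finite) simp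
  then have V: "emeasure lborel (ball (0::real^'n) r) = ennreal V"
    unfolding V_def by (intro emeasure_eq_ennreal_measure) auto
  have V0: "V \<ge> 0" by (simp add: V_def)
  show ?thesis
  proof (intro exI[of _ "4 powr t * V + K * suminf f + 1"] ballI impI)
    fix F :: "real^'n \<Rightarrow> real"
    assume [measurable]: "F \<in> borel_measurable borel"
      and bd: "\<forall>\<epsilon>. 0 < \<epsilon> \<and> \<epsilon> < 1/2 \<longrightarrow> emeasure lborel {x \<in> ball 0 r. \<bar>F x\<bar> < \<epsilon>} \<le> ennreal (C * \<epsilon> powr h * \<bar>ln \<epsilon>\<bar> ^ l)"
    define B where "B k = {x \<in> ball 0 r. \<bar>F x\<bar> < 2 powr (- real (k + 2))}" for k
    have [measurable]: "B k \<in> sets borel" for k unfolding B_def by measurable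
    have "(\<integral>\<^sup>+x\<in>ball 0 r. inverse (ennreal (\<bar>F x\<bar> powr t)) \<partial>lborel)
      \<le> (\<integral>\<^sup>+x. ennreal (4 powr t) * indicator (ball 0 r) x + (\<Sum>k. ennreal (2 powr (t * real (k + 3))) * indicator (B k) x) \<partial>lborel)"
    proof (rule nn_integral_mono)
      fix x
      show "inverse (ennreal (\<bar>F x\<bar> powr t)) * indicator (ball 0 r) x
        \<le> ennreal (4 powr t) * indicator (ball 0 r) x + (\<Sum>k. ennreal (2 powr (t * real (k + 3))) * indicator (B k) x)"
        using inverse_powr_le_dyadic_sum[OF t(1), of "F x"]
        by (cases "x \<in> ball 0 r") (auto simp: B_def indicator_def)
    qed
    also have "\<dots> = ennreal (4 powr t) * emeasure lborel (ball (0::real^'n) r) + (\<Sum>k. ennreal (2 powr (t * real (k + 3))) * emeasure lborel (B k))"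
      by (rule nn_integral_layers) auto
    also have "\<dots> \<le> ennreal (4 powr t) * ennreal V + (\<Sum>k. ennreal (K * f k))"
    proof (intro add_mono suminf_le)
      fix k :: nat
      have "(2::real) powr (- real (k + 2)) < 2 powr (- 1)" by (intro powr_less_mono) auto
      then have e: "0 < 2 powr (- real (k + 2))" "2 powr (- real (k + 2)) < (1/2::real)" by (auto simp: powr_minus)
      have "ennreal (2 powr (t * real (k + 3))) * emeasure lborel (B k)
        \<le> ennreal (2 powr (t * real (k + 3))) * ennreal (C * (2 powr (- real (k + 2))) powr h * \<bar>ln (2 powr (- real (k + 2)))\<bar> ^ l)"
        unfolding B_def by (intro mult_left_mono bd[rule_format] conjI e) auto
      also have "\<dots> = ennreal (2 powr (t * real (k + 3)) * (C * (2 powr (- real (k + 2))) powr h * \<bar>ln (2 powr (- real (k + 2)))\<bar> ^ l))"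
        using C by (intro ennreal_mult[symmetric]) auto
      also have "\<dots> \<le> ennreal (K * f k)"
      proof (rule ennreal_leI)
        have "\<bar>ln (2 powr (- real (k + 2)))\<bar> = real (k + 2) * ln 2" by (simp add: ln_powr abs_mult)
        also have "\<dots> \<le> real (k + 2) * 1" using ln2_le_25_over_36 by (intro mult_left_mono) auto
        also have "\<dots> \<le> 4 + real k" by simp
        finally have "\<bar>ln (2 powr (- real (k + 2)))\<bar> ^ l \<le> (4 + real k) ^ l" by (intro power_mono) auto
        then have "2 powr (t * real (k + 3)) * (C * (2 powr (- real (k + 2))) powr h * \<bar>ln (2 powr (- real (k + 2)))\<bar> ^ l)
            \<le> 2 powr (t * real (k + 3)) * (C * (2 powr (- real (k + 2))) powr h * (4 + real k) ^ l)"
          using C by (intro mult_left_mono) auto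
        also have "\<dots> = C * (2 powr (t * real (k + 3)) * 2 powr (- real (k + 2) * h)) * (4 + real k) ^ l"
          by (simp add: powr_powr mult_ac)
        also have "2 powr (t * real (k + 3)) * 2 powr (- real (k + 2) * h) = 2 powr (3 * t - 2 * h) * 2 powr (- (h - t) * real k)"
          by (simp add: powr_add[symmetric] algebra_simps)
        finally show "2 powr (t * real (k + 3)) * (C * (2 powr (- real (k + 2))) powr h * \<bar>ln (2 powr (- real (k + 2)))\<bar> ^ l) \<le> K * f k"
          by (simp add: K_def f_def mult_ac)
      qed
      finally show "ennreal (2 powr (t * real (k + 3))) * emeasure lborel (B k) \<le> ennreal (K * f k)" .
    qed (auto simp: V)
    also have "(\<Sum>k. ennreal (K * f k)) = ennreal (K * suminf f)"
    proof -
      have "(\<Sum>k. ennreal (K * f k)) = ennreal (\<Sum>k. K * f k)"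
        using f f0 K by (intro suminf_ennreal2 summable_mult) auto
      then show ?thesis using suminf_mult[OF f] by simp
    qed
    also have "ennreal (4 powr t) * ennreal V + ennreal (K * suminf f) = ennreal (4 powr t * V + K * suminf f)"
      using V0 K suminf_nonneg[OF f f0] by (simp add: ennreal_mult ennreal_plus)
    also have "\<dots> < ennreal (4 powr t * V + K * suminf f + 1)"
      using V0 K suminf_nonneg[OF f f0] by (intro ennreal_lessI) (auto intro!: add_nonneg_pos)
    finally show "(\<integral>\<^sup>+x\<in>ball 0 r. inverse (ennreal (\<bar>F x\<bar> powr t)) \<partial>lborel) < ennreal (4 powr t * V + K * suminf f + 1)" .
  qed
qed

lemma log_shift_bound:
  fixes \<epsilon> :: real
  assumes "0 < \<epsilon>" "\<epsilon> < 1/2"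
  shows "(1 + \<bar>ln \<epsilon>\<bar>) ^ l \<le> 3 ^ l * \<bar>ln \<epsilon>\<bar> ^ l"
proof -
  have "ln \<epsilon> \<le> ln (1/2)" using assms by simp
  also have "\<dots> = - ln 2" by (simp add: ln_div)
  finally have "ln 2 \<le> \<bar>ln \<epsilon>\<bar>" by simp
  then have "1 \<le> 2 * \<bar>ln \<epsilon>\<bar>" using ln2_ge_two_thirds by linarith
  then have "(1 + \<bar>ln \<epsilon>\<bar>) ^ l \<le> (3 * \<bar>ln \<epsilon>\<bar>) ^ l" by (intro power_mono) auto
  then show ?thesis by (simp add: power_mult_distrib)
qed

lemma ex_dyadic:
  fixes y \<epsilon> :: real
  assumes "0 < \<epsilon>" "\<epsilon> \<le> y"
  shows "\<exists>k. 2 ^ k * \<epsilon> \<le> y \<and> y < 2 * (2 ^ k * \<epsilon>)"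
proof -
  have ex: "\<exists>n. y / \<epsilon> < 2 ^ n" by (rule real_arch_pow) simp
  define n where "n = (LEAST n. y / \<epsilon> < 2 ^ n)"
  have n: "y / \<epsilon> < 2 ^ n" unfolding n_def by (rule LeastI_ex[OF ex])
  have "n \<noteq> 0"
  proof
    assume "n = 0"
    with n assms show False by (simp add: divide_simps)
  qed
  then obtain k where k: "n = Suc k" by (cases n) auto
  have "\<not> y / \<epsilon> < 2 ^ k" using not_less_Least[of k "\<lambda>n. y / \<epsilon> < 2 ^ n"] k by (simp add: n_def)
  with n k assms show ?thesis by (intro exI[of _ k]) (simp add: divide_simps mult_ac not_less)
qed

section \<open>The uniform bounds for the perturbed function\<close>

text \<open>Points with |q| < \<epsilon> are covered by the bound for \<open>q\<close> alone; the
  others are sorted into shells 2^k \<epsilon> \<le> |q| < 2^(k+1) \<epsilon>, where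
  \<open>local_estimate\<close> applies with \<sigma> = 2^k \<epsilon>.\<close>

lemma perturbed_sublevel_bound:
  fixes q :: "real^'n::finite \<Rightarrow> real" and s :: "nat \<Rightarrow> real^'n \<Rightarrow> real" and m :: nat
  assumes an: "an q" "\<And>i. i \<in> {1..m} \<Longrightarrow> an (s i)"
    and q[measurable]: "q \<in> borel_measurable borel" and s: "\<And>i. i \<in> {1..m} \<Longrightarrow> s i \<in> borel_measurable borel"
    and a: "a > 0" and h: "h > 0" "m \<ge> 1 \<Longrightarrow> h < 1 / real m" and C1: "C1 \<ge> 0"
    and \<mu>: "\<And>\<sigma>. \<sigma> > 0 \<Longrightarrow> emeasure lborel {x \<in> ball 0 a. \<bar>q x\<bar> < \<sigma>} \<le> ennreal (C1 * \<sigma> powr h * (1 + \<bar>ln \<sigma>\<bar>) ^ l)"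
  shows "\<exists>C \<delta> r. 0 < C \<and> 0 < \<delta> \<and> 0 < r \<and> r < a \<and> (\<forall>\<eta> \<epsilon>. (\<forall>i\<in>{1..m}. \<bar>\<eta> i\<bar> < \<delta>) \<longrightarrow> 0 < \<epsilon> \<longrightarrow> \<epsilon> < 1/2 \<longrightarrow>
    emeasure lborel {x \<in> ball 0 r. \<bar>q x + (\<Sum>i=1..m. \<eta> i * s i x)\<bar> < \<epsilon>} \<le> ennreal (C * \<epsilon> powr h * \<bar>ln \<epsilon>\<bar> ^ l))"
proof (cases "m = 0")
  case True
  show ?thesis
  \<comment> \<open>For m = 0 the perturbation is an empty sum and the bound for \<open>q\<close> is
    final; the added 1 keeps the constant positive when C1 = 0.\<close>
  proof (rule exI[of _ "C1 * 3 ^ l + 1"], rule exI[of _ 1], rule exI[of _ "a / 2"], intro conjI allI impI)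
    fix \<eta> :: "nat \<Rightarrow> real" and \<epsilon> :: real assume \<epsilon>: "0 < \<epsilon>" "\<epsilon> < 1/2"
    have [measurable]: "ball (0::real^'n) a \<in> sets borel" by simp
    have "emeasure lborel {x \<in> ball 0 (a / 2). \<bar>q x + (\<Sum>i=1..m. \<eta> i * s i x)\<bar> < \<epsilon>} \<le> emeasure lborel {x \<in> ball 0 a. \<bar>q x\<bar> < \<epsilon>}"
      using True a by (intro emeasure_mono) auto
    also have "\<dots> \<le> ennreal (C1 * \<epsilon> powr h * (1 + \<bar>ln \<epsilon>\<bar>) ^ l)" by (rule \<mu>[OF \<epsilon>(1)])
    also have "\<dots> \<le> ennreal ((C1 * 3 ^ l + 1) * \<epsilon> powr h * \<bar>ln \<epsilon>\<bar> ^ l)"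
    proof (rule ennreal_leI)
      have "C1 * \<epsilon> powr h * (1 + \<bar>ln \<epsilon>\<bar>) ^ l \<le> C1 * \<epsilon> powr h * (3 ^ l * \<bar>ln \<epsilon>\<bar> ^ l)"
        using C1 by (intro mult_left_mono log_shift_bound \<epsilon>) auto
      also have "\<dots> \<le> C1 * \<epsilon> powr h * (3 ^ l * \<bar>ln \<epsilon>\<bar> ^ l) + \<epsilon> powr h * \<bar>ln \<epsilon>\<bar> ^ l" by simp
      also have "\<dots> = (C1 * 3 ^ l + 1) * \<epsilon> powr h * \<bar>ln \<epsilon>\<bar> ^ l" by (simp add: algebra_simps)
      finally show "C1 * \<epsilon> powr h * (1 + \<bar>ln \<epsilon>\<bar>) ^ l \<le> (C1 * 3 ^ l + 1) * \<epsilon> powr h * \<bar>ln \<epsilon>\<bar> ^ l" .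
    qed
    finally show "emeasure lborel {x \<in> ball 0 (a / 2). \<bar>q x + (\<Sum>i=1..m. \<eta> i * s i x)\<bar> < \<epsilon>}
      \<le> ennreal ((C1 * 3 ^ l + 1) * \<epsilon> powr h * \<bar>ln \<epsilon>\<bar> ^ l)" .
  qed (use a C1 in \<open>auto intro: add_nonneg_pos\<close>)
next
  case False
  then have m: "m \<ge> 1" by simp
  \<comment> \<open>\<open>local_estimate\<close> compares with a box while the hypothesis is about
    a ball; this box fits into the ball of radius \<open>a\<close>.\<close>
  define a' where "a' = a / CARD('n)"
  have a': "a' > 0" using a by (simp add: a'_def)
  have RBa: "RB a' \<subseteq> (ball 0 a :: (real^'n) set)" unfolding a'_def by (rule RB_subset_ball)
  have "\<exists>r C \<delta>. r > 0 \<and> C \<ge> 0 \<and> \<delta> > 0 \<and> (\<forall>\<eta> \<sigma> \<epsilon>. (\<forall>i\<in>{1..m}. \<bar>\<eta> i\<bar> < \<delta>) \<longrightarrow> 0 < \<sigma> \<longrightarrow> 0 < \<epsilon> \<longrightarrow>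
    emeasure lborel {x \<in> RB r. \<sigma> \<le> \<bar>q x\<bar> \<and> \<bar>q x\<bar> < 2 * \<sigma> \<and> \<bar>q x + (\<Sum>i=1..m. \<eta> i * s i x)\<bar> < \<epsilon>}
    \<le> ennreal (C * (\<epsilon> / \<sigma>) powr (1 / m)) * emeasure lborel {x \<in> RB a'. \<bar>q x\<bar> < 8 * \<sigma>})"
    using m an(1) an(2) q s a' by (rule local_estimate)
  then obtain r K \<delta> where r: "r > 0" and K: "K \<ge> 0" and \<delta>: "\<delta> > 0" and
    est: "\<forall>\<eta> \<sigma> \<epsilon>. (\<forall>i\<in>{1..m}. \<bar>\<eta> i\<bar> < \<delta>) \<longrightarrow> 0 < \<sigma> \<longrightarrow> 0 < \<epsilon> \<longrightarrow>
    emeasure lborel {x \<in> RB r. \<sigma> \<le> \<bar>q x\<bar> \<and> \<bar>q x\<bar> < 2 * \<sigma> \<and> \<bar>q x + (\<Sum>i=1..m. \<eta> i * s i x)\<bar> < \<epsilon>}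
    \<le> ennreal (K * (\<epsilon> / \<sigma>) powr (1 / m)) * emeasure lborel {x \<in> RB a'. \<bar>q x\<bar> < 8 * \<sigma>}"
    by (elim exE conjE) (rule that)
  define \<mu>' where "\<mu>' \<sigma> = emeasure lborel {x \<in> ball (0::real^'n) a. \<bar>q x\<bar> < \<sigma>}" for \<sigma>
  have \<mu>2: "\<mu>' \<sigma> \<le> ennreal (C1 * \<sigma> powr h * (1 + \<bar>ln \<sigma>\<bar>) ^ l)" if "\<sigma> > 0" for \<sigma>
    unfolding \<mu>'_def using that by (rule \<mu>)
  have "\<exists>C>0. \<forall>\<epsilon>. 0 < \<epsilon> \<longrightarrow> \<epsilon> < 1/2 \<longrightarrow>
    \<mu>' \<epsilon> + (\<Sum>k. ennreal (K * (\<epsilon> / (2^k * \<epsilon>)) powr (1 / m)) * \<mu>' (8 * (2^k * \<epsilon>))) \<le> ennreal (C * \<epsilon> powr h * \<bar>ln \<epsilon>\<bar> ^ l)"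
    by (rule dyadic_sum_bound[OF m h(1) h(2)[OF m] C1 K]) (rule \<mu>2)
  then obtain C where C: "C > 0" and sumb: "\<forall>\<epsilon>. 0 < \<epsilon> \<longrightarrow> \<epsilon> < 1/2 \<longrightarrow>
    \<mu>' \<epsilon> + (\<Sum>k. ennreal (K * (\<epsilon> / (2^k * \<epsilon>)) powr (1 / m)) * \<mu>' (8 * (2^k * \<epsilon>))) \<le> ennreal (C * \<epsilon> powr h * \<bar>ln \<epsilon>\<bar> ^ l)"
    by (elim exE conjE) (rule that)
  define r1 where "r1 = min r a / 2"
  have r1: "r1 > 0" "r1 < r" "r1 < a" using r a by (auto simp: r1_def)
  show ?thesis
  proof (rule exI[of _ C], rule exI[of _ \<delta>], rule exI[of _ r1], intro conjI allI impI)
    fix \<eta> :: "nat \<Rightarrow> real" and \<epsilon> :: real assume \<eta>: "\<forall>i\<in>{1..m}. \<bar>\<eta> i\<bar> < \<delta>" and \<epsilon>: "0 < \<epsilon>" "\<epsilon> < 1/2"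
    have [measurable]: "(\<lambda>x. \<Sum>i=1..m. \<eta> i * s i x) \<in> borel_measurable borel"
      by (intro borel_measurable_sum borel_measurable_times s) auto
    have [measurable]: "RB r \<in> sets (borel :: (real^'n) measure)" "ball (0::real^'n) a \<in> sets borel"
      by (simp_all add: open_RB borel_open)
    define E where "E k = {x \<in> RB r. 2^k * \<epsilon> \<le> \<bar>q x\<bar> \<and> \<bar>q x\<bar> < 2 * (2^k * \<epsilon>) \<and> \<bar>q x + (\<Sum>i=1..m. \<eta> i * s i x)\<bar> < \<epsilon>}" for k :: nat
    have E: "E k \<in> sets lborel" for k unfolding E_def by measurable
    define Z where "Z = {x \<in> ball (0::real^'n) a. \<bar>q x\<bar> < \<epsilon>}"
    have Z: "Z \<in> sets lborel" unfolding Z_def by measurable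
    have "{x \<in> ball 0 r1. \<bar>q x + (\<Sum>i=1..m. \<eta> i * s i x)\<bar> < \<epsilon>} \<subseteq> Z \<union> (\<Union>k. E k)"
    proof
      fix x assume x: "x \<in> {x \<in> ball 0 r1. \<bar>q x + (\<Sum>i=1..m. \<eta> i * s i x)\<bar> < \<epsilon>}"
      then have xr: "x \<in> ball 0 a" "x \<in> RB r" using r1 ball_subset_RB[of r, where 'n = 'n] by auto
      show "x \<in> Z \<union> (\<Union>k. E k)"
      proof (cases "\<bar>q x\<bar> < \<epsilon>")
        case True
        then show ?thesis using xr by (simp add: Z_def)
      next
        case False
        then have "\<epsilon> \<le> \<bar>q x\<bar>" by simp
        from ex_dyadic[OF \<epsilon>(1) this] obtain k where "2 ^ k * \<epsilon> \<le> \<bar>q x\<bar>" "\<bar>q x\<bar> < 2 * (2 ^ k * \<epsilon>)" by blast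
        then have "x \<in> E k" using x xr by (simp add: E_def)
        then show ?thesis by blast
      qed
    qed
    then have "emeasure lborel {x \<in> ball 0 r1. \<bar>q x + (\<Sum>i=1..m. \<eta> i * s i x)\<bar> < \<epsilon>} \<le> emeasure lborel (Z \<union> (\<Union>k. E k))"
      using E Z by (intro emeasure_mono) auto
    also have "\<dots> \<le> emeasure lborel Z + emeasure lborel (\<Union>k. E k)"
      using E Z by (intro emeasure_subadditive) auto
    also have "\<dots> \<le> emeasure lborel Z + (\<Sum>k. emeasure lborel (E k))"
      using E by (intro add_left_mono emeasure_subadditive_countably) auto
    also have "\<dots> \<le> \<mu>' \<epsilon> + (\<Sum>k. ennreal (K * (\<epsilon> / (2^k * \<epsilon>)) powr (1 / m)) * \<mu>' (8 * (2^k * \<epsilon>)))"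
    proof (intro add_mono suminf_le)
      show "emeasure lborel Z \<le> \<mu>' \<epsilon>" by (simp add: Z_def \<mu>'_def)
      fix k :: nat
      have pos: "0 < 2^k * \<epsilon>" using \<epsilon> by simp
      have "emeasure lborel (E k) \<le> ennreal (K * (\<epsilon> / (2^k * \<epsilon>)) powr (1 / m)) * emeasure lborel {x \<in> RB a'. \<bar>q x\<bar> < 8 * (2^k * \<epsilon>)}"
        unfolding E_def using est[rule_format, OF _ pos \<epsilon>(1), of \<eta>] \<eta> by blast
      also have "\<dots> \<le> ennreal (K * (\<epsilon> / (2^k * \<epsilon>)) powr (1 / m)) * \<mu>' (8 * (2^k * \<epsilon>))"
        unfolding \<mu>'_def using RBa by (intro mult_left_mono emeasure_mono) auto
      finally show "emeasure lborel (E k) \<le> ennreal (K * (\<epsilon> / (2^k * \<epsilon>)) powr (1 / m)) * \<mu>' (8 * (2^k * \<epsilon>))" .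
    qed auto
    also have "\<dots> \<le> ennreal (C * \<epsilon> powr h * \<bar>ln \<epsilon>\<bar> ^ l)" using sumb \<epsilon> by simp
    finally show "emeasure lborel {x \<in> ball 0 r1. \<bar>q x + (\<Sum>i=1..m. \<eta> i * s i x)\<bar> < \<epsilon>} \<le> ennreal (C * \<epsilon> powr h * \<bar>ln \<epsilon>\<bar> ^ l)" .
  qed (use C \<delta> r1 in auto)
qed

theorem theorem1p4:
  fixes q :: "real^'n::finite \<Rightarrow> real"
    and s :: "nat \<Rightarrow> real^'n \<Rightarrow> real"
    and R \<rho> r0 h \<gamma> :: real and l m :: nat
  assumes q_an: "R > 0" "real_analytic_on q (ball 0 R)"
    and q0: "q 0 = 0"
    and r0: "0 < r0" "r0 \<le> R"
    and h: "h > 0"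
    and l: "l \<le> CARD('n) - 1"
    and asym: "\<forall>r. 0 < r \<and> r \<le> r0 \<longrightarrow> (\<exists>c>0.
       (\<lambda>\<epsilon>. measure lebesgue {x. norm x < r \<and> \<bar>q x\<bar> < \<epsilon>} - c * \<epsilon> powr h * \<bar>ln \<epsilon>\<bar> ^ l)
         \<in> o[at_right 0](\<lambda>\<epsilon>. \<epsilon> powr h * \<bar>ln \<epsilon>\<bar> ^ l))"
    and hm: "h = 1 / (real m + \<gamma>)" and \<gamma>: "0 < \<gamma>" "\<gamma> \<le> 1"
    and s_an: "\<rho> > 0" "\<forall>i\<in>{1..m}. real_analytic_on (s i) (ball 0 \<rho>)"
    and s0: "\<forall>i\<in>{1..m}. s i 0 = 0"
    and s_indep: "\<forall>\<eta>::nat \<Rightarrow> real. (\<forall>x\<in>ball 0 \<rho>. (\<Sum>i=1..m. \<eta> i * s i x) = 0)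
                    \<longrightarrow> (\<forall>i\<in>{1..m}. \<eta> i = 0)"
  shows "\<exists>C>0. \<exists>\<delta>>0. \<exists>r1. 0 < r1 \<and> r1 < r0 \<and>
    (\<forall>\<eta>::nat \<Rightarrow> real. (\<forall>i\<in>{1..m}. \<bar>\<eta> i\<bar> < \<delta>) \<longrightarrow>
       (\<forall>\<epsilon>. 0 < \<epsilon> \<and> \<epsilon> < 1/2 \<longrightarrow>
          emeasure lebesgue {x. norm x < r1 \<and> \<bar>q x + (\<Sum>i=1..m. \<eta> i * s i x)\<bar> < \<epsilon>}
            \<le> ennreal (C * \<epsilon> powr h * \<bar>ln \<epsilon>\<bar> ^ l))) \<and>
    (\<forall>t>0. (\<integral>\<^sup>+ x \<in> ball 0 r0. inverse (ennreal (\<bar>q x\<bar> powr t)) \<partial>lebesgue) < \<infinity> \<longrightarrow>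
       (\<exists>D. \<forall>\<eta>::nat \<Rightarrow> real. (\<forall>i\<in>{1..m}. \<bar>\<eta> i\<bar> < \<delta>) \<longrightarrow>
          (\<integral>\<^sup>+ x \<in> ball 0 r1. inverse (ennreal (\<bar>q x + (\<Sum>i=1..m. \<eta> i * s i x)\<bar> powr t)) \<partial>lebesgue)
            < ennreal D))"
proof -
  have an_q: "an q" by (rule an_of_real_analytic[OF q_an])
  have an_s: "an (s i)" if "i \<in> {1..m}" for i
    using s_an(2) that by (intro an_of_real_analytic[OF s_an(1)]) blast
  \<comment> \<open>\<open>q\<close> and the s_i are controlled only near 0; Borel functions with
    the same germs take their place.\<close>
  obtain q' where q': "an q'" "q' \<in> borel_measurable borel" "\<forall>\<^sub>F x in nhds 0. q' x = q x"
    by (rule an_borel_version[OF an_q dep_UNIV]) (rule that)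
  have "\<forall>i\<in>{1..m}. \<exists>s'. an s' \<and> s' \<in> borel_measurable borel \<and> (\<forall>\<^sub>F x in nhds 0. s' x = s i x)"
  proof
    fix i assume "i \<in> {1..m}"
    then obtain g where "an g" "g \<in> borel_measurable borel" "\<forall>\<^sub>F x in nhds 0. g x = s i x"
      using an_borel_version[OF an_s dep_UNIV] by metis
    then show "\<exists>s'. an s' \<and> s' \<in> borel_measurable borel \<and> (\<forall>\<^sub>F x in nhds 0. s' x = s i x)" by (intro exI[of _ g] conjI)
  qed
  then obtain s' where s'0: "\<forall>i\<in>{1..m}. an (s' i) \<and> s' i \<in> borel_measurable borel \<and> (\<forall>\<^sub>F x in nhds 0. s' i x = s i x)"
    by (rule bchoice[THEN exE])
  have s': "an (s' i)" "s' i \<in> borel_measurable borel" "\<forall>\<^sub>F x in nhds 0. s' i x = s i x" if "i \<in> {1..m}" for i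
    using bspec[OF s'0 that] by simp_all
  have "\<forall>\<^sub>F x in nhds 0. q' x = q x \<and> (\<forall>i\<in>{1..m}. s' i x = s i x)"
    by (intro eventually_conj q' eventually_ball_finite ballI s' finite_atLeastAtMost)
  then obtain d where d: "d > 0" and eq: "\<forall>x\<in>RB d. q' x = q x \<and> (\<forall>i\<in>{1..m}. s' i x = s i x)"
    unfolding eventually_RB by (elim exE conjE) (rule that)
  \<comment> \<open>On the ball of radius \<open>a\<close> the Borel versions agree with the given
    functions, and the asymptotics, available at every radius up to \<open>r0\<close>, apply with r
    = a.\<close>
  define a where "a = min r0 d"
  have a: "a > 0" "a \<le> r0" "a \<le> d" using r0 d by (auto simp: a_def)
  have eq: "q' x = q x" "\<And>i. i \<in> {1..m} \<Longrightarrow> s' i x = s i x" if "norm x < a" for x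
  proof -
    have "x \<in> RB d" using that a ball_subset_RB[of d] by auto
    from bspec[OF eq this] show "q' x = q x" "\<And>i. i \<in> {1..m} \<Longrightarrow> s' i x = s i x" by simp_all
  qed
  have [measurable]: "q' \<in> borel_measurable borel" by (rule q')
  have [measurable]: "ball (0::real^'n) b \<in> sets borel" for b by simp
  define \<mu> where "\<mu> \<sigma> = measure lborel {x \<in> ball 0 a. \<bar>q' x\<bar> < \<sigma>}" for \<sigma>
  have \<mu>_fin: "emeasure lborel {x \<in> ball 0 a. \<bar>q' x\<bar> < \<sigma>} = ennreal (\<mu> \<sigma>)" for \<sigma>
  proof -
    have "emeasure lborel {x \<in> ball 0 a. \<bar>q' x\<bar> < \<sigma>} < \<infinity>"
      by (rule emeasure_bounded_finite) (rule bounded_subset[OF bounded_ball], blast)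
    then show ?thesis unfolding \<mu>_def by (intro emeasure_eq_ennreal_measure) auto
  qed
  have \<mu>_leb: "measure lebesgue {x. norm x < a \<and> \<bar>q x\<bar> < \<sigma>} = \<mu> \<sigma>" for \<sigma>
  proof -
    have "{x. norm x < a \<and> \<bar>q x\<bar> < \<sigma>} = {x \<in> ball 0 a. \<bar>q' x\<bar> < \<sigma>}" using eq(1) by auto
    moreover have "{x \<in> ball 0 a. \<bar>q' x\<bar> < \<sigma>} \<in> sets lborel" by measurable
    ultimately show ?thesis by (simp add: \<mu>_def measure_completion)
  qed
  obtain c where c: "c > 0" and as: "(\<lambda>\<epsilon>. \<mu> \<epsilon> - c * \<epsilon> powr h * \<bar>ln \<epsilon>\<bar> ^ l) \<in> o[at_right 0](\<lambda>\<epsilon>. \<epsilon> powr h * \<bar>ln \<epsilon>\<bar> ^ l)"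
    using asym[rule_format, of a] a unfolding \<mu>_leb by blast
  have V: "\<mu> \<sigma> \<le> measure lborel (ball (0::real^'n) a)" for \<sigma>
  proof -
    have "emeasure lborel (ball (0::real^'n) a) < \<infinity>" by (rule emeasure_bounded_finite) simp
    then show ?thesis unfolding \<mu>_def by (intro measure_mono_fmeasurable) (auto simp: fmeasurable_def)
  qed
  obtain C1 where C1: "C1 \<ge> 0" "\<forall>\<sigma>>0. \<mu> \<sigma> \<le> C1 * \<sigma> powr h * (1 + \<bar>ln \<sigma>\<bar>) ^ l"
    using log_powr_upper_bound(1)[OF c h V as] by (elim exE conjE) (rule that)
  have "\<exists>C \<delta> r. 0 < C \<and> 0 < \<delta> \<and> 0 < r \<and> r < a \<and> (\<forall>\<eta> \<epsilon>. (\<forall>i\<in>{1..m}. \<bar>\<eta> i\<bar> < \<delta>) \<longrightarrow> 0 < \<epsilon> \<longrightarrow> \<epsilon> < 1/2 \<longrightarrow>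
    emeasure lborel {x \<in> ball 0 r. \<bar>q' x + (\<Sum>i=1..m. \<eta> i * s' i x)\<bar> < \<epsilon>} \<le> ennreal (C * \<epsilon> powr h * \<bar>ln \<epsilon>\<bar> ^ l))"
  proof (rule perturbed_sublevel_bound[OF q'(1) _ q'(2) _ a(1) h _ C1(1)])
    \<comment> \<open>Here \<gamma> > 0 enters: h = 1/(m + \<gamma>) lies strictly below 1/m, the
      margin that the dyadic sum requires.\<close>
    show "h < 1 / real m" if "m \<ge> 1"
      unfolding hm using that \<gamma>(1) by (intro divide_strict_left_mono) auto
    show "emeasure lborel {x \<in> ball 0 a. \<bar>q' x\<bar> < \<sigma>} \<le> ennreal (C1 * \<sigma> powr h * (1 + \<bar>ln \<sigma>\<bar>) ^ l)" if "\<sigma> > 0" for \<sigma>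
      unfolding \<mu>_fin using C1(2) that by (intro ennreal_leI) blast
  qed (use s' in auto)
  then obtain C \<delta> r1 where C: "0 < C" and \<delta>: "0 < \<delta>" and r1: "0 < r1" "r1 < a"
    and main: "\<forall>\<eta> \<epsilon>. (\<forall>i\<in>{1..m}. \<bar>\<eta> i\<bar> < \<delta>) \<longrightarrow> 0 < \<epsilon> \<longrightarrow> \<epsilon> < 1/2 \<longrightarrow>
    emeasure lborel {x \<in> ball 0 r1. \<bar>q' x + (\<Sum>i=1..m. \<eta> i * s' i x)\<bar> < \<epsilon>} \<le> ennreal (C * \<epsilon> powr h * \<bar>ln \<epsilon>\<bar> ^ l)"
    by (elim exE conjE) (rule that)
  have F_meas: "(\<lambda>x. q' x + (\<Sum>i=1..m. \<eta> i * s' i x)) \<in> borel_measurable borel" for \<eta>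
    by (intro borel_measurable_add borel_measurable_sum borel_measurable_times s' q') auto
  have F_eq: "q' x + (\<Sum>i=1..m. \<eta> i * s' i x) = q x + (\<Sum>i=1..m. \<eta> i * s i x)" if "norm x < a" for x \<eta>
    using eq[OF that] by simp
  show ?thesis
  proof (rule exI[of _ C], rule conjI[OF C], rule exI[of _ \<delta>], rule conjI[OF \<delta>], rule exI[of _ r1], intro conjI)
    show "0 < r1" "r1 < r0" using r1 a by auto
    show "\<forall>\<eta>. (\<forall>i\<in>{1..m}. \<bar>\<eta> i\<bar> < \<delta>) \<longrightarrow> (\<forall>\<epsilon>. 0 < \<epsilon> \<and> \<epsilon> < 1/2 \<longrightarrow>
      emeasure lebesgue {x. norm x < r1 \<and> \<bar>q x + (\<Sum>i=1..m. \<eta> i * s i x)\<bar> < \<epsilon>} \<le> ennreal (C * \<epsilon> powr h * \<bar>ln \<epsilon>\<bar> ^ l))"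
    proof (intro allI impI, elim conjE)
      fix \<eta> :: "nat \<Rightarrow> real" and \<epsilon> :: real assume \<eta>: "\<forall>i\<in>{1..m}. \<bar>\<eta> i\<bar> < \<delta>" and \<epsilon>: "0 < \<epsilon>" "\<epsilon> < 1/2"
      note [measurable] = F_meas[of \<eta>]
      have "{x. norm x < r1 \<and> \<bar>q x + (\<Sum>i=1..m. \<eta> i * s i x)\<bar> < \<epsilon>} = {x \<in> ball 0 r1. \<bar>q' x + (\<Sum>i=1..m. \<eta> i * s' i x)\<bar> < \<epsilon>}"
        using F_eq r1 by auto
      moreover have "{x \<in> ball 0 r1. \<bar>q' x + (\<Sum>i=1..m. \<eta> i * s' i x)\<bar> < \<epsilon>} \<in> sets lborel" by measurable
      ultimately show "emeasure lebesgue {x. norm x < r1 \<and> \<bar>q x + (\<Sum>i=1..m. \<eta> i * s i x)\<bar> < \<epsilon>} \<le> ennreal (C * \<epsilon> powr h * \<bar>ln \<epsilon>\<bar> ^ l)"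
        using main[rule_format, OF _ \<epsilon>, of \<eta>] \<eta> by (simp add: emeasure_completion)
    qed
    show "\<forall>t>0. (\<integral>\<^sup>+ x \<in> ball 0 r0. inverse (ennreal (\<bar>q x\<bar> powr t)) \<partial>lebesgue) < \<infinity> \<longrightarrow>
       (\<exists>D. \<forall>\<eta>::nat \<Rightarrow> real. (\<forall>i\<in>{1..m}. \<bar>\<eta> i\<bar> < \<delta>) \<longrightarrow>
          (\<integral>\<^sup>+ x \<in> ball 0 r1. inverse (ennreal (\<bar>q x + (\<Sum>i=1..m. \<eta> i * s i x)\<bar> powr t)) \<partial>lebesgue) < ennreal D)"
    proof (intro allI impI)
      fix t :: real assume t: "t > 0" and int: "(\<integral>\<^sup>+ x \<in> ball 0 r0. inverse (ennreal (\<bar>q x\<bar> powr t)) \<partial>lebesgue) < \<infinity>"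
      have "(\<integral>\<^sup>+ x \<in> ball 0 a. inverse (ennreal (\<bar>q' x\<bar> powr t)) \<partial>lborel) = (\<integral>\<^sup>+ x \<in> ball 0 a. inverse (ennreal (\<bar>q' x\<bar> powr t)) \<partial>lebesgue)"
        by (rule nn_integral_completion[symmetric]) measurable
      also have "\<dots> \<le> (\<integral>\<^sup>+ x \<in> ball 0 r0. inverse (ennreal (\<bar>q x\<bar> powr t)) \<partial>lebesgue)"
        using eq(1) a by (intro nn_integral_mono) (auto simp: indicator_def)
      also note int
      \<comment> \<open>Integrability on the ball of radius \<open>r0\<close> passes to the smaller
        ball and forces the strict inequality that makes the sum over layers converge.\<close>
      finally have "t < h"
        using c by (intro exponent_less_of_integrable[OF q'(2) _ t log_powr_upper_bound(2)[OF c h V as, unfolded \<mu>_def]]) auto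
      obtain D where D: "\<forall>F \<in> borel_measurable borel.
        (\<forall>\<epsilon>. 0 < \<epsilon> \<and> \<epsilon> < 1/2 \<longrightarrow> emeasure lborel {x \<in> ball (0::real^'n) r1. \<bar>F x\<bar> < \<epsilon>} \<le> ennreal (C * \<epsilon> powr h * \<bar>ln \<epsilon>\<bar> ^ l)) \<longrightarrow>
        (\<integral>\<^sup>+x\<in>ball 0 r1. inverse (ennreal (\<bar>F x\<bar> powr t)) \<partial>lborel) < ennreal D"
        using layer_cake_bound[where 'n = 'n and r = r1 and l = l, OF t \<open>t < h\<close> less_imp_le[OF C]] by (elim exE) (rule that)
      show "\<exists>D. \<forall>\<eta>::nat \<Rightarrow> real. (\<forall>i\<in>{1..m}. \<bar>\<eta> i\<bar> < \<delta>) \<longrightarrow>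
          (\<integral>\<^sup>+ x \<in> ball 0 r1. inverse (ennreal (\<bar>q x + (\<Sum>i=1..m. \<eta> i * s i x)\<bar> powr t)) \<partial>lebesgue) < ennreal D"
      proof (intro exI[of _ D] allI impI)
        fix \<eta> :: "nat \<Rightarrow> real" assume \<eta>: "\<forall>i\<in>{1..m}. \<bar>\<eta> i\<bar> < \<delta>"
        note [measurable] = F_meas[of \<eta>]
        have "(\<integral>\<^sup>+ x \<in> ball 0 r1. inverse (ennreal (\<bar>q x + (\<Sum>i=1..m. \<eta> i * s i x)\<bar> powr t)) \<partial>lebesgue)
          = (\<integral>\<^sup>+ x \<in> ball 0 r1. inverse (ennreal (\<bar>q' x + (\<Sum>i=1..m. \<eta> i * s' i x)\<bar> powr t)) \<partial>lebesgue)"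
        proof (rule nn_integral_cong)
          fix x
          show "inverse (ennreal (\<bar>q x + (\<Sum>i=1..m. \<eta> i * s i x)\<bar> powr t)) * indicator (ball 0 r1) x
            = inverse (ennreal (\<bar>q' x + (\<Sum>i=1..m. \<eta> i * s' i x)\<bar> powr t)) * indicator (ball 0 r1) x"
          proof (cases "x \<in> ball 0 r1")
            case True
            then have "norm x < a" using r1 by simp
            then show ?thesis by (simp only: F_eq)
          qed simp
        qed
        also have "\<dots> = (\<integral>\<^sup>+ x \<in> ball 0 r1. inverse (ennreal (\<bar>q' x + (\<Sum>i=1..m. \<eta> i * s' i x)\<bar> powr t)) \<partial>lborel)"
          by (rule nn_integral_completion) measurable
        also have "\<dots> < ennreal D"
          by (rule mp[OF bspec[OF D F_meas]]) (use main \<eta> in blast)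
        finally show "(\<integral>\<^sup>+ x \<in> ball 0 r1. inverse (ennreal (\<bar>q x + (\<Sum>i=1..m. \<eta> i * s i x)\<bar> powr t)) \<partial>lebesgue) < ennreal D" .
      qed
    qed
  qed
qed

end
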